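(* Let $0<p,q\le\infty$, $s\in\mathbb{R}$ and $0\le\alpha\le1$, and let $(c_{\bar j,\bar k})$, $\bar j\in(\mathbb{N}\cup\{-1\})^2$, $\bar k\in\mathbb{Z}^2$, denote the sequence of hyperbolic Meyer wavelet coefficients of $f\in\mathcal{S}'(\mathbb{R}^2)$. The following assertions are equivalent: 1. $f\in T^{s,\alpha}_{p,q}B(\mathbb{R}^2)$; 2. $(c_{\bar j,\bar k})\in t^{s,\alpha}_{p,q}b$. Moreover, there exist two constants $C_1,C_2>0$ (independent of $f$) such that $$C_1\,\|(c_{\bar j,\bar k})\|_{t^{s,\alpha}_{p,q}b}\le \|f\|_{T^{s,\alpha}_{p,q}B(\mathbb{R}^2)}\le C_2\,\|(c_{\bar j,\bar k})\|_{t^{s,\alpha}_{p,q}b}.$$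
   Context: Notation: $\mathbb{N}=\{0,1,2,\dots\}$; for $\bar j=(j_1,j_2)$, $\max(\bar j)=\max\{j_1,j_2\}$ and $\min(\bar j)=\min\{j_1,j_2\}$. Hyperbolic Littlewood–Paley analysis: let $\theta_0\in\mathcal{S}(\mathbb{R})$ be non-negative, supported in $[-2,2]$, with $\theta_0=1$ on $[-1,1]$; for $j\ge1$ let $\theta_j=\theta_0(2^{-j}\cdot)-\theta_0(2^{-(j-1)}\cdot)$. For $\bar j\in\mathbb{N}^2$ let $\theta_{\bar j}(\xi_1,\xi_2)=\theta_{j_1}(\xi_1)\theta_{j_2}(\xi_2)$ and, for $f\in\mathcal{S}'(\mathbb{R}^2)$, $\Delta_{\bar j}f=\mathcal{F}^{-1}(\theta_{\bar j}\mathcal{F}f)$. Weighted tensorized Besov space: $T^{s,\alpha}_{p,q}B(\mathbb{R}^2)$ is the set of $f\in\mathcal{S}'(\mathbb{R}^2)$ such that $$\|f\|_{T^{s,\alpha}_{p,q}B(\mathbb{R}^2)}:=\Big(\sum_{\bar j\in\mathbb{N}^2}2^{((1+\alpha)\max(\bar j)+(1-\alpha)\min(\bar j))sq}\|\Delta_{\bar j}f\|_{L^p}^q\Big)^{1/q}<\infty$$ (supremum over $\bar j$ if $q=\infty$). Up to equivalence of (quasi-)norms it does not depend on the choice of $\theta_0$. Hyperbolic Meyer wavelets: let $\psi$ be a Lemarié–Meyer wavelet on $\mathbb{R}$ and $\varphi$ its associated scaling function (both in $\mathcal{S}(\mathbb{R})$ with compactly supported Fourier transforms, $\operatorname{supp}\widehat\psi\subseteq[-\frac{8\pi}3,-\frac{2\pi}3]\cup[\frac{2\pi}3,\frac{8\pi}3]$,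 and such that $\{\varphi(\cdot-k)\}_{k\in\mathbb{Z}}\cup\{2^{j/2}\psi(2^j\cdot-k)\}_{j\in\mathbb{N},k\in\mathbb{Z}}$ is an orthonormal basis of $L^2(\mathbb{R})$). Write $\psi_{j,k}=\psi(2^j\cdot-k)$ for $j\ge0$ and $\psi_{-1,k}=\varphi(\cdot-k)$, and $\psi_{\bar j,\bar k}(x_1,x_2)=\psi_{j_1,k_1}(x_1)\psi_{j_2,k_2}(x_2)$. The hyperbolic wavelet coefficients of $f\in\mathcal{S}'(\mathbb{R}^2)$ are $c_{\bar j,\bar k}=2^{\max(j_1,0)+\max(j_2,0)}\langle f,\psi_{\bar j,\bar k}\rangle$. Sequence space: $t^{s,\alpha}_{p,q}b$ is the set of sequences $c=(c_{\bar j,\bar k})$ with $$\|c\|_{t^{s,\alpha}_{p,q}b}:=\Big(\sum_{\bar j\in(\mathbb{N}\cup\{-1\})^2}2^{-\frac{(j_1+j_2)q}{p}}\,2^{((1+\alpha)\max(\bar j)+(1-\alpha)\min(\bar j))sq}\Big(\sum_{\bar k\in\mathbb{Z}^2}|c_{\bar j,\bar k}|^p\Big)^{q/p}\Big)^{1/q}<\infty,$$ with the usual modifications (suprema) if $p=\infty$ or $q=\infty$. *)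

theory Defs
  imports "HOL-Analysis.Analysis" "HOL-Probability.Essential_Supremum"
begin

text \<open>\<open>\<real>\<^sup>2\<close> is rendered as \<open>real \<times> real\<close>, whose norm, inner product and Borel measure are the
  Euclidean ones.\<close>

section \<open>Schwartz functions and tempered distributions\<close>

primrec partial_derivs ::
  "'a::euclidean_space list \<Rightarrow> ('a \<Rightarrow> 'b::real_normed_vector) \<Rightarrow> 'a \<Rightarrow> 'b" where
  "partial_derivs [] f = f"
| "partial_derivs (b # bs) f = (\<lambda>x. frechet_derivative (partial_derivs bs f) (at x) b)"

definition smooth :: "('a::euclidean_space \<Rightarrow> 'b::real_normed_vector) \<Rightarrow> bool" where
  "smooth f \<longleftrightarrow> (\<forall>bs x. set bs \<subseteq> Basis \<longrightarrow> partial_derivs bs f differentiable (at x))"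

definition schwartz :: "('a::euclidean_space \<Rightarrow> 'b::real_normed_vector) \<Rightarrow> bool" where
  "schwartz f \<longleftrightarrow> smooth f \<and>
     (\<forall>n bs. set bs \<subseteq> Basis \<longrightarrow> bounded (range (\<lambda>x. (1 + norm x) ^ n *\<^sub>R partial_derivs bs f x)))"

definition schwartz_seminorm ::
  "nat \<Rightarrow> 'a::euclidean_space list \<Rightarrow> ('a \<Rightarrow> 'b::real_normed_vector) \<Rightarrow> real" where
  "schwartz_seminorm n bs f = (SUP x. (1 + norm x) ^ n * norm (partial_derivs bs f x))"

text \<open>A tempered distribution is a functional on functions of which only the values on Schwartz
  functions matter; there it is linear and bounded by finitely many of the defining seminorms.\<close>

definition tempered_distribution :: "(('a::euclidean_space \<Rightarrow> complex) \<Rightarrow> complex) \<Rightarrow> bool" where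
  "tempered_distribution u \<longleftrightarrow>
     (\<forall>f g. schwartz f \<longrightarrow> schwartz g \<longrightarrow> u (\<lambda>x. f x + g x) = u f + u g) \<and>
     (\<forall>c f. schwartz f \<longrightarrow> u (\<lambda>x. c * f x) = c * u f) \<and>
     (\<exists>C N. \<forall>f. schwartz f \<longrightarrow>
        norm (u f) \<le> C * (\<Sum>n\<le>N. \<Sum>bs | set bs \<subseteq> Basis \<and> length bs \<le> N. schwartz_seminorm n bs f))"

section \<open>Fourier transform\<close>

definition fourier :: "('a::euclidean_space \<Rightarrow> complex) \<Rightarrow> 'a \<Rightarrow> complex" where
  "fourier f \<xi> = (LINT x|lborel. cis (- (x \<bullet> \<xi>)) * f x)"

definition inv_fourier :: "('a::euclidean_space \<Rightarrow> complex) \<Rightarrow> 'a \<Rightarrow> complex" where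
  "inv_fourier g x = (LINT \<xi>|lborel. cis (x \<bullet> \<xi>) * g \<xi>) / of_real ((2 * pi) ^ DIM('a))"

definition dist_fourier ::
  "(('a::euclidean_space \<Rightarrow> complex) \<Rightarrow> complex) \<Rightarrow> ('a \<Rightarrow> complex) \<Rightarrow> complex" where
  "dist_fourier u f = u (fourier f)"

definition dist_inv_fourier ::
  "(('a::euclidean_space \<Rightarrow> complex) \<Rightarrow> complex) \<Rightarrow> ('a \<Rightarrow> complex) \<Rightarrow> complex" where
  "dist_inv_fourier u f = u (inv_fourier f)"

definition dist_mult ::
  "('a \<Rightarrow> real) \<Rightarrow> (('a::euclidean_space \<Rightarrow> complex) \<Rightarrow> complex) \<Rightarrow> ('a \<Rightarrow> complex) \<Rightarrow> complex" where
  "dist_mult m u f = u (\<lambda>x. of_real (m x) * f x)"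

definition support :: "('a::topological_space \<Rightarrow> 'b::zero) \<Rightarrow> 'a set" where
  "support f = closure {x. f x \<noteq> 0}"

section \<open>Quasi-norms with exponents in \<open>(0, \<infinity>]\<close>\<close>

text \<open>Power of an extended nonnegative real with a positive real exponent.\<close>

definition epowr :: "ennreal \<Rightarrow> real \<Rightarrow> ennreal" where
  "epowr x r = (if x = \<infinity> then \<infinity> else ennreal (enn2real x powr r))"

definition Lp_norm :: "ennreal \<Rightarrow> ('a::euclidean_space \<Rightarrow> complex) \<Rightarrow> ennreal" where
  "Lp_norm p g =
     (if p = \<infinity> then esssup lborel (\<lambda>x. ennreal (norm (g x)))
      else epowr (\<integral>\<^sup>+ x. epowr (ennreal (norm (g x))) (enn2real p) \<partial>lborel) (1 / enn2real p))"

text \<open>The \<open>L\<^sup>p\<close> quasi-norm of a tempered distribution: that of the function representing it (all such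
  functions agree almost everywhere), and \<open>\<infinity>\<close> if the distribution is not given by a function.\<close>

definition represents ::
  "('a::euclidean_space \<Rightarrow> complex) \<Rightarrow> (('a \<Rightarrow> complex) \<Rightarrow> complex) \<Rightarrow> bool" where
  "represents g u \<longleftrightarrow> g \<in> borel_measurable lborel \<and>
     (\<forall>f. schwartz f \<longrightarrow> integrable lborel (\<lambda>x. g x * f x) \<and> u f = (LINT x|lborel. g x * f x))"

definition dist_Lp_norm ::
  "ennreal \<Rightarrow> (('a::euclidean_space \<Rightarrow> complex) \<Rightarrow> complex) \<Rightarrow> ennreal" where
  "dist_Lp_norm p u = Inf {Lp_norm p g | g. represents g u}"

definition lq_norm :: "ennreal \<Rightarrow> 'i set \<Rightarrow> ('i \<Rightarrow> ennreal) \<Rightarrow> ennreal" where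
  "lq_norm q I a =
     (if q = \<infinity> then (SUP i\<in>I. a i)
      else epowr (\<Sum>\<^sub>\<infinity>i\<in>I. epowr (a i) (enn2real q)) (1 / enn2real q))"

section \<open>Weighted tensorized Besov spaces\<close>

definition littlewood_paley_generator :: "(real \<Rightarrow> real) \<Rightarrow> bool" where
  "littlewood_paley_generator \<theta>\<^sub>0 \<longleftrightarrow>
     schwartz \<theta>\<^sub>0 \<and> (\<forall>x. 0 \<le> \<theta>\<^sub>0 x) \<and> support \<theta>\<^sub>0 \<subseteq> {-2..2} \<and> (\<forall>x\<in>{-1..1}. \<theta>\<^sub>0 x = 1)"

definition theta :: "(real \<Rightarrow> real) \<Rightarrow> nat \<Rightarrow> real \<Rightarrow> real" where
  "theta \<theta>\<^sub>0 j \<xi> = (if j = 0 then \<theta>\<^sub>0 \<xi> else \<theta>\<^sub>0 (\<xi> / 2 ^ j) - \<theta>\<^sub>0 (\<xi> / 2 ^ (j - 1)))"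

definition theta2 :: "(real \<Rightarrow> real) \<Rightarrow> nat \<times> nat \<Rightarrow> real \<times> real \<Rightarrow> real" where
  "theta2 \<theta>\<^sub>0 = (\<lambda>(j1, j2) (\<xi>1, \<xi>2). theta \<theta>\<^sub>0 j1 \<xi>1 * theta \<theta>\<^sub>0 j2 \<xi>2)"

definition hyp_block :: "(real \<Rightarrow> real) \<Rightarrow> nat \<times> nat \<Rightarrow>
  ((real \<times> real \<Rightarrow> complex) \<Rightarrow> complex) \<Rightarrow> (real \<times> real \<Rightarrow> complex) \<Rightarrow> complex" where
  "hyp_block \<theta>\<^sub>0 j f = dist_inv_fourier (dist_mult (theta2 \<theta>\<^sub>0 j) (dist_fourier f))"

definition hyp_weight :: "real \<Rightarrow> real \<Rightarrow> real \<Rightarrow> real \<Rightarrow> real" where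
  "hyp_weight s \<alpha> j1 j2 = 2 powr (((1 + \<alpha>) * max j1 j2 + (1 - \<alpha>) * min j1 j2) * s)"

text \<open>In this and the sequence quasi-norm below, the weights stand inside the \<open>q\<close>-th power, so that
  the case \<open>q = \<infinity>\<close> is the supremum of the weighted terms.\<close>

definition tensor_besov_norm :: "(real \<Rightarrow> real) \<Rightarrow> real \<Rightarrow> real \<Rightarrow> ennreal \<Rightarrow> ennreal \<Rightarrow>
  ((real \<times> real \<Rightarrow> complex) \<Rightarrow> complex) \<Rightarrow> ennreal" where
  "tensor_besov_norm \<theta>\<^sub>0 s \<alpha> p q f =
     lq_norm q UNIV (\<lambda>(j1, j2).
       ennreal (hyp_weight s \<alpha> (real j1) (real j2)) * dist_Lp_norm p (hyp_block \<theta>\<^sub>0 (j1, j2) f))"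

definition tensor_besov :: "(real \<Rightarrow> real) \<Rightarrow> real \<Rightarrow> real \<Rightarrow> ennreal \<Rightarrow> ennreal \<Rightarrow>
  ((real \<times> real \<Rightarrow> complex) \<Rightarrow> complex) set" where
  "tensor_besov \<theta>\<^sub>0 s \<alpha> p q =
     {f. tempered_distribution f \<and> tensor_besov_norm \<theta>\<^sub>0 s \<alpha> p q f < \<infinity>}"

section \<open>Hyperbolic Meyer wavelets\<close>

definition square_integrable :: "(real \<Rightarrow> complex) \<Rightarrow> bool" where
  "square_integrable g \<longleftrightarrow>
     g \<in> borel_measurable lborel \<and> integrable lborel (\<lambda>x. (cmod (g x))\<^sup>2)"

text \<open>Orthonormal basis of \<open>L\<^sup>2(\<real>)\<close>: an orthonormal family with dense linear span.\<close>

definition orthonormal_basis_L2 :: "'i set \<Rightarrow> ('i \<Rightarrow> real \<Rightarrow> complex) \<Rightarrow> bool" where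
  "orthonormal_basis_L2 I e \<longleftrightarrow>
     (\<forall>i\<in>I. square_integrable (e i)) \<and>
     (\<forall>i\<in>I. \<forall>j\<in>I. (LINT x|lborel. e i x * cnj (e j x)) = (if i = j then 1 else 0)) \<and>
     (\<forall>g \<epsilon>. square_integrable g \<longrightarrow> 0 < \<epsilon> \<longrightarrow>
        (\<exists>F c. finite F \<and> F \<subseteq> I \<and> (LINT x|lborel. (cmod (g x - (\<Sum>i\<in>F. c i * e i x)))\<^sup>2) < \<epsilon>))"

definition wavelet :: "(real \<Rightarrow> complex) \<Rightarrow> (real \<Rightarrow> complex) \<Rightarrow> int \<Rightarrow> int \<Rightarrow> real \<Rightarrow> complex" where
  "wavelet \<psi> \<phi> j k x = (if j = -1 then \<phi> (x - of_int k) else \<psi> (2 powi j * x - of_int k))"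

text \<open>In the orthonormality condition the factor \<open>2 powr (max j 0 / 2)\<close> is \<open>1\<close> for the translates of
  the scaling function (\<open>j = -1\<close>) and \<open>2\<^bsup>j/2\<^esup>\<close> for \<open>j \<ge> 0\<close>.\<close>

definition lemarie_meyer :: "(real \<Rightarrow> complex) \<Rightarrow> (real \<Rightarrow> complex) \<Rightarrow> bool" where
  "lemarie_meyer \<psi> \<phi> \<longleftrightarrow>
     schwartz \<psi> \<and> schwartz \<phi> \<and>
     support (fourier \<psi>) \<subseteq> {- (8 * pi / 3)..- (2 * pi / 3)} \<union> {2 * pi / 3..8 * pi / 3} \<and>
     compact (support (fourier \<phi>)) \<and>
     orthonormal_basis_L2 ({-1..} \<times> UNIV)
       (\<lambda>(j, k) x. of_real (2 powr (of_int (max j 0) / 2)) * wavelet \<psi> \<phi> j k x)"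

definition wavelet2 :: "(real \<Rightarrow> complex) \<Rightarrow> (real \<Rightarrow> complex) \<Rightarrow>
  int \<times> int \<Rightarrow> int \<times> int \<Rightarrow> real \<times> real \<Rightarrow> complex" where
  "wavelet2 \<psi> \<phi> = (\<lambda>(j1, j2) (k1, k2) (x1, x2). wavelet \<psi> \<phi> j1 k1 x1 * wavelet \<psi> \<phi> j2 k2 x2)"

text \<open>The pairing is the bilinear duality bracket; no conjugate is taken of the wavelet.\<close>

definition wavelet_coeff :: "(real \<Rightarrow> complex) \<Rightarrow> (real \<Rightarrow> complex) \<Rightarrow>
  ((real \<times> real \<Rightarrow> complex) \<Rightarrow> complex) \<Rightarrow> int \<times> int \<Rightarrow> int \<times> int \<Rightarrow> complex" where
  "wavelet_coeff \<psi> \<phi> f = (\<lambda>(j1, j2) k.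
     2 powi (max j1 0 + max j2 0) * f (wavelet2 \<psi> \<phi> (j1, j2) k))"

section \<open>Sequence spaces\<close>

text \<open>The factor \<open>enn2real (1 / p)\<close> is \<open>1/p\<close> for finite \<open>p\<close> and \<open>0\<close> for \<open>p = \<infinity>\<close>. Sequences are indexed
  by \<open>int \<times> int\<close>, but only scales in \<open>{-1..} \<times> {-1..}\<close> enter.\<close>

definition seq_besov_norm :: "real \<Rightarrow> real \<Rightarrow> ennreal \<Rightarrow> ennreal \<Rightarrow>
  (int \<times> int \<Rightarrow> int \<times> int \<Rightarrow> complex) \<Rightarrow> ennreal" where
  "seq_besov_norm s \<alpha> p q c =
     lq_norm q ({-1..} \<times> {-1..}) (\<lambda>(j1, j2).
       ennreal (2 powr (- of_int (j1 + j2) * enn2real (1 / p)) *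
                hyp_weight s \<alpha> (of_int j1) (of_int j2)) *
       lq_norm p UNIV (\<lambda>k. ennreal (cmod (c (j1, j2) k))))"

definition seq_besov :: "real \<Rightarrow> real \<Rightarrow> ennreal \<Rightarrow> ennreal \<Rightarrow>
  (int \<times> int \<Rightarrow> int \<times> int \<Rightarrow> complex) set" where
  "seq_besov s \<alpha> p q = {c. seq_besov_norm s \<alpha> p q c < \<infinity>}"

end

theory Submission
  imports Defs "HOL-Probability.Characteristic_Functions" "HOL-Real_Asymp.Real_Asymp"
begin

text \<open>The block \<open>\<Delta>\<^sub>j f\<close> is \<open>f\<close> tested against a tensor kernel \<open>\<kappa>\<^sub>j(y - x)\<close>. In one variable, a
  Littlewood--Paley kernel and a wavelet are orthogonal unless their scales differ by at most a fixed
  \<open>band\<close>, so the orthonormal expansion of \<open>\<kappa>\<^sub>j(\<cdot> - x)\<close> involves boundedly many scales; it converges in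
  \<open>\<S>\<close>, and applying \<open>f\<close> termwise writes \<open>\<Delta>\<^sub>j f\<close> as a sum over neighbouring scales of coefficients
  against well-localised functions. Conversely each wavelet is the sum of its neighbouring blocks, so a
  coefficient of \<open>f\<close> is a sum of integrals of the functions \<open>\<Delta>\<^sub>j f\<close> against well-localised functions. Both
  \<open>L\<^sup>p\<close> bounds are then Schur-type estimates with polynomial weights; for \<open>p < 1\<close> the second one
  uses that \<open>\<Delta>\<^sub>j f\<close> reproduces itself by convolution with a low-pass kernel.\<close>

section \<open>Polynomial weights\<close>

text \<open>A tempered distribution is given only through linearity and a bound by finitely many
  seminorms, so it cannot simply be moved under an integral sign. Wavelet series replace that step:
  their coefficients decay faster than any power of \<open>k\<close>, which beats the polynomial
  growth of \<open>f\<close> along the wavelets. The notion of orthonormal basis supplies only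
  density in \<open>L^2\<close>, so an expansion is first identified almost everywhere and then
  everywhere by continuity. The quasi-norm of a block is an infimum over representing functions,
  hence uniqueness of that function has to precede all estimates. Every constant must be independent
  of the scale and of \<open>f\<close>. This comes from having only finitely many profiles up to
  dilation, and from \<open>band\<close>, which bounds the interaction of scales once and for all.
  For \<open>p < 1\<close> Jensen's inequality points the wrong way. The substitute divides by a
  power of the quantity to be estimated, which must therefore be finite beforehand. Finiteness is
  extracted from the polynomial growth of the block, at the cost of constants that do depend on
  \<open>f\<close> but drop out of the final bound.\<close>

definition wt :: "nat \<Rightarrow> real \<Rightarrow> real" where
  "wt N t = inverse ((1 + \<bar>t\<bar>) ^ N)"

lemma wt_pos [simp]: "0 < wt N t"
  by (simp add: wt_def add_pos_nonneg)

lemma wt_nonneg [simp]: "0 \<le> wt N t"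
  by (simp add: less_imp_le)

lemma wt_minus [simp]: "wt N (- t) = wt N t"
  by (simp add: wt_def)

lemma wt_minus_commute: "wt N (s - t) = wt N (t - s)"
  by (simp add: wt_def abs_minus_commute)

lemma wt_antimono: "M \<le> N \<Longrightarrow> wt N t \<le> wt M t"
  unfolding wt_def by (intro le_imp_inverse_le power_increasing) auto

lemma wt_le_1: "wt N t \<le> 1"
  using wt_antimono[of 0 N t] by (simp add: wt_def)

lemma wt_add: "wt (M + N) t = wt M t * wt N t"
  by (simp add: wt_def power_add)

lemma one_le_poly_wt: "(1 + \<bar>t\<bar>) ^ N * wt N t = 1"
  by (simp add: wt_def add_pos_nonneg)

text \<open>Follows from \<open>1 + |s + t| \<le> (1 + |s|) * (1 + |t|)\<close>. It plays the part
  of a triangle inequality: localisation around one point and decay away from another combine into a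
  single weight.\<close>

lemma wt_mult_le: "wt N s * wt N t \<le> wt N (s + t)"
proof -
  have "1 + \<bar>s + t\<bar> \<le> (1 + \<bar>s\<bar>) * (1 + \<bar>t\<bar>)"
    using abs_triangle_ineq[of s t] mult_nonneg_nonneg[of "\<bar>s\<bar>" "\<bar>t\<bar>"]
    by (simp add: algebra_simps del: mult_nonneg_nonneg)
  hence "(1 + \<bar>s + t\<bar>) ^ N \<le> ((1 + \<bar>s\<bar>) * (1 + \<bar>t\<bar>)) ^ N"
    by (intro power_mono) auto
  thus ?thesis unfolding wt_def
    by (subst inverse_mult_distrib[symmetric], subst power_mult_distrib[symmetric])
       (intro le_imp_inverse_le, auto simp: add_pos_nonneg)
qed

lemma wt_le_poly: "wt N s \<le> (1 + \<bar>t\<bar>) ^ N * wt N (s + t)"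
proof -
  have "wt N s = (1 + \<bar>t\<bar>) ^ N * (wt N s * wt N t)"
    using one_le_poly_wt[of t N] by (simp add: mult.left_commute)
  also have "\<dots> \<le> (1 + \<bar>t\<bar>) ^ N * wt N (s + t)"
    by (intro mult_left_mono wt_mult_le) auto
  finally show ?thesis .
qed

text \<open>A contraction costs nothing and an expansion by \<open>a\<close> costs
  \<open>a ^ N\<close>; the maximum covers both cases.\<close>

lemma wt_scale:
  assumes "0 \<le> a"
  shows "wt N t \<le> max 1 a ^ N * wt N (a * t)"
proof -
  have "\<bar>a * t\<bar> \<le> max 1 a * \<bar>t\<bar>" using assms by (simp add: abs_mult mult_right_mono)
  hence "1 + \<bar>a * t\<bar> \<le> max 1 a * (1 + \<bar>t\<bar>)" by (auto simp: algebra_simps)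
  hence "(1 + \<bar>a * t\<bar>) ^ N \<le> max 1 a ^ N * (1 + \<bar>t\<bar>) ^ N"
    by (subst power_mult_distrib[symmetric], intro power_mono) auto
  thus ?thesis unfolding wt_def
    by (simp add: field_simps add_pos_nonneg)
qed

text \<open>However small \<open>p\<close> is, a large enough \<open>N\<close> leaves an integrable
  weight after taking the power. This is how small exponents are accommodated.\<close>

lemma wt_powr_le:
  assumes "2 \<le> real N * p"
  shows "wt N t powr p \<le> wt 2 t"
proof -
  have *: "wt n t = (1 + \<bar>t\<bar>) powr (- real n)" for n
    unfolding wt_def by (subst powr_minus, subst powr_realpow) auto
  have "wt N t powr p = (1 + \<bar>t\<bar>) powr (- (real N * p))"
    by (simp only: * powr_powr) simp
  also have "\<dots> \<le> (1 + \<bar>t\<bar>) powr (- 2)"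
    using assms by (intro powr_mono) auto
  also have "\<dots> = wt 2 t" by (simp add: *)
  finally show ?thesis .
qed

lemma continuous_on_wt [continuous_intros]:
  "continuous_on A f \<Longrightarrow> continuous_on A (\<lambda>x. wt N (f x))"
  unfolding wt_def by (intro continuous_intros) (auto simp: add_nonneg_eq_0_iff)

lemma borel_measurable_wt [measurable]: "wt N \<in> borel_measurable borel"
  by (intro borel_measurable_continuous_onI continuous_intros)

lemma nn_integral_wt_2: "(\<integral>\<^sup>+t. ennreal (wt 2 t) \<partial>lborel) = 2"
proof -
  let ?f = "\<lambda>t. ennreal (wt 2 t) * indicator {0..} t"
  have half: "(\<integral>\<^sup>+t. ?f t \<partial>lborel) = ennreal (0 - (- inverse (1 + 0)))"
  proof (rule nn_integral_FTC_atLeast)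
    show "((\<lambda>t::real. - inverse (1 + t)) has_real_derivative wt 2 x) (at x)" if "0 \<le> x" for x
      using that by (auto intro!: derivative_eq_intros simp: wt_def power2_eq_square divide_simps)
    show "((\<lambda>t::real. - inverse (1 + t)) \<longlongrightarrow> 0) at_top" by real_asymp
  qed auto
  have "(\<integral>\<^sup>+t. ennreal (wt 2 t) \<partial>lborel) = (\<integral>\<^sup>+t. ?f t + ?f (- t) \<partial>lborel)"
  proof (rule nn_integral_cong_AE)
    \<comment> \<open>Both half-line indicators are closed at 0, so the origin is counted twice; it
      is a null set.\<close>
    have "AE t in lborel. t \<noteq> (0::real)" by (rule AE_lborel_singleton)
    thus "AE t in lborel. ennreal (wt 2 t) = ?f t + ?f (- t)"
      by eventually_elim (auto simp: indicator_def)
  qed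
  also have "\<dots> = (\<integral>\<^sup>+t. ?f t \<partial>lborel) + (\<integral>\<^sup>+t. ?f (- t) \<partial>lborel)"
    by (intro nn_integral_add) auto
  also have "(\<integral>\<^sup>+t. ?f (- t) \<partial>lborel) = (\<integral>\<^sup>+t. ?f t \<partial>lborel)"
    using nn_integral_real_affine[of ?f "-1" 0] by simp
  finally show ?thesis using half by simp
qed

lemma nn_integral_wt:
  assumes "2 \<le> N"
  shows "(\<integral>\<^sup>+t. ennreal (wt N t) \<partial>lborel) \<le> 2"
proof -
  have "(\<integral>\<^sup>+t. ennreal (wt N t) \<partial>lborel) \<le> (\<integral>\<^sup>+t. ennreal (wt 2 t) \<partial>lborel)"
    by (intro nn_integral_mono ennreal_leI wt_antimono assms)
  thus ?thesis by (simp add: nn_integral_wt_2)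
qed

lemma nn_integral_wt_affine:
  assumes "2 \<le> N" "0 < a"
  shows "ennreal a * (\<integral>\<^sup>+t. ennreal (wt N (a * t - b)) \<partial>lborel) \<le> 2"
proof -
  have "(\<integral>\<^sup>+t. ennreal (wt N t) \<partial>lborel) = ennreal a * (\<integral>\<^sup>+t. ennreal (wt N (- b + a * t)) \<partial>lborel)"
    using nn_integral_real_affine[of "\<lambda>t. ennreal (wt N t)" a "- b"] assms by simp
  thus ?thesis using nn_integral_wt[OF assms(1)] by simp
qed

text \<open>Comparison with an integral: the weight at \<open>k\<close> is at most 4 times the
  weight at any point of the cell \<open>[k, k+1)\<close>, and the cells tile the line. The bound 8
  is this 4 times the integral 2 of \<open>wt 2\<close>, uniformly in \<open>t\<close>.\<close>

lemma nn_integral_wt_sum: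
  assumes "2 \<le> N"
  shows "(\<integral>\<^sup>+k. ennreal (wt N (t - of_int k)) \<partial>count_space (UNIV :: int set)) \<le> 8"
proof -
  have cell: "wt 2 (t - of_int k) \<le> 4 * wt 2 (t - y)" if "y \<in> {of_int k..<of_int k + 1}" for y k
  proof -
    have "wt 2 (t - of_int k) \<le> (1 + \<bar>of_int k - y\<bar>)\<^sup>2 * wt 2 (t - of_int k + (of_int k - y))"
      by (rule wt_le_poly)
    also have "\<dots> \<le> 2\<^sup>2 * wt 2 (t - of_int k + (of_int k - y))"
      using that by (intro mult_right_mono power_mono) auto
    finally show ?thesis by simp
  qed
  have one: "(\<integral>\<^sup>+k. indicator {of_int k..<of_int k + 1} y \<partial>count_space (UNIV::int set)) = 1" for y :: real
  proof -
    have "(\<integral>\<^sup>+k. indicator {of_int k..<of_int k + 1} y \<partial>count_space (UNIV::int set)) =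
          (\<integral>\<^sup>+k. indicator {\<lfloor>y\<rfloor>} k \<partial>count_space (UNIV::int set))"
      by (intro nn_integral_cong) (auto simp: indicator_def floor_eq_iff, linarith+)
    thus ?thesis by simp
  qed
  have "(\<integral>\<^sup>+k. ennreal (wt N (t - of_int k)) \<partial>count_space (UNIV :: int set))
        \<le> (\<integral>\<^sup>+k. (\<integral>\<^sup>+y. 4 * ennreal (wt 2 (t - y)) * indicator {of_int k..<of_int k + 1} y \<partial>lborel) \<partial>count_space (UNIV :: int set))"
  proof (intro nn_integral_mono)
    fix k :: int
    have "ennreal (wt N (t - of_int k)) = (\<integral>\<^sup>+(y::real). ennreal (wt N (t - of_int k)) * indicator {of_int k..<of_int k + 1} y \<partial>lborel)"
      
      by (subst nn_integral_cmult_indicator) auto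
    also have "\<dots> \<le> (\<integral>\<^sup>+y. 4 * ennreal (wt 2 (t - y)) * indicator {of_int k..<of_int k + 1} y \<partial>lborel)"
    proof (intro nn_integral_mono)
      fix y :: real
      show "ennreal (wt N (t - of_int k)) * indicator {of_int k..<of_int k + 1} y
            \<le> 4 * ennreal (wt 2 (t - y)) * indicator {of_int k..<of_int k + 1} y"
      proof (cases "y \<in> {of_int k..<of_int k + 1}")
        case True
        have "ennreal (wt N (t - of_int k)) \<le> ennreal (4 * wt 2 (t - y))"
          by (intro ennreal_leI order_trans[OF wt_antimono[OF assms] cell[OF True]])
        thus ?thesis using True by (simp add: ennreal_mult)
      qed simp
    qed
    finally show "ennreal (wt N (t - of_int k)) \<le> (\<integral>\<^sup>+y. 4 * ennreal (wt 2 (t - y)) * indicator {of_int k..<of_int k + 1} y \<partial>lborel)" .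
  qed
  also have "\<dots> = (\<integral>\<^sup>+y. (\<integral>\<^sup>+k. 4 * ennreal (wt 2 (t - y)) * indicator {of_int k..<of_int k + 1} y \<partial>count_space (UNIV :: int set)) \<partial>lborel)"
    by (rule nn_integral_count_space_nn_integral[symmetric]) auto
  also have "\<dots> = 4 * (\<integral>\<^sup>+y. ennreal (wt 2 (t - y)) \<partial>lborel)"
    by (simp add: nn_integral_cmult one)
  also have "(\<integral>\<^sup>+y. ennreal (wt 2 (t - y)) \<partial>lborel) = 2"
    using nn_integral_real_affine[of "\<lambda>t. ennreal (wt 2 t)" "-1" t] by (simp add: nn_integral_wt_2)
  finally show ?thesis by simp
qed

section \<open>Schwartz functions\<close>

text \<open>A one-variable Schwartz function is carried together with all its derivatives:
  \<open>D n\<close> is the n-th derivative of \<open>D 0\<close>. New Schwartz functions are then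
  built by exhibiting their derivatives, without computing any
  \<open>frechet_derivative\<close>.\<close>

definition schwartz_seq :: "(nat \<Rightarrow> real \<Rightarrow> 'b::real_normed_vector) \<Rightarrow> bool" where
  "schwartz_seq D \<longleftrightarrow> (\<forall>n x. (D n has_vector_derivative D (Suc n) x) (at x)) \<and>
     (\<forall>n N. \<exists>C. \<forall>x. norm (D n x) \<le> C * wt N x)"

lemma schwartz_seqI:
  assumes "\<And>n x. (D n has_vector_derivative D (Suc n) x) (at x)"
    and "\<And>n N. \<exists>C. \<forall>x. norm (D n x) \<le> C * wt N x"
  shows "schwartz_seq D"
  using assms unfolding schwartz_seq_def by auto

lemma schwartz_seq_deriv:
  "schwartz_seq D \<Longrightarrow> (D n has_vector_derivative D (Suc n) x) (at x)"
  unfolding schwartz_seq_def by auto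

lemma schwartz_seq_bound:
  assumes "schwartz_seq D"
  obtains C where "0 < C" "\<And>x. norm (D n x) \<le> C * wt N x"
proof -
  obtain C where C: "\<forall>x. norm (D n x) \<le> C * wt N x"
    using assms unfolding schwartz_seq_def by blast
  have "norm (D n x) \<le> (\<bar>C\<bar> + 1) * wt N x" for x
    by (rule order_trans[OF C[rule_format] mult_right_mono]) auto
  thus thesis using that[of "\<bar>C\<bar> + 1"] by simp
qed

lemma schwartz_seq_continuous: "schwartz_seq D \<Longrightarrow> continuous_on A (D n)"
  by (intro continuous_at_imp_continuous_on ballI has_vector_derivative_continuous)
     (rule schwartz_seq_deriv)

lemma schwartz_seq_measurable: "schwartz_seq D \<Longrightarrow> D n \<in> borel_measurable borel"
  by (intro borel_measurable_continuous_onI schwartz_seq_continuous)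

lemma schwartz_seq_bounded_linear:
  assumes D: "schwartz_seq D" and h: "bounded_linear h"
  shows "schwartz_seq (\<lambda>n x. h (D n x))"
proof (rule schwartz_seqI)
  show "((\<lambda>x. h (D n x)) has_vector_derivative h (D (Suc n) x)) (at x)" for n x
    by (intro bounded_linear.has_vector_derivative[OF h] schwartz_seq_deriv D)
next
  fix n N
  obtain C where C: "\<And>x. norm (D n x) \<le> C * wt N x" using schwartz_seq_bound[OF D] by metis
  obtain K where K: "0 \<le> K" "\<And>x. norm (h x) \<le> norm x * K"
    using bounded_linear.nonneg_bounded[OF h] by blast
  have "norm (h (D n x)) \<le> (C * K) * wt N x" for x
    using K(2)[of "D n x"] mult_right_mono[OF C[of x] K(1)] by (simp add: mult_ac)
  thus "\<exists>C. \<forall>x. norm (h (D n x)) \<le> C * wt N x" by blast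
qed

text \<open>The factor \<open>a ^ n\<close> is the chain rule. The decay constants depend on
  \<open>a\<close> and \<open>b\<close>; bounds uniform in the scale are obtained separately from
  explicit dilation formulas.\<close>

lemma schwartz_seq_affine:
  fixes D :: "nat \<Rightarrow> real \<Rightarrow> 'b::real_normed_vector"
  assumes D: "schwartz_seq D" and a: "a \<noteq> 0"
  shows "schwartz_seq (\<lambda>n x. a ^ n *\<^sub>R D n (a * x - b))"
proof (rule schwartz_seqI)
  fix n x
  have "((D n \<circ> (\<lambda>x. a * x - b)) has_vector_derivative a *\<^sub>R D (Suc n) (a * x - b)) (at x)"
    by (rule vector_diff_chain_at)
       (auto intro!: derivative_eq_intros schwartz_seq_deriv D
             simp flip: has_real_derivative_iff_has_vector_derivative)
  from has_vector_derivative_scaleR[OF DERIV_const[of "a ^ n"] this]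
  show "((\<lambda>x. a ^ n *\<^sub>R D n (a * x - b)) has_vector_derivative
         a ^ Suc n *\<^sub>R D (Suc n) (a * x - b)) (at x)"
    by (simp add: o_def mult.commute)
next
  fix n N
  obtain C where C: "0 < C" "\<And>x. norm (D n x) \<le> C * wt N x" using schwartz_seq_bound[OF D] by metis
  let ?K = "(1 + \<bar>b\<bar>) ^ N * max 1 (1 / \<bar>a\<bar>) ^ N"
  have "norm (a ^ n *\<^sub>R D n (a * x - b)) \<le> (\<bar>a\<bar> ^ n * C * ?K) * wt N x" for x
  proof -
    have "wt N (a * x - b) \<le> (1 + \<bar>b\<bar>) ^ N * wt N (a * x)"
      using wt_le_poly[of N "a * x - b" b] by simp
    also have "wt N (a * x) = wt N (\<bar>a\<bar> * x)" by (simp add: wt_def abs_mult)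
    also have "\<dots> \<le> max 1 (1 / \<bar>a\<bar>) ^ N * wt N x"
      using wt_scale[of "1 / \<bar>a\<bar>" N "\<bar>a\<bar> * x"] a by simp
    finally have "wt N (a * x - b) \<le> ?K * wt N x" by (simp add: mult_left_mono mult.assoc)
    hence "norm (D n (a * x - b)) \<le> C * (?K * wt N x)"
      using order_trans[OF C(2)[of "a * x - b"] mult_left_mono] C(1) by simp
    hence "\<bar>a\<bar> ^ n * norm (D n (a * x - b)) \<le> \<bar>a\<bar> ^ n * (C * (?K * wt N x))"
      by (intro mult_left_mono) auto
    thus ?thesis by (simp add: power_abs mult.assoc)
  qed
  thus "\<exists>C. \<forall>x. norm (a ^ n *\<^sub>R D n (a * x - b)) \<le> C * wt N x" by blast
qed

lemma schwartz_real_seq: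
  fixes f :: "real \<Rightarrow> 'b::real_normed_vector"
  assumes "schwartz f"
  shows "\<exists>D. D 0 = f \<and> schwartz_seq D"
proof -
  define D where "D n = partial_derivs (replicate n 1) f" for n
  have sub: "set (replicate n 1) \<subseteq> (Basis :: real set)" for n by auto
  have "(D n has_vector_derivative D (Suc n) x) (at x)" for n x
  proof -
    have "D n differentiable (at x)"
      using assms sub[of n] unfolding schwartz_def smooth_def D_def by blast
    hence "(D n has_derivative frechet_derivative (D n) (at x)) (at x)"
      by (simp add: frechet_derivative_works)
    \<comment> \<open>A linear map on the reals is determined by its value at 1, and that value is
      the next member of the sequence because the list \<open>replicate n 1\<close> grows by one
      entry.\<close>
    moreover from this have "frechet_derivative (D n) (at x) = (\<lambda>h. h *\<^sub>R D (Suc n) x)"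
      using linear_scale[OF has_derivative_linear, of "D n" _ "at x" _ 1] by (auto simp: D_def fun_eq_iff)
    ultimately show ?thesis by (simp add: has_vector_derivative_def)
  qed
  moreover have "\<exists>C. \<forall>x. norm (D n x) \<le> C * wt N x" for n N
  proof -
    have "bounded (range (\<lambda>x. (1 + norm x) ^ N *\<^sub>R partial_derivs (replicate n 1) f x))"
      using assms sub[of n] unfolding schwartz_def by blast
    then obtain C where "\<forall>x. norm ((1 + norm x) ^ N *\<^sub>R D n x) \<le> C"
      unfolding bounded_iff D_def by auto
    hence C: "(1 + \<bar>x\<bar>) ^ N * norm (D n x) \<le> C" for x by (auto simp: power_abs dest!: spec[of _ x])
    have "norm (D n x) \<le> C * wt N x" for x
      using C[of x] by (simp add: wt_def field_simps add_pos_nonneg)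
    thus ?thesis by blast
  qed
  ultimately have "schwartz_seq D" by (intro schwartz_seqI) auto
  thus ?thesis by (intro exI[of _ D]) (auto simp: D_def)
qed

section \<open>Seminorms and linear operations in several variables\<close>

lemma schwartz_bound:
  assumes "schwartz f" "set bs \<subseteq> Basis"
  shows "(1 + norm x) ^ n * norm (partial_derivs bs f x) \<le> schwartz_seminorm n bs f"
proof -
  have "bounded (range (\<lambda>x. (1 + norm x) ^ n *\<^sub>R partial_derivs bs f x))"
    using assms unfolding schwartz_def by blast
  then obtain C where "\<forall>x. norm ((1 + norm x) ^ n *\<^sub>R partial_derivs bs f x) \<le> C"
    unfolding bounded_iff by auto
  \<comment> \<open>The supremum defining the seminorm is meaningful only for a set bounded above;
    this is where membership in the Schwartz class enters.\<close>
  hence "bdd_above (range (\<lambda>x. (1 + norm x) ^ n * norm (partial_derivs bs f x)))"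
    by (intro bdd_aboveI2[of _ _ C]) (auto simp: power_abs)
  thus ?thesis unfolding schwartz_seminorm_def by (intro cSUP_upper) auto
qed

lemma schwartz_seminorm_nonneg:
  assumes "schwartz f" "set bs \<subseteq> Basis"
  shows "0 \<le> schwartz_seminorm n bs f"
  by (rule order_trans[OF _ schwartz_bound[OF assms, of 0]]) auto

lemma schwartz_seminorm_le:
  assumes "\<And>x. (1 + norm x) ^ n * norm (partial_derivs bs f x) \<le> C"
  shows "schwartz_seminorm n bs f \<le> C"
  unfolding schwartz_seminorm_def by (intro cSUP_least assms) auto

lemma schwartzI:
  assumes "\<And>bs x. set bs \<subseteq> Basis \<Longrightarrow> partial_derivs bs f differentiable (at x)"
    and "\<And>n bs. set bs \<subseteq> Basis \<Longrightarrow> \<exists>C. \<forall>x. (1 + norm x) ^ n * norm (partial_derivs bs f x) \<le> C"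
  shows "schwartz f"
  unfolding schwartz_def smooth_def
proof (intro conjI allI impI)
  fix n and bs :: "'a list" assume "set bs \<subseteq> Basis"
  then obtain C where "\<forall>x. (1 + norm x) ^ n * norm (partial_derivs bs f x) \<le> C"
    using assms(2) by blast
  thus "bounded (range (\<lambda>x. (1 + norm x) ^ n *\<^sub>R partial_derivs bs f x))"
    unfolding bounded_iff by (intro exI[of _ C]) (auto simp: power_abs)
qed (use assms(1) in auto)

lemma schwartz_differentiable:
  "schwartz f \<Longrightarrow> set bs \<subseteq> Basis \<Longrightarrow> partial_derivs bs f differentiable (at x)"
  unfolding schwartz_def smooth_def by blast

lemma schwartz_continuous: "schwartz f \<Longrightarrow> continuous_on A f"
  using schwartz_differentiable[of f "[]"]
  by (intro continuous_at_imp_continuous_on ballI differentiable_imp_continuous_within) auto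

lemma schwartz_measurable [measurable_dest]:
  "schwartz f \<Longrightarrow> f \<in> borel_measurable borel"
  by (intro borel_measurable_continuous_onI schwartz_continuous)

lemma partial_derivs_add:
  assumes "schwartz f" "schwartz g" "set bs \<subseteq> Basis"
  shows "partial_derivs bs (\<lambda>x. f x + g x) = (\<lambda>x. partial_derivs bs f x + partial_derivs bs g x)"
  using assms(3)
proof (induction bs)
  case (Cons b bs)
  hence "partial_derivs bs f differentiable (at x)" "partial_derivs bs g differentiable (at x)" for x
    using assms(1,2) by (auto intro: schwartz_differentiable)
  hence "((\<lambda>x. partial_derivs bs f x + partial_derivs bs g x) has_derivative
     (\<lambda>h. frechet_derivative (partial_derivs bs f) (at x) h + frechet_derivative (partial_derivs bs g) (at x) h)) (at x)" for x
    by (intro has_derivative_add) (auto simp: frechet_derivative_works)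
  from frechet_derivative_at[OF this, symmetric] show ?case using Cons by simp
qed simp

lemma schwartz_add:
  assumes "schwartz f" "schwartz g"
  shows "schwartz (\<lambda>x. f x + g x)"
proof (rule schwartzI)
  fix bs :: "'a list" and x assume bs: "set bs \<subseteq> Basis"
  show "partial_derivs bs (\<lambda>x. f x + g x) differentiable (at x)"
    using bs assms by (auto simp: partial_derivs_add intro!: differentiable_add schwartz_differentiable)
next
  fix n and bs :: "'a list" assume bs: "set bs \<subseteq> Basis"
  have "(1 + norm x) ^ n * norm (partial_derivs bs (\<lambda>x. f x + g x) x)
        \<le> schwartz_seminorm n bs f + schwartz_seminorm n bs g" for x
  proof -
    have "(1 + norm x) ^ n * norm (partial_derivs bs f x + partial_derivs bs g x)
        \<le> (1 + norm x) ^ n * (norm (partial_derivs bs f x) + norm (partial_derivs bs g x))"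
      by (intro mult_left_mono norm_triangle_ineq) auto
    also have "\<dots> \<le> schwartz_seminorm n bs f + schwartz_seminorm n bs g"
      using schwartz_bound[OF assms(1) bs, of x n] schwartz_bound[OF assms(2) bs, of x n]
      by (simp add: algebra_simps)
    finally show ?thesis using bs assms by (simp add: partial_derivs_add)
  qed
  thus "\<exists>C. \<forall>x. (1 + norm x) ^ n * norm (partial_derivs bs (\<lambda>x. f x + g x) x) \<le> C" by blast
qed

lemma partial_derivs_cmult:
  fixes f :: "'a::euclidean_space \<Rightarrow> complex"
  assumes "schwartz f" "set bs \<subseteq> Basis"
  shows "partial_derivs bs (\<lambda>x. c * f x) = (\<lambda>x. c * partial_derivs bs f x)"
  using assms(2)
proof (induction bs)
  case (Cons b bs)
  hence "partial_derivs bs f differentiable (at x)" for x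
    using assms(1) by (auto intro: schwartz_differentiable)
  hence "((\<lambda>x. c * partial_derivs bs f x) has_derivative
     (\<lambda>h. c * frechet_derivative (partial_derivs bs f) (at x) h)) (at x)" for x
    by (intro has_derivative_mult_right) (auto simp: frechet_derivative_works)
  from frechet_derivative_at[OF this, symmetric] show ?case using Cons by simp
qed simp

lemma schwartz_cmult:
  fixes f :: "'a::euclidean_space \<Rightarrow> complex"
  assumes "schwartz f"
  shows "schwartz (\<lambda>x. c * f x)"
proof (rule schwartzI)
  fix bs :: "'a list" and x assume bs: "set bs \<subseteq> Basis"
  show "partial_derivs bs (\<lambda>x. c * f x) differentiable (at x)"
    using bs assms
    by (auto simp: partial_derivs_cmult intro!: differentiable_mult schwartz_differentiable)
next
  fix n and bs :: "'a list" assume bs: "set bs \<subseteq> Basis"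
  have "(1 + norm x) ^ n * norm (partial_derivs bs (\<lambda>x. c * f x) x) \<le> norm c * schwartz_seminorm n bs f" for x
    using mult_left_mono[OF schwartz_bound[OF assms bs, of x n], of "norm c"] bs assms
    by (simp add: partial_derivs_cmult norm_mult mult.left_commute)
  thus "\<exists>C. \<forall>x. (1 + norm x) ^ n * norm (partial_derivs bs (\<lambda>x. c * f x) x) \<le> C" by blast
qed

lemma schwartz_seminorm_cmult_le:
  fixes f :: "'a::euclidean_space \<Rightarrow> complex"
  assumes "schwartz f" "set bs \<subseteq> Basis"
  shows "schwartz_seminorm n bs (\<lambda>x. c * f x) \<le> norm c * schwartz_seminorm n bs f"
  using mult_left_mono[OF schwartz_bound[OF assms], of "norm c"] assms
  by (intro schwartz_seminorm_le) (simp add: partial_derivs_cmult norm_mult mult.left_commute)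

section \<open>Tensor products of one-variable Schwartz functions\<close>

definition tensor :: "(real \<Rightarrow> complex) \<Rightarrow> (real \<Rightarrow> complex) \<Rightarrow> real \<times> real \<Rightarrow> complex" where
  "tensor f g x = f (fst x) * g (snd x)"

text \<open>The basis of the plane consists of \<open>(1, 0)\<close> and \<open>(0, 1)\<close>, and
  each of them differentiates one factor only. Hence the order of the list is immaterial and only
  its two multiplicities count.\<close>

lemma partial_derivs_tensor:
  assumes D: "schwartz_seq D" "schwartz_seq E" and bs: "set bs \<subseteq> Basis"
  shows "partial_derivs bs (tensor (D 0) (E 0)) =
     tensor (D (count_list bs (1, 0))) (E (count_list bs (0, 1)))"
    and tensor_has_derivative: "(tensor (D m) (E n) has_derivative
       (\<lambda>h. D m (fst x) * (snd h *\<^sub>R E (Suc n) (snd x)) + (fst h *\<^sub>R D (Suc m) (fst x)) * E n (snd x))) (at x)"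
proof -
  have der: "(tensor (D m) (E n) has_derivative
       (\<lambda>h. D m (fst x) * (snd h *\<^sub>R E (Suc n) (snd x)) + (fst h *\<^sub>R D (Suc m) (fst x)) * E n (snd x))) (at x)"
    for m n and x :: "real \<times> real"
  proof -
    have 1: "((\<lambda>x. D m (fst x)) has_derivative (\<lambda>h. fst h *\<^sub>R D (Suc m) (fst x))) (at x)"
      using diff_chain_at[OF bounded_linear_imp_has_derivative[OF bounded_linear_fst]
        schwartz_seq_deriv[OF D(1), of m "fst x", unfolded has_vector_derivative_def]]
      by (simp add: o_def)
    have 2: "((\<lambda>x. E n (snd x)) has_derivative (\<lambda>h. snd h *\<^sub>R E (Suc n) (snd x))) (at x)"
      using diff_chain_at[OF bounded_linear_imp_has_derivative[OF bounded_linear_snd]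
        schwartz_seq_deriv[OF D(2), of n "snd x", unfolded has_vector_derivative_def]]
      by (simp add: o_def)
    show ?thesis unfolding tensor_def using has_derivative_mult[OF 1 2] by simp
  qed
  thus "(tensor (D m) (E n) has_derivative
       (\<lambda>h. D m (fst x) * (snd h *\<^sub>R E (Suc n) (snd x)) + (fst h *\<^sub>R D (Suc m) (fst x)) * E n (snd x))) (at x)" .
  show "partial_derivs bs (tensor (D 0) (E 0)) =
     tensor (D (count_list bs (1, 0))) (E (count_list bs (0, 1)))"
    using bs
  proof (induction bs)
    case (Cons b bs)
    have pd: "partial_derivs (b # bs) (tensor (D 0) (E 0)) =
      (\<lambda>x. frechet_derivative (tensor (D (count_list bs (1, 0))) (E (count_list bs (0, 1)))) (at x) b)"
      using Cons by simp
    have "b = (1, 0) \<or> b = (0, 1)" using Cons.prems by (auto simp: Basis_prod_def)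
    thus ?case
    proof
      assume "b = (1, 0)"
      thus ?thesis unfolding pd frechet_derivative_at[OF der, symmetric]
        by (intro ext) (simp add: tensor_def)
    next
      assume "b = (0, 1)"
      thus ?thesis unfolding pd frechet_derivative_at[OF der, symmetric]
        by (intro ext) (simp add: tensor_def)
    qed
  qed simp
qed

text \<open>The Euclidean weight is dominated by the product of the two one-variable weights, so the
  same \<open>N\<close> in each factor suffices.\<close>

lemma schwartz_tensor_bound:
  assumes D: "\<And>x. norm (D m x) \<le> A * wt N x" "\<And>x. norm (E n x) \<le> B * wt N x" and "0 \<le> A"
  shows "(1 + norm x) ^ N * norm (tensor (D m) (E n) x) \<le> A * B"
proof -
  obtain s t where x: "x = (s, t)" by fastforce
  have "1 + norm x \<le> (1 + \<bar>s\<bar>) * (1 + \<bar>t\<bar>)"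
    using norm_Pair_le[of s t] mult_nonneg_nonneg[of "\<bar>s\<bar>" "\<bar>t\<bar>"]
    by (simp add: x algebra_simps del: mult_nonneg_nonneg)
  hence "(1 + norm x) ^ N \<le> ((1 + \<bar>s\<bar>) * (1 + \<bar>t\<bar>)) ^ N"
    by (intro power_mono) auto
  moreover have "norm (tensor (D m) (E n) x) \<le> (A * wt N s) * (B * wt N t)"
    using mult_mono[OF D(1)[of s] D(2)[of t]] \<open>0 \<le> A\<close> by (simp add: tensor_def x norm_mult)
  ultimately have "(1 + norm x) ^ N * norm (tensor (D m) (E n) x)
     \<le> ((1 + \<bar>s\<bar>) * (1 + \<bar>t\<bar>)) ^ N * ((A * wt N s) * (B * wt N t))"
    by (intro mult_mono) auto
  also have "\<dots> = A * B * ((1 + \<bar>s\<bar>) ^ N * wt N s) * ((1 + \<bar>t\<bar>) ^ N * wt N t)"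
    by (simp add: power_mult_distrib mult_ac)
  finally show ?thesis by (simp add: one_le_poly_wt)
qed

lemma schwartz_tensor:
  assumes D: "schwartz_seq D" "schwartz_seq E"
  shows "schwartz (tensor (D 0) (E 0))"
proof (rule schwartzI)
  fix bs :: "(real \<times> real) list" and x assume bs: "set bs \<subseteq> Basis"
  show "partial_derivs bs (tensor (D 0) (E 0)) differentiable (at x)"
    unfolding partial_derivs_tensor[OF D bs]
    using tensor_has_derivative[OF D bs] unfolding differentiable_def by blast
next
  fix n and bs :: "(real \<times> real) list" assume bs: "set bs \<subseteq> Basis"
  obtain A where A: "0 < A" "\<And>x. norm (D (count_list bs (1, 0)) x) \<le> A * wt n x"
    using schwartz_seq_bound[OF D(1)] by blast
  obtain B where B: "0 < B" "\<And>x. norm (E (count_list bs (0, 1)) x) \<le> B * wt n x"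
    using schwartz_seq_bound[OF D(2)] by blast
  show "\<exists>C. \<forall>x. (1 + norm x) ^ n * norm (partial_derivs bs (tensor (D 0) (E 0)) x) \<le> C"
    unfolding partial_derivs_tensor[OF D bs]
    using schwartz_tensor_bound[of D "count_list bs (1, 0)" A n E "count_list bs (0, 1)" B] A B
    by (meson less_imp_le)
qed

section \<open>Tempered distributions and series of Schwartz functions\<close>

text \<open>The total derivative is rebuilt from the partial ones: a series is differentiated
  termwise through total derivatives, whereas the seminorms control
  \<open>partial_derivs\<close>.\<close>

lemma has_derivative_partial_derivs:
  assumes "schwartz f" "set bs \<subseteq> Basis"
  shows "(partial_derivs bs f has_derivative
           (\<lambda>h. \<Sum>b\<in>Basis. (h \<bullet> b) *\<^sub>R partial_derivs (b # bs) f x)) (at x)"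
proof -
  have der: "(partial_derivs bs f has_derivative frechet_derivative (partial_derivs bs f) (at x)) (at x)"
    using schwartz_differentiable[OF assms] by (simp add: frechet_derivative_works)
  have lin: "linear (frechet_derivative (partial_derivs bs f) (at x))"
    by (rule has_derivative_linear[OF der])
  have eq: "frechet_derivative (partial_derivs bs f) (at x) =
        (\<lambda>h. \<Sum>b\<in>Basis. (h \<bullet> b) *\<^sub>R partial_derivs (b # bs) f x)"
  proof
    fix h :: 'a
    have "frechet_derivative (partial_derivs bs f) (at x) h =
          frechet_derivative (partial_derivs bs f) (at x) (\<Sum>b\<in>Basis. (h \<bullet> b) *\<^sub>R b)"
      by (simp add: euclidean_representation)
    also have "\<dots> = (\<Sum>b\<in>Basis. (h \<bullet> b) *\<^sub>R frechet_derivative (partial_derivs bs f) (at x) b)"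
      using lin by (simp add: linear_sum linear_scale)
    finally show "frechet_derivative (partial_derivs bs f) (at x) h = (\<Sum>b\<in>Basis. (h \<bullet> b) *\<^sub>R partial_derivs (b # bs) f x)"
      by simp
  qed
  show ?thesis using der by (simp only: eq)
qed

section \<open>Termwise differentiation of series that converge in every Schwartz seminorm\<close>

context
  fixes g :: "nat \<Rightarrow> 'a::euclidean_space \<Rightarrow> complex"
  assumes sch: "\<And>n. schwartz (g n)"
    and summ: "\<And>N bs. set bs \<subseteq> Basis \<Longrightarrow> summable (\<lambda>n. schwartz_seminorm N bs (g n))"
begin

lemma norm_partial_derivs_le_seminorm:
  assumes "set bs \<subseteq> Basis"
  shows "norm (partial_derivs bs (g n) x) \<le> schwartz_seminorm 0 bs (g n)"
  using schwartz_bound[OF sch[of n] assms, of x 0] by simp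

lemma summable_norm_partial_derivs:
  assumes "set bs \<subseteq> Basis"
  shows "summable (\<lambda>n. norm (partial_derivs bs (g n) x))"
  by (rule summable_comparison_test'[where N = 0, OF summ[OF assms, of 0]])
     (simp add: norm_partial_derivs_le_seminorm[OF assms])

lemma summable_partial_derivs:
  assumes "set bs \<subseteq> Basis"
  shows "summable (\<lambda>n. partial_derivs bs (g n) x)"
  by (rule summable_norm_cancel[OF summable_norm_partial_derivs[OF assms]])

text \<open>The series of derivatives converges uniformly in \<open>x\<close>, because its remainder
  is dominated by the tail \<open>T\<close> of a convergent series of seminorms, one for each basis
  direction.\<close>

lemma has_derivative_suminf_partial_derivs:
  assumes bs: "set bs \<subseteq> Basis"
  shows "((\<lambda>x. \<Sum>n. partial_derivs bs (g n) x) has_derivative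
           (\<lambda>h. \<Sum>b\<in>Basis. (h \<bullet> b) *\<^sub>R (\<Sum>n. partial_derivs (b # bs) (g n) x))) (at x)"
proof -
  have bbs: "set (b # bs) \<subseteq> Basis" if "b \<in> Basis" for b using bs that by simp
  define T where "T b n = (\<Sum>i. schwartz_seminorm 0 (b # bs) (g (i + n)))" for b n
  have T0: "(\<lambda>n. T b n) \<longlonglongrightarrow> 0" if "b \<in> Basis" for b
    unfolding T_def by (rule suminf_exist_split2[OF summ[OF bbs[OF that]]])
  have "(\<lambda>n. \<Sum>b\<in>Basis. T b n) \<longlonglongrightarrow> (\<Sum>b\<in>(Basis::'a set). 0)"
    by (intro tendsto_sum T0)
  hence ST0: "(\<lambda>n. \<Sum>b\<in>Basis. T b n) \<longlonglongrightarrow> 0" by simp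
  have tail: "norm ((\<Sum>i<n. partial_derivs (b # bs) (g i) x) - (\<Sum>i. partial_derivs (b # bs) (g i) x)) \<le> T b n"
    if b: "b \<in> Basis" for b n x
  proof -
    have "(\<Sum>i. partial_derivs (b # bs) (g i) x) =
          (\<Sum>i. partial_derivs (b # bs) (g (i + n)) x) + (\<Sum>i<n. partial_derivs (b # bs) (g i) x)"
      by (rule suminf_split_initial_segment[OF summable_partial_derivs[OF bbs[OF b]]])
    hence "norm ((\<Sum>i<n. partial_derivs (b # bs) (g i) x) - (\<Sum>i. partial_derivs (b # bs) (g i) x))
        = norm (\<Sum>i. partial_derivs (b # bs) (g (i + n)) x)" by simp
    also have "\<dots> \<le> (\<Sum>i. norm (partial_derivs (b # bs) (g (i + n)) x))"
      by (rule summable_norm[OF summable_ignore_initial_segment[OF summable_norm_partial_derivs[OF bbs[OF b]]]])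
    also have "\<dots> \<le> T b n" unfolding T_def
      by (intro suminf_le norm_partial_derivs_le_seminorm bbs b
            summable_ignore_initial_segment[OF summable_norm_partial_derivs[OF bbs[OF b]]]
            summable_ignore_initial_segment[OF summ[OF bbs[OF b]]])
    finally show ?thesis .
  qed
  have "\<exists>G. \<forall>x\<in>UNIV. (\<lambda>n. partial_derivs bs (g n) x) sums G x \<and>
     (G has_derivative (\<lambda>h. \<Sum>b\<in>Basis. (h \<bullet> b) *\<^sub>R (\<Sum>n. partial_derivs (b # bs) (g n) x))) (at x within UNIV)"
  proof (rule has_derivative_series)
    show "(partial_derivs bs (g n) has_derivative
           (\<lambda>h. \<Sum>b\<in>Basis. (h \<bullet> b) *\<^sub>R partial_derivs (b # bs) (g n) x)) (at x within UNIV)" for n x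
      by (rule has_derivative_partial_derivs[OF sch bs])
    show "(\<lambda>n. partial_derivs bs (g n) x) sums (\<Sum>n. partial_derivs bs (g n) x)"
      by (rule summable_sums[OF summable_partial_derivs[OF bs]])
    fix e :: real assume "0 < e"
    hence "\<forall>\<^sub>F n in sequentially. (\<Sum>b\<in>(Basis::'a set). T b n) < e"
      using ST0 by (auto simp: order_tendsto_iff)
    thus "\<forall>\<^sub>F n in sequentially. \<forall>x\<in>UNIV. \<forall>h. norm ((\<Sum>i<n. \<Sum>b\<in>Basis. (h \<bullet> b) *\<^sub>R partial_derivs (b # bs) (g i) x) -
        (\<Sum>b\<in>Basis. (h \<bullet> b) *\<^sub>R (\<Sum>n. partial_derivs (b # bs) (g n) x))) \<le> e * norm h"
    proof eventually_elim
      case (elim n)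
      show ?case
      proof (intro ballI allI)
        fix x h :: 'a
        have "norm ((\<Sum>i<n. \<Sum>b\<in>Basis. (h \<bullet> b) *\<^sub>R partial_derivs (b # bs) (g i) x) -
          (\<Sum>b\<in>Basis. (h \<bullet> b) *\<^sub>R (\<Sum>n. partial_derivs (b # bs) (g n) x)))
          = norm (\<Sum>b\<in>Basis. (h \<bullet> b) *\<^sub>R ((\<Sum>i<n. partial_derivs (b # bs) (g i) x) - (\<Sum>n. partial_derivs (b # bs) (g n) x)))"
          by (subst sum.swap) (simp add: scaleR_sum_right scaleR_diff_right sum_subtractf del: partial_derivs.simps)
        also have "\<dots> \<le> (\<Sum>b\<in>Basis. norm ((h \<bullet> b) *\<^sub>R ((\<Sum>i<n. partial_derivs (b # bs) (g i) x) - (\<Sum>n. partial_derivs (b # bs) (g n) x))))"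
          by (rule norm_sum)
        also have "\<dots> \<le> (\<Sum>b\<in>Basis. norm h * T b n)"
        proof (rule sum_mono)
          fix b :: 'a assume b: "b \<in> Basis"
          show "norm ((h \<bullet> b) *\<^sub>R ((\<Sum>i<n. partial_derivs (b # bs) (g i) x) - (\<Sum>n. partial_derivs (b # bs) (g n) x))) \<le> norm h * T b n"
            unfolding norm_scaleR real_norm_def
            by (intro mult_mono tail b Basis_le_norm) auto
        qed
        also have "\<dots> = (\<Sum>b\<in>Basis. T b n) * norm h" by (simp add: sum_distrib_left sum_distrib_right mult.commute)
        also have "\<dots> \<le> e * norm h" using elim by (intro mult_right_mono) auto
        finally show "norm ((\<Sum>i<n. \<Sum>b\<in>Basis. (h \<bullet> b) *\<^sub>R partial_derivs (b # bs) (g i) x) -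
          (\<Sum>b\<in>Basis. (h \<bullet> b) *\<^sub>R (\<Sum>n. partial_derivs (b # bs) (g n) x))) \<le> e * norm h" .
      qed
    qed
  qed auto
  then obtain G where G: "\<And>x. (\<lambda>n. partial_derivs bs (g n) x) sums G x"
     "\<And>x. (G has_derivative (\<lambda>h. \<Sum>b\<in>Basis. (h \<bullet> b) *\<^sub>R (\<Sum>n. partial_derivs (b # bs) (g n) x))) (at x)"
    by auto
  have "G = (\<lambda>x. \<Sum>n. partial_derivs bs (g n) x)" using G(1) by (auto simp: sums_iff)
  with G(2) show ?thesis by simp
qed

lemma partial_derivs_suminf:
  assumes "set bs \<subseteq> Basis"
  shows "partial_derivs bs (\<lambda>x. \<Sum>n. g n x) = (\<lambda>x. \<Sum>n. partial_derivs bs (g n) x)"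
  using assms
proof (induction bs)
  case (Cons b bs)
  hence bs: "set bs \<subseteq> Basis" and b: "b \<in> Basis" by auto
  \<comment> \<open>By orthonormality of the basis the total derivative in the direction
    \<open>b\<close> reduces to one partial derivative.\<close>
  have *: "(\<Sum>c\<in>Basis. (b \<bullet> c) *\<^sub>R F c) = F b" for F :: "'a \<Rightarrow> complex"
  proof -
    have "(\<Sum>c\<in>Basis. (b \<bullet> c) *\<^sub>R F c) = (\<Sum>c\<in>Basis. if c = b then F c else 0)"
      using b by (intro sum.cong) (auto simp: inner_Basis)
    thus ?thesis using b by simp
  qed
  have "partial_derivs (b # bs) (\<lambda>x. \<Sum>n. g n x) =
        (\<lambda>x. frechet_derivative (\<lambda>x. \<Sum>n. partial_derivs bs (g n) x) (at x) b)"
    using Cons.IH[OF bs] by simp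
  also have "\<dots> = (\<lambda>x. \<Sum>n. partial_derivs (b # bs) (g n) x)"
    unfolding frechet_derivative_at[OF has_derivative_suminf_partial_derivs[OF bs], symmetric] * ..
  finally show ?case .
qed simp

lemma schwartz_suminf_seminorm:
  assumes bs: "set bs \<subseteq> Basis"
  shows "(1 + norm x) ^ N * norm (partial_derivs bs (\<lambda>x. \<Sum>n. g n x) x) \<le> (\<Sum>n. schwartz_seminorm N bs (g n))"
proof -
  have "(1 + norm x) ^ N * norm (partial_derivs bs (\<lambda>x. \<Sum>n. g n x) x)
        \<le> (1 + norm x) ^ N * (\<Sum>n. norm (partial_derivs bs (g n) x))"
    unfolding partial_derivs_suminf[OF bs]
    by (intro mult_left_mono summable_norm summable_norm_partial_derivs bs) auto
  also have "\<dots> = (\<Sum>n. (1 + norm x) ^ N * norm (partial_derivs bs (g n) x))"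
    by (rule suminf_mult[OF summable_norm_partial_derivs[OF bs], symmetric])
  also have "\<dots> \<le> (\<Sum>n. schwartz_seminorm N bs (g n))"
    by (intro suminf_le schwartz_bound sch bs summ summable_mult summable_norm_partial_derivs)
  finally show ?thesis .
qed

lemma schwartz_suminf: "schwartz (\<lambda>x. \<Sum>n. g n x)"
proof (rule schwartzI)
  fix bs :: "'a list" and x assume bs: "set bs \<subseteq> Basis"
  show "partial_derivs bs (\<lambda>x. \<Sum>n. g n x) differentiable (at x)"
    unfolding partial_derivs_suminf[OF bs] differentiable_def
    using has_derivative_suminf_partial_derivs[OF bs] by blast
qed (use schwartz_suminf_seminorm in blast)

end

section \<open>Exchange of a tempered distribution with a series\<close>

lemma tempered_distribution_add:
  "tempered_distribution u \<Longrightarrow> schwartz f \<Longrightarrow> schwartz g \<Longrightarrow> u (\<lambda>x. f x + g x) = u f + u g"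
  unfolding tempered_distribution_def by blast

lemma tempered_distribution_cmult:
  "tempered_distribution u \<Longrightarrow> schwartz f \<Longrightarrow> u (\<lambda>x. c * f x) = c * u f"
  unfolding tempered_distribution_def by blast

text \<open>Additivity peels off finitely many terms. What remains is \<open>u\<close> applied to
  the remainder \<open>R m\<close>, again a Schwartz function, whose seminorms are bounded by tails.
  Since the bound on \<open>u\<close> involves finitely many seminorms, \<open>u (R m)\<close> tends
  to 0.\<close>

lemma tempered_distribution_sums:
  fixes g :: "nat \<Rightarrow> 'a::euclidean_space \<Rightarrow> complex"
  assumes u: "tempered_distribution u" and sch: "\<And>n. schwartz (g n)"
    and summ: "\<And>N bs. set bs \<subseteq> Basis \<Longrightarrow> summable (\<lambda>n. schwartz_seminorm N bs (g n))"
  shows "(\<lambda>n. u (g n)) sums u (\<lambda>x. \<Sum>n. g n x)"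
proof -
  define R where "R m = (\<lambda>x. \<Sum>n. g (n + m) x)" for m
  have summ': "summable (\<lambda>n. schwartz_seminorm N bs (g (n + m)))" if "set bs \<subseteq> Basis" for N bs m
    by (rule summable_ignore_initial_segment[OF summ[OF that]])
  have R: "schwartz (R m)" for m unfolding R_def by (rule schwartz_suminf[OF sch summ'])
  have R_step: "R m = (\<lambda>x. g m x + R (Suc m) x)" for m
  proof
    fix x
    have "summable (\<lambda>n. g (n + m) x)"
      using summable_partial_derivs[of "\<lambda>n. g (n + m)" "[]" x] sch summ' by simp
    from suminf_split_head[OF this] show "R m x = g m x + R (Suc m) x"
      by (simp add: R_def)
  qed
  have split: "u (R 0) = (\<Sum>n<m. u (g n)) + u (R m)" for m
  proof (induction m)
    case (Suc m)
    have "u (R m) = u (g m) + u (R (Suc m))"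
      by (subst R_step) (rule tempered_distribution_add[OF u sch R])
    thus ?case using Suc by (simp add: add_ac)
  qed simp
  obtain C N where C: "\<And>f. schwartz f \<Longrightarrow> norm (u f) \<le>
      C * (\<Sum>n\<le>N. \<Sum>bs | set bs \<subseteq> Basis \<and> length bs \<le> N. schwartz_seminorm n bs f)"
    using u unfolding tempered_distribution_def by blast
  have lim: "(\<lambda>m. schwartz_seminorm n bs (R m)) \<longlonglongrightarrow> 0" if bs: "set bs \<subseteq> Basis" for n bs
  proof (rule tendsto_sandwich[OF _ _ tendsto_const suminf_exist_split2[OF summ[OF bs, of n]]])
    show "\<forall>\<^sub>F m in sequentially. 0 \<le> schwartz_seminorm n bs (R m)"
      by (intro always_eventually allI schwartz_seminorm_nonneg R bs)
    show "\<forall>\<^sub>F m in sequentially. schwartz_seminorm n bs (R m) \<le> (\<Sum>i. schwartz_seminorm n bs (g (i + m)))"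
      unfolding R_def
      by (intro always_eventually allI schwartz_seminorm_le schwartz_suminf_seminorm sch summ' bs)
  qed
  have "(\<lambda>m. C * (\<Sum>n\<le>N. \<Sum>bs | set bs \<subseteq> Basis \<and> length bs \<le> N. schwartz_seminorm n bs (R m)))
        \<longlonglongrightarrow> C * (\<Sum>n\<le>N. \<Sum>bs\<in>{bs. set bs \<subseteq> (Basis::'a set) \<and> length bs \<le> N}. 0)"
    by (intro tendsto_mult tendsto_sum tendsto_const lim) auto
  hence L0: "(\<lambda>m. C * (\<Sum>n\<le>N. \<Sum>bs | set bs \<subseteq> Basis \<and> length bs \<le> N. schwartz_seminorm n bs (R m))) \<longlonglongrightarrow> 0"
    by (simp only: sum.neutral_const mult_zero_right)
  have "(\<lambda>m. u (R m)) \<longlonglongrightarrow> 0"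
    by (rule Lim_null_comparison[OF _ L0]) (intro always_eventually allI C R)
  hence "(\<lambda>m. u (R 0) - u (R m)) \<longlonglongrightarrow> u (R 0) - 0" by (intro tendsto_intros)
  moreover have "(\<lambda>m. u (R 0) - u (R m)) = (\<lambda>m. \<Sum>n<m. u (g n))"
    using split by (auto simp: fun_eq_iff algebra_simps)
  ultimately show ?thesis by (simp add: sums_def R_def)
qed

lemma schwartz_zero: "schwartz (\<lambda>x. 0 :: complex)"
proof -
  have "partial_derivs bs (\<lambda>x::'a. 0 :: complex) = (\<lambda>x. 0)" for bs
    by (induction bs) auto
  thus ?thesis by (intro schwartzI) auto
qed

lemma tempered_distribution_sum:
  assumes u: "tempered_distribution u" and "finite I" and "\<And>i. i \<in> I \<Longrightarrow> schwartz (F i)"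
  shows "schwartz (\<lambda>x. \<Sum>i\<in>I. F i x) \<and> u (\<lambda>x. \<Sum>i\<in>I. F i x) = (\<Sum>i\<in>I. u (F i))"
  using assms(2,3)
proof (induction I rule: finite_induct)
  case empty
  have "u (\<lambda>x. 0 * 0) = 0 * u (\<lambda>x. 0)" by (rule tempered_distribution_cmult[OF u schwartz_zero])
  thus ?case by (auto intro: schwartz_zero)
next
  case (insert i I)
  hence "u (\<lambda>x. F i x + (\<Sum>i\<in>I. F i x)) = u (F i) + u (\<lambda>x. \<Sum>i\<in>I. F i x)"
    by (intro tempered_distribution_add[OF u]) auto
  with insert show ?case by (auto intro!: schwartz_add)
qed

lemma enumerate_int_prod:
  obtains \<nu> :: "nat \<Rightarrow> int \<times> int" where "bij_betw \<nu> UNIV UNIV"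
  by (rule that[OF bij_betw_from_nat_into]) (auto simp: finite_prod)

text \<open>An enumeration of the lattice reduces the unordered sum to an ordinary series. The
  continuity bound of \<open>u\<close> makes the values absolutely summable, so the result does not
  depend on the enumeration.\<close>

lemma tempered_distribution_has_sum:
  fixes g :: "int \<times> int \<Rightarrow> 'a::euclidean_space \<Rightarrow> complex"
  assumes u: "tempered_distribution u" and sch: "\<And>k. schwartz (g k)"
    and summ: "\<And>N bs. set bs \<subseteq> Basis \<Longrightarrow> (\<lambda>k. schwartz_seminorm N bs (g k)) summable_on UNIV"
    and G: "\<And>x. ((\<lambda>k. g k x) has_sum G x) UNIV"
  shows "schwartz G" "((\<lambda>k. u (g k)) has_sum u G) UNIV"
proof -
  obtain \<nu> :: "nat \<Rightarrow> int \<times> int" where \<nu>: "bij_betw \<nu> UNIV UNIV"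
    by (rule enumerate_int_prod)
  have summ': "summable (\<lambda>n. schwartz_seminorm N bs (g (\<nu> n)))" if "set bs \<subseteq> Basis" for N bs
    using summ[OF that, of N] summable_on_reindex_bij_betw[OF \<nu>, of "\<lambda>k. schwartz_seminorm N bs (g k)"]
    by (auto intro: summable_on_imp_summable)
  have "(\<lambda>n. g (\<nu> n) x) sums G x" for x
    using G[of x] has_sum_reindex_bij_betw[OF \<nu>, of "\<lambda>k. g k x" "G x"] by (auto intro: has_sum_imp_sums)
  hence G_eq: "G = (\<lambda>x. \<Sum>n. g (\<nu> n) x)" by (auto simp: sums_iff)
  show "schwartz G" unfolding G_eq by (rule schwartz_suminf[OF sch summ'])
  have s: "(\<lambda>n. u (g (\<nu> n))) sums u G"
    unfolding G_eq by (rule tempered_distribution_sums[OF u sch summ'])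
  obtain C N where C: "\<And>f. schwartz f \<Longrightarrow> norm (u f) \<le>
      C * (\<Sum>n\<le>N. \<Sum>bs | set bs \<subseteq> Basis \<and> length bs \<le> N. schwartz_seminorm n bs f)"
    using u unfolding tempered_distribution_def by blast
  have "summable (\<lambda>n. norm (u (g (\<nu> n))))"
    by (rule summable_comparison_test'[where N = 0 and
          g = "\<lambda>m. C * (\<Sum>n\<le>N. \<Sum>bs | set bs \<subseteq> Basis \<and> length bs \<le> N. schwartz_seminorm n bs (g (\<nu> m)))"])
       (auto intro!: summable_mult summable_sum summ' C[OF sch])
  from norm_summable_imp_has_sum[OF this s] show "((\<lambda>k. u (g k)) has_sum u G) UNIV"
    using has_sum_reindex_bij_betw[OF \<nu>, of "\<lambda>k. u (g k)" "u G"] by simp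
qed

section \<open>Fourier analysis\<close>

lemma borel_measurable_cis [measurable]: "cis \<in> borel_measurable borel"
  by (intro borel_measurable_continuous_onI continuous_intros)

lemma integrable_tensor:
  fixes f :: "'a \<Rightarrow> complex" and g :: "'b \<Rightarrow> complex"
  assumes "sigma_finite_measure M" "sigma_finite_measure N" "integrable M f" "integrable N g"
  shows "integrable (M \<Otimes>\<^sub>M N) (\<lambda>(x, y). f x * g y)"
proof -
  interpret M: sigma_finite_measure M by fact
  interpret N: sigma_finite_measure N by fact
  interpret pair_sigma_finite M N ..
  have [measurable]: "f \<in> borel_measurable M" "g \<in> borel_measurable N" using assms by auto
  show ?thesis
    using assms by (intro Fubini_integrable) (auto simp: norm_mult)
qed

text \<open>Fubini, with the two phases merged into one. The order (inverse transform, multiplier,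
  forward transform) is the transpose of a Fourier multiplier and is exactly what reaches the test
  function when the distributional definitions of a block are unfolded.\<close>

lemma fourier_mult_inv_fourier:
  fixes m h :: "'a::euclidean_space \<Rightarrow> complex"
  assumes m: "integrable lborel m" and h: "integrable lborel h"
  shows "fourier (\<lambda>\<xi>. m \<xi> * inv_fourier h \<xi>) y =
    (LINT x|lborel. fourier m (y - x) / of_real ((2 * pi) ^ DIM('a)) * h x)"
proof -
  interpret lborel_pair: pair_sigma_finite "lborel :: 'a measure" "lborel :: 'a measure" ..
  let ?c = "of_real ((2 * pi) ^ DIM('a)) :: complex"
  let ?F = "\<lambda>\<xi> x. cis (\<xi> \<bullet> x - \<xi> \<bullet> y) * (m \<xi> * h x)"
  have [measurable]: "m \<in> borel_measurable borel" "h \<in> borel_measurable borel"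
    using m h by (auto dest: borel_measurable_integrable)
  have int: "integrable (lborel \<Otimes>\<^sub>M lborel) (\<lambda>(\<xi>, x). ?F \<xi> x)"
  proof (rule Bochner_Integration.integrable_bound[OF integrable_tensor[OF sigma_finite_lborel sigma_finite_lborel m h]])
    show "(\<lambda>(\<xi>, x). ?F \<xi> x) \<in> borel_measurable (lborel \<Otimes>\<^sub>M lborel)" by measurable
  qed (auto simp: norm_mult)
  have F: "?F \<xi> x = (cis (- (\<xi> \<bullet> y)) * m \<xi>) * (cis (\<xi> \<bullet> x) * h x)" for \<xi> x
  proof -
    have "cis (\<xi> \<bullet> x - \<xi> \<bullet> y) = cis (- (\<xi> \<bullet> y)) * cis (\<xi> \<bullet> x)" by (simp add: cis_mult)
    thus ?thesis by (simp only: mult_ac)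
  qed
  have "fourier (\<lambda>\<xi>. m \<xi> * inv_fourier h \<xi>) y = (LINT \<xi>|lborel. (LINT x|lborel. ?F \<xi> x) / ?c)"
    unfolding fourier_def inv_fourier_def F integral_mult_right_zero
    by (intro Bochner_Integration.integral_cong refl) (simp only: mult.assoc times_divide_eq_right)
  also have "\<dots> = (LINT \<xi>|lborel. (LINT x|lborel. ?F \<xi> x)) / ?c"
    by (rule integral_divide_zero)
  also have "(LINT \<xi>|lborel. (LINT x|lborel. ?F \<xi> x)) = (LINT x|lborel. (LINT \<xi>|lborel. ?F \<xi> x))"
    by (rule lborel_pair.Fubini_integral[OF int, symmetric])
  also have "\<dots> / ?c = (LINT x|lborel. fourier m (y - x) / ?c * h x)"
  proof (subst integral_divide_zero[symmetric], intro Bochner_Integration.integral_cong refl)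
    fix x
    have "(LINT \<xi>|lborel. ?F \<xi> x) = (LINT \<xi>|lborel. cis (- (\<xi> \<bullet> (y - x))) * m \<xi> * h x)"
      by (intro Bochner_Integration.integral_cong refl) (simp add: inner_diff_right mult_ac)
    thus "(LINT \<xi>|lborel. ?F \<xi> x) / ?c = fourier m (y - x) / ?c * h x"
      by (simp add: fourier_def)
  qed
  finally show ?thesis .
qed

lemma inv_fourier_eq_fourier:
  fixes f :: "'a::euclidean_space \<Rightarrow> complex"
  shows "inv_fourier f x = fourier f (- x) / of_real ((2 * pi) ^ DIM('a))"
  unfolding inv_fourier_def fourier_def by (simp add: inner_commute)

lemma norm_fourier_le: "norm (fourier f \<xi>) \<le> (LINT x|lborel. norm (f x))"
  unfolding fourier_def by (rule order_trans[OF integral_norm_bound]) (simp add: norm_mult)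

lemma integrable_cis_mult:
  assumes "integrable lborel (f :: 'a::euclidean_space \<Rightarrow> complex)"
  shows "integrable lborel (\<lambda>x. cis (- (x \<bullet> \<xi>)) * f x)"
proof (rule Bochner_Integration.integrable_bound[OF assms])
  have [measurable]: "f \<in> borel_measurable borel" using assms by auto
  show "(\<lambda>x. cis (- (x \<bullet> \<xi>)) * f x) \<in> borel_measurable lborel" by measurable
qed (auto simp: norm_mult)

lemma fourier_reflect:
  fixes f :: "real \<Rightarrow> complex"
  shows "fourier (\<lambda>x. f (- x)) \<xi> = fourier f (- \<xi>)"
proof -
  define F where "F x = cis (- (x \<bullet> - \<xi>)) * f x" for x
  have F: "F (0 + - 1 * x) = cis (- (x \<bullet> \<xi>)) * f (- x)" for x
    unfolding F_def by simp
  have "(LINT x|lborel. F x) = \<bar>- 1\<bar> *\<^sub>R (LINT x|lborel. F (0 + - 1 * x))"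
    by (rule lborel_integral_real_affine) simp
  thus ?thesis unfolding fourier_def F unfolding F_def abs_minus_cancel abs_one scaleR_one ..
qed

lemma fourier_affine:
  fixes f :: "real \<Rightarrow> complex"
  assumes "0 < a"
  shows "fourier (\<lambda>x. f (a * x - b)) \<xi> = cis (- (b * \<xi> / a)) / of_real a * fourier f (\<xi> / a)"
proof -
  have "fourier f (\<xi> / a) = of_real a * (LINT x|lborel. cis (- ((a * x - b) * (\<xi> / a))) * f (a * x - b))"
    using lborel_integral_real_affine[of a "\<lambda>x. cis (- (x * (\<xi> / a))) * f x" "- b"] assms
    by (simp add: fourier_def scaleR_conv_of_real)
  also have "(LINT x|lborel. cis (- ((a * x - b) * (\<xi> / a))) * f (a * x - b)) =
     (LINT x|lborel. cis (b * \<xi> / a) * (cis (- (x * \<xi>)) * f (a * x - b)))"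
  proof (intro Bochner_Integration.integral_cong refl)
    fix x
    have "- ((a * x - b) * (\<xi> / a)) = b * \<xi> / a + - (x * \<xi>)" using assms by (simp add: field_simps)
    thus "cis (- ((a * x - b) * (\<xi> / a))) * f (a * x - b) =
          cis (b * \<xi> / a) * (cis (- (x * \<xi>)) * f (a * x - b))"
      by (simp only: mult.assoc[symmetric] cis_mult)
  qed
  also have "\<dots> = cis (b * \<xi> / a) * fourier (\<lambda>x. f (a * x - b)) \<xi>"
    by (simp add: fourier_def)
  finally have "cis (- (b * \<xi> / a)) / of_real a * fourier f (\<xi> / a) =
     (cis (- (b * \<xi> / a)) * cis (b * \<xi> / a)) * fourier (\<lambda>x. f (a * x - b)) \<xi>"
    using assms by simp
  thus ?thesis unfolding cis_mult by simp
qed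

section \<open>Gaussian summation and Fourier inversion\<close>

definition gauss :: "real \<Rightarrow> complex" where
  "gauss x = of_real (exp (- x\<^sup>2 / 2))"

lemma gauss_eq_density: "gauss x = sqrt (2 * pi) * std_normal_density x"
  by (simp add: gauss_def std_normal_density_def)

lemma integrable_gauss: "integrable lborel gauss"
proof -
  have "integrable lborel std_normal_density" by (rule integrable_normal_density) simp
  thus ?thesis unfolding gauss_eq_density[abs_def] by simp
qed

text \<open>A restatement of the characteristic function of the standard normal law; the opposite
  sign convention is harmless because the Gaussian is even.\<close>

lemma fourier_gauss: "fourier gauss \<xi> = sqrt (2 * pi) * gauss \<xi>"
proof -
  have "gauss \<xi> = char std_normal_distribution (- \<xi>)"
    by (simp add: char_std_normal_distribution gauss_def)
  also have "\<dots> = (LINT x|lborel. std_normal_density x *\<^sub>R iexp (- \<xi> * x))"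
    unfolding char_def by (subst integral_density) (auto simp: normal_density_nonneg)
  also have "\<dots> = (LINT x|lborel. cis (- (x * \<xi>)) * std_normal_density x)"
    by (intro Bochner_Integration.integral_cong refl)
       (simp add: cis_conv_exp scaleR_conv_of_real mult_ac)
  finally have "of_real (sqrt (2 * pi)) * gauss \<xi> = (LINT x|lborel. of_real (sqrt (2 * pi)) * (cis (- (x * \<xi>)) * std_normal_density x))"
    by simp
  also have "\<dots> = fourier gauss \<xi>"
    unfolding fourier_def gauss_eq_density
    by (intro Bochner_Integration.integral_cong refl) (simp add: mult_ac)
  finally show ?thesis by simp
qed

lemma integral_gauss: "(LINT x|lborel. gauss x) = sqrt (2 * pi)"
  using fourier_gauss[of 0] by (simp add: fourier_def gauss_def)

text \<open>Fourier inversion by Gaussian summation: damping the frequency integral by \<open>gauss (\<epsilon> \<xi>)\<close>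
  averages \<open>h\<close> against a Gaussian of width \<open>\<epsilon>\<close>.\<close>

lemma fourier_inv_fourier:
  fixes h :: "real \<Rightarrow> complex"
  assumes cont: "continuous_on UNIV h" and bnd: "\<And>x. norm (h x) \<le> B"
    and int: "integrable lborel h" and int': "integrable lborel (inv_fourier h)"
  shows "fourier (inv_fourier h) y = h y"
proof -
  define e where "e n = 1 / real (Suc n)" for n
  have e: "e n > 0" for n by (simp add: e_def)
  have e0: "e \<longlonglongrightarrow> 0" unfolding e_def by real_asymp
  have [measurable]: "h \<in> borel_measurable borel" "inv_fourier h \<in> borel_measurable borel"
    using int int' by auto
  have [measurable]: "gauss \<in> borel_measurable borel"
    using integrable_gauss by auto
  have gcont: "isCont gauss x" for x unfolding gauss_def by (intro continuous_intros) auto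
  have g1: "norm (gauss x) \<le> 1" for x by (simp add: gauss_def)
  have "(\<lambda>n. fourier (\<lambda>\<xi>. gauss (e n * \<xi>) * inv_fourier h \<xi>) y) \<longlonglongrightarrow> fourier (inv_fourier h) y"
    unfolding fourier_def
  proof (rule integral_dominated_convergence[where w = "\<lambda>\<xi>. norm (inv_fourier h \<xi>)"])
    show "AE \<xi> in lborel. (\<lambda>n. cis (- (\<xi> \<bullet> y)) * (gauss (e n * \<xi>) * inv_fourier h \<xi>))
            \<longlonglongrightarrow> cis (- (\<xi> \<bullet> y)) * inv_fourier h \<xi>"
    proof (intro AE_I2)
      fix \<xi> :: real
      have "(\<lambda>n. gauss (e n * \<xi>)) \<longlonglongrightarrow> gauss (0 * \<xi>)"
        by (intro isCont_tendsto_compose[OF gcont] tendsto_intros e0)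
      hence "(\<lambda>n. cis (- (\<xi> \<bullet> y)) * (gauss (e n * \<xi>) * inv_fourier h \<xi>))
            \<longlonglongrightarrow> cis (- (\<xi> \<bullet> y)) * (gauss (0 * \<xi>) * inv_fourier h \<xi>)"
        by (intro tendsto_intros)
      thus "(\<lambda>n. cis (- (\<xi> \<bullet> y)) * (gauss (e n * \<xi>) * inv_fourier h \<xi>))
            \<longlonglongrightarrow> cis (- (\<xi> \<bullet> y)) * inv_fourier h \<xi>" by (simp add: gauss_def)
    qed
    show "AE x in lborel. norm (cis (- (x \<bullet> y)) * (gauss (e i * x) * inv_fourier h x)) \<le> norm (inv_fourier h x)" for i
      using mult_right_mono[OF g1] by (auto simp: norm_mult)
  qed (use int' in auto)
  moreover have "(\<lambda>n. fourier (\<lambda>\<xi>. gauss (e n * \<xi>) * inv_fourier h \<xi>) y) \<longlonglongrightarrow> h y"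
  proof -
    \<comment> \<open>The numerator comes from the transform of the Gaussian, the denominator from
      the inversion formula; multiplied by the total mass of \<open>gauss\<close> the constant gives
      1.\<close>
    define c :: complex where "c = of_real (sqrt (2 * pi) / (2 * pi))"
    have c: "c * of_real (sqrt (2 * pi)) = 1"
      unfolding c_def of_real_mult[symmetric] by (simp add: real_sqrt_mult_self del: real_sqrt_mult)
    have eq: "fourier (\<lambda>\<xi>. gauss (e n * \<xi>) * inv_fourier h \<xi>) y =
          (LINT x|lborel. c * (gauss x * h (y - e n * x)))" for n
    proof -
      define F where "F x = c / of_real (e n) * (gauss ((y - x) / e n) * h x)" for x
      have ig: "integrable lborel (\<lambda>\<xi>. gauss (e n * \<xi>))"
        using lborel_integrable_real_affine[OF integrable_gauss, of "e n" 0] e[of n] by simp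
      have fg: "fourier (\<lambda>\<xi>. gauss (e n * \<xi>)) z = sqrt (2 * pi) / e n * gauss (z / e n)" for z
        using fourier_affine[OF e[of n], of gauss 0 z] by (simp add: fourier_gauss)
      have "fourier (\<lambda>\<xi>. gauss (e n * \<xi>) * inv_fourier h \<xi>) y = (LINT x|lborel. F x)"
        unfolding fourier_mult_inv_fourier[OF ig int] fg F_def c_def
        by (intro Bochner_Integration.integral_cong refl) (simp add: mult_ac)
      also have "\<dots> = \<bar>- e n\<bar> *\<^sub>R (LINT x|lborel. F (y + - e n * x))"
        by (rule lborel_integral_real_affine) (use e[of n] in simp)
      also have "\<dots> = (LINT x|lborel. of_real (e n) * F (y + - e n * x))"
        using e[of n] by (simp add: scaleR_conv_of_real)
      also have "\<dots> = (LINT x|lborel. c * (gauss x * h (y - e n * x)))"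
        unfolding F_def using e[of n] by (intro Bochner_Integration.integral_cong refl) simp
      finally show ?thesis .
    qed
    have "(\<lambda>n. LINT x|lborel. c * (gauss x * h (y - e n * x)))
       \<longlonglongrightarrow> (LINT x|lborel. c * (gauss x * h y))"
    proof (rule integral_dominated_convergence[where w = "\<lambda>x. norm (c * gauss x) * B"])
      have hc: "isCont h x" for x using cont by (simp add: continuous_on_eq_continuous_at)
      have "(\<lambda>n. h (y - e n * x)) \<longlonglongrightarrow> h (y - 0 * x)" for x
        by (intro isCont_tendsto_compose[OF hc] tendsto_intros e0)
      thus "AE x in lborel. (\<lambda>n. c * (gauss x * h (y - e n * x))) \<longlonglongrightarrow> c * (gauss x * h y)"
        by (intro AE_I2 tendsto_intros) simp
      show "AE x in lborel. norm (c * (gauss x * h (y - e i * x))) \<le> norm (c * gauss x) * B" for i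
        unfolding mult.assoc[symmetric] norm_mult
        by (intro AE_I2 mult_left_mono bnd mult_nonneg_nonneg norm_ge_zero)
      show "integrable lborel (\<lambda>x. norm (c * gauss x) * B)"
        using integrable_gauss by (intro integrable_mult_left integrable_norm integrable_mult_right)
    qed auto
    also have "(LINT x|lborel. c * (gauss x * h y)) = (c * of_real (sqrt (2 * pi))) * h y"
      by (simp only: integral_mult_right_zero integral_mult_left_zero integral_gauss mult.assoc)
    also have "\<dots> = h y" unfolding c by simp
    finally show ?thesis unfolding eq .
  qed
  ultimately show ?thesis by (rule LIMSEQ_unique)
qed

text \<open>The other order of inversion follows by reflection: the inverse transform of
  \<open>h (- x)\<close> is the forward transform of \<open>h\<close> divided by
  \<open>2 * pi\<close>.\<close>

lemma inv_fourier_fourier: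
  fixes h :: "real \<Rightarrow> complex"
  assumes cont: "continuous_on UNIV h" and bnd: "\<And>x. norm (h x) \<le> B"
    and int: "integrable lborel h" and int': "integrable lborel (fourier h)"
  shows "inv_fourier (fourier h) y = h y"
proof -
  let ?h = "\<lambda>x. h (- x)"
  have inv: "inv_fourier ?h = (\<lambda>\<xi>. fourier h \<xi> / (2 * pi))"
    by (intro ext) (simp add: inv_fourier_eq_fourier fourier_reflect)
  have "fourier (inv_fourier ?h) (- y) = ?h (- y)"
  proof (rule fourier_inv_fourier)
    show "integrable lborel ?h"
      using lborel_integrable_real_affine[OF int, of "-1" 0] by simp
    show "integrable lborel (inv_fourier ?h)" unfolding inv using int' by simp
    show "continuous_on UNIV ?h"
      by (intro continuous_on_compose2[OF cont] continuous_intros) auto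
  qed (rule bnd)
  thus ?thesis unfolding inv by (simp add: inv_fourier_eq_fourier fourier_def)
qed

section \<open>The Fourier transform preserves the Schwartz class in one variable\<close>

lemma integrable_wt: "2 \<le> N \<Longrightarrow> integrable lborel (wt N)"
  using nn_integral_wt[of N] by (intro integrableI_nonneg) (auto intro: le_less_trans)

lemma integrable_wt_bound:
  fixes f :: "real \<Rightarrow> 'b::{banach, second_countable_topology}"
  assumes "f \<in> borel_measurable borel" "\<And>x. norm (f x) \<le> C * wt 2 x"
  shows "integrable lborel f"
  by (rule Bochner_Integration.integrable_bound[OF integrable_mult_right[where c = C, OF integrable_wt[of 2]]])
     (use assms in \<open>auto intro: order_trans[OF _ abs_ge_self]\<close>)

lemma schwartz_seq_integrable:
  fixes D :: "nat \<Rightarrow> real \<Rightarrow> complex"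
  assumes "schwartz_seq D"
  shows "integrable lborel (D n)"
  using schwartz_seq_bound[OF assms, of n 2] schwartz_seq_measurable[OF assms, of n]
  by (metis integrable_wt_bound)

lemma schwartz_seq_diff:
  assumes D: "schwartz_seq D" and E: "schwartz_seq E"
  shows "schwartz_seq (\<lambda>n x. D n x - E n x)"
proof (rule schwartz_seqI)
  show "((\<lambda>x. D n x - E n x) has_vector_derivative D (Suc n) x - E (Suc n) x) (at x)" for n x
    by (intro has_vector_derivative_diff schwartz_seq_deriv D E)
  fix n N
  obtain A where A: "\<And>x. norm (D n x) \<le> A * wt N x" using schwartz_seq_bound[OF D] by metis
  obtain B where B: "\<And>x. norm (E n x) \<le> B * wt N x" using schwartz_seq_bound[OF E] by metis
  have "norm (D n x - E n x) \<le> (A + B) * wt N x" for x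
    using norm_triangle_ineq4[of "D n x" "E n x"] A[of x] B[of x] by (simp add: algebra_simps)
  thus "\<exists>C. \<forall>x. norm (D n x - E n x) \<le> C * wt N x" by blast
qed

text \<open>Leibniz' rule for the product with the identity function. At \<open>n = 0\<close> the
  truncated index \<open>n - 1\<close> is harmless, since its coefficient vanishes.\<close>

lemma schwartz_seq_mult_ident:
  fixes D :: "nat \<Rightarrow> real \<Rightarrow> complex"
  assumes D: "schwartz_seq D"
  shows "schwartz_seq (\<lambda>n x. of_real x * D n x + of_nat n * D (n - 1) x)"
proof (rule schwartz_seqI)
  fix n :: nat and x :: real
  have nD: "((\<lambda>x. of_nat n * D (n - 1) x) has_vector_derivative of_nat n * D n x) (at x)"
    using has_vector_derivative_mult_right[OF schwartz_seq_deriv[OF D, of "n - 1" x], of "of_nat n"]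
    by (cases n) auto
  have "((\<lambda>x. of_real x * D n x) has_vector_derivative (of_real x * D (Suc n) x + 1 * D n x)) (at x)"
    by (rule has_vector_derivative_mult[OF _ schwartz_seq_deriv[OF D]])
       (use has_vector_derivative_of_real[OF DERIV_ident] in simp)
  from has_vector_derivative_add[OF this nD]
  show "((\<lambda>x. of_real x * D n x + of_nat n * D (n - 1) x) has_vector_derivative
         of_real x * D (Suc n) x + of_nat (Suc n) * D (Suc n - 1) x) (at x)"
    by (simp add: algebra_simps)
next
  fix n N
  obtain A where A: "0 < A" "\<And>x. norm (D n x) \<le> A * wt (Suc N) x" using schwartz_seq_bound[OF D] by metis
  obtain B where B: "0 < B" "\<And>x. norm (D (n - 1) x) \<le> B * wt N x" using schwartz_seq_bound[OF D] by metis
  have "norm (of_real x * D n x + of_nat n * D (n - 1) x) \<le> (A + of_nat n * B) * wt N x" for x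
  proof -
    have "\<bar>x\<bar> * wt (Suc N) x \<le> (1 + \<bar>x\<bar>) * wt (Suc N) x" by (intro mult_right_mono) auto
    also have "\<dots> = wt N x"
      using one_le_poly_wt[of x 1] wt_add[of 1 N x] by (simp add: mult.assoc[symmetric])
    finally have "norm (of_real x * D n x) \<le> A * wt N x"
      using order_trans[OF mult_left_mono[OF A(2)[of x], of "\<bar>x\<bar>"]]
        mult_left_mono[of "\<bar>x\<bar> * wt (Suc N) x" "wt N x" A] A(1)
      by (simp add: norm_mult mult_ac)
    moreover have "norm (of_nat n * D (n - 1) x) \<le> of_nat n * (B * wt N x)"
      using mult_left_mono[OF B(2)[of x], of "real n"] by (simp add: norm_mult)
    ultimately show ?thesis
      using norm_triangle_ineq[of "of_real x * D n x" "of_nat n * D (n - 1) x"] by (simp add: algebra_simps)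
  qed
  thus "\<exists>C. \<forall>x. norm (of_real x * D n x + of_nat n * D (n - 1) x) \<le> C * wt N x" by blast
qed

lemma schwartz_seq_mult_monom:
  fixes D :: "nat \<Rightarrow> real \<Rightarrow> complex"
  assumes "schwartz_seq D"
  shows "\<exists>E. schwartz_seq E \<and> E 0 = (\<lambda>x. (c * of_real x) ^ k * D 0 x)"
proof (induction k)
  case (Suc k)
  then obtain E where E: "schwartz_seq E" "E 0 = (\<lambda>x. (c * of_real x) ^ k * D 0 x)" by blast
  show ?case
  proof (intro exI conjI)
    show "schwartz_seq (\<lambda>n x. c * (of_real x * E n x + of_nat n * E (n - 1) x))"
      by (rule schwartz_seq_bounded_linear[OF schwartz_seq_mult_ident[OF E(1)] bounded_linear_mult_right])
  qed (simp add: E(2) mult_ac)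
qed (use assms in auto)

text \<open>The estimate \<open>|exp (iu) - 1 - iu| \<le> u^2 / 2\<close> under the integral bounds
  the error of the linear approximation by \<open>t^2\<close> times the second absolute moment of
  \<open>h\<close>.\<close>

lemma fourier_has_vector_derivative:
  fixes h :: "real \<Rightarrow> complex"
  assumes h: "integrable lborel h" "integrable lborel (\<lambda>x. of_real x * h x)" "integrable lborel (\<lambda>x. (of_real x)\<^sup>2 * h x)"
  shows "(fourier h has_vector_derivative fourier (\<lambda>x. - \<i> * of_real x * h x) \<xi>) (at \<xi>)"
proof -
  let ?h' = "\<lambda>x. - \<i> * of_real x * h x"
  have h': "integrable lborel ?h'" using integrable_mult_right[OF h(2), of "- \<i>"] by (simp add: mult.assoc)
  define K where "K = (LINT x|lborel. norm ((of_real x)\<^sup>2 * h x))"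
  have bound: "norm (fourier h (\<xi> + t) - fourier h \<xi> - t *\<^sub>R fourier ?h' \<xi>) \<le> t\<^sup>2 * K" for t
  proof -
    have "fourier h (\<xi> + t) - fourier h \<xi> - t *\<^sub>R fourier ?h' \<xi> =
      (LINT x|lborel. cis (- (x \<bullet> (\<xi> + t))) * h x - cis (- (x \<bullet> \<xi>)) * h x - t *\<^sub>R (cis (- (x \<bullet> \<xi>)) * ?h' x))"
      unfolding fourier_def
      using integrable_cis_mult[OF h(1)] integrable_cis_mult[OF h'] by simp
    also have "norm \<dots> \<le> (LINT x|lborel. t\<^sup>2 * norm ((of_real x)\<^sup>2 * h x))"
    proof (rule order_trans[OF integral_norm_bound integral_mono])
      show "integrable lborel (\<lambda>x. norm (cis (- (x \<bullet> (\<xi> + t))) * h x - cis (- (x \<bullet> \<xi>)) * h x - t *\<^sub>R (cis (- (x \<bullet> \<xi>)) * ?h' x)))"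
        using integrable_cis_mult[OF h(1)] integrable_cis_mult[OF h'] by (intro integrable_norm) simp
      show "integrable lborel (\<lambda>x. t\<^sup>2 * norm ((of_real x)\<^sup>2 * h x))"
        using h(3) by (intro integrable_mult_right integrable_norm)
      fix x :: real
      have "cis (- (x \<bullet> (\<xi> + t))) = cis (- (x * \<xi>)) * iexp (- (x * t))"
        by (simp add: cis_conv_exp exp_add[symmetric] algebra_simps)
      hence "cis (- (x \<bullet> (\<xi> + t))) * h x - cis (- (x \<bullet> \<xi>)) * h x - t *\<^sub>R (cis (- (x \<bullet> \<xi>)) * ?h' x)
          = cis (- (x * \<xi>)) * h x * (iexp (- (x * t)) - (\<Sum>k\<le>1. (\<i> * of_real (- (x * t))) ^ k / fact k))"
        by (simp add: scaleR_conv_of_real algebra_simps)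
      also have "norm \<dots> \<le> norm (h x) * (\<bar>- (x * t)\<bar> ^ Suc 1 / fact (Suc 1))"
        unfolding norm_mult norm_cis mult_1_left
        by (intro mult_left_mono iexp_approx1) auto
      also have "\<dots> \<le> t\<^sup>2 * norm ((of_real x)\<^sup>2 * h x)"
      proof -
        have "norm (h x) * (\<bar>- (x * t)\<bar> ^ Suc 1 / fact (Suc 1)) = norm (h x) * ((x * t)\<^sup>2 / 2)"
          by (simp add: power2_eq_square)
        also have "\<dots> \<le> norm (h x) * (x * t)\<^sup>2" by (intro mult_left_mono) auto
        finally show ?thesis by (simp add: norm_mult norm_power power_mult_distrib mult_ac)
      qed
      finally show "norm (cis (- (x \<bullet> (\<xi> + t))) * h x - cis (- (x \<bullet> \<xi>)) * h x - t *\<^sub>R (cis (- (x \<bullet> \<xi>)) * ?h' x))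
         \<le> t\<^sup>2 * norm ((of_real x)\<^sup>2 * h x)" .
    qed
    finally show ?thesis by (simp add: K_def)
  qed
  have "(\<lambda>t. norm (fourier h (\<xi> + t) - fourier h \<xi> - t *\<^sub>R fourier ?h' \<xi>) / norm t) \<midarrow>0\<rightarrow> 0"
  proof (rule Lim_null_comparison)
    show "\<forall>\<^sub>F t in at 0. norm (norm (fourier h (\<xi> + t) - fourier h \<xi> - t *\<^sub>R fourier ?h' \<xi>) / norm t) \<le> \<bar>t\<bar> * K"
    proof (rule always_eventually, rule allI)
      fix t :: real
      show "norm (norm (fourier h (\<xi> + t) - fourier h \<xi> - t *\<^sub>R fourier ?h' \<xi>) / norm t) \<le> \<bar>t\<bar> * K"
        using bound[of t] by (cases "t = 0") (auto simp: divide_le_eq power2_eq_square mult_ac)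
    qed
    have "(\<lambda>t::real. \<bar>t\<bar> * K) \<midarrow>0\<rightarrow> \<bar>0\<bar> * K" by (intro tendsto_intros)
    thus "(\<lambda>t::real. \<bar>t\<bar> * K) \<midarrow>0\<rightarrow> 0" by simp
  qed
  thus ?thesis unfolding has_vector_derivative_def has_derivative_at
    by (intro conjI bounded_linear_scaleR_left)
qed

text \<open>Integration by parts: the function \<open>cis (- (x * \<xi>)) * D n x\<close> vanishes
  at both ends of the line, so its derivative has integral 0.\<close>

lemma fourier_deriv_seq:
  fixes D :: "nat \<Rightarrow> real \<Rightarrow> complex"
  assumes D: "schwartz_seq D"
  shows "fourier (D (Suc n)) \<xi> = \<i> * of_real \<xi> * fourier (D n) \<xi>"
proof -
  let ?w' = "\<lambda>x. cis (- (x * \<xi>)) * D (Suc n) x - \<i> * of_real \<xi> * (cis (- (x * \<xi>)) * D n x)"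
  note int = integrable_cis_mult[OF schwartz_seq_integrable[OF D], of \<xi>, simplified]
  have der: "((\<lambda>x. cis (- (x * \<xi>)) * D n x) has_vector_derivative ?w' x) (at x)" for x
  proof -
    have "((\<lambda>x. iexp (- (x * \<xi>))) has_vector_derivative (- \<i> * of_real \<xi> * iexp (- (x * \<xi>)))) (at x)"
      by (auto intro!: derivative_eq_intros has_vector_derivative_real_field simp: algebra_simps)
    from has_vector_derivative_mult[OF this schwartz_seq_deriv[OF D]]
    show ?thesis by (simp add: cis_conv_exp algebra_simps)
  qed
  obtain C where C: "0 < C" "\<And>x. norm (D n x) \<le> C * wt 1 x" using schwartz_seq_bound[OF D] by blast
  have lim: "((\<lambda>x. cis (- (x * \<xi>)) * D n x) \<longlongrightarrow> 0) F" if "((\<lambda>x. C * wt 1 x) \<longlongrightarrow> 0) F" for F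
    by (rule Lim_null_comparison[OF always_eventually that]) (use C in \<open>simp add: norm_mult\<close>)
  have "(LBINT x=-\<infinity>..\<infinity>. ?w' x) = 0 - 0"
  proof (rule interval_integral_FTC_integrable)
    show "((\<lambda>x. cis (- (x * \<xi>)) * D n x) has_vector_derivative ?w' x) (at x)" for x by (rule der)
    have "continuous_on UNIV ?w'" by (intro continuous_intros schwartz_seq_continuous[OF D])
    thus "isCont ?w' x" for x by (simp add: continuous_on_eq_continuous_at)
    show "set_integrable lborel (einterval (-\<infinity>) \<infinity>) ?w'"
      using int by (simp add: set_integrable_def)
    show "(((\<lambda>x. cis (- (x * \<xi>)) * D n x) \<circ> real_of_ereal) \<longlongrightarrow> 0) (at_right (- \<infinity>))"
      unfolding ereal_tendsto_simps1 by (rule lim) (simp add: wt_def, real_asymp)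
    show "(((\<lambda>x. cis (- (x * \<xi>)) * D n x) \<circ> real_of_ereal) \<longlongrightarrow> 0) (at_left \<infinity>)"
      unfolding ereal_tendsto_simps1 by (rule lim) (simp add: wt_def, real_asymp)
  qed auto
  hence "(LINT x|lborel. ?w' x) = 0"
    by (simp add: interval_lebesgue_integral_def set_lebesgue_integral_def)
  thus ?thesis using int by (simp add: fourier_def)
qed

text \<open>The n-th derivative of the transform is the transform of \<open>H n\<close>, the
  function multiplied by \<open>(- \<i> x)^n\<close>. Since \<open>H n\<close> is Schwartz,
  transforming its derivatives yields decay of any polynomial order.\<close>

lemma schwartz_seq_fourier:
  fixes D :: "nat \<Rightarrow> real \<Rightarrow> complex"
  assumes D: "schwartz_seq D"
  shows "\<exists>E. schwartz_seq E \<and> E 0 = fourier (D 0)"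
proof -
  define H where "H n x = (- \<i> * of_real x) ^ n * D 0 x" for n x
  have HS: "\<exists>E. schwartz_seq E \<and> E 0 = H n" for n
    using schwartz_seq_mult_monom[OF D] unfolding H_def by blast
  have Hint: "integrable lborel (\<lambda>x. (c * of_real x) ^ k * H n x)" for n k and c :: complex
  proof -
    obtain E where E: "schwartz_seq E" "E 0 = H n" using HS by blast
    obtain E' where E': "schwartz_seq E'" "E' 0 = (\<lambda>x. (c * of_real x) ^ k * E 0 x)"
      using schwartz_seq_mult_monom[OF E(1)] by blast
    show ?thesis using schwartz_seq_integrable[OF E'(1), of 0] unfolding E'(2) E(2) .
  qed
  have "schwartz_seq (\<lambda>n. fourier (H n))"
  proof (rule schwartz_seqI)
    fix n \<xi>
    have "(\<lambda>x. - \<i> * of_real x * H n x) = H (Suc n)" by (simp add: H_def fun_eq_iff mult_ac)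
    moreover have "(fourier (H n) has_vector_derivative fourier (\<lambda>x. - \<i> * of_real x * H n x) \<xi>) (at \<xi>)"
      by (rule fourier_has_vector_derivative)
         (use Hint[of 1 0 n] Hint[of 1 1 n] Hint[of 1 2 n] in auto)
    ultimately show "(fourier (H n) has_vector_derivative fourier (H (Suc n)) \<xi>) (at \<xi>)" by simp
  next
    fix n N
    obtain E where E: "schwartz_seq E" "E 0 = H n" using HS by blast
    define B where "B k = (LINT x|lborel. norm (E k x))" for k
    have pow: "fourier (E k) \<xi> = (\<i> * of_real \<xi>) ^ k * fourier (H n) \<xi>" for k \<xi>
      by (induction k) (simp_all add: E(2) fourier_deriv_seq[OF E(1)] mult_ac)
    have le: "\<bar>\<xi>\<bar> ^ k * norm (fourier (H n) \<xi>) \<le> B k" for k \<xi>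
      using norm_fourier_le[of "E k" \<xi>] unfolding pow B_def by (simp add: norm_mult norm_power)
    have "norm (fourier (H n) \<xi>) \<le> (2 ^ N * (B 0 + B N)) * wt N \<xi>" for \<xi>
    proof -
      \<comment> \<open>The full weight is reduced to the powers 0 and \<open>N\<close> of
        \<open>|\<xi>|\<close>, which are controlled by the \<open>L^1\<close> norms
        \<open>B 0\<close> and \<open>B N\<close>.\<close>
      have "(1 + \<bar>\<xi>\<bar>) ^ N \<le> 2 ^ N * (1 + \<bar>\<xi>\<bar> ^ N)"
      proof (cases "\<bar>\<xi>\<bar> \<le> 1")
        case True
        hence "(1 + \<bar>\<xi>\<bar>) ^ N \<le> 2 ^ N * 1" by (simp add: power_mono)
        also have "\<dots> \<le> 2 ^ N * (1 + \<bar>\<xi>\<bar> ^ N)" by (intro mult_left_mono) auto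
        finally show ?thesis .
      next
        case False
        hence "(1 + \<bar>\<xi>\<bar>) ^ N \<le> (2 * \<bar>\<xi>\<bar>) ^ N" by (intro power_mono) auto
        also have "\<dots> = 2 ^ N * \<bar>\<xi>\<bar> ^ N" by (rule power_mult_distrib)
        also have "\<dots> \<le> 2 ^ N * (1 + \<bar>\<xi>\<bar> ^ N)" by (intro mult_left_mono) auto
        finally show ?thesis .
      qed
      hence "(1 + \<bar>\<xi>\<bar>) ^ N * norm (fourier (H n) \<xi>) \<le> 2 ^ N * (1 + \<bar>\<xi>\<bar> ^ N) * norm (fourier (H n) \<xi>)"
        by (intro mult_right_mono) auto
      also have "\<dots> \<le> 2 ^ N * (B 0 + B N)"
        using le[of \<xi> 0] le[of \<xi> N] unfolding mult.assoc by (intro mult_left_mono) (simp_all add: algebra_simps)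
      finally show ?thesis by (simp add: wt_def field_simps add_pos_nonneg)
    qed
    thus "\<exists>C. \<forall>x. norm (fourier (H n) x) \<le> C * wt N x" by blast
  qed
  moreover have "H 0 = D 0" by (simp add: H_def fun_eq_iff)
  ultimately show ?thesis by (intro exI[of _ "\<lambda>n. fourier (H n)"]) simp
qed

section \<open>Littlewood--Paley kernels\<close>

definition conv :: "(real \<Rightarrow> complex) \<Rightarrow> (real \<Rightarrow> complex) \<Rightarrow> real \<Rightarrow> complex" where
  "conv f h y = (LINT x|lborel. f (y - x) * h x)"

locale littlewood_paley =
  fixes \<theta>\<^sub>0 :: "real \<Rightarrow> real"
  assumes generator: "littlewood_paley_generator \<theta>\<^sub>0"
begin

text \<open>Kernel of the cut-off to frequencies of size at most about \<open>2 ^ b\<close>, in the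
  normalisation of \<open>fourier_mult_inv_fourier\<close>. As the generator need not be even, the
  forward transform is a genuine choice of sign here; the same applies to
  \<open>kern\<close>.\<close>

definition lowpass :: "nat \<Rightarrow> real \<Rightarrow> complex" where
  "lowpass b z = fourier (\<lambda>\<xi>. of_real (\<theta>\<^sub>0 (\<xi> / 2 ^ b))) z / of_real (2 * pi)"

definition kern :: "nat \<Rightarrow> real \<Rightarrow> complex" where
  "kern j z = fourier (\<lambda>\<xi>. of_real (theta \<theta>\<^sub>0 j \<xi>)) z / of_real (2 * pi)"

lemma theta0_eq_0: "2 < \<bar>\<xi>\<bar> \<Longrightarrow> \<theta>\<^sub>0 \<xi> = 0"
  using generator closure_subset[of "{x. \<theta>\<^sub>0 x \<noteq> 0}"]
  unfolding littlewood_paley_generator_def support_def by fastforce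

lemma theta0_eq_1: "\<bar>\<xi>\<bar> \<le> 1 \<Longrightarrow> \<theta>\<^sub>0 \<xi> = 1"
  using generator unfolding littlewood_paley_generator_def
  by (metis abs_le_iff atLeastAtMost_iff minus_le_iff)

lemma theta_eq_0_above: "2 ^ Suc j < \<bar>\<xi>\<bar> \<Longrightarrow> theta \<theta>\<^sub>0 j \<xi> = 0"
proof (cases j)
  case (Suc i)
  assume *: "2 ^ Suc j < \<bar>\<xi>\<bar>"
  have "\<theta>\<^sub>0 (\<xi> / 2 ^ j) = 0" using * by (intro theta0_eq_0) (simp add: field_simps)
  moreover have "\<theta>\<^sub>0 (\<xi> / 2 ^ i) = 0"
  proof (rule theta0_eq_0)
    have "2 * 2 ^ i < \<bar>\<xi>\<bar>"
      using * zero_less_power[of "2::real" i] unfolding Suc power_Suc by linarith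
    thus "2 < \<bar>\<xi> / 2 ^ i\<bar>" by (simp add: pos_less_divide_eq)
  qed
  ultimately show ?thesis using Suc by (simp add: theta_def)
qed (simp add: theta_def theta0_eq_0)

text \<open>Both cut-offs in the difference equal 1 there. Together with
  \<open>theta_eq_0_above\<close> this confines the j-th multiplier, for \<open>j \<ge> 1\<close>,
  to the shell \<open>2^(j-1) \<le> |\<xi>| \<le> 2^(j+1)\<close>.\<close>

lemma theta_eq_0_below: "\<bar>\<xi>\<bar> \<le> 2 ^ j \<Longrightarrow> theta \<theta>\<^sub>0 (Suc j) \<xi> = 0"
  using theta0_eq_1[of "\<xi> / 2 ^ j"] theta0_eq_1[of "\<xi> / 2 ^ Suc j"]
  by (simp add: theta_def field_simps)

lemma sum_theta: "(\<Sum>j\<le>b. theta \<theta>\<^sub>0 j \<xi>) = \<theta>\<^sub>0 (\<xi> / 2 ^ b)"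
  by (induction b) (auto simp: theta_def)

lemma ex_theta0_seq: "\<exists>D. schwartz_seq D \<and> D 0 = (\<lambda>\<xi>. complex_of_real (\<theta>\<^sub>0 (\<xi> / 2 ^ b)))"
proof -
  obtain D where D: "D 0 = \<theta>\<^sub>0" "schwartz_seq D"
    using schwartz_real_seq generator unfolding littlewood_paley_generator_def by blast
  have "schwartz_seq (\<lambda>n x. complex_of_real ((1 / 2 ^ b) ^ n *\<^sub>R D n (1 / 2 ^ b * x - 0)))"
    by (intro schwartz_seq_bounded_linear[OF _ bounded_linear_of_real] schwartz_seq_affine D) auto
  thus ?thesis using D(1)
    by (intro exI[of _ "\<lambda>n x. complex_of_real ((1 / 2 ^ b) ^ n *\<^sub>R D n (1 / 2 ^ b * x - 0))"]) auto
qed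

lemma ex_theta_seq: "\<exists>D. schwartz_seq D \<and> D 0 = (\<lambda>\<xi>. complex_of_real (theta \<theta>\<^sub>0 j \<xi>))"
proof (cases j)
  case 0
  thus ?thesis using ex_theta0_seq[of 0] by (simp add: theta_def)
next
  case (Suc i)
  obtain D where D: "schwartz_seq D" "D 0 = (\<lambda>\<xi>. complex_of_real (\<theta>\<^sub>0 (\<xi> / 2 ^ j)))"
    using ex_theta0_seq by blast
  obtain E where E: "schwartz_seq E" "E 0 = (\<lambda>\<xi>. complex_of_real (\<theta>\<^sub>0 (\<xi> / 2 ^ i)))"
    using ex_theta0_seq by blast
  show ?thesis
  proof (intro exI conjI)
    show "schwartz_seq (\<lambda>n x. D n x - E n x)" by (rule schwartz_seq_diff[OF D(1) E(1)])
  qed (simp add: D(2) E(2) theta_def Suc)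
qed

lemma integrable_theta0: "integrable lborel (\<lambda>\<xi>. complex_of_real (\<theta>\<^sub>0 (\<xi> / 2 ^ b)))"
  using ex_theta0_seq[of b] schwartz_seq_integrable by metis

lemma integrable_theta: "integrable lborel (\<lambda>\<xi>. complex_of_real (theta \<theta>\<^sub>0 j \<xi>))"
  using ex_theta_seq[of j] schwartz_seq_integrable by metis

lemma fourier_diff:
  "integrable lborel f \<Longrightarrow> integrable lborel g \<Longrightarrow> fourier (\<lambda>x. f x - g x) \<xi> = fourier f \<xi> - fourier g \<xi>"
  unfolding fourier_def by (simp add: right_diff_distrib integrable_cis_mult)

lemma kern_0: "kern 0 = lowpass 0"
  by (simp add: kern_def lowpass_def theta_def fun_eq_iff)

lemma kern_Suc: "kern (Suc j) z = lowpass (Suc j) z - lowpass j z"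
  using fourier_diff[OF integrable_theta0[of "Suc j"] integrable_theta0[of j]]
  by (simp add: kern_def lowpass_def theta_def diff_divide_distrib)

text \<open>All low-pass kernels are mass-preserving dilates of one function. Decay of that single
  function therefore gives bounds with the same constant at all scales.\<close>

lemma lowpass_scale: "lowpass b z = 2 ^ b * lowpass 0 (2 ^ b * z)"
  using fourier_affine[of "1 / 2 ^ b" "\<lambda>\<xi>. complex_of_real (\<theta>\<^sub>0 \<xi>)" 0 z]
  by (simp add: lowpass_def mult.commute)

lemma ex_lowpass_seq: "\<exists>D. schwartz_seq D \<and> D 0 = lowpass b"
proof -
  obtain D where D: "schwartz_seq D" "D 0 = (\<lambda>\<xi>. complex_of_real (\<theta>\<^sub>0 (\<xi> / 2 ^ b)))"
    using ex_theta0_seq by blast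
  obtain E where E: "schwartz_seq E" "E 0 = fourier (D 0)" using schwartz_seq_fourier[OF D(1)] by blast
  show ?thesis
  proof (intro exI conjI)
    show "schwartz_seq (\<lambda>n x. E n x / of_real (2 * pi))"
      by (rule schwartz_seq_bounded_linear[OF E(1) bounded_linear_divide])
  qed (simp add: E(2) D(2) lowpass_def fun_eq_iff)
qed

lemma ex_kern_seq: "\<exists>D. schwartz_seq D \<and> D 0 = kern j"
proof -
  obtain D where D: "schwartz_seq D" "D 0 = (\<lambda>\<xi>. complex_of_real (theta \<theta>\<^sub>0 j \<xi>))"
    using ex_theta_seq by blast
  obtain E where E: "schwartz_seq E" "E 0 = fourier (D 0)" using schwartz_seq_fourier[OF D(1)] by blast
  show ?thesis
  proof (intro exI conjI)
    show "schwartz_seq (\<lambda>n x. E n x / of_real (2 * pi))"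
      by (rule schwartz_seq_bounded_linear[OF E(1) bounded_linear_divide])
  qed (simp add: E(2) D(2) kern_def fun_eq_iff)
qed

lemma continuous_kern: "continuous_on A (kern j)"
  using ex_kern_seq[of j] schwartz_seq_continuous by metis

lemma kern_measurable [measurable]: "kern j \<in> borel_measurable borel"
  by (intro borel_measurable_continuous_onI continuous_kern)

lemma lowpass_bound:
  obtains C where "0 < C" "\<And>b z. norm (lowpass b z) \<le> C * 2 ^ b * wt N (2 ^ b * z)"
proof -
  obtain D where D: "schwartz_seq D" "D 0 = lowpass 0" using ex_lowpass_seq by blast
  obtain C where C: "0 < C" "\<And>z. norm (D 0 z) \<le> C * wt N z" using schwartz_seq_bound[OF D(1)] by blast
  have "norm (lowpass b z) \<le> C * 2 ^ b * wt N (2 ^ b * z)" for b z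
    using mult_left_mono[OF C(2)[of "2 ^ b * z"], of "2 ^ b"]
    by (subst lowpass_scale) (simp add: D(2) norm_mult norm_power mult_ac)
  with C(1) show thesis by (rule that)
qed

lemma kern_bound:
  obtains C where "0 < C" "\<And>j z. norm (kern j z) \<le> C * 2 ^ j * wt N (2 ^ j * z)"
proof -
  obtain C where C: "0 < C" "\<And>b z. norm (lowpass b z) \<le> C * 2 ^ b * wt N (2 ^ b * z)"
    using lowpass_bound by blast
  \<comment> \<open>The summand \<open>1\<close> comes from the cut-off at level \<open>j\<close>;
    the summand \<open>2 ^ N\<close> comes from level \<open>j - 1\<close>, whose weight is
    rewritten at the finer dilation \<open>2 ^ j\<close>.\<close>
  have "norm (kern j z) \<le> (C * (1 + 2 ^ N)) * 2 ^ j * wt N (2 ^ j * z)" for j z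
  proof (cases j)
    case 0
    have "norm (kern j z) \<le> C * wt N z" using C(2)[of 0 z] by (simp add: 0 kern_0)
    also have "\<dots> \<le> (C * (1 + 2 ^ N)) * wt N z"
      using C(1) by (intro mult_right_mono) (auto simp: algebra_simps)
    finally show ?thesis by (simp add: 0)
  next
    case (Suc i)
    have "norm (lowpass i z) \<le> C * 2 ^ i * wt N (2 ^ i * z)" by (rule C)
    also have "\<dots> \<le> C * 2 ^ j * (2 ^ N * wt N (2 ^ j * z))"
      using wt_scale[of 2 N "2 ^ i * z"] C(1) Suc by (intro mult_mono) (auto simp: mult_ac)
    finally have "norm (lowpass i z) \<le> C * 2 ^ j * (2 ^ N * wt N (2 ^ j * z))" .
    thus ?thesis
      using C(2)[of j z] norm_triangle_ineq4[of "lowpass j z" "lowpass i z"]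
      by (simp add: kern_Suc Suc algebra_simps)
  qed
  moreover have "0 < C * (1 + 2 ^ N)" using C(1) by (simp add: add_pos_pos)
  ultimately show thesis using that by blast
qed

text \<open>The multiplier is real-valued. The identity lets the conjugate in an \<open>L^2\<close>
  inner product pass from the wavelet to the kernel.\<close>

lemma cnj_kern: "cnj (kern j z) = kern j (- z)"
proof -
  have "cnj (LINT \<xi>|lborel. cis (- (\<xi> \<bullet> z)) * of_real (theta \<theta>\<^sub>0 j \<xi>)) =
        (LINT \<xi>|lborel. cnj (cis (- (\<xi> \<bullet> z)) * of_real (theta \<theta>\<^sub>0 j \<xi>)))"
    by (rule integral_bounded_linear[OF bounded_linear_cnj, symmetric])
       (rule integrable_cis_mult[OF integrable_theta])
  thus ?thesis by (simp add: kern_def fourier_def cis_cnj)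
qed

lemma conv_kern:
  "integrable lborel h \<Longrightarrow> conv (kern j) h y = fourier (\<lambda>\<xi>. of_real (theta \<theta>\<^sub>0 j \<xi>) * inv_fourier h \<xi>) y"
  by (simp add: fourier_mult_inv_fourier[OF integrable_theta] conv_def kern_def)

lemma conv_kern_eq_0:
  assumes "integrable lborel h" "\<And>\<xi>. theta \<theta>\<^sub>0 j \<xi> * inv_fourier h \<xi> = 0"
  shows "conv (kern j) h y = 0"
proof -
  have "(\<lambda>\<xi>. complex_of_real (theta \<theta>\<^sub>0 j \<xi>) * inv_fourier h \<xi>) = (\<lambda>\<xi>. 0)"
    using assms(2) by auto
  thus ?thesis by (simp add: conv_kern[OF assms(1)] fourier_def)
qed

text \<open>The multipliers telescope to a cut-off that equals 1 on all frequencies of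
  \<open>h\<close>, so the blocks up to \<open>b\<close> add up to \<open>h\<close> by Fourier
  inversion.\<close>

lemma sum_conv_kern:
  assumes cont: "continuous_on UNIV h" and bnd: "\<And>x. norm (h x) \<le> B"
    and int: "integrable lborel h" and int': "integrable lborel (inv_fourier h)"
    and freq: "\<And>\<xi>. 2 ^ b < \<bar>\<xi>\<bar> \<Longrightarrow> inv_fourier h \<xi> = 0"
  shows "(\<Sum>j\<le>b. conv (kern j) h y) = h y"
proof -
  have [measurable]: "inv_fourier h \<in> borel_measurable borel" using int' by auto
  have [measurable]: "(\<lambda>\<xi>. complex_of_real (theta \<theta>\<^sub>0 j \<xi>)) \<in> borel_measurable borel" for j
    using integrable_theta[of j] by auto
  have bth: "\<exists>C. \<forall>\<xi>. norm (complex_of_real (theta \<theta>\<^sub>0 j \<xi>)) \<le> C" for j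
  proof -
    obtain D where D: "schwartz_seq D" "D 0 = (\<lambda>\<xi>. complex_of_real (theta \<theta>\<^sub>0 j \<xi>))"
      using ex_theta_seq by blast
    obtain C where "0 < C" "\<And>x. norm (D 0 x) \<le> C * wt 0 x" using schwartz_seq_bound[OF D(1)] by blast
    thus ?thesis by (intro exI[of _ C]) (auto simp: D(2) wt_def)
  qed
  have int_j: "integrable lborel (\<lambda>\<xi>. of_real (theta \<theta>\<^sub>0 j \<xi>) * inv_fourier h \<xi>)" for j
  proof -
    obtain C where C: "\<And>\<xi>. norm (complex_of_real (theta \<theta>\<^sub>0 j \<xi>)) \<le> C" using bth by blast
    show ?thesis
      by (rule Bochner_Integration.integrable_bound[OF integrable_norm[OF integrable_mult_right[OF int', of "of_real C"]]])
         (use C order_trans[OF C abs_ge_self] in \<open>auto simp: norm_mult intro!: mult_right_mono\<close>)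
  qed
  have "(\<Sum>j\<le>b. conv (kern j) h y) = fourier (\<lambda>\<xi>. \<Sum>j\<le>b. of_real (theta \<theta>\<^sub>0 j \<xi>) * inv_fourier h \<xi>) y"
    unfolding conv_kern[OF int] fourier_def sum_distrib_left
    by (rule Bochner_Integration.integral_sum[symmetric]) (rule integrable_cis_mult[OF int_j])
  also have "(\<lambda>\<xi>. \<Sum>j\<le>b. of_real (theta \<theta>\<^sub>0 j \<xi>) * inv_fourier h \<xi>) = inv_fourier h"
  proof
    fix \<xi>
    have "(\<Sum>j\<le>b. of_real (theta \<theta>\<^sub>0 j \<xi>) * inv_fourier h \<xi>) = of_real (\<theta>\<^sub>0 (\<xi> / 2 ^ b)) * inv_fourier h \<xi>"
      by (simp flip: sum_distrib_right of_real_sum sum_theta)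
    also have "\<dots> = inv_fourier h \<xi>"
      using freq[of \<xi>] theta0_eq_1[of "\<xi> / 2 ^ b"] by (cases "2 ^ b < \<bar>\<xi>\<bar>") auto
    finally show "(\<Sum>j\<le>b. of_real (theta \<theta>\<^sub>0 j \<xi>) * inv_fourier h \<xi>) = inv_fourier h \<xi>" .
  qed
  also have "fourier (inv_fourier h) y = h y" by (rule fourier_inv_fourier[OF cont bnd int int'])
  finally show ?thesis .
qed

lemma theta_mult_theta0: "theta \<theta>\<^sub>0 j \<xi> * \<theta>\<^sub>0 (\<xi> / 2 ^ Suc j) = theta \<theta>\<^sub>0 j \<xi>"
  using theta_eq_0_above[of j \<xi>] theta0_eq_1[of "\<xi> / 2 ^ Suc j"]
  by (cases "2 ^ Suc j < \<bar>\<xi>\<bar>") auto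

text \<open>On the Fourier side this is \<open>theta_mult_theta0\<close>: the cut-off at level
  \<open>j + 1\<close> equals 1 wherever the j-th multiplier is nonzero. It is the source of the
  reproducing formula for blocks.\<close>

lemma conv_kern_lowpass: "conv (kern j) (\<lambda>y. lowpass (Suc j) (y - x)) y = kern j (y - x)"
proof -
  let ?g = "\<lambda>\<xi>. complex_of_real (\<theta>\<^sub>0 (\<xi> / 2 ^ Suc j))"
  obtain D where D: "schwartz_seq D" "D 0 = ?g" using ex_theta0_seq by blast
  obtain B where B: "\<And>x. norm (D 0 x) \<le> B * wt 0 x" using schwartz_seq_bound[OF D(1)] by blast
  obtain E where E: "schwartz_seq E" "E 0 = fourier (D 0)" using schwartz_seq_fourier[OF D(1)] by blast
  have inv: "inv_fourier (fourier ?g) \<xi> = ?g \<xi>" for \<xi>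
    by (rule inv_fourier_fourier[of _ B])
       (use schwartz_seq_continuous[OF D(1), of UNIV 0] schwartz_seq_integrable[OF D(1), of 0]
          schwartz_seq_integrable[OF E(1), of 0] B in \<open>auto simp: D(2) E(2) wt_def\<close>)
  obtain L where L: "schwartz_seq L" "L 0 = lowpass (Suc j)" using ex_lowpass_seq by blast
  have int: "integrable lborel (\<lambda>y. lowpass (Suc j) (y - x))"
    using lborel_integrable_real_affine[OF schwartz_seq_integrable[OF L(1), of 0], of 1 "- x"]
    by (simp add: L(2))
  have "inv_fourier (\<lambda>y. lowpass (Suc j) (y - x)) \<xi> = cis (x * \<xi>) * ?g \<xi> / (2 * pi)" for \<xi>
  proof -
    have "fourier (\<lambda>y. lowpass (Suc j) (1 * y - x)) (- \<xi>) = cis (x * \<xi>) * fourier (lowpass (Suc j)) (- \<xi>)"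
      by (subst fourier_affine) auto
    hence "inv_fourier (\<lambda>y. lowpass (Suc j) (y - x)) \<xi> = cis (x * \<xi>) * inv_fourier (lowpass (Suc j)) \<xi>"
      by (simp add: inv_fourier_eq_fourier)
    also have "inv_fourier (lowpass (Suc j)) \<xi> = inv_fourier (fourier ?g) \<xi> / (2 * pi)"
      by (simp add: inv_fourier_def lowpass_def[abs_def])
    finally show ?thesis unfolding inv by simp
  qed
  hence "conv (kern j) (\<lambda>y. lowpass (Suc j) (y - x)) y =
     fourier (\<lambda>\<xi>. of_real (theta \<theta>\<^sub>0 j \<xi>) * (cis (x * \<xi>) * ?g \<xi> / (2 * pi))) y"
    by (simp add: conv_kern[OF int])
  also have "\<dots> = (LINT \<xi>|lborel. cis (- (\<xi> \<bullet> (y - x))) * of_real (theta \<theta>\<^sub>0 j \<xi>) / (2 * pi))"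
    unfolding fourier_def
  proof (intro Bochner_Integration.integral_cong refl)
    fix \<xi>
    have c: "cis (- (\<xi> \<bullet> (y - x))) = cis (- (\<xi> \<bullet> y)) * cis (x * \<xi>)"
      by (simp add: cis_mult algebra_simps)
    have t: "complex_of_real (theta \<theta>\<^sub>0 j \<xi>) = of_real (theta \<theta>\<^sub>0 j \<xi>) * ?g \<xi>"
      unfolding of_real_mult[symmetric] theta_mult_theta0 ..
    have "cis (- (\<xi> \<bullet> y)) * (of_real (theta \<theta>\<^sub>0 j \<xi>) * (cis (x * \<xi>) * ?g \<xi> / (2 * pi))) =
      (cis (- (\<xi> \<bullet> y)) * cis (x * \<xi>)) * (of_real (theta \<theta>\<^sub>0 j \<xi>) * ?g \<xi>) / (2 * pi)"
      by (simp only: times_divide_eq_right mult_ac)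
    thus "cis (- (\<xi> \<bullet> y)) * (of_real (theta \<theta>\<^sub>0 j \<xi>) * (cis (x * \<xi>) * ?g \<xi> / (2 * pi))) =
       cis (- (\<xi> \<bullet> (y - x))) * of_real (theta \<theta>\<^sub>0 j \<xi>) / (2 * pi)"
      unfolding c[symmetric] t[symmetric] .
  qed
  also have "\<dots> = kern j (y - x)" by (simp add: kern_def fourier_def)
  finally show ?thesis .
qed

end

section \<open>Expansions in an orthonormal basis\<close>

lemma borel_measurable_cnj' [measurable]: "cnj \<in> borel_measurable borel"
  by (intro borel_measurable_continuous_onI continuous_intros)

lemma square_integrable_mult_cnj:
  assumes f: "square_integrable f" and g: "square_integrable g"
  shows "integrable lborel (\<lambda>x. f x * cnj (g x))"
proof (rule Bochner_Integration.integrable_bound)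
  show "integrable lborel (\<lambda>x. (cmod (f x))\<^sup>2 + (cmod (g x))\<^sup>2)"
    using f g unfolding square_integrable_def by auto
  have [measurable]: "f \<in> borel_measurable borel" "g \<in> borel_measurable borel"
    using f g by (auto simp: square_integrable_def)
  show "(\<lambda>x. f x * cnj (g x)) \<in> borel_measurable lborel" by measurable
  have "a * b \<le> a\<^sup>2 + b\<^sup>2" if "0 \<le> a" "0 \<le> b" for a b :: real
    using sum_squares_bound[of a b] mult_nonneg_nonneg[OF that] by linarith
  thus "AE x in lborel. norm (f x * cnj (g x)) \<le> norm ((cmod (f x))\<^sup>2 + (cmod (g x))\<^sup>2)"
    by (auto simp: norm_mult)
qed

lemma square_integrable_cmult:
  assumes "square_integrable f"
  shows "square_integrable (\<lambda>x. c * f x)"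
  using assms unfolding square_integrable_def by (auto simp: norm_mult power_mult_distrib)

lemma square_integrable_add:
  assumes f: "square_integrable f" and g: "square_integrable g"
  shows "square_integrable (\<lambda>x. f x + g x)"
  unfolding square_integrable_def
proof
  have [measurable]: "f \<in> borel_measurable borel" "g \<in> borel_measurable borel"
    using f g by (auto simp: square_integrable_def)
  show "(\<lambda>x. f x + g x) \<in> borel_measurable lborel" by measurable
  show "integrable lborel (\<lambda>x. (cmod (f x + g x))\<^sup>2)"
  proof (rule Bochner_Integration.integrable_bound)
    show "integrable lborel (\<lambda>x. 2 * (cmod (f x))\<^sup>2 + 2 * (cmod (g x))\<^sup>2)"
      using f g unfolding square_integrable_def by auto
    have "(cmod (a + b))\<^sup>2 \<le> 2 * (cmod a)\<^sup>2 + 2 * (cmod b)\<^sup>2" for a b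
    proof -
      have "(cmod (a + b))\<^sup>2 \<le> (cmod a + cmod b)\<^sup>2" by (intro power_mono norm_triangle_ineq) auto
      also have "\<dots> \<le> 2 * (cmod a)\<^sup>2 + 2 * (cmod b)\<^sup>2"
        using sum_squares_bound[of "cmod a" "cmod b"] by (simp add: power2_sum)
      finally show ?thesis .
    qed
    thus "AE x in lborel. norm ((cmod (f x + g x))\<^sup>2) \<le> norm (2 * (cmod (f x))\<^sup>2 + 2 * (cmod (g x))\<^sup>2)"
      by auto
  qed measurable
qed

lemma square_integrable_sum:
  "(\<And>i. i \<in> F \<Longrightarrow> square_integrable (f i)) \<Longrightarrow> square_integrable (\<lambda>x. \<Sum>i\<in>F. f i x)"
proof (induction F rule: infinite_finite_induct)
  case (insert i F)
  thus ?case using square_integrable_add[of "f i" "\<lambda>x. \<Sum>i\<in>F. f i x"] by auto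
qed (auto simp: square_integrable_def)

lemma square_integrable_diff:
  "square_integrable f \<Longrightarrow> square_integrable g \<Longrightarrow> square_integrable (\<lambda>x. f x - g x)"
  using square_integrable_add[of f "\<lambda>x. -1 * g x"] square_integrable_cmult[of g "-1"] by simp

text \<open>The residual \<open>r\<close> is orthogonal to every \<open>e i\<close> with
  \<open>i\<close> in \<open>G\<close>, hence to the difference \<open>s\<close> of the two
  combinations; Pythagoras then gives the inequality.\<close>

lemma best_approximation:
  assumes onb: "orthonormal_basis_L2 I e" and h: "square_integrable h"
    and G: "finite G" "G \<subseteq> I" and a: "\<And>i. i \<in> G \<Longrightarrow> a i = (LINT x|lborel. h x * cnj (e i x))"
  shows "(LINT x|lborel. (cmod (h x - (\<Sum>i\<in>G. a i * e i x)))\<^sup>2) \<le>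
         (LINT x|lborel. (cmod (h x - (\<Sum>i\<in>G. b i * e i x)))\<^sup>2)"
proof -
  have e: "square_integrable (e i)" if "i \<in> G" for i
    using onb G that unfolding orthonormal_basis_L2_def by auto
  have orth: "(LINT x|lborel. e i x * cnj (e j x)) = (if i = j then 1 else 0)" if "i \<in> G" "j \<in> G" for i j
    using onb subsetD[OF G(2) that(1)] subsetD[OF G(2) that(2)] unfolding orthonormal_basis_L2_def by blast
  define r where "r x = h x - (\<Sum>i\<in>G. a i * e i x)" for x
  define s where "s x = (\<Sum>i\<in>G. (a i - b i) * e i x)" for x
  have r: "square_integrable r" unfolding r_def
    by (intro square_integrable_diff h square_integrable_sum square_integrable_cmult e)
  have s: "square_integrable s" unfolding s_def
    by (intro square_integrable_sum square_integrable_cmult e)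
  have re: "(LINT x|lborel. r x * cnj (e j x)) = 0" if j: "j \<in> G" for j
  proof -
    have "(LINT x|lborel. r x * cnj (e j x)) =
       (LINT x|lborel. h x * cnj (e j x) - (\<Sum>i\<in>G. a i * (e i x * cnj (e j x))))"
      by (intro Bochner_Integration.integral_cong refl)
         (simp add: r_def algebra_simps sum_distrib_right sum_distrib_left)
    also have "\<dots> = (LINT x|lborel. h x * cnj (e j x)) - (LINT x|lborel. (\<Sum>i\<in>G. a i * (e i x * cnj (e j x))))"
      by (intro Bochner_Integration.integral_diff square_integrable_mult_cnj h e j
            Bochner_Integration.integrable_sum integrable_mult_right)
    also have "(LINT x|lborel. (\<Sum>i\<in>G. a i * (e i x * cnj (e j x)))) = (\<Sum>i\<in>G. a i * (LINT x|lborel. e i x * cnj (e j x)))"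
      by (subst Bochner_Integration.integral_sum)
         (auto intro!: square_integrable_mult_cnj e j integrable_mult_right)
    also have "\<dots> = (\<Sum>i\<in>G. if i = j then a i else 0)"
      using j by (intro sum.cong) (auto simp: orth)
    also have "\<dots> = a j" using j G by simp
    finally show ?thesis using a[OF j] by simp
  qed
  have rs: "(LINT x|lborel. r x * cnj (s x)) = 0"
  proof -
    have "(LINT x|lborel. r x * cnj (s x)) = (LINT x|lborel. (\<Sum>i\<in>G. cnj (a i - b i) * (r x * cnj (e i x))))"
      by (intro Bochner_Integration.integral_cong refl) (simp add: s_def sum_distrib_left mult_ac)
    also have "\<dots> = (\<Sum>i\<in>G. cnj (a i - b i) * (LINT x|lborel. r x * cnj (e i x)))"
      by (subst Bochner_Integration.integral_sum)
         (auto intro!: square_integrable_mult_cnj e r integrable_mult_right)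
    finally show ?thesis by (simp add: re)
  qed
  have int: "integrable lborel (\<lambda>x. (cmod (r x))\<^sup>2)" "integrable lborel (\<lambda>x. (cmod (s x))\<^sup>2)"
    "integrable lborel (\<lambda>x. 2 * Re (r x * cnj (s x)))"
  proof -
    show "integrable lborel (\<lambda>x. 2 * Re (r x * cnj (s x)))"
      by (rule integrable_mult_right[OF integrable_Re[OF square_integrable_mult_cnj[OF r s]]])
  qed (use r s in \<open>simp_all add: square_integrable_def\<close>)
  have "(LINT x|lborel. (cmod (h x - (\<Sum>i\<in>G. b i * e i x)))\<^sup>2) =
        (LINT x|lborel. ((cmod (r x))\<^sup>2 + (cmod (s x))\<^sup>2) + 2 * Re (r x * cnj (s x)))"
  proof (intro Bochner_Integration.integral_cong refl)
    fix x
    have "h x - (\<Sum>i\<in>G. b i * e i x) = r x + s x"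
      by (simp add: r_def s_def left_diff_distrib sum_subtractf)
    thus "(cmod (h x - (\<Sum>i\<in>G. b i * e i x)))\<^sup>2 = ((cmod (r x))\<^sup>2 + (cmod (s x))\<^sup>2) + 2 * Re (r x * cnj (s x))"
      by (simp only: cmod_power2) (simp add: power2_eq_square algebra_simps)
  qed
  also have "\<dots> = (LINT x|lborel. (cmod (r x))\<^sup>2 + (cmod (s x))\<^sup>2) + 2 * Re (LINT x|lborel. r x * cnj (s x))"
    by (simp only: Bochner_Integration.integral_add[OF Bochner_Integration.integrable_add[OF int(1,2)] int(3)]
          integral_mult_right_zero integral_Re[OF square_integrable_mult_cnj[OF r s]])
  also have "\<dots> = (LINT x|lborel. (cmod (r x))\<^sup>2) + (LINT x|lborel. (cmod (s x))\<^sup>2)"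
    using int by (simp add: rs)
  also have "\<dots> \<ge> (LINT x|lborel. (cmod (r x))\<^sup>2)" by simp
  finally show ?thesis by (simp add: r_def)
qed

text \<open>Density gives finite combinations close to \<open>h\<close> in \<open>L^2\<close>, and
  \<open>best_approximation\<close> allows them to be partial sums with the Fourier coefficients.
  Along suitable finite sets these sums converge to \<open>h\<close> in \<open>L^2\<close> and to
  \<open>T\<close> pointwise; Fatou's lemma identifies the two limits.\<close>

lemma orthonormal_expansion_AE:
  assumes onb: "orthonormal_basis_L2 I e" and I: "countable I" and h: "square_integrable h"
    and a: "\<And>i. i \<in> I \<Longrightarrow> a i = (LINT x|lborel. h x * cnj (e i x))"
    and T: "\<And>y. ((\<lambda>i. a i * e i y) has_sum T y) I"
  shows "AE y in lborel. h y = T y"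
proof -
  \<comment> \<open>An exhaustion by initial segments of an enumeration; every finite set of indices
    is eventually swallowed.\<close>
  obtain A :: "nat \<Rightarrow> 'a set" where A: "\<And>n. finite (A n)" "\<And>n. A n \<subseteq> I" "\<And>F. finite F \<Longrightarrow> F \<subseteq> I \<Longrightarrow> \<exists>n. \<forall>m\<ge>n. F \<subseteq> A m"
  proof (rule that[of "\<lambda>n. {i \<in> I. to_nat_on I i < n}"])
    show "finite {i \<in> I. to_nat_on I i < n}" for n
    proof (rule inj_on_finite)
      show "inj_on (to_nat_on I) {i \<in> I. to_nat_on I i < n}"
        using inj_on_to_nat_on[OF I] by (rule inj_on_subset) auto
      show "to_nat_on I ` {i \<in> I. to_nat_on I i < n} \<subseteq> {..<n}" by auto
    qed auto
    fix F assume F: "finite F" "F \<subseteq> I"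
    have "\<forall>i\<in>F. to_nat_on I i < Suc (Max (to_nat_on I ` F))"
      using F by (auto simp: less_Suc_eq_le)
    thus "\<exists>n. \<forall>m\<ge>n. F \<subseteq> {i \<in> I. to_nat_on I i < m}"
      using F(2) by (intro exI[of _ "Suc (Max (to_nat_on I ` F))"] allI impI subsetI CollectI conjI)
        (blast, meson less_le_trans)
  qed auto
  \<comment> \<open>The approximating set \<open>F\<close> supplied by density is enlarged by
    \<open>A n\<close>. This does not worsen the error, by optimality of the Fourier coefficients,
    and it forces the sets through the filter of finite subsets.\<close>
  have "\<exists>G. finite G \<and> G \<subseteq> I \<and> A n \<subseteq> G \<and> (LINT x|lborel. (cmod (h x - (\<Sum>i\<in>G. a i * e i x)))\<^sup>2) < 1 / real (Suc n)" for n
  proof -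
    obtain F c where F: "finite F" "F \<subseteq> I" "(LINT x|lborel. (cmod (h x - (\<Sum>i\<in>F. c i * e i x)))\<^sup>2) < 1 / real (Suc n)"
    proof -
      have "0 < 1 / real (Suc n)" by simp
      moreover have "\<forall>g \<epsilon>. square_integrable g \<longrightarrow> 0 < \<epsilon> \<longrightarrow>
        (\<exists>F c. finite F \<and> F \<subseteq> I \<and> (LINT x|lborel. (cmod (g x - (\<Sum>i\<in>F. c i * e i x)))\<^sup>2) < \<epsilon>)"
        using onb unfolding orthonormal_basis_L2_def by blast
      ultimately show thesis using h that by blast
    qed
    let ?b = "\<lambda>i. if i \<in> F then c i else 0"
    have "(LINT x|lborel. (cmod (h x - (\<Sum>i\<in>F \<union> A n. a i * e i x)))\<^sup>2) \<le>
          (LINT x|lborel. (cmod (h x - (\<Sum>i\<in>F \<union> A n. ?b i * e i x)))\<^sup>2)"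
      using F A(1) A(2)[of n] by (intro best_approximation[OF onb h] a) auto
    also have "\<dots> = (LINT x|lborel. (cmod (h x - (\<Sum>i\<in>F. c i * e i x)))\<^sup>2)"
    proof -
      have "(\<Sum>i\<in>F \<union> A n. ?b i * e i x) = (\<Sum>i\<in>F. c i * e i x)" for x
        by (rule sum.mono_neutral_cong_right) (use F A in auto)
      thus ?thesis by simp
    qed
    also note F(3)
    finally show ?thesis using F A by (intro exI[of _ "F \<union> A n"]) auto
  qed
  hence "\<forall>n. \<exists>G. finite G \<and> G \<subseteq> I \<and> A n \<subseteq> G \<and> (LINT x|lborel. (cmod (h x - (\<Sum>i\<in>G. a i * e i x)))\<^sup>2) < 1 / real (Suc n)"
    by blast
  from choice[OF this] obtain G where G': "\<forall>n. finite (G n) \<and> G n \<subseteq> I \<and> A n \<subseteq> G n \<and>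
    (LINT x|lborel. (cmod (h x - (\<Sum>i\<in>G n. a i * e i x)))\<^sup>2) < 1 / real (Suc n)" by blast
  have G: "finite (G n)" "G n \<subseteq> I" "A n \<subseteq> G n"
    "(LINT x|lborel. (cmod (h x - (\<Sum>i\<in>G n. a i * e i x)))\<^sup>2) < 1 / real (Suc n)" for n
    using G' by blast+
  define S where "S n y = (\<Sum>i\<in>G n. a i * e i y)" for n y
  have e: "square_integrable (e i)" if "i \<in> I" for i
    using onb that unfolding orthonormal_basis_L2_def by auto
  have hS: "square_integrable (\<lambda>x. h x - S n x)" for n
    unfolding S_def using G by (intro square_integrable_diff h square_integrable_sum square_integrable_cmult e) auto
  have SG: "(\<lambda>n. S n y) \<longlonglongrightarrow> T y" for y
  proof -
    have "filterlim G (finite_subsets_at_top I) sequentially"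
      unfolding filterlim_finite_subsets_at_top
    proof (intro allI impI)
      fix X assume "finite X \<and> X \<subseteq> I"
      then obtain n0 where n0: "\<forall>m\<ge>n0. X \<subseteq> A m" using A(3) by blast
      show "\<forall>\<^sub>F n in sequentially. finite (G n) \<and> X \<subseteq> G n \<and> G n \<subseteq> I"
        unfolding eventually_sequentially
        using n0 G(1-3) by (intro exI[of _ n0]) (meson subset_trans)
    qed
    from filterlim_compose[OF T[of y, unfolded has_sum_def] this] show ?thesis by (simp add: S_def)
  qed
  have [measurable]: "(\<lambda>x. h x - S n x) \<in> borel_measurable borel" for n
    using hS[of n] by (auto simp: square_integrable_def)
  have lim: "(\<lambda>n. ennreal ((cmod (h y - S n y))\<^sup>2)) \<longlonglongrightarrow> ennreal ((cmod (h y - T y))\<^sup>2)" for y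
    by (intro tendsto_ennrealI tendsto_intros SG)
  have "(\<integral>\<^sup>+y. ennreal ((cmod (h y - T y))\<^sup>2) \<partial>lborel) = (\<integral>\<^sup>+y. liminf (\<lambda>n. ennreal ((cmod (h y - S n y))\<^sup>2)) \<partial>lborel)"
    by (intro nn_integral_cong lim_imp_Liminf[symmetric] lim) auto
  also have "\<dots> \<le> liminf (\<lambda>n. \<integral>\<^sup>+y. ennreal ((cmod (h y - S n y))\<^sup>2) \<partial>lborel)"
    by (rule nn_integral_liminf) measurable
  also have "\<dots> \<le> liminf (\<lambda>n. ennreal (1 / real (Suc n)))"
  proof (intro Liminf_mono always_eventually allI)
    fix n
    have "(\<integral>\<^sup>+y. ennreal ((cmod (h y - S n y))\<^sup>2) \<partial>lborel) = ennreal (LINT y|lborel. (cmod (h y - S n y))\<^sup>2)"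
      using hS[of n] by (intro nn_integral_eq_integral) (auto simp: square_integrable_def)
    also have "\<dots> \<le> ennreal (1 / real (Suc n))"
      using G(4)[of n] by (intro ennreal_leI) (simp add: S_def)
    finally show "(\<integral>\<^sup>+y. ennreal ((cmod (h y - S n y))\<^sup>2) \<partial>lborel) \<le> ennreal (1 / real (Suc n))" .
  qed
  also have "\<dots> = 0"
  proof (rule lim_imp_Liminf)
    have "(\<lambda>n. ennreal (1 / real (Suc n))) \<longlonglongrightarrow> ennreal 0"
      by (intro tendsto_ennrealI) real_asymp
    thus "(\<lambda>n. ennreal (1 / real (Suc n))) \<longlonglongrightarrow> 0" by simp
  qed auto
  finally have "(\<integral>\<^sup>+y. ennreal ((cmod (h y - T y))\<^sup>2) \<partial>lborel) = 0" by simp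
  moreover have "T \<in> borel_measurable borel"
  proof (rule borel_measurable_LIMSEQ_metric[OF _ SG])
    have "square_integrable (S n)" for n
      unfolding S_def using G by (intro square_integrable_sum square_integrable_cmult e) auto
    thus "S n \<in> borel_measurable borel" for n by (simp add: square_integrable_def)
  qed
  moreover have "h \<in> borel_measurable borel" using h by (simp add: square_integrable_def)
  ultimately show ?thesis by (subst (asm) nn_integral_0_iff_AE) auto
qed

text \<open>The set of disagreement is open, and a nonempty open set is not negligible.\<close>

lemma continuous_AE_eq:
  fixes f g :: "real \<Rightarrow> complex"
  assumes "continuous_on UNIV f" "continuous_on UNIV g" "AE y in lborel. f y = g y"
  shows "f = g"
proof (rule ccontr)
  assume "f \<noteq> g"
  hence ne: "{y. f y \<noteq> g y} \<noteq> {}" by auto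
  have op: "open {y. f y \<noteq> g y}"
    using assms(1,2) by (intro open_Collect_neq) auto
  have "{y. f y \<noteq> g y} \<in> null_sets lborel"
    using assms(3) op by (subst AE_iff_null_sets) auto
  hence "negligible {y. f y \<noteq> g y}"
    using negligible_iff_null_sets null_sets_completionI by blast
  with open_not_negligible[OF op ne] show False by simp
qed

lemma summable_on_of_nn_integral:
  fixes f :: "'a \<Rightarrow> real"
  assumes "\<And>x. 0 \<le> f x" "(\<integral>\<^sup>+x. ennreal (f x) \<partial>count_space UNIV) < \<infinity>"
  shows "f summable_on UNIV"
proof -
  have "integrable (count_space UNIV) f" using assms by (intro integrableI_nonneg) auto
  hence "Infinite_Set_Sum.abs_summable_on f UNIV" by (simp add: Infinite_Set_Sum.abs_summable_on_def)
  hence "(\<lambda>x. norm (f x)) summable_on UNIV" by (simp only: abs_summable_equivalent)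
  thus ?thesis using assms(1) by simp
qed

lemma summable_on_wt: "(\<lambda>k. wt 2 (t - of_int k)) summable_on UNIV"
  by (rule summable_on_of_nn_integral) (use nn_integral_wt_sum[of 2 t] in \<open>auto intro: le_less_trans\<close>)

lemma summable_on_comparison_wt:
  fixes f :: "int \<Rightarrow> 'b::banach"
  assumes "\<And>k. norm (f k) \<le> C * wt 2 (t - of_int k)"
  shows "(\<lambda>k. norm (f k)) summable_on UNIV"
  by (rule summable_on_comparison_test[OF summable_on_cmult_right[OF summable_on_wt]]) (use assms in auto)

section \<open>Meyer wavelets\<close>

text \<open>Since \<open>nat (-1) = 0\<close>, the scaling functions (\<open>i = -1\<close>) and the
  wavelets with \<open>i = 0\<close> both get scale 1, as neither is dilated.\<close>

definition sc :: "int \<Rightarrow> real" where "sc i = 2 ^ nat i"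

lemma sc_pos [simp]: "0 < sc i" and sc_nonneg [simp]: "0 \<le> sc i" and sc_neq_0 [simp]: "sc i \<noteq> 0"
  and sc_ge_1: "1 \<le> sc i"
  by (auto simp: sc_def)

lemma sc_of_nat [simp]: "sc (int j) = 2 ^ j"
  by (simp add: sc_def)

lemma sc_le: "i \<le> l + int m \<Longrightarrow> sc i \<le> 2 ^ m * sc l"
  unfolding sc_def power_add[symmetric] by (intro power_increasing) auto

text \<open>Weights at scales a bounded number of octaves apart are comparable; the loss depends on
  the gap \<open>m\<close> and on \<open>N\<close>, not on the scales.\<close>

lemma wt_rescale:
  assumes "i \<le> l + int m"
  shows "wt N (sc l * t) \<le> 2 ^ (m * N) * wt N (sc i * t)"
proof -
  have "wt N (sc l * t) \<le> max 1 (sc i / sc l) ^ N * wt N (sc i / sc l * (sc l * t))"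
    by (rule wt_scale) (simp add: less_imp_le)
  also have "\<dots> \<le> (2 ^ m) ^ N * wt N (sc i * t)"
    using sc_le[OF assms] by (intro mult_mono power_mono) (auto simp: pos_divide_le_eq)
  finally show ?thesis by (simp add: power_mult)
qed

lemma norm_integral_le_of_nn_integral:
  fixes f :: "'a \<Rightarrow> complex"
  assumes "(\<integral>\<^sup>+x. ennreal (norm (f x)) \<partial>M) \<le> ennreal c" "0 \<le> c"
  shows "norm (LINT x|M. f x) \<le> c"
proof (cases "integrable M f")
  case True
  show ?thesis using order_trans[OF integral_norm_bound_ennreal[OF True] assms(1)] assms(2) by simp
qed (use assms(2) in \<open>simp add: not_integrable_integral_eq\<close>)

lemma continuous_infsum:
  fixes f :: "int \<Rightarrow> real \<Rightarrow> complex"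
  assumes cont: "\<And>k. continuous_on UNIV (f k)" and M: "\<And>k y. norm (f k y) \<le> M k" "M summable_on UNIV"
  shows "continuous_on UNIV (\<lambda>y. \<Sum>\<^sub>\<infinity>k. f k y)"
proof -
  have b: "bij_betw int_decode UNIV UNIV" using bij_int_decode .
  have sM: "summable (\<lambda>n. M (int_decode n))"
    using M(2) summable_on_reindex_bij_betw[OF b, of M] by (auto intro: summable_on_imp_summable)
  have eq: "(\<Sum>\<^sub>\<infinity>k. f k y) = (\<Sum>n. f (int_decode n) y)" for y
  proof -
    have "summable (\<lambda>n. norm (f (int_decode n) y))"
      by (rule summable_comparison_test'[OF sM, of 0]) (simp add: M(1))
    hence "((\<lambda>n. f (int_decode n) y) has_sum (\<Sum>n. f (int_decode n) y)) UNIV"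
      by (intro norm_summable_imp_has_sum summable_sums) (auto dest: summable_norm_cancel)
    thus ?thesis using has_sum_reindex_bij_betw[OF b, of "\<lambda>k. f k y"] by (simp add: infsumI)
  qed
  have "uniform_limit UNIV (\<lambda>n y. \<Sum>i<n. f (int_decode i) y) (\<lambda>y. \<Sum>n. f (int_decode n) y) sequentially"
    by (rule Weierstrass_m_test[OF _ sM]) (rule M(1))
  hence "continuous_on UNIV (\<lambda>y. \<Sum>n. f (int_decode n) y)"
    by (rule uniform_limit_theorem[rotated]) (auto intro!: always_eventually continuous_on_sum cont)
  thus ?thesis unfolding eq .
qed

section \<open>Frequency bands of the wavelets and the one-variable kernel expansion\<close>

locale hyperbolic_wavelets = littlewood_paley \<theta>\<^sub>0 for \<theta>\<^sub>0 :: "real \<Rightarrow> real" +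
  fixes \<psi> \<phi> :: "real \<Rightarrow> complex"
  assumes meyer: "lemarie_meyer \<psi> \<phi>"
begin

abbreviation wv :: "int \<Rightarrow> int \<Rightarrow> real \<Rightarrow> complex" where
  "wv \<equiv> wavelet \<psi> \<phi>"

definition mother :: "int \<Rightarrow> real \<Rightarrow> complex" where
  "mother i = (if i = -1 then \<phi> else \<psi>)"

lemma wavelet_eq: "-1 \<le> i \<Longrightarrow> wv i k x = mother i (sc i * x - of_int k)"
  by (auto simp: wavelet_def mother_def sc_def power_int_def)

lemma ex_mother_seq: "\<exists>D. schwartz_seq D \<and> D 0 = mother i"
  using meyer schwartz_real_seq[of \<psi>] schwartz_real_seq[of \<phi>]
  unfolding lemarie_meyer_def mother_def by auto

text \<open>Only two profiles occur, so a single constant serves all \<open>i\<close>. All wavelet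
  bounds that are uniform in the scale originate here.\<close>

lemma mother_bound:
  obtains C where "0 < C" "\<And>i x. norm (mother i x) \<le> C * wt N x"
proof -
  obtain D E where D: "schwartz_seq D" "D 0 = mother (-1)" and E: "schwartz_seq E" "E 0 = mother 0"
    using ex_mother_seq by metis
  obtain A where A: "0 < A" "\<And>x. norm (D 0 x) \<le> A * wt N x" using schwartz_seq_bound[OF D(1)] by blast
  obtain B where B: "0 < B" "\<And>x. norm (E 0 x) \<le> B * wt N x" using schwartz_seq_bound[OF E(1)] by blast
  have "norm (mother i x) \<le> (A + B) * wt N x" for i x
  proof (cases "i = -1")
    case True
    have "A * wt N x \<le> (A + B) * wt N x" using B(1) by (intro mult_right_mono) auto
    with order_trans[OF A(2)] show ?thesis by (simp add: D(2) True)
  next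
    case False
    have "B * wt N x \<le> (A + B) * wt N x" using A(1) by (intro mult_right_mono) auto
    with order_trans[OF B(2)] False show ?thesis by (simp add: E(2) mother_def)
  qed
  moreover have "0 < A + B" using A B by simp
  ultimately show thesis using that by blast
qed

lemma wavelet_bound:
  obtains C where "0 < C" "\<And>i k x. -1 \<le> i \<Longrightarrow> norm (wv i k x) \<le> C * wt N (sc i * x - of_int k)"
  using mother_bound[of N] by (metis wavelet_eq)

lemma ex_wavelet_seq:
  assumes "-1 \<le> i"
  shows "\<exists>D. schwartz_seq D \<and> D 0 = wv i k"
proof -
  obtain D where D: "schwartz_seq D" "D 0 = mother i" using ex_mother_seq by blast
  from schwartz_seq_affine[OF D(1), of "sc i" "of_int k"]
  show ?thesis using D(2)
    by (intro exI[of _ "\<lambda>n x. sc i ^ n *\<^sub>R D n (sc i * x - of_int k)"]) (auto simp: wavelet_eq assms)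
qed

lemma continuous_wavelet: "-1 \<le> i \<Longrightarrow> continuous_on A (wv i k)"
  using ex_wavelet_seq schwartz_seq_continuous by metis

lemma wavelet_measurable: "-1 \<le> i \<Longrightarrow> wv i k \<in> borel_measurable borel"
  by (intro borel_measurable_continuous_onI continuous_wavelet)

lemma integrable_wavelet: "-1 \<le> i \<Longrightarrow> integrable lborel (wv i k)"
  using ex_wavelet_seq schwartz_seq_integrable by metis

text \<open>The transform of the scaling function has compact support of unspecified size, so the
  radius is not explicit. Demanding \<open>R \<ge> 4\<close> gives \<open>2 ^ R \<ge> 16\<close>,
  which covers the band of \<open>\<psi>\<close> as well.\<close>

lemma ex_band: "\<exists>R\<ge>4. \<forall>\<xi>. 2 ^ R < \<bar>\<xi>\<bar> \<longrightarrow> fourier \<phi> \<xi> = 0"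
proof -
  have "bounded (support (fourier \<phi>))"
    using meyer compact_imp_bounded unfolding lemarie_meyer_def by blast
  then obtain B where B: "\<And>\<xi>. \<xi> \<in> support (fourier \<phi>) \<Longrightarrow> \<bar>\<xi>\<bar> \<le> B" unfolding bounded_iff by auto
  obtain n where n: "B < 2 ^ n" using real_arch_pow[of 2 B] by auto
  have "fourier \<phi> \<xi> = 0" if "2 ^ max n 4 < \<bar>\<xi>\<bar>" for \<xi>
  proof (rule ccontr)
    assume "fourier \<phi> \<xi> \<noteq> 0"
    hence "\<xi> \<in> support (fourier \<phi>)"
      unfolding support_def using closure_subset[of "{x. fourier \<phi> x \<noteq> 0}"] by auto
    hence "\<bar>\<xi>\<bar> < 2 ^ n" using B n by force
    also have "(2::real) ^ n \<le> 2 ^ max n 4" by (intro power_increasing) auto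
    finally show False using that by simp
  qed
  thus ?thesis by (intro exI[of _ "max n 4"]) auto
qed

definition band :: nat where
  "band = (SOME R. 4 \<le> R \<and> (\<forall>\<xi>. 2 ^ R < \<bar>\<xi>\<bar> \<longrightarrow> fourier \<phi> \<xi> = 0))"

lemma band: "4 \<le> band" "2 ^ band < \<bar>\<xi>\<bar> \<Longrightarrow> fourier \<phi> \<xi> = 0"
  using someI_ex[OF ex_band] unfolding band_def by blast+

text \<open>From \<open>2 \<le> pi < 4\<close> one gets \<open>2 * pi / 3 > 1\<close> and
  \<open>8 * pi / 3 < 16\<close>. Rounding to powers of two makes the band directly comparable with
  the dyadic shells.\<close>

lemma fourier_psi_eq_0:
  assumes "\<bar>\<xi>\<bar> < 1 \<or> 16 < \<bar>\<xi>\<bar>"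
  shows "fourier \<psi> \<xi> = 0"
proof (rule ccontr)
  assume "fourier \<psi> \<xi> \<noteq> 0"
  hence "\<xi> \<in> support (fourier \<psi>)"
    unfolding support_def using closure_subset[of "{x. fourier \<psi> x \<noteq> 0}"] by auto
  hence "\<xi> \<in> {- (8 * pi / 3)..- (2 * pi / 3)} \<union> {2 * pi / 3..8 * pi / 3}"
    using meyer unfolding lemarie_meyer_def by blast
  thus False using assms pi_less_4 pi_ge_two by auto
qed

lemma fourier_mother_eq_0: "2 ^ band < \<bar>\<xi>\<bar> \<Longrightarrow> fourier (mother i) \<xi> = 0"
proof -
  have "(16::real) \<le> 2 ^ band" using power_increasing[OF band(1), of "2::real"] by simp
  thus "2 ^ band < \<bar>\<xi>\<bar> \<Longrightarrow> fourier (mother i) \<xi> = 0"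
    using band(2) fourier_psi_eq_0[of \<xi>] by (auto simp: mother_def)
qed

lemma inv_fourier_wavelet:
  assumes "-1 \<le> i"
  shows "inv_fourier (wv i k) \<xi> = cis (of_int k * \<xi> / sc i) / (sc i * (2 * pi)) * fourier (mother i) (- \<xi> / sc i)"
proof -
  have "wv i k = (\<lambda>x. mother i (sc i * x - of_int k))" by (intro ext wavelet_eq assms)
  thus ?thesis by (simp add: inv_fourier_eq_fourier fourier_affine)
qed

lemma inv_fourier_wavelet_high:
  assumes "-1 \<le> i" "sc i * 2 ^ band < \<bar>\<xi>\<bar>"
  shows "inv_fourier (wv i k) \<xi> = 0"
proof -
  have "2 ^ band < \<bar>- \<xi> / sc i\<bar>" using assms(2) by (simp add: pos_less_divide_eq mult.commute)
  thus ?thesis by (simp add: inv_fourier_wavelet[OF assms(1)] fourier_mother_eq_0)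
qed

lemma inv_fourier_wavelet_low:
  assumes "0 \<le> i" "\<bar>\<xi>\<bar> < sc i"
  shows "inv_fourier (wv i k) \<xi> = 0"
proof -
  have "\<bar>- \<xi> / sc i\<bar> < 1" using assms(2) by (simp add: pos_divide_less_eq)
  thus ?thesis using assms(1) by (simp add: inv_fourier_wavelet mother_def fourier_psi_eq_0)
qed

text \<open>The summand 2 leaves room for the width of a dyadic shell and for the layer
  \<open>i = -1\<close>, whose scale is that of \<open>i = 0\<close>.\<close>

definition near :: "int \<Rightarrow> int \<Rightarrow> bool" where
  "near i j \<longleftrightarrow> \<bar>i - j\<bar> \<le> int (band + 2)"

definition near_scales :: "nat \<Rightarrow> int set" where
  "near_scales j = {i. -1 \<le> i \<and> near i (int j)}"

definition near_blocks :: "int \<Rightarrow> nat set" where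
  "near_blocks i = {j. near i (int j)}"

lemma finite_near_scales [simp]: "finite (near_scales j)"
  by (rule finite_subset[of _ "{int j - int (band + 2)..int j + int (band + 2)}"])
     (auto simp: near_scales_def near_def)

lemma finite_near_blocks [simp]: "finite (near_blocks i)"
  by (rule finite_subset[of _ "{..nat (i + int (band + 2))}"]) (auto simp: near_blocks_def near_def)

definition wblock :: "nat \<Rightarrow> int \<Rightarrow> int \<Rightarrow> real \<Rightarrow> complex" where
  "wblock j i k = conv (kern j) (wv i k)"

text \<open>The frequency supports are disjoint. If \<open>j\<close> is much larger, the shell lies
  above the band limit of the wavelet; if \<open>i\<close> is much larger, it lies in the gap of the
  transform of \<open>\<psi>\<close> around the origin, and then \<open>i \<ge> 0\<close>.\<close>

lemma wblock_eq_0: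
  assumes i: "-1 \<le> i" and far: "\<not> near i (int j)"
  shows "wblock j i k x = 0"
  unfolding wblock_def
proof (rule conv_kern_eq_0[OF integrable_wavelet[OF i]])
  fix \<xi>
  consider "int j > i + int (band + 2)" | "i > int j + int (band + 2)"
    using far unfolding near_def by linarith
  thus "of_real (theta \<theta>\<^sub>0 j \<xi>) * inv_fourier (wv i k) \<xi> = 0"
  proof cases
    case 1
    then obtain l where l: "j = Suc l" using i by (cases j) auto
    show ?thesis
    proof (cases "\<bar>\<xi>\<bar> \<le> 2 ^ l")
      case False
      have "sc i * 2 ^ band \<le> 2 ^ l"
        unfolding sc_def power_add[symmetric] using 1 l i
        by (intro power_increasing) (cases "i = -1", auto)
      thus ?thesis using False i by (simp add: inv_fourier_wavelet_high)
    qed (simp add: l theta_eq_0_below)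
  next
    case 2
    show ?thesis
    proof (cases "2 ^ Suc j < \<bar>\<xi>\<bar>")
      case False
      have "(2::real) ^ Suc j < sc i" unfolding sc_def using 2 by (intro power_strict_increasing) auto
      thus ?thesis using False 2 by (simp add: inv_fourier_wavelet_low)
    qed (simp add: theta_eq_0_above del: power_Suc)
  qed
qed

text \<open>Far scales contribute 0. At neighbouring scales the kernel is as well localised as the
  wavelet, so convolution preserves the localisation, with a constant depending only on
  \<open>band\<close> and \<open>N\<close>.\<close>

lemma wblock_bound:
  obtains C where "0 < C" "\<And>j i k x. -1 \<le> i \<Longrightarrow> norm (wblock j i k x) \<le> C * wt N (sc i * x - of_int k)"
proof -
  \<comment> \<open>Of the \<open>N + 2\<close> orders of decay, \<open>N\<close> transport the
    localisation from \<open>y\<close> to \<open>x\<close> and 2 make the integral in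
    \<open>y\<close> converge.\<close>
  obtain A where A: "0 < A" "\<And>j z. norm (kern j z) \<le> A * 2 ^ j * wt (N + 2) (2 ^ j * z)"
    using kern_bound by blast
  obtain B where B: "0 < B" "\<And>i k x. -1 \<le> i \<Longrightarrow> norm (wv i k x) \<le> B * wt N (sc i * x - of_int k)"
    using wavelet_bound by blast
  define m :: real where "m = 2 ^ ((band + 2) * N)"
  have m: "0 < m" by (simp add: m_def)
  let ?C = "2 * A * B * m"
  have C: "0 < ?C" using A(1) B(1) m by simp
  have "norm (wblock j i k x) \<le> ?C * wt N (sc i * x - of_int k)" if i: "-1 \<le> i" for j i k x
  proof (cases "near i (int j)")
    case False
    thus ?thesis using wblock_eq_0[OF i False] C by simp
  next
    case True
    let ?w = "wt N (sc i * x - of_int k)"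
    have pt: "norm (kern j (x - y) * wv i k y) \<le> A * B * m * ?w * (2 ^ j * wt 2 (2 ^ j * y - 2 ^ j * x))" for y
    proof -
      have "wt N (2 ^ j * (x - y)) \<le> m * wt N (sc i * (x - y))"
        using wt_rescale[of i "int j" "band + 2" N "x - y"] True unfolding near_def m_def by simp
      hence "wt N (2 ^ j * (x - y)) * wt N (sc i * y - of_int k)
         \<le> m * (wt N (sc i * (x - y)) * wt N (sc i * y - of_int k))"
        by (simp add: mult.assoc[symmetric] mult_right_mono)
      also have "\<dots> \<le> m * wt N (sc i * (x - y) + (sc i * y - of_int k))"
        using m by (intro mult_left_mono wt_mult_le) simp
      also have "sc i * (x - y) + (sc i * y - of_int k) = sc i * x - of_int k" by (simp add: algebra_simps)
      finally have w: "wt N (2 ^ j * (x - y)) * wt N (sc i * y - of_int k) \<le> m * ?w" .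
      have "norm (kern j (x - y) * wv i k y) \<le>
         (A * 2 ^ j * wt (N + 2) (2 ^ j * (x - y))) * (B * wt N (sc i * y - of_int k))"
        unfolding norm_mult using A B(2)[OF i] by (intro mult_mono) (auto simp: less_imp_le)
      also have "\<dots> = A * B * 2 ^ j * wt 2 (2 ^ j * (x - y)) * (wt N (2 ^ j * (x - y)) * wt N (sc i * y - of_int k))"
        by (simp only: wt_add mult_ac)
      also have "\<dots> \<le> A * B * 2 ^ j * wt 2 (2 ^ j * (x - y)) * (m * ?w)"
        using A(1) B(1) by (intro mult_left_mono w) auto
      also have "wt 2 (2 ^ j * (x - y)) = wt 2 (2 ^ j * y - 2 ^ j * x)"
        by (subst wt_minus_commute[symmetric]) (simp add: algebra_simps)
      finally show ?thesis by (simp add: mult_ac)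
    qed
    have "(\<integral>\<^sup>+y. ennreal (norm (kern j (x - y) * wv i k y)) \<partial>lborel)
        \<le> (\<integral>\<^sup>+y. ennreal (A * B * m * ?w) * (ennreal (2 ^ j) * ennreal (wt 2 (2 ^ j * y - 2 ^ j * x))) \<partial>lborel)"
      using A(1) B(1) m by (intro nn_integral_mono) (simp add: pt ennreal_mult[symmetric] ennreal_leI)
    also have "\<dots> = ennreal (A * B * m * ?w) * (ennreal (2 ^ j) * (\<integral>\<^sup>+y. ennreal (wt 2 (2 ^ j * y - 2 ^ j * x)) \<partial>lborel))"
      by (simp add: nn_integral_cmult)
    also have "\<dots> \<le> ennreal (A * B * m * ?w) * 2"
      by (intro mult_left_mono nn_integral_wt_affine) auto
    also have "\<dots> = ennreal (A * B * m * ?w) * ennreal 2" by simp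
    also have "\<dots> = ennreal (A * B * m * ?w * 2)"
      using A(1) B(1) m by (intro ennreal_mult[symmetric]) auto
    also have "A * B * m * ?w * 2 = ?C * ?w" by (simp only: mult_ac)
    finally show ?thesis
      unfolding wblock_def conv_def
      by (rule norm_integral_le_of_nn_integral) (use C in simp)
  qed
  with C show thesis by (rule that)
qed

text \<open>The index \<open>?b\<close> lies beyond the band limit of the wavelet, so
  \<open>sum_conv_kern\<close> recovers it from the blocks up to \<open>?b\<close>; the blocks that
  are not near vanish.\<close>

lemma sum_wblock:
  assumes i: "-1 \<le> i"
  shows "(\<Sum>j\<in>near_blocks i. wblock j i k x) = wv i k x"
proof -
  let ?b = "nat (i + int (band + 2))"
  obtain C where C: "\<And>x. norm (wv i k x) \<le> C * wt 0 (sc i * x - of_int k)"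
    using wavelet_bound i by metis
  have freq: "inv_fourier (wv i k) \<xi> = 0" if "2 ^ ?b < \<bar>\<xi>\<bar>" for \<xi>
  proof -
    have "sc i * 2 ^ band \<le> 2 ^ ?b"
      unfolding sc_def power_add[symmetric] using i by (intro power_increasing) auto
    thus ?thesis using that i by (intro inv_fourier_wavelet_high) auto
  qed
  have "integrable lborel (inv_fourier (wv i k))"
  proof -
    obtain D where D: "schwartz_seq D" "D 0 = wv i k" using ex_wavelet_seq[OF i] by blast
    obtain E where E: "schwartz_seq E" "E 0 = fourier (D 0)" using schwartz_seq_fourier[OF D(1)] by blast
    have "integrable lborel (\<lambda>\<xi>. fourier (wv i k) (0 + - 1 * \<xi>))"
      using schwartz_seq_integrable[OF E(1), of 0] unfolding E(2) D(2)
      by (rule lborel_integrable_real_affine) simp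
    thus ?thesis by (simp add: inv_fourier_eq_fourier[abs_def])
  qed
  hence "(\<Sum>j\<le>?b. wblock j i k x) = wv i k x"
    unfolding wblock_def using C
    by (intro sum_conv_kern[of _ C] continuous_wavelet integrable_wavelet i freq) (auto simp: wt_def)
  moreover have "(\<Sum>j\<in>near_blocks i. wblock j i k x) = (\<Sum>j\<le>?b. wblock j i k x)"
    using i by (intro sum.mono_neutral_left) (auto simp: near_blocks_def near_def wblock_eq_0)
  ultimately show ?thesis by simp
qed

text \<open>The right side is the inner product of the translated kernel with a wavelet, that is, an
  expansion coefficient up to normalisation.\<close>

lemma cnj_wblock: "cnj (wblock j i k x) = (LINT y|lborel. kern j (y - x) * cnj (wv i k y))"
proof -
  have "(LINT y|lborel. kern j (y - x) * cnj (wv i k y)) = (LINT y|lborel. cnj (kern j (x - y) * wv i k y))"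
    by (intro Bochner_Integration.integral_cong refl) (simp add: cnj_kern)
  thus ?thesis unfolding wblock_def conv_def by (simp only: Bochner_Integration.integral_cnj)
qed

text \<open>The orthonormal family carries the factor \<open>2^(i/2)\<close> for
  \<open>i \<ge> 0\<close>, which occurs once in the coefficient and once in the basis element.
  Collecting both gives \<open>sc i\<close>, and the wavelets themselves stay unnormalised.\<close>

definition analysis :: "nat \<Rightarrow> int \<Rightarrow> int \<Rightarrow> real \<Rightarrow> complex" where
  "analysis j i k x = of_real (sc i) * cnj (wblock j i k x)"

text \<open>The component at scale \<open>i\<close> of the expansion of the function
  \<open>kern j (y - x)\<close> of \<open>y\<close>.\<close>

definition pkern :: "nat \<Rightarrow> int \<Rightarrow> real \<Rightarrow> real \<Rightarrow> complex" where
  "pkern j i x y = (\<Sum>\<^sub>\<infinity>k. analysis j i k x * wv i k y)"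

lemma analysis_bound:
  obtains C where "0 < C" "\<And>j i k x. -1 \<le> i \<Longrightarrow> norm (analysis j i k x) \<le> C * sc i * wt N (sc i * x - of_int k)"
proof -
  obtain C where C: "0 < C" "\<And>j i k x. -1 \<le> i \<Longrightarrow> norm (wblock j i k x) \<le> C * wt N (sc i * x - of_int k)"
    using wblock_bound by blast
  have "norm (analysis j i k x) \<le> C * sc i * wt N (sc i * x - of_int k)" if "-1 \<le> i" for j i k x
    using mult_left_mono[OF C(2)[OF that], of "sc i"] by (simp add: analysis_def norm_mult mult_ac)
  with C(1) show thesis by (rule that)
qed

lemma analysis_wavelet_bound:
  obtains C where "0 < C"
    "\<And>j i k x y. -1 \<le> i \<Longrightarrow> norm (analysis j i k x * wv i k y) \<le> C * sc i * wt N (sc i * x - of_int k)"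
proof -
  obtain C where C: "0 < C" "\<And>j i k x. -1 \<le> i \<Longrightarrow> norm (analysis j i k x) \<le> C * sc i * wt N (sc i * x - of_int k)"
    using analysis_bound by blast
  obtain B where B: "0 < B" "\<And>i k x. -1 \<le> i \<Longrightarrow> norm (wv i k x) \<le> B * wt 0 (sc i * x - of_int k)"
    using wavelet_bound by blast
  have "norm (analysis j i k x * wv i k y) \<le> (C * sc i * wt N (sc i * x - of_int k)) * B" if "-1 \<le> i" for j i k x y
    unfolding norm_mult using C(1) C(2)[OF that] B(2)[OF that, of k y]
    by (intro mult_mono) (auto simp: wt_def)
  with B(1) C(1) show thesis by (intro that[of "C * B"]) (auto simp: mult_ac)
qed

lemma has_sum_pkern:
  assumes "-1 \<le> i"
  shows "((\<lambda>k. analysis j i k x * wv i k y) has_sum pkern j i x y) UNIV"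
proof -
  obtain C where C: "\<And>k. norm (analysis j i k x * wv i k y) \<le> C * sc i * wt 2 (sc i * x - of_int k)"
    using analysis_wavelet_bound assms by metis
  have "(\<lambda>k. analysis j i k x * wv i k y) summable_on UNIV"
    by (rule abs_summable_summable[OF summable_on_comparison_wt[OF C]])
  thus ?thesis unfolding pkern_def by (rule has_sum_infsum)
qed

lemma continuous_pkern:
  assumes "-1 \<le> i"
  shows "continuous_on UNIV (pkern j i x)"
proof -
  obtain C where C: "\<And>k y. norm (analysis j i k x * wv i k y) \<le> C * sc i * wt 2 (sc i * x - of_int k)"
    using analysis_wavelet_bound assms by metis
  show ?thesis unfolding pkern_def
    by (rule continuous_infsum[OF _ C summable_on_cmult_right[OF summable_on_wt]])
       (intro continuous_intros continuous_wavelet assms)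
qed

text \<open>The orthonormal expansion of the translated kernel, grouped by scale. Only finitely many
  scales survive, so it is an exact finite sum of smooth pieces rather than a limit over
  scales.\<close>

lemma sum_pkern: "(\<Sum>i\<in>near_scales j. pkern j i x y) = kern j (y - x)"
proof -
  let ?I = "{-1..} \<times> (UNIV :: int set)"
  define e where "e = (\<lambda>(i, k) y. complex_of_real (2 powr (of_int (max i 0) / 2)) * wv i k y)"
  define a where "a = (\<lambda>(i, k). complex_of_real (2 powr (of_int (max i 0) / 2)) * cnj (wblock j i k x))"
  define T where "T y = (\<Sum>i\<in>near_scales j. pkern j i x y)" for y
  have onb: "orthonormal_basis_L2 ?I e" using meyer unfolding lemarie_meyer_def e_def by blast
  have ae: "a (i, k) * e (i, k) y = analysis j i k x * wv i k y" for i k y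
  proof -
    have "2 powr (of_int (max i 0) / 2) * 2 powr (of_int (max i 0) / 2) = sc i"
      unfolding powr_add[symmetric] sc_def powr_realpow[OF zero_less_numeral, symmetric]
      by (cases "i \<le> 0") (auto simp: max_def)
    hence c: "complex_of_real (2 powr (of_int (max i 0) / 2)) * complex_of_real (2 powr (of_int (max i 0) / 2)) = sc i"
      by (simp flip: of_real_mult)
    have "(z * u) * (z * v) = (z * z) * u * v" for z u v :: complex by (simp only: mult_ac)
    thus ?thesis unfolding a_def e_def analysis_def prod.case using c by simp
  qed
  obtain C where C: "0 < C" "\<And>i k y. -1 \<le> i \<Longrightarrow> norm (analysis j i k x * wv i k y) \<le> C * sc i * wt 2 (sc i * x - of_int k)"
    using analysis_wavelet_bound by metis
  have sum_near: "((\<lambda>ik. a ik * e ik y) has_sum T y) (near_scales j \<times> UNIV)" for y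
  proof (rule has_sum_SigmaI)
    fix i assume "i \<in> near_scales j"
    thus "((\<lambda>k. a (i, k) * e (i, k) y) has_sum pkern j i x y) UNIV"
      unfolding ae by (intro has_sum_pkern) (simp add: near_scales_def)
  next
    show "((\<lambda>i. pkern j i x y) has_sum T y) (near_scales j)" unfolding T_def by (rule has_sum_finite) simp
    have "(\<lambda>ik. norm (a ik * e ik y)) summable_on (near_scales j \<times> UNIV)"
      unfolding Infinite_Sum.abs_summable_on_Sigma_iff ae
    proof (intro conjI ballI)
      fix i assume "i \<in> near_scales j"
      thus "(\<lambda>k. norm (analysis j i k x * wv i k y)) summable_on UNIV"
        by (intro summable_on_comparison_wt[of _ "C * sc i" "sc i * x"] C(2)) (simp add: near_scales_def)
    qed simp
    thus "(\<lambda>ik. a ik * e ik y) summable_on (near_scales j \<times> UNIV)" by (rule abs_summable_summable)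
  qed
  have "AE y in lborel. kern j (y - x) = T y"
  proof (rule orthonormal_expansion_AE[OF onb])
    obtain K where K: "schwartz_seq K" "K 0 = kern j" using ex_kern_seq by blast
    have "square_integrable (\<lambda>y. K 0 (y - x))"
    proof -
      have sh: "schwartz_seq (\<lambda>n y. 1 ^ n *\<^sub>R K n (1 * y - x))" by (rule schwartz_seq_affine[OF K(1)]) simp
      obtain B where B: "0 < B" "\<And>y. norm (K 0 (1 * y - x)) \<le> B * wt 1 y"
        using schwartz_seq_bound[OF sh, of 0 1] by auto
      have "integrable lborel (\<lambda>y. (cmod (K 0 (y - x)))\<^sup>2)"
      proof (rule integrable_wt_bound[of _ "B\<^sup>2"])
        show "(\<lambda>y. (cmod (K 0 (y - x)))\<^sup>2) \<in> borel_measurable borel" unfolding K(2) by measurable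
        fix y
        have "(cmod (K 0 (y - x)))\<^sup>2 \<le> (B * wt 1 y)\<^sup>2" using B(2)[of y] by (intro power_mono) auto
        also have "\<dots> = B\<^sup>2 * wt 2 y" using wt_add[of 1 1 y] by (simp add: power2_eq_square mult_ac numeral_2_eq_2)
        finally show "norm ((cmod (K 0 (y - x)))\<^sup>2) \<le> B\<^sup>2 * wt 2 y" by simp
      qed
      moreover have "(\<lambda>y. K 0 (y - x)) \<in> borel_measurable lborel" unfolding K(2) by measurable
      ultimately show ?thesis unfolding square_integrable_def by blast
    qed
    thus "square_integrable (\<lambda>y. kern j (y - x))" by (simp add: K(2))
    show "a ik = (LINT y|lborel. kern j (y - x) * cnj (e ik y))" for ik
    proof (cases ik)
      case (Pair i k)
      have "(LINT y|lborel. kern j (y - x) * cnj (e ik y)) =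
        (LINT y|lborel. complex_of_real (2 powr (of_int (max i 0) / 2)) * (kern j (y - x) * cnj (wv i k y)))"
        by (intro Bochner_Integration.integral_cong refl) (simp add: Pair e_def)
      thus ?thesis by (simp add: Pair a_def cnj_wblock)
    qed
    \<comment> \<open>Terms at scales that are not near \<open>j\<close> vanish, so the sum over the
      whole basis is the one computed in \<open>sum_near\<close>.\<close>
    show "((\<lambda>ik. a ik * e ik y) has_sum T y) ?I" for y
    proof (subst has_sum_cong_neutral[where T = "near_scales j \<times> UNIV"])
      show "((\<lambda>ik. a ik * e ik y) has_sum T y) (near_scales j \<times> UNIV)" by (rule sum_near)
    next
      fix ik assume "ik \<in> ?I - near_scales j \<times> UNIV"
      then obtain i k where "ik = (i, k)" "-1 \<le> i" "\<not> near i (int j)"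
        by (auto simp: near_scales_def)
      thus "a ik * e ik y = 0" by (simp add: a_def wblock_eq_0)
    qed (auto simp: near_scales_def)
  qed auto
  \<comment> \<open>Both sides are continuous, which upgrades the almost everywhere identity to
    equality at every point.\<close>
  hence "(\<lambda>y. kern j (y - x)) = T"
    by (intro continuous_AE_eq)
       (auto simp: T_def near_scales_def intro!: continuous_on_sum continuous_pkern
          continuous_on_compose2[OF continuous_kern[of UNIV]] continuous_intros)
  thus ?thesis by (metis T_def)
qed

end

section \<open>Weights and series in two variables\<close>

definition wt2 :: "nat \<Rightarrow> real \<times> real \<Rightarrow> real" where
  "wt2 N x = wt N (fst x) * wt N (snd x)"

definition ireal :: "int \<times> int \<Rightarrow> real \<times> real" where
  "ireal k = (of_int (fst k), of_int (snd k))"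

definition sc2 :: "int \<times> int \<Rightarrow> real \<times> real \<Rightarrow> real \<times> real" where
  "sc2 i x = (sc (fst i) * fst x, sc (snd i) * snd x)"

definition vol :: "int \<times> int \<Rightarrow> real" where
  "vol i = sc (fst i) * sc (snd i)"

lemma vol_pos [simp]: "0 < vol i" and vol_nonneg [simp]: "0 \<le> vol i"
  by (simp_all add: vol_def)

lemma wt2_pos [simp]: "0 < wt2 N x" and wt2_nonneg [simp]: "0 \<le> wt2 N x"
  by (simp_all add: wt2_def)

lemma wt2_neq_0 [simp]: "wt2 N x \<noteq> 0"
  using wt2_pos[of N x] by linarith

lemma wt2_add: "wt2 (M + N) x = wt2 M x * wt2 N x"
  by (simp only: wt2_def wt_add mult_ac)

lemma wt2_le_1: "wt2 N x \<le> 1"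
  unfolding wt2_def using mult_mono[OF wt_le_1 wt_le_1] by simp

lemma wt2_antimono: "M \<le> N \<Longrightarrow> wt2 N x \<le> wt2 M x"
  unfolding wt2_def by (intro mult_mono wt_antimono) auto

lemma wt2_mult_le: "wt2 N x * wt2 N y \<le> wt2 N (x + y)"
  unfolding wt2_def using mult_mono[OF wt_mult_le[of N "fst x" "fst y"] wt_mult_le[of N "snd x" "snd y"]]
  by (simp add: mult_ac)

lemma wt2_minus [simp]: "wt2 N (- x) = wt2 N x"
  by (simp add: wt2_def)

lemma wt2_le_inverse: "wt2 N x \<le> wt2 N (x + y) / wt2 N y"
  using wt2_mult_le[of N x y] by (simp add: pos_le_divide_eq)

text \<open>The form in which localisation around a fixed \<open>x\<close> is traded for decay in
  \<open>y\<close>, at the price of polynomial growth in \<open>x\<close>.\<close>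

lemma wt2_shift_le: "wt2 N (x - y) \<le> wt2 N y / wt2 N x"
  using wt2_le_inverse[of N "x - y" "- x"] by simp

lemma sc2_diff: "sc2 i (x - y) = sc2 i x - sc2 i y"
  by (simp add: sc2_def algebra_simps prod_eq_iff)

lemma wt2_sc2_le: "wt2 N (sc2 i x) \<le> wt2 N x"
proof -
  have "wt N (sc i * t) \<le> wt N t" for i t
    using wt_scale[of "1 / sc i" N "sc i * t"] sc_ge_1[of i] by simp
  thus ?thesis unfolding wt2_def sc2_def by (intro mult_mono) auto
qed

lemma wt2_le_sc2: "wt2 N x \<le> vol i ^ N * wt2 N (sc2 i x)"
proof -
  have "wt N t \<le> sc i ^ N * wt N (sc i * t)" for i t
    using wt_scale[of "sc i" N t] sc_ge_1[of i] by (simp add: max_def)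
  hence "wt2 N x \<le> (sc (fst i) ^ N * wt N (sc (fst i) * fst x)) * (sc (snd i) ^ N * wt N (sc (snd i) * snd x))"
    unfolding wt2_def by (intro mult_mono) auto
  thus ?thesis by (simp add: wt2_def sc2_def vol_def power_mult_distrib mult_ac)
qed

lemma continuous_on_wt2 [continuous_intros]:
  "continuous_on A f \<Longrightarrow> continuous_on A (\<lambda>x. wt2 N (f x))"
  unfolding wt2_def by (intro continuous_intros)

lemma continuous_on_sc2 [continuous_intros]:
  "continuous_on A f \<Longrightarrow> continuous_on A (\<lambda>x. sc2 i (f x))"
  unfolding sc2_def by (intro continuous_intros)

lemma borel_measurable_wt2 [measurable]: "wt2 N \<in> borel_measurable borel"
  by (intro borel_measurable_continuous_onI continuous_intros)

lemma borel_measurable_sc2 [measurable]: "sc2 i \<in> borel_measurable borel"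
  by (intro borel_measurable_continuous_onI continuous_intros)

lemma nn_integral_tensor:
  fixes f g :: "real \<Rightarrow> ennreal"
  assumes [measurable]: "f \<in> borel_measurable borel" "g \<in> borel_measurable borel"
  shows "(\<integral>\<^sup>+x. f (fst x) * g (snd x) \<partial>lborel) = (\<integral>\<^sup>+x. f x \<partial>lborel) * (\<integral>\<^sup>+x. g x \<partial>lborel)"
proof -
  have "(\<integral>\<^sup>+x. f (fst x) * g (snd x) \<partial>lborel) = (\<integral>\<^sup>+x. f (fst x) * g (snd x) \<partial>(lborel \<Otimes>\<^sub>M lborel))"
    by (simp add: lborel_prod)
  also have "\<dots> = (\<integral>\<^sup>+x. \<integral>\<^sup>+y. f x * g y \<partial>lborel \<partial>lborel)"
    by (subst lborel.nn_integral_fst[symmetric]) auto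
  also have "\<dots> = (\<integral>\<^sup>+x. f x * (\<integral>\<^sup>+y. g y \<partial>lborel) \<partial>lborel)"
    by (simp add: nn_integral_cmult)
  finally show ?thesis by (simp add: nn_integral_multc)
qed

lemma nn_integral_wt2_affine:
  assumes "2 \<le> N"
  shows "ennreal (vol i) * (\<integral>\<^sup>+x. ennreal (wt2 N (sc2 i x - b)) \<partial>lborel) \<le> 4"
proof -
  let ?A = "\<lambda>i b. (\<integral>\<^sup>+t. ennreal (wt N (sc i * t - b)) \<partial>lborel)"
  have "(\<integral>\<^sup>+x. ennreal (wt2 N (sc2 i x - b)) \<partial>lborel) = ?A (fst i) (fst b) * ?A (snd i) (snd b)"
    by (subst nn_integral_tensor[symmetric]) (auto simp: wt2_def sc2_def ennreal_mult)
  hence "ennreal (vol i) * (\<integral>\<^sup>+x. ennreal (wt2 N (sc2 i x - b)) \<partial>lborel) =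
     (ennreal (sc (fst i)) * ?A (fst i) (fst b)) * (ennreal (sc (snd i)) * ?A (snd i) (snd b))"
    by (simp add: vol_def ennreal_mult mult_ac)
  also have "\<dots> \<le> 2 * 2" by (intro mult_mono nn_integral_wt_affine assms) auto
  finally show ?thesis by simp
qed

lemma nn_integral_wt2: "(\<integral>\<^sup>+x. ennreal (wt2 2 x) \<partial>lborel) \<le> 4"
  using nn_integral_wt2_affine[of 2 "(0, 0)" 0] by (simp add: vol_def sc2_def sc_def)

lemma nn_integral_wt2_sum:
  assumes "2 \<le> N"
  shows "(\<integral>\<^sup>+k. ennreal (wt2 N (x - ireal k)) \<partial>count_space UNIV) \<le> 64"
proof -
  let ?A = "\<lambda>t. (\<integral>\<^sup>+k. ennreal (wt N (t - of_int k)) \<partial>count_space UNIV)"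
  have "(\<integral>\<^sup>+k. ennreal (wt2 N (x - ireal k)) \<partial>count_space UNIV) =
        (\<integral>\<^sup>+k. \<integral>\<^sup>+l. ennreal (wt N (fst x - of_int k)) * ennreal (wt N (snd x - of_int l)) \<partial>count_space UNIV \<partial>count_space UNIV)"
    by (subst nn_integral_fst_count_space[symmetric]) (simp add: wt2_def ireal_def ennreal_mult)
  also have "\<dots> = ?A (fst x) * ?A (snd x)"
    by (simp add: nn_integral_cmult nn_integral_multc)
  also have "\<dots> \<le> 8 * 8" by (intro mult_mono nn_integral_wt_sum assms) auto
  finally show ?thesis by simp
qed

lemma summable_on_wt2: "(\<lambda>k. wt2 2 (x - ireal k)) summable_on UNIV"
  by (rule summable_on_of_nn_integral) (use nn_integral_wt2_sum[of 2 x] in \<open>auto intro: le_less_trans\<close>)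

lemma summable_on_wt2_0: "(\<lambda>k. wt2 2 (ireal k)) summable_on UNIV"
  using summable_on_wt2[of 0] by simp

lemma integrable_wt2: "integrable lborel (wt2 2)"
  using nn_integral_wt2 by (intro integrableI_nonneg) (auto intro: le_less_trans)

lemma integrable_wt2_bound:
  fixes f :: "real \<times> real \<Rightarrow> 'b::{banach, second_countable_topology}"
  assumes "f \<in> borel_measurable borel" "\<And>x. norm (f x) \<le> C * wt2 2 x"
  shows "integrable lborel f"
proof (rule Bochner_Integration.integrable_bound[OF integrable_mult_right[where c = C, OF integrable_wt2]])
  show "AE x in lborel. norm (f x) \<le> norm (C * wt2 2 x)"
    by (intro AE_I2 order_trans[OF assms(2)]) simp
qed (use assms(1) in simp)

lemma integral_tensor:
  fixes f g :: "real \<Rightarrow> complex"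
  assumes "integrable lborel f" "integrable lborel g"
  shows "(LINT x|lborel. f (fst x) * g (snd x)) = (LINT x|lborel. f x) * (LINT x|lborel. g x)"
    and "integrable lborel (\<lambda>x. f (fst x) * g (snd x))"
proof -
  have int: "integrable (lborel \<Otimes>\<^sub>M lborel) (\<lambda>(x, y). f x * g y)"
    by (rule integrable_tensor[OF sigma_finite_lborel sigma_finite_lborel assms])
  thus "integrable lborel (\<lambda>x. f (fst x) * g (snd x))" by (simp add: case_prod_unfold lborel_prod)
  have "(LINT x|lborel. f (fst x) * g (snd x)) = (LINT x|(lborel \<Otimes>\<^sub>M lborel). (\<lambda>(x, y). f x * g y) x)"
    by (simp add: case_prod_unfold lborel_prod)
  also have "\<dots> = (LINT x|lborel. LINT y|lborel. f x * g y)"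
    by (rule lborel_pair.integral_fst'[OF int, symmetric, unfolded prod.case])
  finally show "(LINT x|lborel. f (fst x) * g (snd x)) = (LINT x|lborel. f x) * (LINT x|lborel. g x)" by simp
qed

lemma has_sum_product:
  fixes f g :: "int \<Rightarrow> complex"
  assumes f: "(f has_sum a) UNIV" and g: "(g has_sum b) UNIV"
  shows "((\<lambda>k. f (fst k) * g (snd k)) has_sum a * b) UNIV"
proof -
  have fn: "(\<lambda>k. norm (f k)) summable_on UNIV" and gn: "(\<lambda>k. norm (g k)) summable_on UNIV"
    using f g by (auto simp flip: summable_on_iff_abs_summable_on_complex intro: has_sum_imp_summable)
  have "(\<lambda>k. norm (f (fst k) * g (snd k))) summable_on UNIV \<times> UNIV"
    unfolding Infinite_Sum.abs_summable_on_Sigma_iff unfolding fst_conv snd_conv norm_mult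
  proof (intro conjI ballI)
    show "(\<lambda>l. norm (f k) * norm (g l)) summable_on UNIV" for k
      by (rule summable_on_cmult_right[OF gn])
    have "norm (\<Sum>\<^sub>\<infinity>l. norm (f k) * norm (g l)) = norm (f k) * (\<Sum>\<^sub>\<infinity>l. norm (g l))" for k
      by (simp add: infsum_cmult_right' infsum_nonneg abs_mult)
    thus "(\<lambda>k. norm (\<Sum>\<^sub>\<infinity>l. norm (f k) * norm (g l))) summable_on UNIV"
      using summable_on_cmult_left[OF fn] by simp
  qed
  hence summ: "(\<lambda>k. f (fst k) * g (snd k)) summable_on UNIV \<times> UNIV"
    by (rule abs_summable_summable)
  have "((\<lambda>k. f (fst k) * g (snd k)) has_sum a * b) (UNIV \<times> UNIV)"
  proof (rule has_sum_SigmaI[OF _ has_sum_cmult_left[OF f] summ])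
    show "((\<lambda>l. f (fst (k, l)) * g (snd (k, l))) has_sum f k * b) UNIV" for k
      unfolding fst_conv snd_conv by (rule has_sum_cmult_right[OF g])
  qed
  thus ?thesis by simp
qed

lemma integral_has_sum:
  fixes F :: "int \<times> int \<Rightarrow> 'a \<Rightarrow> complex"
  assumes int: "\<And>k. integrable M (F k)"
    and S: "\<And>x. ((\<lambda>k. F k x) has_sum S x) UNIV"
    and summ: "(\<lambda>k. LINT x|M. norm (F k x)) summable_on UNIV"
  shows "integrable M S" "((\<lambda>k. LINT x|M. F k x) has_sum (LINT x|M. S x)) UNIV"
proof -
  obtain \<nu> :: "nat \<Rightarrow> int \<times> int" where \<nu>: "bij_betw \<nu> UNIV UNIV"
    by (rule enumerate_int_prod)
  have summ': "summable (\<lambda>n. LINT x|M. norm (F (\<nu> n) x))"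
    using summ summable_on_reindex_bij_betw[OF \<nu>, of "\<lambda>k. LINT x|M. norm (F k x)"]
    by (auto intro: summable_on_imp_summable)
  have pt: "summable (\<lambda>n. norm (F (\<nu> n) x))" for x
  proof -
    have "(\<lambda>k. norm (F k x)) summable_on UNIV"
      using S[of x] by (auto simp flip: summable_on_iff_abs_summable_on_complex intro: has_sum_imp_summable)
    thus ?thesis using summable_on_reindex_bij_betw[OF \<nu>, of "\<lambda>k. norm (F k x)"]
      by (auto intro: summable_on_imp_summable)
  qed
  have "(\<lambda>n. F (\<nu> n) x) sums S x" for x
    using S[of x] has_sum_reindex_bij_betw[OF \<nu>, of "\<lambda>k. F k x" "S x"] by (auto intro: has_sum_imp_sums)
  hence S_eq: "S = (\<lambda>x. \<Sum>n. F (\<nu> n) x)" by (auto simp: sums_iff)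
  show "integrable M S"
    unfolding S_eq by (rule integrable_suminf[OF int _ summ']) (simp add: pt)
  have "(\<lambda>n. LINT x|M. F (\<nu> n) x) sums (LINT x|M. S x)"
    unfolding S_eq by (rule sums_integral[OF int _ summ']) (simp add: pt)
  moreover have "summable (\<lambda>n. norm (LINT x|M. F (\<nu> n) x))"
    by (rule summable_comparison_test'[OF summ', of 0]) simp
  ultimately have "((\<lambda>n. LINT x|M. F (\<nu> n) x) has_sum (LINT x|M. S x)) UNIV"
    by (intro norm_summable_imp_has_sum)
  thus "((\<lambda>k. LINT x|M. F k x) has_sum (LINT x|M. S x)) UNIV"
    using has_sum_reindex_bij_betw[OF \<nu>, of "\<lambda>k. LINT x|M. F k x"] by simp
qed

text \<open>Each coordinate uses up \<open>N\<close> powers of \<open>1 + norm x\<close>, hence the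
  seminorm of order \<open>N + N\<close>.\<close>

lemma schwartz_wt2_bound:
  fixes \<eta> :: "real \<times> real \<Rightarrow> complex"
  assumes "schwartz \<eta>"
  obtains C where "0 \<le> C" "\<And>x. norm (\<eta> x) \<le> C * wt2 N x"
proof -
  let ?C = "schwartz_seminorm (N + N) [] \<eta>"
  have "norm (\<eta> x) \<le> ?C * wt2 N x" for x
  proof -
    have "(1 + \<bar>fst x\<bar>) ^ N * (1 + \<bar>snd x\<bar>) ^ N \<le> (1 + norm x) ^ N * (1 + norm x) ^ N"
      using norm_fst_le[of "fst x" "snd x"] norm_snd_le[of "snd x" "fst x"] by (intro mult_mono power_mono) auto
    hence "(1 + \<bar>fst x\<bar>) ^ N * (1 + \<bar>snd x\<bar>) ^ N * norm (\<eta> x) \<le> (1 + norm x) ^ (N + N) * norm (\<eta> x)"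
      by (intro mult_right_mono) (auto simp: power_add)
    also have "\<dots> \<le> ?C" using schwartz_bound[OF assms, of "[]" x "N + N"] by simp
    finally show ?thesis by (simp add: wt2_def wt_def field_simps add_pos_nonneg)
  qed
  thus thesis using that schwartz_seminorm_nonneg[OF assms, of "[]"] by auto
qed

lemma schwartz_integrable:
  fixes \<eta> :: "real \<times> real \<Rightarrow> complex"
  assumes "schwartz \<eta>"
  shows "integrable lborel \<eta>"
proof -
  obtain C where "\<And>x. norm (\<eta> x) \<le> C * wt2 2 x" using schwartz_wt2_bound[OF assms] by metis
  thus ?thesis using schwartz_measurable[OF assms] by (rule integrable_wt2_bound[rotated])
qed

section \<open>Hyperbolic blocks of a tempered distribution\<close>

context hyperbolic_wavelets
begin

abbreviation wv2 :: "int \<times> int \<Rightarrow> int \<times> int \<Rightarrow> real \<times> real \<Rightarrow> complex" where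
  "wv2 \<equiv> wavelet2 \<psi> \<phi>"

definition kern2 :: "nat \<times> nat \<Rightarrow> real \<times> real \<Rightarrow> complex" where
  "kern2 j z = kern (fst j) (fst z) * kern (snd j) (snd z)"

definition analysis2 :: "nat \<times> nat \<Rightarrow> int \<times> int \<Rightarrow> int \<times> int \<Rightarrow> real \<times> real \<Rightarrow> complex" where
  "analysis2 j i k x = analysis (fst j) (fst i) (fst k) (fst x) * analysis (snd j) (snd i) (snd k) (snd x)"

definition pkern2 :: "nat \<times> nat \<Rightarrow> int \<times> int \<Rightarrow> real \<times> real \<Rightarrow> real \<times> real \<Rightarrow> complex" where
  "pkern2 j i x y = pkern (fst j) (fst i) (fst x) (fst y) * pkern (snd j) (snd i) (snd x) (snd y)"

definition scales2 :: "(int \<times> int) set" where "scales2 = {-1..} \<times> {-1..}"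

definition near_scales2 :: "nat \<times> nat \<Rightarrow> (int \<times> int) set" where
  "near_scales2 j = near_scales (fst j) \<times> near_scales (snd j)"

definition near_blocks2 :: "int \<times> int \<Rightarrow> (nat \<times> nat) set" where
  "near_blocks2 i = near_blocks (fst i) \<times> near_blocks (snd i)"

lemma finite_near_scales2 [simp]: "finite (near_scales2 j)"
  by (simp add: near_scales2_def)

lemma finite_near_blocks2 [simp]: "finite (near_blocks2 i)"
  by (simp add: near_blocks2_def)

lemma near_scales2_subset: "i \<in> near_scales2 j \<Longrightarrow> i \<in> scales2"
  by (auto simp: near_scales2_def scales2_def near_scales_def)

lemma wavelet2_eq: "wv2 i k y = wv (fst i) (fst k) (fst y) * wv (snd i) (snd k) (snd y)"
  by (simp add: wavelet2_def case_prod_unfold)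

lemma wavelet2_eq_tensor: "wv2 i k = tensor (wv (fst i) (fst k)) (wv (snd i) (snd k))"
  by (simp add: wavelet2_eq tensor_def fun_eq_iff)

lemma has_sum_pkern2:
  assumes "i \<in> scales2"
  shows "((\<lambda>k. analysis2 j i k x * wv2 i k y) has_sum pkern2 j i x y) UNIV"
proof -
  have "((\<lambda>k. (analysis (fst j) (fst i) (fst k) (fst x) * wv (fst i) (fst k) (fst y)) *
      (analysis (snd j) (snd i) (snd k) (snd x) * wv (snd i) (snd k) (snd y))) has_sum pkern2 j i x y) UNIV"
    unfolding pkern2_def using assms
    by (intro has_sum_product has_sum_pkern) (auto simp: scales2_def)
  thus ?thesis by (simp add: analysis2_def wavelet2_eq mult_ac)
qed

lemma sum_pkern2: "(\<Sum>i\<in>near_scales2 j. pkern2 j i x y) = kern2 j (y - x)"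
  unfolding pkern2_def near_scales2_def kern2_def fst_diff snd_diff sum_pkern[symmetric]
  by (simp add: sum_product sum.cartesian_product case_prod_unfold)

lemma analysis2_bound:
  obtains C where "0 < C"
    "\<And>j i k x. i \<in> scales2 \<Longrightarrow> norm (analysis2 j i k x) \<le> C * vol i * wt2 N (sc2 i x - ireal k)"
proof -
  obtain C where C: "0 < C" "\<And>j i k x. -1 \<le> i \<Longrightarrow> norm (analysis j i k x) \<le> C * sc i * wt N (sc i * x - of_int k)"
    using analysis_bound by blast
  have "norm (analysis2 j i k x) \<le> (C * C) * vol i * wt2 N (sc2 i x - ireal k)" if "i \<in> scales2" for j i k x
  proof -
    have "norm (analysis2 j i k x) \<le> (C * sc (fst i) * wt N (sc (fst i) * fst x - of_int (fst k))) *
       (C * sc (snd i) * wt N (sc (snd i) * snd x - of_int (snd k)))"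
      unfolding analysis2_def norm_mult using that C(1)
      by (intro mult_mono C(2)) (auto simp: scales2_def)
    thus ?thesis by (simp add: vol_def wt2_def sc2_def ireal_def mult_ac)
  qed
  thus thesis using that[of "C * C"] C(1) by simp
qed

lemma wavelet2_bound:
  obtains C where "0 < C"
    "\<And>i k x. i \<in> scales2 \<Longrightarrow> norm (wv2 i k x) \<le> C * wt2 N (sc2 i x - ireal k)"
proof -
  obtain C where C: "0 < C" "\<And>i k x. -1 \<le> i \<Longrightarrow> norm (wv i k x) \<le> C * wt N (sc i * x - of_int k)"
    using wavelet_bound by blast
  have "norm (wv2 i k x) \<le> (C * C) * wt2 N (sc2 i x - ireal k)" if "i \<in> scales2" for i k x
  proof -
    have "norm (wv2 i k x) \<le> (C * wt N (sc (fst i) * fst x - of_int (fst k))) *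
       (C * wt N (sc (snd i) * snd x - of_int (snd k)))"
      unfolding wavelet2_eq norm_mult using that C(1)
      by (intro mult_mono C(2)) (auto simp: scales2_def)
    thus ?thesis by (simp add: wt2_def sc2_def ireal_def mult_ac)
  qed
  thus thesis using that[of "C * C"] C(1) by simp
qed

section \<open>Seminorms of the wavelets and growth of a distribution along them\<close>

lemma schwartz_wavelet2:
  assumes "i \<in> scales2"
  shows "schwartz (wv2 i k)"
proof -
  obtain D E where "schwartz_seq D" "D 0 = wv (fst i) (fst k)" "schwartz_seq E" "E 0 = wv (snd i) (snd k)"
    using ex_wavelet_seq assms unfolding scales2_def by (metis SigmaE atLeast_iff fst_conv snd_conv)
  thus ?thesis unfolding wavelet2_eq_tensor using schwartz_tensor[of D E] by simp
qed

text \<open>The scale is fixed and the translation varies: each derivative grows at most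
  polynomially in \<open>k\<close> in every weighted norm, since moving the centre by
  \<open>k\<close> costs \<open>1 / wt N k\<close>.\<close>

lemma wavelet_seq_bound:
  assumes i: "-1 \<le> i"
  shows "\<exists>D. \<forall>k. schwartz_seq (D k) \<and> D k 0 = wv i k \<and>
     (\<forall>n N. \<exists>C>0. \<forall>k x. norm (D k n x) \<le> C / wt N (of_int k) * wt N x)"
proof -
  obtain M where M: "schwartz_seq M" "M 0 = mother i" using ex_mother_seq by blast
  let ?D = "\<lambda>k n x. sc i ^ n *\<^sub>R M n (sc i * x - of_int k)"
  have "\<exists>C>0. \<forall>k x. norm (?D k n x) \<le> C / wt N (of_int k) * wt N x" for n N
  proof -
    obtain A where A: "0 < A" "\<And>x. norm (M n x) \<le> A * wt N x" using schwartz_seq_bound[OF M(1)] by blast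
    have "norm (?D k n x) \<le> (sc i ^ n * A) / wt N (of_int k) * wt N x" for k x
    proof -
      have "wt N (sc i * x - of_int k) * wt N (of_int k) \<le> wt N (sc i * x)"
        using wt_mult_le[of N "sc i * x - of_int k" "of_int k"] by simp
      also have "\<dots> \<le> wt N x" using wt_scale[of "1 / sc i" N "sc i * x"] sc_ge_1[of i] by simp
      finally have "wt N (sc i * x - of_int k) \<le> wt N x / wt N (of_int k)" by (simp add: pos_le_divide_eq)
      hence "norm (M n (sc i * x - of_int k)) \<le> A * (wt N x / wt N (of_int k))"
        by (rule order_trans[OF A(2) mult_left_mono]) (use A(1) in simp)
      hence "sc i ^ n * norm (M n (sc i * x - of_int k)) \<le> sc i ^ n * (A * (wt N x / wt N (of_int k)))"
        by (intro mult_left_mono) auto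
      thus ?thesis by (simp add: mult_ac)
    qed
    thus ?thesis using A(1) by (intro exI[of _ "sc i ^ n * A"]) auto
  qed
  moreover have "schwartz_seq (?D k)" for k by (rule schwartz_seq_affine[OF M(1)]) simp
  moreover have "?D k 0 = wv i k" for k using M(2) i by (auto simp: wavelet_eq fun_eq_iff)
  ultimately show ?thesis by (intro exI[of _ ?D] allI conjI)
qed

lemma seminorm_wavelet2:
  assumes i: "i \<in> scales2" and bs: "set bs \<subseteq> Basis"
  shows "\<exists>C\<ge>0. \<forall>k. schwartz_seminorm N bs (wv2 i k) \<le> C / wt2 N (ireal k)"
proof -
  obtain D where D: "\<And>k. schwartz_seq (D k)" "\<And>k. D k 0 = wv (fst i) k"
    "\<And>n N. \<exists>C>0. \<forall>k x. norm (D k n x) \<le> C / wt N (of_int k) * wt N x"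
    using wavelet_seq_bound[of "fst i"] i unfolding scales2_def by fastforce
  obtain E where E: "\<And>k. schwartz_seq (E k)" "\<And>k. E k 0 = wv (snd i) k"
    "\<And>n N. \<exists>C>0. \<forall>k x. norm (E k n x) \<le> C / wt N (of_int k) * wt N x"
    using wavelet_seq_bound[of "snd i"] i unfolding scales2_def by fastforce
  let ?m = "count_list bs (1, 0)" and ?n = "count_list bs (0, 1)"
  obtain A where A: "0 < A" "\<And>k x. norm (D k ?m x) \<le> A / wt N (of_int k) * wt N x"
    using D(3)[of ?m N] by blast
  obtain B where B: "0 < B" "\<And>k x. norm (E k ?n x) \<le> B / wt N (of_int k) * wt N x"
    using E(3)[of ?n N] by blast
  have "schwartz_seminorm N bs (wv2 i k) \<le> (A * B) / wt2 N (ireal k)" for k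
  proof (rule schwartz_seminorm_le)
    fix x :: "real \<times> real"
    have "partial_derivs bs (wv2 i k) = tensor (D (fst k) ?m) (E (snd k) ?n)"
      unfolding wavelet2_eq_tensor D(2)[symmetric] E(2)[symmetric]
      by (rule partial_derivs_tensor[OF D(1) E(1) bs])
    moreover have "(1 + norm x) ^ N * norm (tensor (D (fst k) ?m) (E (snd k) ?n) x)
       \<le> (A / wt N (of_int (fst k))) * (B / wt N (of_int (snd k)))"
      using A(1) by (intro schwartz_tensor_bound A(2) B(2)) (simp add: less_imp_le)
    ultimately show "(1 + norm x) ^ N * norm (partial_derivs bs (wv2 i k) x) \<le> A * B / wt2 N (ireal k)"
      by (simp add: wt2_def ireal_def)
  qed
  thus ?thesis using A(1) B(1) by (intro exI[of _ "A * B"]) auto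
qed

text \<open>The coefficient sequences for which a wavelet series at a fixed scale converges in the
  Schwartz space.\<close>

definition rapid :: "(int \<times> int \<Rightarrow> complex) \<Rightarrow> bool" where
  "rapid a \<longleftrightarrow> (\<forall>N. \<exists>C. \<forall>k. norm (a k) \<le> C * wt2 N (ireal k))"

lemma rapid_bound:
  assumes "rapid a"
  obtains C where "0 \<le> C" "\<And>k. norm (a k) \<le> C * wt2 N (ireal k)"
proof -
  obtain C where C: "\<And>k. norm (a k) \<le> C * wt2 N (ireal k)" using assms unfolding rapid_def by blast
  have "0 \<le> C"
    using order_trans[OF norm_ge_zero C[of 0]] mult_neg_pos[of C "wt2 N (ireal 0)"] by force
  thus thesis using that C by blast
qed

text \<open>The exponent \<open>M\<close> reflects the order of \<open>f\<close> and serves all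
  scales; only the constant \<open>K\<close> depends on the scale.\<close>

lemma tempered_wavelet_bound:
  assumes f: "tempered_distribution f"
  obtains M where "\<And>i. i \<in> scales2 \<Longrightarrow> \<exists>K\<ge>0. \<forall>k. norm (f (wv2 i k)) \<le> K / wt2 M (ireal k)"
proof -
  obtain C M where C: "\<And>\<eta>. schwartz \<eta> \<Longrightarrow> norm (f \<eta>) \<le>
      C * (\<Sum>n\<le>M. \<Sum>bs | set bs \<subseteq> Basis \<and> length bs \<le> M. schwartz_seminorm n bs \<eta>)"
    using f unfolding tempered_distribution_def by blast
  have "\<exists>K\<ge>0. \<forall>k. norm (f (wv2 i k)) \<le> K / wt2 M (ireal k)" if i: "i \<in> scales2" for i
  proof -
    have "\<forall>n. \<forall>bs\<in>{bs. set bs \<subseteq> Basis}. \<exists>K\<ge>0. \<forall>k. schwartz_seminorm n bs (wv2 i k) \<le> K / wt2 n (ireal k)"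
      using seminorm_wavelet2[OF i] by blast
    then obtain K where K0: "\<forall>n. \<forall>bs\<in>{bs. set bs \<subseteq> Basis}. 0 \<le> K n bs \<and>
      (\<forall>k. schwartz_seminorm n bs (wv2 i k) \<le> K n bs / wt2 n (ireal k))"
      unfolding bchoice_iff choice_iff by blast
    have K: "\<And>n bs. set bs \<subseteq> Basis \<Longrightarrow> 0 \<le> K n bs"
      "\<And>n bs k. set bs \<subseteq> Basis \<Longrightarrow> schwartz_seminorm n bs (wv2 i k) \<le> K n bs / wt2 n (ireal k)"
      using K0 by blast+
    let ?K = "\<bar>C\<bar> * (\<Sum>n\<le>M. \<Sum>bs | set bs \<subseteq> Basis \<and> length bs \<le> M. K n bs)"
    have "norm (f (wv2 i k)) \<le> ?K / wt2 M (ireal k)" for k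
    proof -
      let ?S = "\<Sum>n\<le>M. \<Sum>bs | set bs \<subseteq> Basis \<and> length bs \<le> M. schwartz_seminorm n bs (wv2 i k)"
      have "0 \<le> ?S" by (intro sum_nonneg schwartz_seminorm_nonneg schwartz_wavelet2 i) auto
      hence "norm (f (wv2 i k)) \<le> \<bar>C\<bar> * ?S"
        by (intro order_trans[OF C[OF schwartz_wavelet2[OF i]]] mult_right_mono) auto
      also have "\<dots> \<le> \<bar>C\<bar> * (\<Sum>n\<le>M. \<Sum>bs | set bs \<subseteq> Basis \<and> length bs \<le> M. K n bs / wt2 M (ireal k))"
      proof (intro mult_left_mono sum_mono)
        fix n and bs :: "(real \<times> real) list"
        assume "n \<in> {..M}" and bs: "bs \<in> {bs. set bs \<subseteq> Basis \<and> length bs \<le> M}"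
        hence "K n bs / wt2 n (ireal k) \<le> K n bs / wt2 M (ireal k)"
          by (intro divide_left_mono wt2_antimono K) auto
        thus "schwartz_seminorm n bs (wv2 i k) \<le> K n bs / wt2 M (ireal k)"
          using K(2)[of bs n k] bs by auto
      qed auto
      also have "\<dots> = ?K / wt2 M (ireal k)" 
        by (simp only: sum_divide_distrib[symmetric] times_divide_eq_right)
      finally show ?thesis .
    qed
    moreover have "0 \<le> ?K" using K(1) by (intro mult_nonneg_nonneg sum_nonneg) auto
    ultimately show ?thesis by blast
  qed
  thus thesis by (rule that)
qed

text \<open>Rapid decay of the coefficients beats the polynomial growth of each seminorm in
  \<open>k\<close>, so the series meets the summability condition for applying \<open>f\<close>
  termwise.\<close>

lemma tempered_wavelet_series:
  assumes f: "tempered_distribution f" and i: "i \<in> scales2" and a: "rapid a"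
    and F: "\<And>y. ((\<lambda>k. a k * wv2 i k y) has_sum F y) UNIV"
  shows "schwartz F" "((\<lambda>k. a k * f (wv2 i k)) has_sum f F) UNIV"
proof -
  have summ: "(\<lambda>k. schwartz_seminorm N bs (\<lambda>y. a k * wv2 i k y)) summable_on UNIV" if bs: "set bs \<subseteq> Basis" for N bs
  proof -
    \<comment> \<open>Of these orders of decay, \<open>N\<close> cancel the growth of the seminorm
      and the remaining 2 make the sum over \<open>k\<close> converge.\<close>
    obtain A where A: "0 \<le> A" "\<And>k. norm (a k) \<le> A * wt2 (2 + N) (ireal k)" using rapid_bound[OF a] by blast
    obtain B where B: "0 \<le> B" "\<And>k. schwartz_seminorm N bs (wv2 i k) \<le> B / wt2 N (ireal k)"
      using seminorm_wavelet2[OF i bs] by blast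
    show ?thesis
    proof (rule summable_on_comparison_test[OF summable_on_cmult_right[OF summable_on_wt2_0]])
      fix k
      have "schwartz_seminorm N bs (\<lambda>y. a k * wv2 i k y) \<le> norm (a k) * schwartz_seminorm N bs (wv2 i k)"
        by (rule schwartz_seminorm_cmult_le[OF schwartz_wavelet2[OF i] bs])
      also have "\<dots> \<le> (A * wt2 (2 + N) (ireal k)) * (B / wt2 N (ireal k))"
        using A(1) by (intro mult_mono A B schwartz_seminorm_nonneg schwartz_wavelet2 i bs) auto
      also have "\<dots> = (A * B) * wt2 2 (ireal k)" unfolding wt2_add by simp
      finally show "schwartz_seminorm N bs (\<lambda>y. a k * wv2 i k y) \<le> (A * B) * wt2 2 (ireal k)" .
      show "0 \<le> schwartz_seminorm N bs (\<lambda>y. a k * wv2 i k y)"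
        by (intro schwartz_seminorm_nonneg schwartz_cmult schwartz_wavelet2 i bs)
    qed
  qed
  show "schwartz F" "((\<lambda>k. a k * f (wv2 i k)) has_sum f F) UNIV"
    using tempered_distribution_has_sum[OF f schwartz_cmult[OF schwartz_wavelet2[OF i]] summ F]
    by (simp_all add: tempered_distribution_cmult[OF f schwartz_wavelet2[OF i]])
qed

end

lemma borel_measurable_fst' [measurable]: "(fst :: real \<times> real \<Rightarrow> real) \<in> borel_measurable borel"
  and borel_measurable_snd' [measurable]: "(snd :: real \<times> real \<Rightarrow> real) \<in> borel_measurable borel"
  by (intro borel_measurable_continuous_onI continuous_intros)+

lemma nn_integral_count_space_eq_infsum:
  fixes f :: "'a \<Rightarrow> real"
  assumes "\<And>x. 0 \<le> f x" "f summable_on UNIV"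
  shows "(\<integral>\<^sup>+x. ennreal (f x) \<partial>count_space UNIV) = ennreal (\<Sum>\<^sub>\<infinity>x. f x)"
proof -
  have "(\<lambda>x. norm (f x)) summable_on UNIV" using assms by simp
  hence *: "Infinite_Set_Sum.abs_summable_on f UNIV" by (simp only: abs_summable_equivalent)
  show ?thesis
    using nn_integral_conv_infsetsum[OF *] assms(1) infsetsum_infsum[OF *] by simp
qed

lemma norm_infsum_le_nn_integral:
  fixes f :: "'a \<Rightarrow> complex"
  shows "ennreal (norm (\<Sum>\<^sub>\<infinity>x. f x)) \<le> (\<integral>\<^sup>+x. ennreal (norm (f x)) \<partial>count_space UNIV)"
proof (cases "f summable_on UNIV")
  case True
  hence n: "(\<lambda>x. norm (f x)) summable_on UNIV" by (simp add: summable_on_iff_abs_summable_on_complex)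
  thus ?thesis
    by (subst nn_integral_count_space_eq_infsum) (auto intro!: ennreal_leI norm_infsum_bound)
qed (simp add: infsum_not_exists)

lemma infsum_wt2_le: "(\<Sum>\<^sub>\<infinity>k. wt2 2 (x - ireal k)) \<le> 64"
proof -
  have "ennreal (\<Sum>\<^sub>\<infinity>k. wt2 2 (x - ireal k)) \<le> ennreal 64"
    using nn_integral_wt2_sum[of 2 x] nn_integral_count_space_eq_infsum[OF _ summable_on_wt2, of x] by simp
  thus ?thesis by (subst (asm) ennreal_le_iff) auto
qed

section \<open>The function representing a hyperbolic block\<close>

context hyperbolic_wavelets
begin

text \<open>\<open>blockfun f j\<close> is the smooth function representing the block \<open>\<Delta>\<^sub>j f\<close>: the wavelet expansion of the
  kernel \<open>kern2 j (y - x)\<close> in \<open>y\<close>, with \<open>f\<close> applied termwise.\<close>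

definition blockfun :: "((real \<times> real \<Rightarrow> complex) \<Rightarrow> complex) \<Rightarrow> nat \<times> nat \<Rightarrow> real \<times> real \<Rightarrow> complex" where
  "blockfun f j x = (\<Sum>i\<in>near_scales2 j. \<Sum>\<^sub>\<infinity>k. analysis2 j i k x * f (wv2 i k))"

lemma rapid_analysis2:
  assumes i: "i \<in> scales2"
  shows "rapid (\<lambda>k. analysis2 j i k x)"
  unfolding rapid_def
proof
  fix N
  obtain C where C: "0 < C" "\<And>j i k x. i \<in> scales2 \<Longrightarrow> norm (analysis2 j i k x) \<le> C * vol i * wt2 N (sc2 i x - ireal k)"
    using analysis2_bound by blast
  have "norm (analysis2 j i k x) \<le> (C * vol i / wt2 N (sc2 i x)) * wt2 N (ireal k)" for k
  proof -
    have "C * vol i * wt2 N (sc2 i x - ireal k) \<le> C * vol i * (wt2 N (ireal k) / wt2 N (sc2 i x))"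
      using C(1) by (intro mult_left_mono wt2_shift_le) auto
    thus ?thesis using C(2)[OF i, of j k x] by simp
  qed
  thus "\<exists>C. \<forall>k. norm (analysis2 j i k x) \<le> C * wt2 N (ireal k)" by blast
qed

text \<open>For each near scale the expansion coefficients in \<open>k\<close> are rapid, so
  \<open>f\<close> may be applied termwise; finitely many scales are then added.\<close>

lemma kern2_test:
  assumes f: "tempered_distribution f"
  shows "schwartz (\<lambda>y. kern2 j (y - x))" "f (\<lambda>y. kern2 j (y - x)) = blockfun f j x"
proof -
  have 1: "schwartz (pkern2 j i x)" "((\<lambda>k. analysis2 j i k x * f (wv2 i k)) has_sum f (pkern2 j i x)) UNIV"
    if "i \<in> near_scales2 j" for i
    using tempered_wavelet_series[OF f near_scales2_subset[OF that] rapid_analysis2[OF near_scales2_subset[OF that]]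
        has_sum_pkern2[OF near_scales2_subset[OF that]]] by blast+
  have "schwartz (\<lambda>y. \<Sum>i\<in>near_scales2 j. pkern2 j i x y) \<and>
        f (\<lambda>y. \<Sum>i\<in>near_scales2 j. pkern2 j i x y) = (\<Sum>i\<in>near_scales2 j. f (pkern2 j i x))"
    by (rule tempered_distribution_sum[OF f]) (auto intro: 1)
  moreover have "(\<Sum>i\<in>near_scales2 j. f (pkern2 j i x)) = blockfun f j x"
    unfolding blockfun_def by (intro sum.cong refl infsumI[symmetric] 1)
  ultimately show "schwartz (\<lambda>y. kern2 j (y - x))" "f (\<lambda>y. kern2 j (y - x)) = blockfun f j x"
    by (simp_all add: sum_pkern2)
qed

lemma measurable_wblock: "-1 \<le> i \<Longrightarrow> wblock j i k \<in> borel_measurable borel"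
proof -
  assume "-1 \<le> i"
  hence [measurable]: "wv i k \<in> borel_measurable borel" by (rule wavelet_measurable)
  show ?thesis unfolding wblock_def conv_def[abs_def] by measurable
qed

lemma measurable_analysis2:
  assumes "i \<in> scales2"
  shows "analysis2 j i k \<in> borel_measurable borel"
proof -
  have [measurable]: "wblock (fst j) (fst i) (fst k) \<in> borel_measurable borel"
    "wblock (snd j) (snd i) (snd k) \<in> borel_measurable borel"
    using assms by (auto simp: scales2_def intro: measurable_wblock)
  show ?thesis unfolding analysis2_def[abs_def] analysis_def by measurable
qed

text \<open>The function \<open>analysis2 j i k\<close> lives where \<open>sc2 i x\<close> is close
  to \<open>k\<close>, and there \<open>\<eta>\<close> is small when \<open>k\<close> is large.
  Integration against \<open>\<eta>\<close> therefore produces a rapid sequence.\<close>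

lemma analysis2_test_bound:
  assumes i: "i \<in> scales2" and \<eta>: "schwartz \<eta>"
  shows "integrable lborel (\<lambda>x. analysis2 j i k x * \<eta> x)"
    and "\<exists>C. \<forall>k. (LINT x|lborel. norm (analysis2 j i k x * \<eta> x)) \<le> C * wt2 N (ireal k)"
proof -
  have [measurable]: "analysis2 j i k \<in> borel_measurable borel" "\<eta> \<in> borel_measurable borel" for k
    using measurable_analysis2[OF i] schwartz_measurable[OF \<eta>] by auto
  have *: "\<exists>C. \<forall>k x. norm (analysis2 j i k x * \<eta> x) \<le> C * wt2 N (ireal k) * wt2 2 x" for N
  proof -
    obtain C where C: "0 < C" "\<And>j i k x. i \<in> scales2 \<Longrightarrow> norm (analysis2 j i k x) \<le> C * vol i * wt2 N (sc2 i x - ireal k)"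
      using analysis2_bound by blast
    \<comment> \<open>The decay of order \<open>N\<close> is converted into decay in
      \<open>k\<close>; the additional 2 makes the bound integrable in \<open>x\<close>.\<close>
    obtain B where B: "0 \<le> B" "\<And>x. norm (\<eta> x) \<le> B * wt2 (N + 2) x" using schwartz_wt2_bound[OF \<eta>] by blast
    have "norm (analysis2 j i k x * \<eta> x) \<le> (C * vol i * vol i ^ N * B) * wt2 N (ireal k) * wt2 2 x" for k x
    proof -
      have "norm (analysis2 j i k x * \<eta> x) \<le> (C * vol i * wt2 N (sc2 i x - ireal k)) * (B * wt2 (N + 2) x)"
        unfolding norm_mult using C(1) by (intro mult_mono C(2) B i) auto
      also have "\<dots> = (C * vol i * B * wt2 2 x) * (wt2 N (sc2 i x - ireal k) * wt2 N x)"
        by (simp only: wt2_add mult_ac)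
      also have "\<dots> \<le> (C * vol i * B * wt2 2 x) * (wt2 N (ireal k) / wt2 N (sc2 i x) * (vol i ^ N * wt2 N (sc2 i x)))"
        using C(1) B(1) by (intro mult_left_mono mult_mono wt2_shift_le wt2_le_sc2) auto
      also have "\<dots> = (C * vol i * vol i ^ N * B) * wt2 N (ireal k) * wt2 2 x" by simp
      finally show ?thesis .
    qed
    thus ?thesis by blast
  qed
  show "integrable lborel (\<lambda>x. analysis2 j i k x * \<eta> x)"
  proof -
    obtain C where C: "\<And>k x. norm (analysis2 j i k x * \<eta> x) \<le> C * wt2 0 (ireal k) * wt2 2 x" using * by blast
    show ?thesis by (rule integrable_wt2_bound[OF _ C]) measurable
  qed
  obtain C where C: "\<And>k x. norm (analysis2 j i k x * \<eta> x) \<le> C * wt2 N (ireal k) * wt2 2 x" using * by blast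
  have "(LINT x|lborel. norm (analysis2 j i k x * \<eta> x)) \<le> (C * (LINT x|lborel. wt2 2 x)) * wt2 N (ireal k)" for k
  proof -
    have "(LINT x|lborel. norm (analysis2 j i k x * \<eta> x)) \<le> (LINT x|lborel. C * wt2 N (ireal k) * wt2 2 x)"
      by (intro integral_mono C integrable_norm integrable_mult_right integrable_wt2
            integrable_wt2_bound[OF _ C]) measurable
    thus ?thesis by (simp add: mult_ac)
  qed
  thus "\<exists>C. \<forall>k. (LINT x|lborel. norm (analysis2 j i k x * \<eta> x)) \<le> C * wt2 N (ireal k)" by blast
qed

definition conv2 :: "nat \<times> nat \<Rightarrow> (real \<times> real \<Rightarrow> complex) \<Rightarrow> real \<times> real \<Rightarrow> complex" where
  "conv2 j \<eta> y = (LINT x|lborel. kern2 j (y - x) * \<eta> x)"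

lemma fourier_theta2: "fourier (\<lambda>\<xi>. complex_of_real (theta2 \<theta>\<^sub>0 j \<xi>)) z / of_real ((2 * pi) ^ DIM(real \<times> real)) = kern2 j z"
  and integrable_theta2: "integrable lborel (\<lambda>\<xi>. complex_of_real (theta2 \<theta>\<^sub>0 j \<xi>))"
proof -
  let ?t = "\<lambda>j \<xi>. complex_of_real (theta \<theta>\<^sub>0 j \<xi>)"
  have th: "complex_of_real (theta2 \<theta>\<^sub>0 j \<xi>) = ?t (fst j) (fst \<xi>) * ?t (snd j) (snd \<xi>)" for \<xi>
    by (simp add: theta2_def case_prod_unfold)
  show "integrable lborel (\<lambda>\<xi>. complex_of_real (theta2 \<theta>\<^sub>0 j \<xi>))"
    unfolding th by (rule integral_tensor(2)[OF integrable_theta integrable_theta])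
  have e: "cis (- (\<xi> \<bullet> z)) * (?t (fst j) (fst \<xi>) * ?t (snd j) (snd \<xi>)) =
     (cis (- (fst \<xi> \<bullet> fst z)) * ?t (fst j) (fst \<xi>)) * (cis (- (snd \<xi> \<bullet> snd z)) * ?t (snd j) (snd \<xi>))" for \<xi>
  proof -
    have "- (\<xi> \<bullet> z) = - (fst \<xi> \<bullet> fst z) + - (snd \<xi> \<bullet> snd z)" by (simp add: inner_prod_def)
    thus ?thesis by (simp only: cis_mult[symmetric] mult_ac)
  qed
  have "fourier (\<lambda>\<xi>. complex_of_real (theta2 \<theta>\<^sub>0 j \<xi>)) z =
     (LINT \<xi>|lborel. (cis (- (fst \<xi> \<bullet> fst z)) * ?t (fst j) (fst \<xi>)) * (cis (- (snd \<xi> \<bullet> snd z)) * ?t (snd j) (snd \<xi>)))"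
    unfolding fourier_def th by (intro Bochner_Integration.integral_cong refl e)
  also have "\<dots> = fourier (?t (fst j)) (fst z) * fourier (?t (snd j)) (snd z)"
    unfolding fourier_def
    by (rule integral_tensor(1)[OF integrable_cis_mult[OF integrable_theta] integrable_cis_mult[OF integrable_theta]])
  finally have "fourier (\<lambda>\<xi>. complex_of_real (theta2 \<theta>\<^sub>0 j \<xi>)) z = fourier (?t (fst j)) (fst z) * fourier (?t (snd j)) (snd z)" .
  thus "fourier (\<lambda>\<xi>. complex_of_real (theta2 \<theta>\<^sub>0 j \<xi>)) z / of_real ((2 * pi) ^ DIM(real \<times> real)) = kern2 j z"
    by (simp add: kern2_def kern_def power2_eq_square)
qed

text \<open>Transposing the inverse transform, the multiplier and the transform in turn moves all
  three onto the test function, where they amount to convolution with \<open>kern2\<close>.\<close>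

lemma hyp_block_eq:
  assumes "schwartz \<eta>"
  shows "hyp_block \<theta>\<^sub>0 j f \<eta> = f (conv2 j \<eta>)"
proof -
  have "fourier (\<lambda>\<xi>. of_real (theta2 \<theta>\<^sub>0 j \<xi>) * inv_fourier \<eta> \<xi>) = conv2 j \<eta>"
    unfolding conv2_def
    by (intro ext) (simp only: fourier_mult_inv_fourier[OF integrable_theta2 schwartz_integrable[OF assms]] fourier_theta2)
  thus ?thesis by (simp add: hyp_block_def dist_inv_fourier_def dist_mult_def dist_fourier_def)
qed

text \<open>This says that \<open>f\<close> commutes with the integral over \<open>x\<close>. Both
  sides are expanded at each near scale, and both become the series of
  \<open>a k * f (wv2 i k)\<close> with \<open>a k\<close> the integral of
  \<open>analysis2 j i k\<close> against \<open>\<eta>\<close>.\<close>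

lemma conv2_test:
  assumes f: "tempered_distribution f" and \<eta>: "schwartz \<eta>"
  shows "schwartz (conv2 j \<eta>)" "integrable lborel (\<lambda>x. blockfun f j x * \<eta> x)"
    "f (conv2 j \<eta>) = (LINT x|lborel. blockfun f j x * \<eta> x)"
proof -
  have main: "integrable lborel (\<lambda>x. pkern2 j i x y * \<eta> x)"
    "schwartz (\<lambda>y. LINT x|lborel. pkern2 j i x y * \<eta> x)"
    "integrable lborel (\<lambda>x. (\<Sum>\<^sub>\<infinity>k. analysis2 j i k x * f (wv2 i k)) * \<eta> x)"
    "f (\<lambda>y. LINT x|lborel. pkern2 j i x y * \<eta> x) = (LINT x|lborel. (\<Sum>\<^sub>\<infinity>k. analysis2 j i k x * f (wv2 i k)) * \<eta> x)"
    if "i \<in> near_scales2 j" for i y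
  proof -
    have i: "i \<in> scales2" by (rule near_scales2_subset[OF that])
    define a where "a k = (LINT x|lborel. analysis2 j i k x * \<eta> x)" for k
    note int = analysis2_test_bound(1)[OF i \<eta>, of j]
    note bnd = analysis2_test_bound(2)[OF i \<eta>, of j]
    have a: "rapid a"
      unfolding rapid_def
    proof
      fix N
      obtain B where B: "\<And>k. (LINT x|lborel. norm (analysis2 j i k x * \<eta> x)) \<le> B * wt2 N (ireal k)"
        using bnd by blast
      have "norm (a k) \<le> B * wt2 N (ireal k)" for k
        unfolding a_def by (rule order_trans[OF integral_norm_bound B])
      thus "\<exists>C. \<forall>k. norm (a k) \<le> C * wt2 N (ireal k)" by blast
    qed
    \<comment> \<open>The sequence \<open>c\<close> of polynomial growth is kept general because the
      exchange of sum and integral is used twice: with \<open>c k = wv2 i k y\<close>, before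
      \<open>f\<close> is applied, and with \<open>c k = f (wv2 i k)\<close>, after.\<close>
    have ex: "integrable lborel (\<lambda>x. S x * \<eta> x) \<and> ((\<lambda>k. a k * c k) has_sum (LINT x|lborel. S x * \<eta> x)) UNIV"
      if S: "\<And>x. ((\<lambda>k. analysis2 j i k x * c k) has_sum S x) UNIV"
        and c: "\<And>k. norm (c k) \<le> K / wt2 M (ireal k)" for c :: "int \<times> int \<Rightarrow> complex" and S K M
    proof -
      have K: "0 \<le> K / wt2 M (ireal k)" for k by (rule order_trans[OF norm_ge_zero c])
      obtain B where B: "\<And>k. (LINT x|lborel. norm (analysis2 j i k x * \<eta> x)) \<le> B * wt2 (2 + M) (ireal k)"
        using bnd by blast
      have h1: "integrable lborel (\<lambda>x. c k * (analysis2 j i k x * \<eta> x))" for k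
          by (intro integrable_mult_right int)
      have h2: "((\<lambda>k. c k * (analysis2 j i k x * \<eta> x)) has_sum S x * \<eta> x) UNIV" for x
          using has_sum_cmult_left[OF S[of x], of "\<eta> x"] by (simp add: mult_ac)
      have h3: "(\<lambda>k. LINT x|lborel. norm (c k * (analysis2 j i k x * \<eta> x))) summable_on UNIV"
        proof (rule summable_on_comparison_test[OF summable_on_cmult_right[OF summable_on_wt2_0]])
          fix k
          have "(LINT x|lborel. norm (c k * (analysis2 j i k x * \<eta> x))) = norm (c k) * (LINT x|lborel. norm (analysis2 j i k x * \<eta> x))"
            unfolding norm_mult[of "c k"] by (rule integral_mult_right_zero)
          also have "\<dots> \<le> (K / wt2 M (ireal k)) * (B * wt2 (2 + M) (ireal k))"
            by (intro mult_mono c B K) auto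
          also have "\<dots> = (K * B) * wt2 2 (ireal k)" unfolding wt2_add by simp
          finally show "(LINT x|lborel. norm (c k * (analysis2 j i k x * \<eta> x))) \<le> (K * B) * wt2 2 (ireal k)" .
        qed auto
      note integral_has_sum[OF h1 h2 h3]
      thus ?thesis by (simp add: a_def mult.commute)
    qed
    obtain C where C: "0 < C" "\<And>i k x. i \<in> scales2 \<Longrightarrow> norm (wv2 i k x) \<le> C * wt2 0 (sc2 i x - ireal k)"
      using wavelet2_bound by blast
    \<comment> \<open>The wavelets are bounded, so the growth exponent is 0 in this first
      use.\<close>
    have C': "norm (wv2 i k y) \<le> C / wt2 0 (ireal k)" for k y
      using C(2)[OF i, of k y] by (simp add: wt2_def wt_def)
    note p = ex[OF has_sum_pkern2[OF i] C']
    show "integrable lborel (\<lambda>x. pkern2 j i x y * \<eta> x)" using p by blast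
    note series = tempered_wavelet_series[OF f i a, of "\<lambda>y. LINT x|lborel. pkern2 j i x y * \<eta> x"]
    have p': "((\<lambda>k. a k * wv2 i k y) has_sum (LINT x|lborel. pkern2 j i x y * \<eta> x)) UNIV" for y using p by blast
    show "schwartz (\<lambda>y. LINT x|lborel. pkern2 j i x y * \<eta> x)" by (rule series(1)[OF p'])
    obtain M where "\<And>i. i \<in> scales2 \<Longrightarrow> \<exists>K\<ge>0. \<forall>k. norm (f (wv2 i k)) \<le> K / wt2 M (ireal k)"
      using tempered_wavelet_bound[OF f] by blast
    then obtain K where K: "\<And>k. norm (f (wv2 i k)) \<le> K / wt2 M (ireal k)" using i by blast
    have S: "((\<lambda>k. analysis2 j i k x * f (wv2 i k)) has_sum (\<Sum>\<^sub>\<infinity>k. analysis2 j i k x * f (wv2 i k))) UNIV" for x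
      using tempered_wavelet_series(2)[OF f i rapid_analysis2[OF i] has_sum_pkern2[OF i]]
      by (intro has_sum_infsum has_sum_imp_summable)
    note q = ex[OF S K]
    show "integrable lborel (\<lambda>x. (\<Sum>\<^sub>\<infinity>k. analysis2 j i k x * f (wv2 i k)) * \<eta> x)" using q by blast
    show "f (\<lambda>y. LINT x|lborel. pkern2 j i x y * \<eta> x) = (LINT x|lborel. (\<Sum>\<^sub>\<infinity>k. analysis2 j i k x * f (wv2 i k)) * \<eta> x)"
      using has_sum_unique[OF series(2)[OF p']] q by blast
  qed
  have conv: "conv2 j \<eta> = (\<lambda>y. \<Sum>i\<in>near_scales2 j. LINT x|lborel. pkern2 j i x y * \<eta> x)"
  proof
    fix y
    have "conv2 j \<eta> y = (LINT x|lborel. (\<Sum>i\<in>near_scales2 j. pkern2 j i x y * \<eta> x))"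
      unfolding conv2_def sum_pkern2[symmetric] sum_distrib_right ..
    also have "\<dots> = (\<Sum>i\<in>near_scales2 j. LINT x|lborel. pkern2 j i x y * \<eta> x)"
      by (rule Bochner_Integration.integral_sum) (rule main)
    finally show "conv2 j \<eta> y = (\<Sum>i\<in>near_scales2 j. LINT x|lborel. pkern2 j i x y * \<eta> x)" .
  qed
  have *: "schwartz (conv2 j \<eta>) \<and> f (conv2 j \<eta>) = (\<Sum>i\<in>near_scales2 j. f (\<lambda>y. LINT x|lborel. pkern2 j i x y * \<eta> x))"
    unfolding conv by (rule tempered_distribution_sum[OF f]) (auto intro: main)
  thus "schwartz (conv2 j \<eta>)" by blast
  have G: "(\<lambda>x. blockfun f j x * \<eta> x) = (\<lambda>x. \<Sum>i\<in>near_scales2 j. (\<Sum>\<^sub>\<infinity>k. analysis2 j i k x * f (wv2 i k)) * \<eta> x)"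
    by (simp add: blockfun_def sum_distrib_right)
  show "integrable lborel (\<lambda>x. blockfun f j x * \<eta> x)"
    unfolding G by (intro Bochner_Integration.integrable_sum main)
  have "f (conv2 j \<eta>) = (\<Sum>i\<in>near_scales2 j. LINT x|lborel. (\<Sum>\<^sub>\<infinity>k. analysis2 j i k x * f (wv2 i k)) * \<eta> x)"
    using * main(4) by simp
  also have "\<dots> = (LINT x|lborel. blockfun f j x * \<eta> x)"
    unfolding G by (rule Bochner_Integration.integral_sum[symmetric]) (rule main)
  finally show "f (conv2 j \<eta>) = (LINT x|lborel. blockfun f j x * \<eta> x)" .
qed

text \<open>Polynomial growth with constants depending on \<open>f\<close> and \<open>j\<close>. It
  is a qualitative fact, used only to know that certain weighted means are finite.\<close>

lemma blockfun_growth: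
  assumes f: "tempered_distribution f"
  shows "\<exists>K M. 0 \<le> K \<and> (\<forall>x. norm (blockfun f j x) \<le> K / wt2 M x)"
proof -
  obtain M where M: "\<And>i. i \<in> scales2 \<Longrightarrow> \<exists>K\<ge>0. \<forall>k. norm (f (wv2 i k)) \<le> K / wt2 M (ireal k)"
    using tempered_wavelet_bound[OF f] by blast
  \<comment> \<open>The decay of order \<open>M\<close> compensates the growth of \<open>f\<close>
    along the wavelets, and the remaining 2 sums over \<open>k\<close>.\<close>
  obtain C where C: "0 < C" "\<And>j i k x. i \<in> scales2 \<Longrightarrow> norm (analysis2 j i k x) \<le> C * vol i * wt2 (M + 2) (sc2 i x - ireal k)"
    using analysis2_bound by blast
  have "\<exists>B\<ge>0. \<forall>x. norm (\<Sum>\<^sub>\<infinity>k. analysis2 j i k x * f (wv2 i k)) \<le> B / wt2 M x" if "i \<in> near_scales2 j" for i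
  proof -
    have i: "i \<in> scales2" by (rule near_scales2_subset[OF that])
    obtain K where K: "0 \<le> K" "\<And>k. norm (f (wv2 i k)) \<le> K / wt2 M (ireal k)" using M[OF i] by blast
    let ?B = "64 * (C * vol i * K * vol i ^ M)"
    have "norm (\<Sum>\<^sub>\<infinity>k. analysis2 j i k x * f (wv2 i k)) \<le> ?B / wt2 M x" for x
    proof -
      let ?D = "C * vol i * K * (vol i ^ M / wt2 M x)"
      have D: "0 \<le> ?D" using C(1) K(1) by simp
      have pt: "norm (analysis2 j i k x * f (wv2 i k)) \<le> ?D * wt2 2 (sc2 i x - ireal k)" for k
      proof -
        have "wt2 M (sc2 i x - ireal k) / wt2 M (ireal k) \<le> 1 / wt2 M (sc2 i x)"
          using wt2_shift_le[of M "sc2 i x" "ireal k"] by (simp add: divide_simps mult_ac)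
        also have "\<dots> \<le> vol i ^ M / wt2 M x"
          using wt2_le_sc2[of M x i] by (simp add: divide_simps mult_ac)
        finally have w: "wt2 M (sc2 i x - ireal k) / wt2 M (ireal k) \<le> vol i ^ M / wt2 M x" .
        have "norm (analysis2 j i k x * f (wv2 i k)) \<le> (C * vol i * wt2 (M + 2) (sc2 i x - ireal k)) * (K / wt2 M (ireal k))"
          unfolding norm_mult using C(1) by (intro mult_mono C(2) K i) auto
        also have "\<dots> = (C * vol i * K * wt2 2 (sc2 i x - ireal k)) * (wt2 M (sc2 i x - ireal k) / wt2 M (ireal k))"
          unfolding wt2_add by (simp add: mult_ac)
        also have "\<dots> \<le> (C * vol i * K * wt2 2 (sc2 i x - ireal k)) * (vol i ^ M / wt2 M x)"
          using C(1) K(1) by (intro mult_left_mono w) auto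
        finally show ?thesis by (simp only: mult_ac)
      qed
      have S: "(\<lambda>k. ?D * wt2 2 (sc2 i x - ireal k)) summable_on UNIV"
        by (intro summable_on_cmult_right summable_on_wt2)
      have "norm (\<Sum>\<^sub>\<infinity>k. analysis2 j i k x * f (wv2 i k)) \<le> (\<Sum>\<^sub>\<infinity>k. ?D * wt2 2 (sc2 i x - ireal k))"
      proof (rule norm_infsum_le[OF has_sum_infsum has_sum_infsum[OF S] pt])
        show "(\<lambda>k. analysis2 j i k x * f (wv2 i k)) summable_on UNIV"
          by (rule abs_summable_summable[OF summable_on_comparison_test[OF S pt]]) auto
      qed
      also have "\<dots> = ?D * (\<Sum>\<^sub>\<infinity>k. wt2 2 (sc2 i x - ireal k))" by (rule infsum_cmult_right')
      also have "\<dots> \<le> ?D * 64" by (intro mult_left_mono infsum_wt2_le D)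
      finally show ?thesis by (simp add: mult_ac)
    qed
    moreover have "0 \<le> ?B" using C(1) K(1) by simp
    ultimately show ?thesis by blast
  qed
  then obtain B where B: "\<And>i. i \<in> near_scales2 j \<Longrightarrow> 0 \<le> B i"
    "\<And>i x. i \<in> near_scales2 j \<Longrightarrow> norm (\<Sum>\<^sub>\<infinity>k. analysis2 j i k x * f (wv2 i k)) \<le> B i / wt2 M x" by metis
  have "norm (blockfun f j x) \<le> (\<Sum>i\<in>near_scales2 j. B i) / wt2 M x" for x
    unfolding blockfun_def sum_divide_distrib by (intro order_trans[OF norm_sum] sum_mono B)
  moreover have "0 \<le> (\<Sum>i\<in>near_scales2 j. B i)" by (intro sum_nonneg B)
  ultimately show ?thesis by blast
qed

end

section \<open>Uniqueness of the representing function\<close>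

text \<open>Open boxes are stable under intersection and generate the Borel sets. The sets over
  which \<open>w\<close> integrates to 0 are closed under complements, thanks to
  \<open>zero\<close>, and under countable disjoint unions, so they are all the Borel sets.\<close>

lemma AE_zero_of_box_integrals:
  fixes w :: "real \<times> real \<Rightarrow> real"
  assumes int: "integrable lborel w" and zero: "(LINT x|lborel. w x) = 0"
    and box: "\<And>a b. (LINT x|lborel. indicator (box a b) x * w x) = 0"
  shows "AE x in lborel. w x = 0"
proof -
  let ?G = "range (\<lambda>(a, b). box a b :: (real \<times> real) set)"
  have sets: "sets (borel :: (real \<times> real) measure) = sigma_sets UNIV ?G"
    by (subst borel_eq_box) auto
  have "(LINT x|lborel. indicator A x * w x) = 0" if A: "A \<in> sets borel" for A
  proof -
    have int_A: "integrable lborel (\<lambda>x. indicator A x * w x)" if "A \<in> sigma_sets UNIV ?G" for A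
      using integrable_mult_indicator[OF _ int, of A] that by (simp add: sets)
    have stable: "Int_stable ?G" by (auto simp: Int_stable_def box_Int_box)
    have "?G \<subseteq> Pow UNIV" by simp
    from stable this A[unfolded sets] show ?thesis
    proof (induction rule: sigma_sets_induct_disjoint)
      case (basic A)
      thus ?case using box by auto
    next
      case (compl A)
      have "(LINT x|lborel. indicator (UNIV - A) x * w x) = (LINT x|lborel. w x - indicator A x * w x)"
        by (intro Bochner_Integration.integral_cong refl) (auto simp: indicator_def)
      also have "\<dots> = 0" using compl int_A int by (simp add: zero)
      finally show ?case .
    next
      case (union A)
      have "(LINT x:(\<Union>n. A n)|lborel. w x) = (\<Sum>n. (LINT x:A n|lborel. w x))"
      proof (rule lebesgue_integral_countable_add)
        show "A i \<in> sets lborel" for i using union by (auto simp: sets)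
        show "A i \<inter> A j = {}" if "i \<noteq> j" for i j using union that by (auto simp: disjoint_family_on_def)
        have "(\<Union>n. A n) \<in> sigma_sets UNIV ?G" using union by (auto intro: sigma_sets.Union)
        thus "set_integrable lborel (\<Union>n. A n) w"
          unfolding set_integrable_def using int_A by simp
      qed
      also have "\<dots> = (\<Sum>n. 0)" using union by (simp add: set_lebesgue_integral_def)
      finally show ?case by (simp add: set_lebesgue_integral_def)
    qed simp
  qed
  hence "AE x in lborel. w x = (\<lambda>_. 0) x"
    using int by (intro density_unique_real) (auto simp: set_lebesgue_integral_def)
  thus ?thesis by simp
qed

section \<open>Schwartz test functions approximating boxes\<close>

context littlewood_paley
begin

text \<open>Differences of rescaled steps are Schwartz functions that approximate indicators of intervals.\<close>

definition step :: "real \<Rightarrow> real" where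
  "step x = (LBINT y=ereal 0..ereal x. \<theta>\<^sub>0 y)"

lemma theta0_nonneg: "0 \<le> \<theta>\<^sub>0 x"
  using generator unfolding littlewood_paley_generator_def by auto

lemma theta0_continuous: "continuous_on A \<theta>\<^sub>0"
  using generator schwartz_continuous unfolding littlewood_paley_generator_def by blast

lemma step_deriv: "(step has_real_derivative \<theta>\<^sub>0 x) (at x)"
proof -
  let ?a = "- \<bar>x\<bar> - 1" and ?b = "\<bar>x\<bar> + 1"
  have "(step has_vector_derivative \<theta>\<^sub>0 x) (at x within {?a..?b})"
    unfolding step_def[abs_def]
    by (rule interval_integral_FTC2) (auto intro: theta0_continuous)
  hence "(step has_vector_derivative \<theta>\<^sub>0 x) (at x)"
    by (subst (asm) at_within_Icc_at) auto
  thus ?thesis by (simp add: has_real_derivative_iff_has_vector_derivative)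
qed

lemma step_mono: "x \<le> y \<Longrightarrow> step x \<le> step y"
  by (rule DERIV_nonneg_imp_nondecreasing) (auto intro: step_deriv theta0_nonneg)

lemma step_const_above:
  assumes "2 \<le> x"
  shows "step x = step 2"
proof (cases "x = 2")
  case False
  show ?thesis
  proof (rule DERIV_isconst2[of 2 x step x])
    show "continuous_on {2..x} step"
      by (intro continuous_at_imp_continuous_on ballI) (rule DERIV_isCont[OF step_deriv])
    show "(step has_real_derivative 0) (at t)" if "2 < t" "t < x" for t
      using step_deriv[of t] theta0_eq_0[of t] that by simp
  qed (use assms False in auto)
qed simp

lemma step_const_below:
  assumes "x \<le> - 2"
  shows "step x = step (- 2)"
proof (cases "x = - 2")
  case False
  show ?thesis
  proof (rule DERIV_isconst2[of x "- 2" step "- 2", symmetric])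
    show "continuous_on {x..- 2} step"
      by (intro continuous_at_imp_continuous_on ballI) (rule DERIV_isCont[OF step_deriv])
    show "(step has_real_derivative 0) (at t)" if "x < t" "t < - 2" for t
      using step_deriv[of t] theta0_eq_0[of t] that by simp
  qed (use assms False in auto)
qed simp

text \<open>The total integral of the generator, that is, the height of the rescaled steps.\<close>

definition jump :: real where "jump = step 2 - step (- 2)"

lemma jump_pos: "0 < jump"
proof -
  have "step (- 1) < step 1"
  proof (rule DERIV_pos_imp_increasing[of "- 1" 1 step])
    fix x :: real assume "- 1 \<le> x" "x \<le> 1"
    hence "\<theta>\<^sub>0 x = 1" by (intro theta0_eq_1) auto
    thus "\<exists>y. (step has_real_derivative y) (at x) \<and> 0 < y" using step_deriv[of x] by auto
  qed simp
  thus ?thesis using step_mono[of 1 2] step_mono[of "- 2" "- 1"] by (simp add: jump_def)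
qed

lemma step_bounds: "step (- 2) \<le> step x" "step x \<le> step 2"
proof -
  show "step (- 2) \<le> step x"
    using step_mono[of "- 2" x] step_const_below[of x] by (cases "x \<le> - 2") auto
  show "step x \<le> step 2"
    using step_mono[of x 2] step_const_above[of x] by (cases "2 \<le> x") auto
qed

definition bump :: "nat \<Rightarrow> real \<Rightarrow> real \<Rightarrow> real \<Rightarrow> real" where
  "bump n a b x = step (real (Suc n) * (x - a)) - step (real (Suc n) * (x - b))"

lemma abs_bump_le: "\<bar>bump n a b x\<bar> \<le> jump"
  using step_bounds[of "real (Suc n) * (x - a)"] step_bounds[of "real (Suc n) * (x - b)"]
  by (simp add: bump_def jump_def abs_le_iff)

lemma bump_eq_0:
  assumes "\<bar>a\<bar> \<le> R" "\<bar>b\<bar> \<le> R" "R + 2 \<le> \<bar>x\<bar>"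
  shows "bump n a b x = 0"
proof (cases "0 \<le> x")
  case True
  have "2 \<le> real (Suc n) * (x - c)" if "\<bar>c\<bar> \<le> R" for c
    using mult_mono[of 1 "real (Suc n)" 2 "x - c"] that assms(3) True by simp
  from step_const_above[OF this[OF assms(1)]] step_const_above[OF this[OF assms(2)]]
  show ?thesis by (simp only: bump_def)
next
  case False
  have "real (Suc n) * (x - c) \<le> - 2" if "\<bar>c\<bar> \<le> R" for c
    using mult_mono[of 1 "real (Suc n)" 2 "c - x"] that assms(3) False by (simp add: algebra_simps)
  from step_const_below[OF this[OF assms(1)]] step_const_below[OF this[OF assms(2)]]
  show ?thesis by (simp only: bump_def)
qed

lemma bump_tendsto:
  assumes "a < b" "x \<noteq> a" "x \<noteq> b"
  shows "(\<lambda>n. bump n a b x) \<longlonglongrightarrow> jump * indicator {a<..<b} x"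
proof -
  have step_lim: "(\<lambda>n. step (real (Suc n) * (x - c))) \<longlonglongrightarrow> (if c < x then step 2 else step (- 2))" if "x \<noteq> c" for c
  proof (rule tendsto_eventually)
    obtain m :: nat where m: "2 / \<bar>x - c\<bar> \<le> real m" using real_arch_simple by blast
    have "2 \<le> real (Suc n) * \<bar>x - c\<bar>" if "m \<le> n" for n
    proof -
      have "2 / \<bar>x - c\<bar> \<le> real (Suc n)" using m that by linarith
      thus ?thesis using \<open>x \<noteq> c\<close> by (simp add: pos_divide_le_eq)
    qed
    hence "\<forall>\<^sub>F n in sequentially. 2 \<le> real (Suc n) * \<bar>x - c\<bar>"
      unfolding eventually_sequentially by blast
    thus "\<forall>\<^sub>F n in sequentially. step (real (Suc n) * (x - c)) = (if c < x then step 2 else step (- 2))"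
    proof eventually_elim
      case (elim n)
      show ?case
      proof (cases "c < x")
        case True
        thus ?thesis using elim step_const_above[of "real (Suc n) * (x - c)"] by simp
      next
        case False
        hence "x - c = - \<bar>x - c\<bar>" by simp
        hence "real (Suc n) * (x - c) = - (real (Suc n) * \<bar>x - c\<bar>)"
          by (metis mult_minus_right)
        hence "real (Suc n) * (x - c) \<le> - 2" using elim by linarith
        thus ?thesis using False step_const_below[of "real (Suc n) * (x - c)"] by simp
      qed
    qed
  qed
  have "(\<lambda>n. bump n a b x) \<longlonglongrightarrow> (if a < x then step 2 else step (- 2)) - (if b < x then step 2 else step (- 2))"
    unfolding bump_def by (intro tendsto_diff step_lim assms)
  also have "(if a < x then step 2 else step (- 2)) - (if b < x then step 2 else step (- 2)) = jump * indicator {a<..<b} x"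
    using assms by (auto simp: jump_def indicator_def)
  finally show ?thesis .
qed

text \<open>The bump is not itself a dilate of the generator, but its derivative is a difference of
  two such dilates. The derivative sequence is thus that difference shifted by one index, while
  decay at index 0 follows from bounded support.\<close>

lemma ex_bump_seq: "\<exists>D. schwartz_seq D \<and> D 0 = (\<lambda>x. complex_of_real (bump n a b x))"
proof -
  let ?n = "real (Suc n)"
  obtain T where T: "schwartz_seq T" "T 0 = (\<lambda>\<xi>. complex_of_real (\<theta>\<^sub>0 \<xi>))"
    using ex_theta0_seq[of 0] by auto
  define A where "A c k x = ?n ^ k *\<^sub>R T k (?n * x - ?n * c)" for c k x
  have A: "schwartz_seq (A c)" for c unfolding A_def by (rule schwartz_seq_affine[OF T(1)]) simp
  define E where "E k = (if k = 0 then (\<lambda>x. complex_of_real (bump n a b x))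
      else (\<lambda>x. ?n *\<^sub>R (A a (k - 1) x - A b (k - 1) x)))" for k
  have AS: "schwartz_seq (\<lambda>k x. ?n *\<^sub>R (A a k x - A b k x))"
    by (rule schwartz_seq_bounded_linear[OF schwartz_seq_diff[OF A A] bounded_linear_scaleR_right])
  have "schwartz_seq E"
  proof (rule schwartz_seqI)
    fix k x
    show "(E k has_vector_derivative E (Suc k) x) (at x)"
    proof (cases k)
      case 0
      have st: "((\<lambda>x. step (?n * (x - c))) has_real_derivative \<theta>\<^sub>0 (?n * (x - c)) * ?n) (at x)" for c
        by (rule DERIV_chain2[OF step_deriv]) (auto intro!: derivative_eq_intros)
      have "((\<lambda>x. bump n a b x) has_real_derivative \<theta>\<^sub>0 (?n * (x - a)) * ?n - \<theta>\<^sub>0 (?n * (x - b)) * ?n) (at x)"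
        unfolding bump_def by (intro DERIV_diff st)
      from has_vector_derivative_of_real[OF this] show ?thesis
        by (simp add: 0 E_def A_def T(2) scaleR_conv_of_real algebra_simps)
    next
      case (Suc l)
      thus ?thesis using schwartz_seq_deriv[OF AS, of l x] by (simp add: E_def)
    qed
  next
    fix k N
    show "\<exists>C. \<forall>x. norm (E k x) \<le> C * wt N x"
    proof (cases k)
      case 0
      define R where "R = max \<bar>a\<bar> \<bar>b\<bar>"
      have "norm (E 0 x) \<le> (jump * (1 + (R + 2)) ^ N) * wt N x" for x
      proof (cases "R + 2 \<le> \<bar>x\<bar>")
        case True
        thus ?thesis using bump_eq_0[of a R b x n] jump_pos by (simp add: E_def R_def)
      next
        case False
        have "1 = (1 + \<bar>x\<bar>) ^ N * wt N x" by (simp add: one_le_poly_wt)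
        also have "\<dots> \<le> (1 + (R + 2)) ^ N * wt N x"
          using False by (intro mult_right_mono power_mono) auto
        finally have "jump * 1 \<le> jump * ((1 + (R + 2)) ^ N * wt N x)"
          using jump_pos by (intro mult_left_mono) auto
        thus ?thesis using abs_bump_le[of n a b x] by (simp add: E_def mult.assoc)
      qed
      thus ?thesis unfolding 0 by blast
    next
      case (Suc l)
      obtain C where "\<And>x. norm (?n *\<^sub>R (A a l x - A b l x)) \<le> C * wt N x"
        using schwartz_seq_bound[OF AS, of l N] by blast
      thus ?thesis using Suc by (auto simp: E_def)
    qed
  qed
  thus ?thesis by (intro exI[of _ E]) (simp add: E_def)
qed

text \<open>A function that annihilates all Schwartz functions annihilates indicators of boxes, as
  limits of products of bumps. Since \<open>h\<close> itself need not be integrable, domination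
  comes from a Schwartz cut-off, and the box criterion is applied to truncations of
  \<open>h\<close>.\<close>

lemma AE_zero_of_test_integrals:
  fixes h :: "real \<times> real \<Rightarrow> complex"
  assumes int: "\<And>\<eta>. schwartz \<eta> \<Longrightarrow> integrable lborel (\<lambda>x. h x * \<eta> x)"
    and zero: "\<And>\<eta>. schwartz \<eta> \<Longrightarrow> (LINT x|lborel. h x * \<eta> x) = 0"
    and [measurable]: "h \<in> borel_measurable borel"
  shows "AE x in lborel. h x = 0"
proof -
  have box_int: "integrable lborel (\<lambda>x. indicator (box a b) x *\<^sub>R h x)" and
    box_zero: "(LINT x|lborel. indicator (box a b) x *\<^sub>R h x) = 0" for a b :: "real \<times> real"
  proof -
    \<comment> \<open>The margin 2 accommodates the bumps, whose support may exceed the box by the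
      radius 2 of the support of the generator.\<close>
    obtain R :: nat where R: "max (max \<bar>fst a\<bar> \<bar>fst b\<bar>) (max \<bar>snd a\<bar> \<bar>snd b\<bar>) + 2 \<le> 2 ^ R"
      using real_arch_pow[of 2] by (metis less_imp_le one_less_numeral_iff semiring_norm(76))
    have R1: "max \<bar>fst a\<bar> \<bar>fst b\<bar> + 2 \<le> 2 ^ R" and R2: "max \<bar>snd a\<bar> \<bar>snd b\<bar> + 2 \<le> 2 ^ R"
      by (rule order_trans[OF _ R], simp)+
    \<comment> \<open>This Schwartz function equals 1 on a square containing the supports of all the
      bumps, so an integrable multiple of \<open>norm (h x * K x)\<close> dominates.\<close>
    define K where "K x = complex_of_real (\<theta>\<^sub>0 (fst x / 2 ^ R)) * complex_of_real (\<theta>\<^sub>0 (snd x / 2 ^ R))" for x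
    obtain D where D: "schwartz_seq D" "D 0 = (\<lambda>\<xi>. complex_of_real (\<theta>\<^sub>0 (\<xi> / 2 ^ R)))"
      using ex_theta0_seq by blast
    have KS: "schwartz K"
      using schwartz_tensor[OF D(1) D(1)] by (simp add: D(2) K_def[abs_def] tensor_def[abs_def])
    have K1: "K x = 1" if "\<bar>fst x\<bar> \<le> 2 ^ R" "\<bar>snd x\<bar> \<le> 2 ^ R" for x
      using that by (simp add: K_def theta0_eq_1)
    have hK: "integrable lborel (\<lambda>x. norm (h x * K x))" by (intro integrable_norm int KS)
    show "integrable lborel (\<lambda>x. indicator (box a b) x *\<^sub>R h x)"
    proof (rule Bochner_Integration.integrable_bound[OF hK])
      show "AE x in lborel. norm (indicator (box a b) x *\<^sub>R h x) \<le> norm (norm (h x * K x))"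
      proof (intro AE_I2)
        fix x
        show "norm (indicator (box a b) x *\<^sub>R h x) \<le> norm (norm (h x * K x))"
        proof (cases "x \<in> box a b")
          case True
          hence "fst a < fst x" "fst x < fst b" "snd a < snd x" "snd x < snd b"
            by (auto simp: box_prod box_real mem_Times_iff)
          hence "\<bar>fst x\<bar> \<le> max \<bar>fst a\<bar> \<bar>fst b\<bar>" "\<bar>snd x\<bar> \<le> max \<bar>snd a\<bar> \<bar>snd b\<bar>" by linarith+
          hence "\<bar>fst x\<bar> \<le> 2 ^ R" "\<bar>snd x\<bar> \<le> 2 ^ R" using R1 R2 by linarith+
          thus ?thesis using True by (simp add: K1)
        qed simp
      qed
    qed measurable
    show "(LINT x|lborel. indicator (box a b) x *\<^sub>R h x) = 0"
    proof (cases "fst a < fst b \<and> snd a < snd b")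
      case False
      hence "box a b = {}" by (auto simp: box_prod box_real)
      thus ?thesis by simp
    next
      case True
      define \<eta> where "\<eta> n x = complex_of_real (bump n (fst a) (fst b) (fst x)) * complex_of_real (bump n (snd a) (snd b) (snd x))" for n x
      have \<eta>: "schwartz (\<eta> n)" for n
      proof -
        obtain D where D: "schwartz_seq D" "D 0 = (\<lambda>x. complex_of_real (bump n (fst a) (fst b) x))"
          using ex_bump_seq by blast
        obtain E where E: "schwartz_seq E" "E 0 = (\<lambda>x. complex_of_real (bump n (snd a) (snd b) x))"
          using ex_bump_seq by blast
        show ?thesis
          using schwartz_tensor[OF D(1) E(1)] by (simp add: D(2) E(2) \<eta>_def[abs_def] tensor_def[abs_def])
      qed
      have [measurable]: "\<eta> n \<in> borel_measurable borel" for n by (rule schwartz_measurable[OF \<eta>])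
      have "(\<lambda>n. LINT x|lborel. h x * \<eta> n x) \<longlonglongrightarrow> (LINT x|lborel. of_real (jump * jump) * (indicator (box a b) x *\<^sub>R h x))"
      proof (rule integral_dominated_convergence[where w = "\<lambda>x. (jump * jump) * norm (h x * K x)"])
        show "integrable lborel (\<lambda>x. (jump * jump) * norm (h x * K x))"
          by (intro integrable_mult_right hK)
        \<comment> \<open>Convergence of the bumps is known only off the endpoints of the two
          intervals; the exceptional set is a union of four lines and is null.\<close>
        have ne: "AE x in (lborel :: (real \<times> real) measure). fst x \<noteq> c \<and> snd x \<noteq> c'" for c c'
        proof -
          have *: "AE x in (lborel :: (real \<times> real) measure). fst x \<noteq> c" for c
          proof -
            have "{x \<in> space lborel. \<not> fst x \<noteq> c} = {c} \<times> (UNIV :: real set)" by auto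
            moreover have "emeasure (lborel :: (real \<times> real) measure) ({c} \<times> UNIV) = 0"
              by (subst lborel_prod[symmetric], subst lborel.emeasure_pair_measure_Times) auto
            ultimately show ?thesis by (intro AE_I[of _ _ "{c} \<times> UNIV"]) (auto simp: borel_Times)
          qed
          have **: "AE x in (lborel :: (real \<times> real) measure). snd x \<noteq> c" for c
          proof -
            have "{x \<in> space lborel. \<not> snd x \<noteq> c} = (UNIV :: real set) \<times> {c}" by auto
            moreover have "emeasure (lborel :: (real \<times> real) measure) (UNIV \<times> {c}) = 0"
              by (subst lborel_prod[symmetric], subst lborel.emeasure_pair_measure_Times) auto
            ultimately show ?thesis by (intro AE_I[of _ _ "UNIV \<times> {c}"]) (auto simp: borel_Times)
          qed
          from *[of c] **[of c'] show ?thesis by eventually_elim simp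
        qed
        from ne[of "fst a" "snd a"] ne[of "fst b" "snd b"]
        show "AE x in lborel. (\<lambda>n. h x * \<eta> n x) \<longlonglongrightarrow> of_real (jump * jump) * (indicator (box a b) x *\<^sub>R h x)"
        proof eventually_elim
          case (elim x)
          have "(\<lambda>n. h x * \<eta> n x) \<longlonglongrightarrow> h x * (of_real (jump * indicator {fst a<..<fst b} (fst x)) * of_real (jump * indicator {snd a<..<snd b} (snd x)))"
            unfolding \<eta>_def using True elim by (intro tendsto_intros bump_tendsto) auto
          also have "h x * (of_real (jump * indicator {fst a<..<fst b} (fst x)) * of_real (jump * indicator {snd a<..<snd b} (snd x)))
             = of_real (jump * jump) * (indicator (box a b) x *\<^sub>R h x)"
            by (auto simp: indicator_def box_prod box_real mem_Times_iff)
          finally show ?case .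
        qed
        show "AE x in lborel. norm (h x * \<eta> n x) \<le> (jump * jump) * norm (h x * K x)" for n
        proof (intro AE_I2)
          fix x
          have b: "\<bar>bump n (fst a) (fst b) (fst x)\<bar> * \<bar>bump n (snd a) (snd b) (snd x)\<bar> \<le> jump * jump"
            using jump_pos by (intro mult_mono abs_bump_le) auto
          show "norm (h x * \<eta> n x) \<le> (jump * jump) * norm (h x * K x)"
          proof (cases "\<bar>fst x\<bar> \<le> 2 ^ R \<and> \<bar>snd x\<bar> \<le> 2 ^ R")
            case True
            thus ?thesis using mult_right_mono[OF b, of "norm (h x)"]
              by (simp add: K1 \<eta>_def norm_mult mult_ac)
          next
            case False
            then consider "2 ^ R < \<bar>fst x\<bar>" | "2 ^ R < \<bar>snd x\<bar>" by linarith
            hence "\<eta> n x = 0"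
            proof cases
              case 1
              have "bump n (fst a) (fst b) (fst x) = 0"
                by (rule bump_eq_0[of _ "max \<bar>fst a\<bar> \<bar>fst b\<bar>"])
                  (use order_trans[OF R1 less_imp_le[OF 1]] in simp_all)
              thus ?thesis by (simp add: \<eta>_def)
            next
              case 2
              have "bump n (snd a) (snd b) (snd x) = 0"
                by (rule bump_eq_0[of _ "max \<bar>snd a\<bar> \<bar>snd b\<bar>"])
                  (use order_trans[OF R2 less_imp_le[OF 2]] in simp_all)
              thus ?thesis by (simp add: \<eta>_def)
            qed
            thus ?thesis using jump_pos by simp
          qed
        qed
      qed measurable
      hence "(LINT x|lborel. of_real (jump * jump) * (indicator (box a b) x *\<^sub>R h x)) = 0"
        unfolding zero[OF \<eta>] by (simp only: tendsto_const_iff[OF sequentially_bot])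
      hence "complex_of_real (jump * jump) * (LINT x|lborel. indicator (box a b) x *\<^sub>R h x) = 0"
        by (simp only: integral_mult_right_zero)
      thus ?thesis using jump_pos by (simp del: of_real_mult)
    qed
  qed
  \<comment> \<open>The criterion needs a globally integrable function, so \<open>h\<close> is
    truncated to growing boxes; a countable union of null sets finishes the argument.\<close>
  have "AE x in lborel. x \<in> box (- (real n, real n)) (real n, real n) \<longrightarrow> h x = 0" for n :: nat
  proof -
    let ?B = "box (- (real n, real n)) (real n, real n)"
    define w where "w x = indicator ?B x *\<^sub>R h x" for x
    have wi: "integrable lborel w" unfolding w_def by (rule box_int)
    have wz: "(LINT x|lborel. w x) = 0" unfolding w_def by (rule box_zero)
    have wb: "integrable lborel (\<lambda>x. indicator (box a b) x *\<^sub>R w x)"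
         "(LINT x|lborel. indicator (box a b) x *\<^sub>R w x) = 0" for a b
    proof -
      obtain c d where cd: "box a b \<inter> ?B = box c d" using box_Int_box by blast
      have "indicator (box a b) x *\<^sub>R w x = indicator (box c d) x *\<^sub>R h x" for x
        unfolding w_def cd[symmetric] by (auto simp: indicator_def)
      thus "integrable lborel (\<lambda>x. indicator (box a b) x *\<^sub>R w x)"
         "(LINT x|lborel. indicator (box a b) x *\<^sub>R w x) = 0"
        using box_int[of c d] box_zero[of c d] by simp_all
    qed
    have "AE x in lborel. Re (w x) = 0"
    proof (rule AE_zero_of_box_integrals)
      show "(LINT x|lborel. indicator (box a b) x * Re (w x)) = 0" for a b
        using integral_Re[OF wb(1)[of a b]] wb(2)[of a b] by simp
    qed (use wi wz in \<open>auto simp: integral_Re\<close>)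
    moreover have "AE x in lborel. Im (w x) = 0"
    proof (rule AE_zero_of_box_integrals)
      show "(LINT x|lborel. indicator (box a b) x * Im (w x)) = 0" for a b
        using integral_Im[OF wb(1)[of a b]] wb(2)[of a b] by simp
    qed (use wi wz in \<open>auto simp: integral_Im\<close>)
    ultimately show ?thesis by eventually_elim (auto simp: w_def complex_eq_iff)
  qed
  hence "AE x in lborel. \<forall>n::nat. x \<in> box (- (real n, real n)) (real n, real n) \<longrightarrow> h x = 0"
    unfolding AE_all_countable by blast
  thus ?thesis
  proof eventually_elim
    case (elim x)
    obtain n :: nat where "max \<bar>fst x\<bar> \<bar>snd x\<bar> < real n" using reals_Archimedean2 by blast
    hence "x \<in> box (- (real n, real n)) (real n, real n)"
      by (auto simp: box_prod box_real mem_Times_iff)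
    thus ?case using elim by blast
  qed
qed

lemma represents_unique:
  fixes u :: "(real \<times> real \<Rightarrow> complex) \<Rightarrow> complex"
  assumes g: "represents g u" and G: "represents G u"
  shows "AE x in lborel. g x = G x"
proof -
  have [measurable]: "g \<in> borel_measurable borel" "G \<in> borel_measurable borel"
    using g G by (auto simp: represents_def)
  have "AE x in lborel. g x - G x = 0"
  proof (rule AE_zero_of_test_integrals)
    fix \<eta> :: "real \<times> real \<Rightarrow> complex" assume "schwartz \<eta>"
    hence *: "integrable lborel (\<lambda>x. g x * \<eta> x)" "u \<eta> = (LINT x|lborel. g x * \<eta> x)"
      "integrable lborel (\<lambda>x. G x * \<eta> x)" "u \<eta> = (LINT x|lborel. G x * \<eta> x)"
      using g G by (auto simp: represents_def)
    show "integrable lborel (\<lambda>x. (g x - G x) * \<eta> x)" using * by (simp add: left_diff_distrib)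
    show "(LINT x|lborel. (g x - G x) * \<eta> x) = 0" using * by (simp add: left_diff_distrib)
  qed measurable
  thus ?thesis by eventually_elim simp
qed

end

section \<open>Reproducing formulas\<close>

lemma borel_measurable_infsum:
  fixes f :: "int \<times> int \<Rightarrow> 'a \<Rightarrow> complex"
  assumes f: "\<And>k. f k \<in> borel_measurable M" and s: "\<And>x. (\<lambda>k. f k x) summable_on UNIV"
  shows "(\<lambda>x. \<Sum>\<^sub>\<infinity>k. f k x) \<in> borel_measurable M"
proof -
  obtain \<nu> :: "nat \<Rightarrow> int \<times> int" where \<nu>: "bij_betw \<nu> UNIV UNIV"
    by (rule enumerate_int_prod)
  have sums: "(\<lambda>n. f (\<nu> n) x) sums (\<Sum>\<^sub>\<infinity>k. f k x)" for x
    using has_sum_infsum[OF s[of x]] has_sum_reindex_bij_betw[OF \<nu>, of "\<lambda>k. f k x"]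
    by (auto intro: has_sum_imp_sums)
  have lim: "(\<lambda>n. \<Sum>i<n. f (\<nu> i) x) \<longlonglongrightarrow> (\<Sum>\<^sub>\<infinity>k. f k x)" for x
    using sums[of x] unfolding sums_def .
  show ?thesis
    by (rule borel_measurable_LIMSEQ_metric[OF _ lim]) (intro borel_measurable_sum f)
qed

context hyperbolic_wavelets
begin

lemma blockfun_summable:
  assumes f: "tempered_distribution f" and i: "i \<in> scales2"
  shows "(\<lambda>k. analysis2 j i k x * f (wv2 i k)) summable_on UNIV"
  using tempered_wavelet_series(2)[OF f i rapid_analysis2[OF i] has_sum_pkern2[OF i]]
  by (rule has_sum_imp_summable)

lemma blockfun_measurable:
  assumes f: "tempered_distribution f"
  shows "blockfun f j \<in> borel_measurable borel"
  unfolding blockfun_def[abs_def]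
proof (intro borel_measurable_sum borel_measurable_infsum)
  fix i k assume "i \<in> near_scales2 j"
  hence i: "i \<in> scales2" by (rule near_scales2_subset)
  show "(\<lambda>x. analysis2 j i k x * f (wv2 i k)) \<in> borel_measurable borel"
    using measurable_analysis2[OF i] by measurable
  show "(\<lambda>k. analysis2 j i k x * f (wv2 i k)) summable_on UNIV" for x
    by (rule blockfun_summable[OF f i])
qed

lemma represents_blockfun:
  assumes f: "tempered_distribution f"
  shows "represents (blockfun f j) (hyp_block \<theta>\<^sub>0 j f)"
  unfolding represents_def
  using blockfun_measurable[OF f] conv2_test[OF f] by (auto simp: hyp_block_eq)

lemma Lp_norm_cong_AE:
  assumes "AE x in lborel. g x = h x" "g \<in> borel_measurable borel" "h \<in> borel_measurable borel"
  shows "Lp_norm p g = Lp_norm p h"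
proof -
  have "esssup lborel (\<lambda>x. ennreal (norm (g x))) = esssup lborel (\<lambda>x. ennreal (norm (h x)))"
    using assms by (intro esssup_AE_cong) auto
  moreover have "(\<integral>\<^sup>+ x. epowr (ennreal (norm (g x))) (enn2real p) \<partial>lborel) = (\<integral>\<^sup>+ x. epowr (ennreal (norm (h x))) (enn2real p) \<partial>lborel)"
    using assms(1) by (intro nn_integral_cong_AE) auto
  ultimately show ?thesis by (simp add: Lp_norm_def)
qed

text \<open>All representing functions agree almost everywhere, so the infimum runs over a single
  value.\<close>

lemma dist_Lp_norm_hyp_block:
  assumes f: "tempered_distribution f"
  shows "dist_Lp_norm p (hyp_block \<theta>\<^sub>0 j f) = Lp_norm p (blockfun f j)"
proof -
  have "{Lp_norm p g |g. represents g (hyp_block \<theta>\<^sub>0 j f)} = {Lp_norm p (blockfun f j)}"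
  proof (intro equalityI subsetI)
    fix v assume "v \<in> {Lp_norm p g |g. represents g (hyp_block \<theta>\<^sub>0 j f)}"
    then obtain g where g: "v = Lp_norm p g" "represents g (hyp_block \<theta>\<^sub>0 j f)" by blast
    have "Lp_norm p g = Lp_norm p (blockfun f j)"
      using g(2) blockfun_measurable[OF f]
      by (intro Lp_norm_cong_AE represents_unique[OF g(2) represents_blockfun[OF f]]) (auto simp: represents_def)
    thus "v \<in> {Lp_norm p (blockfun f j)}" by (simp add: g)
  next
    fix v assume "v \<in> {Lp_norm p (blockfun f j)}"
    thus "v \<in> {Lp_norm p g |g. represents g (hyp_block \<theta>\<^sub>0 j f)}"
      using represents_blockfun[OF f, of j] by blast
  qed
  thus ?thesis by (simp add: dist_Lp_norm_def)
qed

section \<open>Reproduction of blocks and of wavelet coefficients\<close>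

definition int2 :: "nat \<times> nat \<Rightarrow> int \<times> int" where
  "int2 j = (int (fst j), int (snd j))"

text \<open>The \<open>Suc\<close> puts the whole support of the j-th multiplier inside the region
  where the cut-off equals 1.\<close>

definition lowpass2 :: "nat \<times> nat \<Rightarrow> real \<times> real \<Rightarrow> complex" where
  "lowpass2 j z = lowpass (Suc (fst j)) (fst z) * lowpass (Suc (snd j)) (snd z)"

text \<open>Stated at scale \<open>j\<close> although the kernel lives at \<open>j + 1\<close>; this
  costs a factor 2 in each coordinate and matches the weights used for the blocks.\<close>

lemma lowpass2_bound:
  obtains C where "0 < C" "\<And>j z. norm (lowpass2 j z) \<le> C * vol (int2 j) * wt2 N (sc2 (int2 j) z)"
proof -
  obtain C where C: "0 < C" "\<And>b z. norm (lowpass b z) \<le> C * 2 ^ b * wt N (2 ^ b * z)"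
    using lowpass_bound by blast
  have 1: "norm (lowpass (Suc j) z) \<le> 2 * C * 2 ^ j * wt N (2 ^ j * z)" for j z
  proof -
    have "wt N (2 ^ Suc j * z) \<le> wt N (2 ^ j * z)"
      using wt_scale[of "1 / 2" N "2 ^ Suc j * z"] by simp
    hence "C * 2 ^ Suc j * wt N (2 ^ Suc j * z) \<le> C * 2 ^ Suc j * wt N (2 ^ j * z)"
      using C(1) by (intro mult_left_mono) auto
    from order_trans[OF C(2) this] show ?thesis by (simp add: mult_ac)
  qed
  have "norm (lowpass2 j z) \<le> (2 * C * 2 ^ fst j * wt N (2 ^ fst j * fst z)) * (2 * C * 2 ^ snd j * wt N (2 ^ snd j * snd z))" for j z
    unfolding lowpass2_def norm_mult using C(1) by (intro mult_mono 1) auto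
  hence "norm (lowpass2 j z) \<le> (2 * C * (2 * C)) * vol (int2 j) * wt2 N (sc2 (int2 j) z)" for j z
    by (simp add: vol_def int2_def wt2_def sc2_def mult_ac)
  moreover have "0 < 2 * C * (2 * C)" using C(1) by simp
  ultimately show thesis using that by blast
qed

lemma schwartz_lowpass2: "schwartz (\<lambda>y. lowpass2 j (y - x))"
proof -
  have sh: "\<exists>D. schwartz_seq D \<and> D 0 = (\<lambda>y. lowpass b (y - c))" for b c
  proof -
    obtain D where D: "schwartz_seq D" "D 0 = lowpass b" using ex_lowpass_seq by blast
    from schwartz_seq_affine[OF D(1), of 1 c] show ?thesis
      by (intro exI[of _ "\<lambda>n y. 1 ^ n *\<^sub>R D n (1 * y - c)"]) (auto simp: D(2))
  qed
  obtain D where D: "schwartz_seq D" "D 0 = (\<lambda>y. lowpass (Suc (fst j)) (y - fst x))" using sh by blast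
  obtain E where E: "schwartz_seq E" "E 0 = (\<lambda>y. lowpass (Suc (snd j)) (y - snd x))" using sh by blast
  have "(\<lambda>y. lowpass2 j (y - x)) = tensor (D 0) (E 0)"
    by (simp add: lowpass2_def tensor_def D(2) E(2) fun_eq_iff)
  thus ?thesis using schwartz_tensor[OF D(1) E(1)] by simp
qed

lemma integrable_kern_shift: "integrable lborel h \<Longrightarrow> integrable lborel (\<lambda>x. kern j (y - x) * h x)"
proof -
  assume h: "integrable lborel h"
  obtain C where C: "\<And>j z. norm (kern j z) \<le> C * 2 ^ j * wt 0 (2 ^ j * z)" using kern_bound by metis
  have [measurable]: "h \<in> borel_measurable borel" using h by auto
  have b: "norm (kern j z) \<le> \<bar>C * 2 ^ j\<bar>" for z using order_trans[OF C[of j z] abs_ge_self] by (simp add: wt_def)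
  show ?thesis
  proof (rule Bochner_Integration.integrable_bound[OF integrable_mult_right[OF integrable_norm[OF h], of "\<bar>C * 2 ^ j\<bar>"]])
    show "AE x in lborel. norm (kern j (y - x) * h x) \<le> norm (\<bar>C * 2 ^ j\<bar> * norm (h x))"
      using mult_right_mono[OF b] by (auto simp: norm_mult)
  qed measurable
qed

lemma conv2_tensor:
  assumes "integrable lborel g" "integrable lborel h"
  shows "conv2 j (\<lambda>x. g (fst x) * h (snd x)) y = conv (kern (fst j)) g (fst y) * conv (kern (snd j)) h (snd y)"
proof -
  have "conv2 j (\<lambda>x. g (fst x) * h (snd x)) y = (LINT x|lborel. (kern (fst j) (fst y - fst x) * g (fst x)) * (kern (snd j) (snd y - snd x) * h (snd x)))"
    unfolding conv2_def kern2_def by (intro Bochner_Integration.integral_cong refl) (simp add: mult_ac)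
  also have "\<dots> = conv (kern (fst j)) g (fst y) * conv (kern (snd j)) h (snd y)"
    unfolding conv_def by (rule integral_tensor(1)) (intro integrable_kern_shift assms)+
  finally show ?thesis .
qed

text \<open>Testing the block against the translated low-pass kernel gives the integral. By
  \<open>conv_kern_lowpass\<close> in each variable this is also \<open>f\<close> applied to the
  translated \<open>kern2\<close>, which is the value of \<open>blockfun\<close> at
  \<open>x\<close>.\<close>

lemma blockfun_reproducing:
  assumes f: "tempered_distribution f"
  shows "blockfun f j x = (LINT y|lborel. blockfun f j y * lowpass2 j (y - x))"
proof -
  have int: "integrable lborel (\<lambda>y. lowpass b (y - c))" for b c
  proof -
    obtain D where D: "schwartz_seq D" "D 0 = lowpass b" using ex_lowpass_seq by blast
    show ?thesis
      using schwartz_seq_integrable[OF schwartz_seq_affine[OF D(1), of 1 c], of 0] by (simp add: D(2))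
  qed
  have "conv2 j (\<lambda>y. lowpass2 j (y - x)) = (\<lambda>y. kern2 j (y - x))"
    using conv2_tensor[OF int int, of j "Suc (fst j)" "fst x" "Suc (snd j)" "snd x"]
    by (auto simp: lowpass2_def kern2_def conv_kern_lowpass)
  thus ?thesis
    using conv2_test(3)[OF f schwartz_lowpass2[of j x], of j] kern2_test(2)[OF f, of j x] by simp
qed

text \<open>A wavelet is the finite sum of its near blocks, and \<open>f\<close> applied to each
  block of the wavelet is the integral of the corresponding block of \<open>f\<close> against the
  wavelet.\<close>

lemma wavelet_reproducing:
  assumes f: "tempered_distribution f" and i: "i \<in> scales2"
  shows "f (wv2 i k) = (\<Sum>j\<in>near_blocks2 i. LINT x|lborel. blockfun f j x * wv2 i k x)"
proof -
  have i': "-1 \<le> fst i" "-1 \<le> snd i" using i by (auto simp: scales2_def)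
  note S = schwartz_wavelet2[OF i, of k]
  have "conv2 j (wv2 i k) y = wblock (fst j) (fst i) (fst k) (fst y) * wblock (snd j) (snd i) (snd k) (snd y)" for j y
    using conv2_tensor[OF integrable_wavelet[OF i'(1)] integrable_wavelet[OF i'(2)], of j "fst k" "snd k" y]
    by (simp add: wblock_def wavelet2_eq[abs_def])
  hence "(\<Sum>j\<in>near_blocks2 i. conv2 j (wv2 i k) y) = wv2 i k y" for y
    unfolding wavelet2_eq sum_wblock[OF i'(1), symmetric] sum_wblock[OF i'(2), symmetric] near_blocks2_def
    by (simp add: sum_product sum.cartesian_product case_prod_unfold)
  hence "f (wv2 i k) = f (\<lambda>y. \<Sum>j\<in>near_blocks2 i. conv2 j (wv2 i k) y)" by simp
  also have "\<dots> = (\<Sum>j\<in>near_blocks2 i. f (conv2 j (wv2 i k)))"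
    by (rule conjunct2[OF tempered_distribution_sum[OF f finite_near_blocks2 conv2_test(1)[OF f S]]])
  finally show ?thesis by (simp add: conv2_test(3)[OF f S])
qed

end

section \<open>Powers and sums of extended nonnegative reals\<close>

lemma epowr_top [simp]: "epowr top r = top"
  by (simp add: epowr_def)

lemma epowr_ennreal [simp]: "0 \<le> x \<Longrightarrow> epowr (ennreal x) r = ennreal (x powr r)"
  by (simp add: epowr_def)

lemma epowr_0 [simp]: "epowr 0 r = 0"
  by (simp add: epowr_def)

lemma epowr_1 [simp]: "epowr x 1 = x"
  by (cases x) (auto simp: epowr_def)

lemma epowr_mono: "x \<le> y \<Longrightarrow> 0 \<le> r \<Longrightarrow> epowr x r \<le> epowr y r"
  by (cases x; cases y) (auto intro!: ennreal_leI powr_mono2 simp: top_unique)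

lemma epowr_epowr: "epowr (epowr x r) s = epowr x (r * s)"
  by (cases x) (auto simp: powr_powr)

lemma epowr_mult: "0 < r \<Longrightarrow> epowr (x * y) r = epowr x r * epowr y r"
proof (cases x; cases y)
  fix a b assume "x = ennreal a" "0 \<le> a" "y = ennreal b" "0 \<le> b"
  thus ?thesis by (simp add: powr_mult flip: ennreal_mult)
next
  fix a assume "x = ennreal a" "0 \<le> a" "y = top"
  thus ?thesis by (cases "a = 0") (auto simp: ennreal_mult_top)
next
  fix b assume "x = top" "y = ennreal b" "0 \<le> b"
  thus ?thesis by (cases "b = 0") (auto simp: ennreal_top_mult)
qed simp

lemma epowr_eq_0_iff: "epowr x r = 0 \<longleftrightarrow> x = 0"
  by (cases x) auto

lemma borel_measurable_epowr [measurable]: "(\<lambda>x. epowr x r) \<in> borel_measurable borel"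
  unfolding epowr_def[abs_def] by measurable

text \<open>A sum is at most its number of terms times its largest term. The crude bound has the
  merit of one form for all positive exponents, below and above 1.\<close>

lemma epowr_sum_le:
  assumes r: "0 < r" and F: "finite F"
  shows "epowr (\<Sum>i\<in>F. a i) r \<le> epowr (of_nat (card F)) r * (\<Sum>i\<in>F. epowr (a i) r)"
proof (cases "F = {}")
  case False
  define m where "m = Max (a ` F)"
  have "m \<in> a ` F" unfolding m_def using F False by (intro Max_in) auto
  then obtain i where i: "i \<in> F" "m = a i" by blast
  have "(\<Sum>i\<in>F. a i) \<le> of_nat (card F) * m"
    by (rule sum_bounded_above) (use F in \<open>auto simp: m_def\<close>)
  hence "epowr (\<Sum>i\<in>F. a i) r \<le> epowr (of_nat (card F) * m) r" using r by (intro epowr_mono) auto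
  also have "\<dots> = epowr (of_nat (card F)) r * epowr (a i) r" using r by (simp add: epowr_mult i)
  also have "\<dots> \<le> epowr (of_nat (card F)) r * (\<Sum>i\<in>F. epowr (a i) r)"
    using F i(1) by (intro mult_left_mono member_le_sum) auto
  finally show ?thesis .
qed simp

text \<open>Jensen's inequality up to a constant: integrate
  \<open>b \<le> \<lambda> + \<lambda> powr (1 - p) * b powr p\<close> against the weight, where \<open>\<lambda>\<close> is the \<open>p\<close>-th root of the right integral.\<close>

lemma epowr_nn_integral_le:
  fixes b w :: "'a \<Rightarrow> ennreal"
  assumes p: "1 \<le> p" and [measurable]: "b \<in> borel_measurable M" "w \<in> borel_measurable M"
    and W: "(\<integral>\<^sup>+x. w x \<partial>M) \<le> ennreal W" "0 \<le> W"
  shows "epowr (\<integral>\<^sup>+x. b x * w x \<partial>M) p \<le> ennreal ((1 + W) powr p) * (\<integral>\<^sup>+x. epowr (b x) p * w x \<partial>M)"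
proof -
  define J where "J = (\<integral>\<^sup>+x. epowr (b x) p * w x \<partial>M)"
  consider "J = top" | "J = 0" | l where "J = ennreal (l powr p)" "0 < l"
  proof (cases J)
    case (real r)
    show thesis
    proof (cases "r = 0")
      case False
      hence "r = (r powr (1 / p)) powr p" using real p by (simp add: powr_powr)
      thus thesis using that(3)[of "r powr (1 / p)"] real False by simp
    qed (use real that in simp)
  qed (use that in auto)
  thus ?thesis
  proof cases
    case 1
    have "0 < (1 + W) powr p" using W(2) by simp
    thus ?thesis unfolding J_def[symmetric] 1 by (simp add: ennreal_mult_top)
  next
    case 2
    hence "AE x in M. epowr (b x) p * w x = 0" unfolding J_def by (simp add: nn_integral_0_iff_AE)
    hence "AE x in M. b x * w x = 0" by eventually_elim (auto simp: epowr_eq_0_iff)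
    hence "(\<integral>\<^sup>+x. b x * w x \<partial>M) = 0" by (simp add: nn_integral_0_iff_AE)
    thus ?thesis by simp
  next
    case (3 l)
    have pt: "t \<le> ennreal l + ennreal (l powr (1 - p)) * epowr t p" for t
    proof (cases t)
      case (real r)
      have "r \<le> l + l powr (1 - p) * r powr p"
      proof (cases "r \<le> l")
        case False
        have "r = r powr (1 - p) * r powr p" using False 3(2) by (simp flip: powr_add)
        also have "\<dots> \<le> l powr (1 - p) * r powr p"
          using False 3(2) p by (intro mult_right_mono powr_mono2') auto
        finally show ?thesis using 3(2) by simp
      qed (use 3(2) in \<open>simp add: add_increasing2\<close>)
      thus ?thesis using real 3(2) by (simp add: ennreal_leI flip: ennreal_mult ennreal_plus)
    qed (use 3(2) in \<open>simp add: ennreal_mult_top\<close>)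
    have "(\<integral>\<^sup>+x. b x * w x \<partial>M) \<le> (\<integral>\<^sup>+x. ennreal l * w x + ennreal (l powr (1 - p)) * (epowr (b x) p * w x) \<partial>M)"
    proof (intro nn_integral_mono)
      fix x
      show "b x * w x \<le> ennreal l * w x + ennreal (l powr (1 - p)) * (epowr (b x) p * w x)"
        using mult_right_mono[OF pt[of "b x"], of "w x"] by (simp add: distrib_right mult.assoc)
    qed
    also have "\<dots> = ennreal l * (\<integral>\<^sup>+x. w x \<partial>M) + ennreal (l powr (1 - p)) * J"
      by (simp add: nn_integral_add nn_integral_cmult J_def)
    also have "\<dots> \<le> ennreal l * ennreal W + ennreal (l powr (1 - p)) * J"
      by (intro add_right_mono mult_left_mono W) auto
    also have "\<dots> = ennreal ((1 + W) * l)"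
    proof -
      have "l powr (1 - p) * l powr p = l" using 3(2) by (simp flip: powr_add)
      hence "ennreal (l powr (1 - p)) * J = ennreal l" by (simp add: 3(1) flip: ennreal_mult)
      thus ?thesis using 3(2) W(2) by (simp add: algebra_simps flip: ennreal_mult ennreal_plus)
    qed
    finally have "epowr (\<integral>\<^sup>+x. b x * w x \<partial>M) p \<le> epowr (ennreal ((1 + W) * l)) p"
      using p by (intro epowr_mono) auto
    also have "\<dots> = ennreal ((1 + W) powr p) * J"
      using 3 W(2) by (subst epowr_ennreal) (auto simp: powr_mult ennreal_mult')
    finally show ?thesis unfolding J_def .
  qed
qed

text \<open>Each term satisfies \<open>a k powr p \<le> T\<close>, hence
  \<open>a k = a k powr (1 - p) * a k powr p\<close> is at most
  \<open>T powr ((1 - p) / p) * a k powr p\<close>. Summation gives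
  \<open>T powr (1 / p)\<close>.\<close>

lemma epowr_nn_integral_count_le:
  fixes a :: "'i \<Rightarrow> ennreal"
  assumes p: "0 < p" "p \<le> 1"
  shows "epowr (\<integral>\<^sup>+k. a k \<partial>count_space UNIV) p \<le> (\<integral>\<^sup>+k. epowr (a k) p \<partial>count_space UNIV)"
proof -
  define T where "T = (\<integral>\<^sup>+k. epowr (a k) p \<partial>count_space UNIV)"
  show ?thesis
  proof (cases T)
    case (real t)
    have le: "epowr (a k) p \<le> T" for k
      unfolding T_def by (rule nn_integral_ge_point) simp
    have pt: "a k \<le> ennreal (t powr ((1 - p) / p)) * epowr (a k) p" for k
    proof (cases "a k")
      case (real r)
      have rt: "r powr p \<le> t" using le[of k] real \<open>T = ennreal t\<close> \<open>0 \<le> t\<close> by simp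
      show ?thesis
      proof (cases "r = 0")
        case False
        hence "r = (r powr p) powr ((1 - p) / p) * r powr p"
          using real p by (simp add: powr_powr flip: powr_add)
        also have "\<dots> \<le> t powr ((1 - p) / p) * r powr p"
          using p rt by (intro mult_right_mono powr_mono2) auto
        finally show ?thesis using real by (simp add: ennreal_leI flip: ennreal_mult)
      qed (use real in simp)
    next
      case top
      thus ?thesis using le[of k] real by (simp add: top_unique)
    qed
    have "(\<integral>\<^sup>+k. a k \<partial>count_space UNIV) \<le> ennreal (t powr ((1 - p) / p)) * T"
      unfolding T_def by (subst nn_integral_cmult[symmetric]) (auto intro!: nn_integral_mono pt)
    also have "\<dots> = ennreal (t powr (1 / p))"
    proof (cases "t = 0")
      case False
      hence "t powr ((1 - p) / p) * t powr 1 = t powr (1 / p)"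
        unfolding powr_add[symmetric] using p by (simp add: field_simps)
      thus ?thesis using real False by (simp flip: ennreal_mult)
    qed (use real in simp)
    finally have "epowr (\<integral>\<^sup>+k. a k \<partial>count_space UNIV) p \<le> epowr (ennreal (t powr (1 / p))) p"
      using p by (intro epowr_mono) auto
    also have "\<dots> = T" using real p by (simp add: powr_powr)
    finally show ?thesis unfolding T_def .
  qed (simp add: T_def)
qed

lemma epowr_wt2_le:
  assumes "2 \<le> real N * p"
  shows "epowr (ennreal (wt2 N x)) p \<le> ennreal (wt2 2 x)"
proof -
  have "wt2 N x powr p \<le> wt2 2 x"
    unfolding wt2_def powr_mult by (intro mult_mono wt_powr_le assms) auto
  thus ?thesis by (simp add: ennreal_leI)
qed

text \<open>For \<open>p \<ge> 1\<close> this is the Jensen bound with total weight at most 64, so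
  65 is \<open>1 + 64\<close>. For \<open>p < 1\<close> powers of a sum are subadditive and the
  weight survives the power by the choice of \<open>N\<close>; then \<open>1 \<le> 65 powr p\<close>
  gives the same form.\<close>

lemma epowr_wavelet_sum_le:
  assumes p: "0 < p" and N: "2 \<le> N" "2 \<le> real N * p"
  shows "epowr (\<integral>\<^sup>+k. b k * ennreal (wt2 N (x - ireal k)) \<partial>count_space UNIV) p
    \<le> ennreal (65 powr p) * (\<integral>\<^sup>+k. epowr (b k) p * ennreal (wt2 2 (x - ireal k)) \<partial>count_space UNIV)"
proof (cases "1 \<le> p")
  case True
  have "epowr (\<integral>\<^sup>+k. b k * ennreal (wt2 N (x - ireal k)) \<partial>count_space UNIV) p \<le>
     epowr (\<integral>\<^sup>+k. b k * ennreal (wt2 2 (x - ireal k)) \<partial>count_space UNIV) p"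
    using p by (intro epowr_mono nn_integral_mono mult_left_mono ennreal_leI wt2_antimono N(1)) auto
  also have "\<dots> \<le> ennreal ((1 + 64) powr p) * (\<integral>\<^sup>+k. epowr (b k) p * ennreal (wt2 2 (x - ireal k)) \<partial>count_space UNIV)"
    by (rule epowr_nn_integral_le[OF True]) (use nn_integral_wt2_sum[of 2 x] in auto)
  finally show ?thesis by simp
next
  case False
  have "epowr (\<integral>\<^sup>+k. b k * ennreal (wt2 N (x - ireal k)) \<partial>count_space UNIV) p
     \<le> (\<integral>\<^sup>+k. epowr (b k * ennreal (wt2 N (x - ireal k))) p \<partial>count_space UNIV)"
    by (rule epowr_nn_integral_count_le) (use p False in auto)
  also have "\<dots> \<le> (\<integral>\<^sup>+k. epowr (b k) p * ennreal (wt2 2 (x - ireal k)) \<partial>count_space UNIV)"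
    unfolding epowr_mult[OF p] by (intro nn_integral_mono mult_left_mono epowr_wt2_le N) auto
  also have "\<dots> = 1 * (\<integral>\<^sup>+k. epowr (b k) p * ennreal (wt2 2 (x - ireal k)) \<partial>count_space UNIV)" by simp
  also have "\<dots> \<le> ennreal (65 powr p) * (\<integral>\<^sup>+k. epowr (b k) p * ennreal (wt2 2 (x - ireal k)) \<partial>count_space UNIV)"
    using p by (intro mult_right_mono) (auto simp: ge_one_powr_ge_zero simp flip: ennreal_1 intro!: ennreal_leI)
  finally show ?thesis .
qed

section \<open>A Plancherel--Polya inequality\<close>

text \<open>The factor \<open>vol i\<close> normalises the weight: its total mass is at most 4 at
  every scale once \<open>N \<ge> 2\<close>.\<close>

definition wmean :: "nat \<Rightarrow> int \<times> int \<Rightarrow> (real \<times> real \<Rightarrow> ennreal) \<Rightarrow> real \<times> real \<Rightarrow> ennreal" where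
  "wmean N i g x = (\<integral>\<^sup>+y. g y * ennreal (vol i * wt2 N (sc2 i (y - x))) \<partial>lborel)"

lemma wmean_antimono: "M \<le> N \<Longrightarrow> wmean N i g x \<le> wmean M i g x"
  unfolding wmean_def by (intro nn_integral_mono mult_left_mono ennreal_leI wt2_antimono) auto

lemma nn_integral_vol_wt2:
  assumes "2 \<le> N"
  shows "(\<integral>\<^sup>+y. ennreal (vol i * wt2 N (sc2 i (y - x))) \<partial>lborel) \<le> 4"
  using nn_integral_wt2_affine[OF assms, of i "sc2 i x"]
  by (simp add: sc2_diff ennreal_mult nn_integral_cmult)

text \<open>For \<open>p < 1\<close>: a function dominated by its weighted means satisfies \<open>g(z) V(z - x) \<le> C I(x)\<close> with
  \<open>I\<close> the mean with weight \<open>V\<close>, so \<open>I = \<integral> (g V)\<^sup>p (g V)\<^bsup>1-p\<^esup> \<le> (C I)\<^bsup>1-p\<^esup> \<integral> (g V)\<^sup>p\<close>.\<close>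

lemma epowr_wmean_le_of_finite:
  fixes g :: "real \<times> real \<Rightarrow> ennreal"
  assumes p: "0 < p" "p < 1" and N: "2 \<le> real N * p"
    and [measurable]: "g \<in> borel_measurable borel" and C: "0 < C"
    and rep: "\<And>z. g z \<le> ennreal C * wmean N i g z" and fin: "wmean N i g x < \<infinity>"
  shows "epowr (wmean N i g x) p \<le>
    ennreal (C powr (1 - p)) * (\<integral>\<^sup>+y. epowr (g y) p * ennreal (vol i * wt2 2 (sc2 i (y - x))) \<partial>lborel)"
proof -
  define V where "V y = wt2 N (sc2 i (y - x))" for y
  have [measurable]: "V \<in> borel_measurable borel" unfolding V_def[abs_def] by measurable
  obtain I where I: "wmean N i g x = ennreal I" "0 \<le> I"
    using fin by (cases "wmean N i g x") auto
  have gV: "g z * ennreal (V z) \<le> ennreal (C * I)" for z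
  proof -
    have "g z * ennreal (V z) \<le> (ennreal C * wmean N i g z) * ennreal (V z)"
      by (intro mult_right_mono rep) auto
    also have "\<dots> = ennreal C * (\<integral>\<^sup>+y. g y * ennreal (vol i * wt2 N (sc2 i (y - z))) * ennreal (V z) \<partial>lborel)"
      unfolding wmean_def mult.assoc[of "ennreal C"] by (subst nn_integral_multc) auto
    also have "\<dots> \<le> ennreal C * (\<integral>\<^sup>+y. g y * ennreal (vol i * wt2 N (sc2 i (y - x))) \<partial>lborel)"
    proof (intro mult_left_mono nn_integral_mono)
      fix y
      have "wt2 N (sc2 i (y - z)) * V z \<le> wt2 N (sc2 i (y - x))"
        using wt2_mult_le[of N "sc2 i (y - z)" "sc2 i (z - x)"] by (simp add: V_def sc2_diff)
      hence "vol i * wt2 N (sc2 i (y - z)) * V z \<le> vol i * wt2 N (sc2 i (y - x))"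
        by (simp add: mult.assoc mult_left_mono)
      hence "ennreal (vol i * wt2 N (sc2 i (y - z))) * ennreal (V z) \<le> ennreal (vol i * wt2 N (sc2 i (y - x)))"
        by (simp add: V_def ennreal_leI flip: ennreal_mult)
      thus "g y * ennreal (vol i * wt2 N (sc2 i (y - z))) * ennreal (V z) \<le> g y * ennreal (vol i * wt2 N (sc2 i (y - x)))"
        unfolding mult.assoc by (intro mult_left_mono) auto
    qed auto
    also have "\<dots> = ennreal (C * I)" using I C by (simp add: wmean_def ennreal_mult)
    finally show ?thesis .
  qed
  define Q where "Q = (\<integral>\<^sup>+y. epowr (g y) p * ennreal (vol i * wt2 2 (sc2 i (y - x))) \<partial>lborel)"
  have "ennreal I = (\<integral>\<^sup>+y. g y * ennreal (V y) * ennreal (vol i) \<partial>lborel)"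
    unfolding I(1)[symmetric] wmean_def V_def
    by (intro nn_integral_cong) (simp add: ennreal_mult mult_ac)
  also have "\<dots> \<le> (\<integral>\<^sup>+y. ennreal ((C * I) powr (1 - p)) * (epowr (g y) p * ennreal (vol i * wt2 2 (sc2 i (y - x)))) \<partial>lborel)"
  proof (intro nn_integral_mono)
    fix y
    obtain r where r: "g y * ennreal (V y) = ennreal r" "0 \<le> r"
      using gV[of y] by (cases "g y * ennreal (V y)") (auto simp: top_unique)
    have rC: "r \<le> C * I" using gV[of y] I C by (simp add: r)
    have "r = r powr (1 - p) * r powr p" using r(2) p by (cases "r = 0") (auto simp flip: powr_add)
    also have "\<dots> \<le> (C * I) powr (1 - p) * r powr p"
      using rC r(2) p by (intro mult_right_mono powr_mono2) auto
    finally have "g y * ennreal (V y) \<le> ennreal ((C * I) powr (1 - p)) * epowr (g y * ennreal (V y)) p"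
      unfolding r(1) using r(2) by (simp add: ennreal_leI flip: ennreal_mult)
    also have "\<dots> \<le> ennreal ((C * I) powr (1 - p)) * (epowr (g y) p * ennreal (wt2 2 (sc2 i (y - x))))"
      unfolding epowr_mult[OF p(1)] V_def by (intro mult_left_mono epowr_wt2_le N) auto
    finally have "g y * ennreal (V y) * ennreal (vol i) \<le>
       ennreal ((C * I) powr (1 - p)) * (epowr (g y) p * ennreal (wt2 2 (sc2 i (y - x)))) * ennreal (vol i)"
      by (rule mult_right_mono) simp
    thus "g y * ennreal (V y) * ennreal (vol i) \<le>
       ennreal ((C * I) powr (1 - p)) * (epowr (g y) p * ennreal (vol i * wt2 2 (sc2 i (y - x))))"
      by (simp add: ennreal_mult mult_ac)
  qed
  also have "\<dots> = ennreal ((C * I) powr (1 - p)) * Q"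
    by (simp add: nn_integral_cmult Q_def)
  finally have main: "ennreal I \<le> ennreal ((C * I) powr (1 - p)) * Q" .
  have "epowr (ennreal I) p \<le> ennreal (C powr (1 - p)) * Q"
  proof (cases "I = 0")
    case False
    have "ennreal (I powr (p - 1)) * ennreal I \<le> ennreal (I powr (p - 1)) * (ennreal ((C * I) powr (1 - p)) * Q)"
      by (intro mult_left_mono main) auto
    moreover have "I powr (p - 1) * I = I powr p"
      using powr_add[of I "p - 1" 1] False I(2) by simp
    moreover have "I powr (p - 1) * (C * I) powr (1 - p) = C powr (1 - p)"
      using powr_add[of I "p - 1" "1 - p"] False I(2) C by (simp add: powr_mult)
    ultimately show ?thesis using I(2) by (simp add: mult.assoc[symmetric] flip: ennreal_mult)
  qed simp
  thus ?thesis by (simp add: I(1) Q_def)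
qed

text \<open>What has to be shown is that the mean is finite. A larger exponent \<open>N'\<close>
  gives finite means by polynomial growth; the finite case at \<open>N'\<close> combined with
  finiteness of the \<open>L^p\<close> integral bounds \<open>g\<close> by a constant, and then the
  mean at \<open>N\<close> is finite too. The auxiliary \<open>D\<close>, \<open>K\<close> and
  \<open>M\<close> do not enter the result.\<close>

lemma epowr_wmean_le:
  fixes g :: "real \<times> real \<Rightarrow> ennreal"
  assumes p: "0 < p" "p < 1" and N: "2 \<le> N" "2 \<le> real N * p"
    and [measurable]: "g \<in> borel_measurable borel"
    and rep: "\<And>N. \<exists>C>0. \<forall>z. g z \<le> ennreal C * wmean N i g z"
    and growth: "\<And>y. g y \<le> ennreal (K / wt2 M y)" "0 \<le> K"
    and Lp: "(\<integral>\<^sup>+y. epowr (g y) p \<partial>lborel) < \<infinity>" and C: "0 < C" "\<And>z. g z \<le> ennreal C * wmean N i g z"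
  shows "epowr (wmean N i g x) p \<le>
    ennreal (C powr (1 - p)) * (\<integral>\<^sup>+y. epowr (g y) p * ennreal (vol i * wt2 2 (sc2 i (y - x))) \<partial>lborel)"
proof (rule epowr_wmean_le_of_finite[OF p N(2) _ C])
  obtain L :: nat where "2 / p \<le> real L" using real_arch_simple by blast
  \<comment> \<open>The part \<open>L\<close> makes the p-th power of the weight integrable;
    \<open>M + 2\<close> absorbs the growth of order \<open>M\<close> and leaves an integrable
    weight.\<close>
  define N' where "N' = max L (M + 2)"
  have N': "2 \<le> real N' * p" "M + 2 \<le> N'"
  proof -
    have "2 / p \<le> real N'" using \<open>2 / p \<le> real L\<close> by (simp add: N'_def)
    thus "2 \<le> real N' * p" using p by (simp add: pos_divide_le_eq)
  qed (simp add: N'_def)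
  obtain D where D: "0 < D" "\<And>z. g z \<le> ennreal D * wmean N' i g z" using rep by blast
  have fin': "wmean N' i g z < \<infinity>" for z
  proof -
    have "wmean N' i g z \<le> wmean (M + 2) i g z" by (rule wmean_antimono[OF N'(2)])
    also have "\<dots> \<le> (\<integral>\<^sup>+y. ennreal (K / wt2 M z) * ennreal (vol i * wt2 2 (sc2 i (y - z))) \<partial>lborel)"
      unfolding wmean_def
    proof (intro nn_integral_mono)
      fix y
      have "wt2 M (sc2 i (y - z)) * wt2 M z \<le> wt2 M (y - z) * wt2 M z"
        by (intro mult_right_mono wt2_sc2_le) auto
      also have "\<dots> \<le> wt2 M y" using wt2_mult_le[of M "y - z" z] by simp
      finally have "wt2 M (sc2 i (y - z)) / wt2 M y \<le> 1 / wt2 M z" by (simp add: divide_simps mult_ac)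
      hence "K * vol i * wt2 2 (sc2 i (y - z)) * (wt2 M (sc2 i (y - z)) / wt2 M y) \<le>
             K * vol i * wt2 2 (sc2 i (y - z)) * (1 / wt2 M z)"
        using growth(2) by (intro mult_left_mono) auto
      hence "K / wt2 M y * (vol i * wt2 (M + 2) (sc2 i (y - z))) \<le> K / wt2 M z * (vol i * wt2 2 (sc2 i (y - z)))"
        unfolding wt2_add by (simp add: mult_ac)
      hence "ennreal (K / wt2 M y) * ennreal (vol i * wt2 (M + 2) (sc2 i (y - z))) \<le> ennreal (K / wt2 M z) * ennreal (vol i * wt2 2 (sc2 i (y - z)))"
        using growth(2) by (simp add: ennreal_leI flip: ennreal_mult)
      thus "g y * ennreal (vol i * wt2 (M + 2) (sc2 i (y - z))) \<le> ennreal (K / wt2 M z) * ennreal (vol i * wt2 2 (sc2 i (y - z)))"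
        by (rule order_trans[OF mult_right_mono[OF growth(1)], rotated]) simp
    qed
    also have "\<dots> \<le> ennreal (K / wt2 M z) * 4"
      by (simp add: nn_integral_cmult mult_left_mono nn_integral_vol_wt2)
    also have "\<dots> < \<infinity>" by (simp add: ennreal_mult_less_top)
    finally show ?thesis .
  qed
  \<comment> \<open>The bound that the finite case at \<open>N'\<close> yields for \<open>g\<close>
    once the weight is replaced by its maximum \<open>vol i\<close>; it is finite but depends on
    \<open>g\<close>.\<close>
  define B where "B = ennreal D * epowr (ennreal (D powr (1 - p)) * (ennreal (vol i) * (\<integral>\<^sup>+y. epowr (g y) p \<partial>lborel))) (1 / p)"
  have gB: "g z \<le> B" for z
  proof -
    have "epowr (wmean N' i g z) p \<le>
       ennreal (D powr (1 - p)) * (\<integral>\<^sup>+y. epowr (g y) p * ennreal (vol i * wt2 2 (sc2 i (y - z))) \<partial>lborel)"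
      by (rule epowr_wmean_le_of_finite[OF p N'(1) _ D fin']) measurable
    also have "\<dots> \<le> ennreal (D powr (1 - p)) * (\<integral>\<^sup>+y. ennreal (vol i) * epowr (g y) p \<partial>lborel)"
    proof (intro mult_left_mono nn_integral_mono)
      fix y
      have "vol i * wt2 2 (sc2 i (y - z)) \<le> vol i * 1" by (intro mult_left_mono wt2_le_1) auto
      hence "ennreal (vol i * wt2 2 (sc2 i (y - z))) \<le> ennreal (vol i)" by (intro ennreal_leI) simp
      thus "epowr (g y) p * ennreal (vol i * wt2 2 (sc2 i (y - z))) \<le> ennreal (vol i) * epowr (g y) p"
        by (subst mult.commute) (rule mult_right_mono, auto)
    qed auto
    finally have "epowr (wmean N' i g z) p \<le> ennreal (D powr (1 - p)) * (ennreal (vol i) * (\<integral>\<^sup>+y. epowr (g y) p \<partial>lborel))"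
      by (simp add: nn_integral_cmult)
    hence "epowr (epowr (wmean N' i g z) p) (1 / p) \<le> epowr (ennreal (D powr (1 - p)) * (ennreal (vol i) * (\<integral>\<^sup>+y. epowr (g y) p \<partial>lborel))) (1 / p)"
      using p by (intro epowr_mono) auto
    hence "wmean N' i g z \<le> epowr (ennreal (D powr (1 - p)) * (ennreal (vol i) * (\<integral>\<^sup>+y. epowr (g y) p \<partial>lborel))) (1 / p)"
      using p by (simp add: epowr_epowr)
    thus ?thesis unfolding B_def by (intro order_trans[OF D(2)] mult_left_mono) auto
  qed
  have "B < \<infinity>"
  proof -
    have "ennreal (D powr (1 - p)) * (ennreal (vol i) * (\<integral>\<^sup>+y. epowr (g y) p \<partial>lborel)) < top"
      using Lp by (simp add: ennreal_mult_less_top)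
    hence "epowr (ennreal (D powr (1 - p)) * (ennreal (vol i) * (\<integral>\<^sup>+y. epowr (g y) p \<partial>lborel))) (1 / p) < top"
      by (auto simp: epowr_def)
    thus ?thesis unfolding B_def by (simp add: ennreal_mult_less_top)
  qed
  have "wmean N i g x \<le> wmean 2 i g x" by (rule wmean_antimono[OF N(1)])
  also have "\<dots> \<le> (\<integral>\<^sup>+y. B * ennreal (vol i * wt2 2 (sc2 i (y - x))) \<partial>lborel)"
    unfolding wmean_def by (intro nn_integral_mono mult_right_mono gB) auto
  also have "\<dots> \<le> B * 4"
    by (simp add: nn_integral_cmult mult_left_mono nn_integral_vol_wt2)
  also have "\<dots> < \<infinity>" using \<open>B < \<infinity>\<close> by (simp add: ennreal_mult_less_top)
  finally show "wmean N i g x < \<infinity>" .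
qed measurable

section \<open>Comparison of blocks and coefficients\<close>

text \<open>The norms are written with unordered sums, whereas the interchange of sums and integrals
  is carried out with integrals over counting measure. Infiniteness of the index type makes the
  enumeration a bijection with the naturals.\<close>

lemma infsum_ennreal_eq_nn_integral:
  fixes f :: "'i::countable \<Rightarrow> ennreal"
  assumes "infinite (UNIV :: 'i set)"
  shows "(\<Sum>\<^sub>\<infinity>i. f i) = (\<integral>\<^sup>+i. f i \<partial>count_space UNIV)"
proof -
  define \<nu> :: "nat \<Rightarrow> 'i" where "\<nu> = from_nat_into UNIV"
  have \<nu>: "bij_betw \<nu> UNIV UNIV"
    unfolding \<nu>_def by (rule bij_betw_from_nat_into) (use assms in auto)
  have "((\<lambda>n. f (\<nu> n)) has_sum (\<Sum>\<^sub>\<infinity>n. f (\<nu> n))) UNIV"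
    by (intro has_sum_infsum nonneg_summable_on_complete) auto
  hence "(\<Sum>\<^sub>\<infinity>n. f (\<nu> n)) = (\<Sum>n. f (\<nu> n))"
    by (auto dest: has_sum_imp_sums simp: sums_iff)
  also have "\<dots> = (\<integral>\<^sup>+n. f (\<nu> n) \<partial>count_space UNIV)"
    by (rule nn_integral_count_space_nat[symmetric])
  also have "\<dots> = (\<integral>\<^sup>+i. f i \<partial>count_space UNIV)"
    by (rule nn_integral_bij_count_space[OF \<nu>])
  finally show ?thesis by (simp add: infsum_reindex_bij_betw[OF \<nu>])
qed

lemma infinite_UNIV_int_prod [simp]: "infinite (UNIV :: (int \<times> int) set)"
  by (simp add: finite_prod)

section \<open>Pointwise domination between blocks and coefficients\<close>

context hyperbolic_wavelets
begin

definition coef :: "((real \<times> real \<Rightarrow> complex) \<Rightarrow> complex) \<Rightarrow> int \<times> int \<Rightarrow> int \<times> int \<Rightarrow> ennreal" where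
  "coef f i k = ennreal (cmod (wavelet_coeff \<psi> \<phi> f i k))"

definition block_norm :: "ennreal \<Rightarrow> ((real \<times> real \<Rightarrow> complex) \<Rightarrow> complex) \<Rightarrow> nat \<times> nat \<Rightarrow> ennreal" where
  "block_norm p f j = Lp_norm p (blockfun f j)"

definition coef_norm :: "ennreal \<Rightarrow> ((real \<times> real \<Rightarrow> complex) \<Rightarrow> complex) \<Rightarrow> int \<times> int \<Rightarrow> ennreal" where
  "coef_norm p f i = ennreal (2 powr (- of_int (fst i + snd i) * enn2real (1 / p))) * lq_norm p UNIV (coef f i)"

definition babs :: "((real \<times> real \<Rightarrow> complex) \<Rightarrow> complex) \<Rightarrow> nat \<times> nat \<Rightarrow> real \<times> real \<Rightarrow> ennreal" where
  "babs f j y = ennreal (norm (blockfun f j y))"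

lemma coef_eq: "coef f i k = ennreal (vol i * norm (f (wv2 i k)))"
proof -
  have "(2::complex) powi (max (fst i) 0 + max (snd i) 0) = of_real (vol i)"
  proof -
    have "nat (max (fst i) 0 + max (snd i) 0) = nat (fst i) + nat (snd i)" by (auto simp: nat_add_distrib max_def)
    thus ?thesis by (simp add: power_int_def vol_def sc_def power_add)
  qed
  hence "norm ((2::complex) powi (max (fst i) 0 + max (snd i) 0)) = vol i"
    by (simp only: norm_of_real abs_of_nonneg vol_nonneg)
  thus ?thesis by (simp add: coef_def wavelet_coeff_def case_prod_unfold norm_mult)
qed

lemma vol_ge: "2 powr of_int (fst i + snd i) \<le> vol i"
proof -
  have "2 powr of_int (fst i + snd i) \<le> 2 powr real (nat (fst i) + nat (snd i))"
    by (intro powr_mono) auto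
  also have "\<dots> = vol i" by (simp add: vol_def sc_def power_add powr_add powr_realpow)
  finally show ?thesis .
qed

text \<open>The two sides differ only in layers with a coordinate \<open>-1\<close>, where
  \<open>sc\<close> is 1 rather than 1/2. Two coordinates allow a factor 4.\<close>

lemma vol_le:
  assumes "i \<in> scales2"
  shows "vol i \<le> 4 * 2 powr of_int (fst i + snd i)"
proof -
  have "vol i = 2 powr real (nat (fst i) + nat (snd i))"
    by (simp add: vol_def sc_def power_add powr_add powr_realpow)
  also have "\<dots> \<le> 2 powr (2 + of_int (fst i + snd i))"
    using assms by (intro powr_mono) (auto simp: scales2_def)
  also have "\<dots> = 4 * 2 powr of_int (fst i + snd i)" by (simp add: powr_add)
  finally show ?thesis .
qed

definition overlap :: nat where "overlap = (2 * (band + 2) + 1) * (2 * (band + 2) + 1)"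

lemma card_near_scales2: "card (near_scales2 j) \<le> overlap"
proof -
  have "card (near_scales b) \<le> 2 * (band + 2) + 1" for b
  proof -
    have "card (near_scales b) \<le> card {int b - int (band + 2)..int b + int (band + 2)}"
      by (intro card_mono) (auto simp: near_scales_def near_def)
    thus ?thesis by simp
  qed
  thus ?thesis unfolding near_scales2_def overlap_def card_cartesian_product by (intro mult_mono) auto
qed

lemma card_near_blocks2: "card (near_blocks2 i) \<le> overlap"
proof -
  have "card (near_blocks b) \<le> 2 * (band + 2) + 1" for b
  proof -
    have "card (near_blocks b) = card (int ` near_blocks b)" by (simp add: card_image)
    also have "\<dots> \<le> card {b - int (band + 2)..b + int (band + 2)}"
      by (intro card_mono) (auto simp: near_blocks_def near_def)
    finally show ?thesis by simp
  qed
  thus ?thesis unfolding near_blocks2_def overlap_def card_cartesian_product by (intro mult_mono) auto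
qed

lemma measurable_babs: "tempered_distribution f \<Longrightarrow> babs f j \<in> borel_measurable borel"
  unfolding babs_def[abs_def] using blockfun_measurable[of f j] by measurable

text \<open>The factor \<open>vol i\<close> in the bound for \<open>analysis2\<close> is absorbed by
  the normalisation of the coefficients, so \<open>C\<close> depends on \<open>N\<close> alone and
  not on the scale or on \<open>f\<close>.\<close>

lemma babs_le:
  obtains C where "0 < C" "\<And>f j x. babs f j x \<le> ennreal C *
     (\<Sum>i\<in>near_scales2 j. \<integral>\<^sup>+k. coef f i k * ennreal (wt2 N (sc2 i x - ireal k)) \<partial>count_space UNIV)"
proof -
  obtain C where C: "0 < C" "\<And>j i k x. i \<in> scales2 \<Longrightarrow> norm (analysis2 j i k x) \<le> C * vol i * wt2 N (sc2 i x - ireal k)"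
    using analysis2_bound by blast
  have "babs f j x \<le> ennreal C *
     (\<Sum>i\<in>near_scales2 j. \<integral>\<^sup>+k. coef f i k * ennreal (wt2 N (sc2 i x - ireal k)) \<partial>count_space UNIV)" for f j x
  proof -
    have "babs f j x \<le> ennreal (\<Sum>i\<in>near_scales2 j. norm (\<Sum>\<^sub>\<infinity>k. analysis2 j i k x * f (wv2 i k)))"
      unfolding babs_def blockfun_def by (intro ennreal_leI norm_sum)
    also have "\<dots> = (\<Sum>i\<in>near_scales2 j. ennreal (norm (\<Sum>\<^sub>\<infinity>k. analysis2 j i k x * f (wv2 i k))))"
      by (rule sum_ennreal[symmetric]) simp
    also have "\<dots> \<le> (\<Sum>i\<in>near_scales2 j. \<integral>\<^sup>+k. ennreal C * (coef f i k * ennreal (wt2 N (sc2 i x - ireal k))) \<partial>count_space UNIV)"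
    proof (intro sum_mono order_trans[OF norm_infsum_le_nn_integral] nn_integral_mono)
      fix i k assume "i \<in> near_scales2 j"
      hence i: "i \<in> scales2" by (rule near_scales2_subset)
      have "norm (analysis2 j i k x * f (wv2 i k)) \<le> (C * vol i * wt2 N (sc2 i x - ireal k)) * norm (f (wv2 i k))"
        unfolding norm_mult by (intro mult_right_mono C i) auto
      also have "\<dots> = C * (vol i * norm (f (wv2 i k)) * wt2 N (sc2 i x - ireal k))" by (simp add: mult_ac)
      finally show "ennreal (norm (analysis2 j i k x * f (wv2 i k))) \<le> ennreal C * (coef f i k * ennreal (wt2 N (sc2 i x - ireal k)))"
        unfolding coef_eq using C(1) by (simp add: ennreal_leI flip: ennreal_mult)
    qed
    also have "\<dots> = ennreal C * (\<Sum>i\<in>near_scales2 j. \<integral>\<^sup>+k. coef f i k * ennreal (wt2 N (sc2 i x - ireal k)) \<partial>count_space UNIV)"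
      by (simp add: nn_integral_cmult sum_distrib_left)
    finally show ?thesis .
  qed
  with C(1) show thesis by (rule that)
qed

text \<open>The point around which the wavelet with indices \<open>i\<close> and \<open>k\<close> is
  concentrated.\<close>

definition node :: "int \<times> int \<Rightarrow> int \<times> int \<Rightarrow> real \<times> real" where
  "node i k = (of_int (fst k) / sc (fst i), of_int (snd k) / sc (snd i))"

lemma sc2_node: "sc2 i (y - node i k) = sc2 i y - ireal k"
  by (simp add: sc2_def node_def ireal_def algebra_simps)

lemma rescale_near:
  assumes "near (fst i) (fst l)" "near (snd i) (snd l)"
  shows "vol i \<le> (2 ^ (band + 2) * 2 ^ (band + 2)) * vol l"
    "wt2 N (sc2 l z) \<le> (2 ^ ((band + 2) * N) * 2 ^ ((band + 2) * N)) * wt2 N (sc2 i z)"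
proof -
  have n: "fst i \<le> fst l + int (band + 2)" "snd i \<le> snd l + int (band + 2)"
    using assms unfolding near_def by linarith+
  have "vol i \<le> (2 ^ (band + 2) * sc (fst l)) * (2 ^ (band + 2) * sc (snd l))"
    unfolding vol_def by (intro mult_mono sc_le n) auto
  thus "vol i \<le> (2 ^ (band + 2) * 2 ^ (band + 2)) * vol l" by (simp only: vol_def mult_ac)
  have "wt2 N (sc2 l z) \<le> (2 ^ ((band + 2) * N) * wt N (sc (fst i) * fst z)) * (2 ^ ((band + 2) * N) * wt N (sc (snd i) * snd z))"
    unfolding wt2_def sc2_def fst_conv snd_conv by (intro mult_mono wt_rescale n) auto
  thus "wt2 N (sc2 l z) \<le> (2 ^ ((band + 2) * N) * 2 ^ ((band + 2) * N)) * wt2 N (sc2 i z)"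
    by (simp only: wt2_def sc2_def fst_conv snd_conv mult_ac)
qed

lemma near_sym: "near a b \<longleftrightarrow> near b a"
  unfolding near_def by linarith

lemma near_int2:
  assumes "j \<in> near_blocks2 i"
  shows "near (fst i) (fst (int2 j))" "near (snd i) (snd (int2 j))"
    "near (fst (int2 j)) (fst i)" "near (snd (int2 j)) (snd i)"
  using assms near_sym by (auto simp: near_blocks2_def near_blocks_def int2_def)

text \<open>The normalising factor \<open>vol i\<close> of the coefficient turns the integral of the
  block against a wavelet into a mean of the block around the node. Passing from scale
  \<open>i\<close> to a near scale \<open>j\<close> costs only the constant
  \<open>A\<close>.\<close>

lemma coef_le:
  obtains C where "0 < C" "\<And>f i k. tempered_distribution f \<Longrightarrow> i \<in> scales2 \<Longrightarrow> coef f i k \<le> ennreal C *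
     (\<Sum>j\<in>near_blocks2 i. wmean N (int2 j) (babs f j) (node i k))"
proof -
  obtain C where C: "0 < C" "\<And>i k x. i \<in> scales2 \<Longrightarrow> norm (wv2 i k x) \<le> C * wt2 N (sc2 i x - ireal k)"
    using wavelet2_bound by blast
  define A where "A = (2 ^ (band + 2) * 2 ^ (band + 2)) * (2 ^ ((band + 2) * N) * 2 ^ ((band + 2) * N) :: real)"
  have A: "0 < A" by (simp add: A_def)
  have "coef f i k \<le> ennreal (A * C) * (\<Sum>j\<in>near_blocks2 i. wmean N (int2 j) (babs f j) (node i k))"
    if f: "tempered_distribution f" and i: "i \<in> scales2" for f i k
  proof -
    have summand: "ennreal (vol i) * ennreal (norm (LINT x|lborel. blockfun f j x * wv2 i k x)) \<le> ennreal (A * C) * wmean N (int2 j) (babs f j) (node i k)"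
      if j: "j \<in> near_blocks2 i" for j
    proof -
      have [measurable]: "babs f j \<in> borel_measurable borel" by (rule measurable_babs[OF f])
      have "ennreal (norm (LINT x|lborel. blockfun f j x * wv2 i k x)) \<le> (\<integral>\<^sup>+x. ennreal (norm (blockfun f j x * wv2 i k x)) \<partial>lborel)"
        by (rule integral_norm_bound_ennreal[OF conv2_test(2)[OF f schwartz_wavelet2[OF i]]])
      hence "ennreal (vol i) * ennreal (norm (LINT x|lborel. blockfun f j x * wv2 i k x)) \<le>
             ennreal (vol i) * (\<integral>\<^sup>+x. ennreal (norm (blockfun f j x * wv2 i k x)) \<partial>lborel)"
        by (intro mult_left_mono) auto
      also have "\<dots> = (\<integral>\<^sup>+x. ennreal (vol i) * ennreal (norm (blockfun f j x * wv2 i k x)) \<partial>lborel)"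
        by (rule nn_integral_cmult[symmetric])
           (use borel_measurable_integrable[OF conv2_test(2)[OF f schwartz_wavelet2[OF i]]] in measurable)
      also have "\<dots> \<le> (\<integral>\<^sup>+x. ennreal (A * C) * (babs f j x * ennreal (vol (int2 j) * wt2 N (sc2 (int2 j) (x - node i k)))) \<partial>lborel)"
      proof (intro nn_integral_mono)
        fix x
        let ?w = "vol (int2 j) * wt2 N (sc2 (int2 j) (x - node i k))"
        have "vol i * wt2 N (sc2 i x - ireal k) \<le> (2 ^ (band + 2) * 2 ^ (band + 2) * vol (int2 j)) *
            (2 ^ ((band + 2) * N) * 2 ^ ((band + 2) * N) * wt2 N (sc2 (int2 j) (x - node i k)))"
          unfolding sc2_node[symmetric] by (intro mult_mono rescale_near near_int2 j) auto
        also have "\<dots> = A * ?w" by (simp only: A_def mult_ac)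
        finally have w: "vol i * wt2 N (sc2 i x - ireal k) \<le> A * ?w" .
        have "vol i * norm (blockfun f j x * wv2 i k x) \<le> vol i * (norm (blockfun f j x) * (C * wt2 N (sc2 i x - ireal k)))"
          unfolding norm_mult by (intro mult_left_mono C i) auto
        also have "\<dots> = C * norm (blockfun f j x) * (vol i * wt2 N (sc2 i x - ireal k))" by (simp only: mult_ac)
        also have "\<dots> \<le> C * norm (blockfun f j x) * (A * ?w)" using C(1) by (intro mult_left_mono w) auto
        also have "\<dots> = A * C * (norm (blockfun f j x) * ?w)" by (simp only: mult_ac)
        finally have "ennreal (vol i * norm (blockfun f j x * wv2 i k x)) \<le> ennreal (A * C * (norm (blockfun f j x) * ?w))"
          by (rule ennreal_leI)
        thus "ennreal (vol i) * ennreal (norm (blockfun f j x * wv2 i k x)) \<le> ennreal (A * C) * (babs f j x * ennreal ?w)"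
          unfolding babs_def using A C(1) by (simp flip: ennreal_mult)
      qed
      also have "\<dots> = ennreal (A * C) * wmean N (int2 j) (babs f j) (node i k)"
        by (simp add: nn_integral_cmult wmean_def)
      finally show ?thesis .
    qed
    have "coef f i k = ennreal (vol i) * ennreal (norm (\<Sum>j\<in>near_blocks2 i. LINT x|lborel. blockfun f j x * wv2 i k x))"
      unfolding coef_eq wavelet_reproducing[OF f i, of k, symmetric] by (simp add: ennreal_mult)
    also have "\<dots> \<le> ennreal (vol i) * (\<Sum>j\<in>near_blocks2 i. ennreal (norm (LINT x|lborel. blockfun f j x * wv2 i k x)))"
      by (subst sum_ennreal) (auto intro!: mult_left_mono ennreal_leI norm_sum)
    also have "\<dots> \<le> (\<Sum>j\<in>near_blocks2 i. ennreal (A * C) * wmean N (int2 j) (babs f j) (node i k))"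
      unfolding sum_distrib_left by (intro sum_mono summand)
    finally show ?thesis by (simp add: sum_distrib_left)
  qed
  moreover have "0 < A * C" using A C(1) by simp
  ultimately show thesis using that by blast
qed

lemma babs_reproducing:
  obtains C where "0 < C" "\<And>f j z. tempered_distribution f \<Longrightarrow> babs f j z \<le> ennreal C * wmean N (int2 j) (babs f j) z"
proof -
  obtain C where C: "0 < C" "\<And>j z. norm (lowpass2 j z) \<le> C * vol (int2 j) * wt2 N (sc2 (int2 j) z)"
    using lowpass2_bound by blast
  have "babs f j z \<le> ennreal C * wmean N (int2 j) (babs f j) z" if f: "tempered_distribution f" for f j z
  proof -
    have [measurable]: "babs f j \<in> borel_measurable borel" by (rule measurable_babs[OF f])
    have "babs f j z = ennreal (norm (LINT y|lborel. blockfun f j y * lowpass2 j (y - z)))"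
      unfolding babs_def by (subst blockfun_reproducing[OF f]) simp
    also have "\<dots> \<le> (\<integral>\<^sup>+y. ennreal (norm (blockfun f j y * lowpass2 j (y - z))) \<partial>lborel)"
      by (rule integral_norm_bound_ennreal[OF conv2_test(2)[OF f schwartz_lowpass2]])
    also have "\<dots> \<le> (\<integral>\<^sup>+y. ennreal C * (babs f j y * ennreal (vol (int2 j) * wt2 N (sc2 (int2 j) (y - z)))) \<partial>lborel)"
    proof (intro nn_integral_mono)
      fix y
      have "norm (blockfun f j y * lowpass2 j (y - z)) \<le> norm (blockfun f j y) * (C * vol (int2 j) * wt2 N (sc2 (int2 j) (y - z)))"
        unfolding norm_mult by (intro mult_left_mono C) auto
      also have "\<dots> = C * (norm (blockfun f j y) * (vol (int2 j) * wt2 N (sc2 (int2 j) (y - z))))" by (simp only: mult_ac)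
      finally show "ennreal (norm (blockfun f j y * lowpass2 j (y - z))) \<le> ennreal C * (babs f j y * ennreal (vol (int2 j) * wt2 N (sc2 (int2 j) (y - z))))"
        unfolding babs_def using C(1) by (simp add: ennreal_leI flip: ennreal_mult)
    qed
    also have "\<dots> = ennreal C * wmean N (int2 j) (babs f j) z"
      by (simp add: nn_integral_cmult wmean_def)
    finally show ?thesis .
  qed
  with C(1) show thesis by (rule that)
qed

text \<open>For \<open>q \<ge> 1\<close> this is Jensen's bound with total weight at most 4, hence
  \<open>5 powr q\<close>. For \<open>q < 1\<close> the reproducing formula is needed; its constant
  depends only on \<open>N\<close>, so the result is uniform in \<open>f\<close> and
  \<open>j\<close>.\<close>

lemma epowr_wmean_babs_le:
  assumes q: "0 < q" and N: "2 \<le> N" "2 \<le> real N * q"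
  obtains C where "0 < C" "\<And>f j x. tempered_distribution f \<Longrightarrow> (\<integral>\<^sup>+y. epowr (babs f j y) q \<partial>lborel) < \<infinity> \<Longrightarrow>
     epowr (wmean N (int2 j) (babs f j) x) q \<le> ennreal C *
       (\<integral>\<^sup>+y. epowr (babs f j y) q * ennreal (vol (int2 j) * wt2 2 (sc2 (int2 j) (y - x))) \<partial>lborel)"
proof (cases "1 \<le> q")
  case True
  have "epowr (wmean N (int2 j) (babs f j) x) q \<le> ennreal (5 powr q) *
       (\<integral>\<^sup>+y. epowr (babs f j y) q * ennreal (vol (int2 j) * wt2 2 (sc2 (int2 j) (y - x))) \<partial>lborel)"
    if f: "tempered_distribution f" for f j x
  proof -
    have [measurable]: "babs f j \<in> borel_measurable borel" by (rule measurable_babs[OF f])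
    have "epowr (wmean N (int2 j) (babs f j) x) q \<le> epowr (wmean 2 (int2 j) (babs f j) x) q"
      using q by (intro epowr_mono wmean_antimono N) auto
    also have "\<dots> \<le> ennreal ((1 + 4) powr q) *
       (\<integral>\<^sup>+y. epowr (babs f j y) q * ennreal (vol (int2 j) * wt2 2 (sc2 (int2 j) (y - x))) \<partial>lborel)"
      unfolding wmean_def
      by (rule epowr_nn_integral_le[OF True]) (use nn_integral_vol_wt2[of 2] in auto)
    finally show ?thesis by simp
  qed
  thus thesis by (intro that[of "5 powr q"]) auto
next
  case False
  obtain C where C: "0 < C" "\<And>f j z. tempered_distribution f \<Longrightarrow> babs f j z \<le> ennreal C * wmean N (int2 j) (babs f j) z"
    using babs_reproducing by blast
  have "epowr (wmean N (int2 j) (babs f j) x) q \<le> ennreal (C powr (1 - q)) *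
       (\<integral>\<^sup>+y. epowr (babs f j y) q * ennreal (vol (int2 j) * wt2 2 (sc2 (int2 j) (y - x))) \<partial>lborel)"
    if f: "tempered_distribution f" and fin: "(\<integral>\<^sup>+y. epowr (babs f j y) q \<partial>lborel) < \<infinity>" for f j x
  proof -
    obtain K M where K: "0 \<le> K" "\<And>x. norm (blockfun f j x) \<le> K / wt2 M x" using blockfun_growth[OF f] by blast
    show ?thesis
    proof (rule epowr_wmean_le[OF q _ N measurable_babs[OF f] _ _ K(1) fin C(1)])
      show "\<exists>C>0. \<forall>z. babs f j z \<le> ennreal C * wmean N (int2 j) (babs f j) z" for N
        using babs_reproducing[of N] f by metis
      show "babs f j y \<le> ennreal (K / wt2 M y)" for y unfolding babs_def by (intro ennreal_leI K)
    qed (use False C(2)[OF f] in auto)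
  qed
  thus thesis using C(1) by (intro that[of "C powr (1 - q)"]) auto
qed

end

lemma enn2real_one_divide: "0 < q \<Longrightarrow> enn2real (1 / ennreal q) = 1 / q"
  using divide_ennreal[of 1 q] by simp

lemma borel_measurable_nn_integral_count:
  fixes f :: "int \<times> int \<Rightarrow> 'a \<Rightarrow> ennreal"
  assumes [measurable]: "\<And>k. f k \<in> borel_measurable M"
  shows "(\<lambda>x. \<integral>\<^sup>+k. f k x \<partial>count_space UNIV) \<in> borel_measurable M"
proof -
  obtain \<nu> :: "nat \<Rightarrow> int \<times> int" where \<nu>: "bij_betw \<nu> UNIV UNIV"
    by (rule enumerate_int_prod)
  show ?thesis
    unfolding nn_integral_bij_count_space[OF \<nu>, symmetric] nn_integral_count_space_nat by measurable
qed

lemma epowr_sum_le':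
  assumes r: "0 < r" and F: "finite F" and n: "card F \<le> n"
  shows "epowr (\<Sum>i\<in>F. a i) r \<le> ennreal (real n powr r) * (\<Sum>i\<in>F. epowr (a i) r)"
proof -
  have "epowr (of_nat (card F)) r \<le> epowr (ennreal (real n)) r"
    using n r unfolding ennreal_of_nat_eq_real_of_nat by (intro epowr_mono ennreal_leI) auto
  thus ?thesis by (intro order_trans[OF epowr_sum_le[OF r F]] mult_right_mono) auto
qed

section \<open>Comparison of the norms at neighbouring scales\<close>

context hyperbolic_wavelets
begin

lemma overlap_pos: "0 < overlap"
  by (simp add: overlap_def)

lemma coef_norm_finite:
  "0 < q \<Longrightarrow> coef_norm (ennreal q) f i = ennreal (2 powr (- of_int (fst i + snd i) / q)) *
     epowr (\<integral>\<^sup>+k. epowr (coef f i k) q \<partial>count_space UNIV) (1 / q)"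
  by (simp add: coef_norm_def lq_norm_def enn2real_one_divide infsum_ennreal_eq_nn_integral)

lemma block_norm_finite:
  "0 < q \<Longrightarrow> block_norm (ennreal q) f j = epowr (\<integral>\<^sup>+x. epowr (babs f j x) q \<partial>lborel) (1 / q)"
  by (simp add: block_norm_def Lp_norm_def babs_def)

lemma coef_norm_top: "coef_norm top f i = (SUP k. coef f i k)"
  by (simp add: coef_norm_def lq_norm_def)

lemma block_norm_top: "block_norm top f j = esssup lborel (babs f j)"
  by (simp add: block_norm_def Lp_norm_def babs_def[abs_def])

text \<open>The pointwise bound of \<open>babs_le\<close> is raised to the power and integrated by
  Tonelli. The number of neighbouring scales is at most \<open>overlap\<close>, so the finite sums
  cost only constants.\<close>

lemma block_norm_le:
  assumes p: "0 < p"
  obtains C where "0 < C" "\<And>f j. tempered_distribution f \<Longrightarrow>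
    block_norm p f j \<le> ennreal C * (\<Sum>i\<in>near_scales2 j. coef_norm p f i)"
proof (cases p)
  case top
  obtain C where C: "0 < C" "\<And>f j x. babs f j x \<le> ennreal C *
     (\<Sum>i\<in>near_scales2 j. \<integral>\<^sup>+k. coef f i k * ennreal (wt2 2 (sc2 i x - ireal k)) \<partial>count_space UNIV)"
    using babs_le by blast
  have "block_norm p f j \<le> ennreal (C * 64) * (\<Sum>i\<in>near_scales2 j. coef_norm p f i)" if f: "tempered_distribution f" for f j
  proof -
    have "(\<integral>\<^sup>+k. coef f i k * ennreal (wt2 2 (sc2 i x - ireal k)) \<partial>count_space UNIV) \<le> 64 * coef_norm p f i" for i x
    proof -
      have "(\<integral>\<^sup>+k. coef f i k * ennreal (wt2 2 (sc2 i x - ireal k)) \<partial>count_space UNIV) \<le>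
            (\<integral>\<^sup>+k. coef_norm p f i * ennreal (wt2 2 (sc2 i x - ireal k)) \<partial>count_space UNIV)"
        unfolding top coef_norm_top by (intro nn_integral_mono mult_right_mono SUP_upper) auto
      also have "\<dots> \<le> coef_norm p f i * 64"
        by (simp add: nn_integral_cmult mult_left_mono nn_integral_wt2_sum)
      finally show ?thesis by (simp add: mult.commute)
    qed
    hence "babs f j x \<le> ennreal C * (\<Sum>i\<in>near_scales2 j. 64 * coef_norm p f i)" for x
      by (intro order_trans[OF C(2)] mult_left_mono sum_mono) auto
    also have "ennreal C * (\<Sum>i\<in>near_scales2 j. 64 * coef_norm p f i) = ennreal (C * 64) * (\<Sum>i\<in>near_scales2 j. coef_norm p f i)"
      using C(1) by (simp add: sum_distrib_left[symmetric] ennreal_mult mult.assoc)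
    finally have "babs f j x \<le> ennreal (C * 64) * (\<Sum>i\<in>near_scales2 j. coef_norm p f i)" for x .
    thus ?thesis unfolding top block_norm_top[of f j]
      using measurable_babs[OF f] by (intro esssup_I) auto
  qed
  thus thesis using C(1) by (intro that[of "C * 64"]) auto
next
  case (real q)
  hence pq: "p = ennreal q" by simp
  from real have q: "0 < q" using p by (cases "q = 0") auto
  \<comment> \<open>Large enough for two purposes: the weight is summable, and so is its q-th
    power.\<close>
  obtain N :: nat where "2 + 2 / q \<le> real N" using real_arch_simple by blast
  moreover have "0 < 2 / q" using q by simp
  ultimately have N: "2 \<le> N" "2 / q \<le> real N" by linarith+
  hence Nq: "2 \<le> real N * q" using q by (simp add: pos_divide_le_eq)
  obtain C where C: "0 < C" "\<And>f j x. babs f j x \<le> ennreal C *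
     (\<Sum>i\<in>near_scales2 j. \<integral>\<^sup>+k. coef f i k * ennreal (wt2 N (sc2 i x - ireal k)) \<partial>count_space UNIV)"
    using babs_le by blast
  define n where "n = real overlap"
  have n: "0 < n" using overlap_pos by (simp add: n_def)
  define D where "D = C powr q * n powr q * 65 powr q * 4"
  have D: "0 < D" using C(1) n by (simp add: D_def)
  define Q where "Q f i = (\<integral>\<^sup>+k. epowr (coef f i k) q \<partial>count_space UNIV)" for f i
  have "block_norm p f j \<le> ennreal (D powr (1 / q) * n powr (1 / q)) * (\<Sum>i\<in>near_scales2 j. coef_norm p f i)"
    if f: "tempered_distribution f" for f j
  proof -
    have pt: "epowr (babs f j x) q \<le> ennreal (C powr q * n powr q * 65 powr q) *
       (\<Sum>i\<in>near_scales2 j. \<integral>\<^sup>+k. epowr (coef f i k) q * ennreal (wt2 2 (sc2 i x - ireal k)) \<partial>count_space UNIV)" for x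
    proof -
      have "epowr (babs f j x) q \<le> epowr (ennreal C *
         (\<Sum>i\<in>near_scales2 j. \<integral>\<^sup>+k. coef f i k * ennreal (wt2 N (sc2 i x - ireal k)) \<partial>count_space UNIV)) q"
        using q by (intro epowr_mono C) auto
      also have "\<dots> = ennreal (C powr q) * epowr (\<Sum>i\<in>near_scales2 j. \<integral>\<^sup>+k. coef f i k * ennreal (wt2 N (sc2 i x - ireal k)) \<partial>count_space UNIV) q"
        using q C(1) by (simp add: epowr_mult)
      also have "\<dots> \<le> ennreal (C powr q) * (ennreal (n powr q) *
         (\<Sum>i\<in>near_scales2 j. epowr (\<integral>\<^sup>+k. coef f i k * ennreal (wt2 N (sc2 i x - ireal k)) \<partial>count_space UNIV) q))"
        unfolding n_def by (intro mult_left_mono epowr_sum_le' q card_near_scales2) auto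
      also have "\<dots> \<le> ennreal (C powr q) * (ennreal (n powr q) *
         (\<Sum>i\<in>near_scales2 j. ennreal (65 powr q) * (\<integral>\<^sup>+k. epowr (coef f i k) q * ennreal (wt2 2 (sc2 i x - ireal k)) \<partial>count_space UNIV)))"
        by (intro mult_left_mono sum_mono epowr_wavelet_sum_le q N Nq) auto
      also have "\<dots> = ennreal (C powr q * n powr q * 65 powr q) *
         (\<Sum>i\<in>near_scales2 j. \<integral>\<^sup>+k. epowr (coef f i k) q * ennreal (wt2 2 (sc2 i x - ireal k)) \<partial>count_space UNIV)"
        by (simp add: sum_distrib_left[symmetric] ennreal_mult mult.assoc)
      finally show ?thesis .
    qed
    \<comment> \<open>Each translated weight has integral at most \<open>4 / vol i\<close>. After
      the q-th root this factor turns into the weight \<open>2 powr (- (j1 + j2) / p)\<close> of the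
      sequence norm.\<close>
    have int: "(\<integral>\<^sup>+x. (\<integral>\<^sup>+k. epowr (coef f i k) q * ennreal (wt2 2 (sc2 i x - ireal k)) \<partial>count_space UNIV) \<partial>lborel) \<le> ennreal (4 / vol i) * Q f i" for i
    proof -
      have w: "(\<integral>\<^sup>+x. ennreal (wt2 2 (sc2 i x - b)) \<partial>lborel) \<le> ennreal (4 / vol i)" for b
      proof -
        have "ennreal (vol i) * (\<integral>\<^sup>+x. ennreal (wt2 2 (sc2 i x - b)) \<partial>lborel) \<le> 4"
          by (rule nn_integral_wt2_affine) simp
        hence "ennreal (1 / vol i) * (ennreal (vol i) * (\<integral>\<^sup>+x. ennreal (wt2 2 (sc2 i x - b)) \<partial>lborel)) \<le> ennreal (1 / vol i) * 4"
          by (rule mult_left_mono) simp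
        moreover have "ennreal (1 / vol i) * ennreal (vol i) = 1"
          using less_imp_neq[OF vol_pos[of i]] by (subst ennreal_mult[symmetric]) auto
        moreover have "ennreal (1 / vol i) * 4 = ennreal (4 / vol i)"
          using ennreal_mult[of "1 / vol i" 4] by simp
        ultimately show ?thesis by (simp add: mult.assoc[symmetric])
      qed
      have "(\<integral>\<^sup>+x. (\<integral>\<^sup>+k. epowr (coef f i k) q * ennreal (wt2 2 (sc2 i x - ireal k)) \<partial>count_space UNIV) \<partial>lborel)
         = (\<integral>\<^sup>+k. (\<integral>\<^sup>+x. epowr (coef f i k) q * ennreal (wt2 2 (sc2 i x - ireal k)) \<partial>lborel) \<partial>count_space UNIV)"
        by (rule nn_integral_count_space_nn_integral) auto
      also have "\<dots> = (\<integral>\<^sup>+k. epowr (coef f i k) q * (\<integral>\<^sup>+x. ennreal (wt2 2 (sc2 i x - ireal k)) \<partial>lborel) \<partial>count_space UNIV)"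
        by (intro nn_integral_cong nn_integral_cmult) measurable
      also have "\<dots> \<le> (\<integral>\<^sup>+k. epowr (coef f i k) q * ennreal (4 / vol i) \<partial>count_space UNIV)"
        by (intro nn_integral_mono mult_left_mono w) auto
      also have "\<dots> = ennreal (4 / vol i) * Q f i"
        by (subst nn_integral_multc) (auto simp: Q_def mult.commute)
      finally show ?thesis .
    qed
    have meas: "(\<lambda>x. \<integral>\<^sup>+k. epowr (coef f i k) q * ennreal (wt2 2 (sc2 i x - ireal k)) \<partial>count_space UNIV) \<in> borel_measurable lborel" for i
      by (intro borel_measurable_nn_integral_count) measurable
    have "(\<integral>\<^sup>+x. epowr (babs f j x) q \<partial>lborel) \<le> (\<integral>\<^sup>+x. ennreal (C powr q * n powr q * 65 powr q) *
       (\<Sum>i\<in>near_scales2 j. \<integral>\<^sup>+k. epowr (coef f i k) q * ennreal (wt2 2 (sc2 i x - ireal k)) \<partial>count_space UNIV) \<partial>lborel)"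
      by (intro nn_integral_mono pt)
    also have "\<dots> = ennreal (C powr q * n powr q * 65 powr q) * (\<Sum>i\<in>near_scales2 j.
       \<integral>\<^sup>+x. (\<integral>\<^sup>+k. epowr (coef f i k) q * ennreal (wt2 2 (sc2 i x - ireal k)) \<partial>count_space UNIV) \<partial>lborel)"
      using meas by (subst nn_integral_cmult) (auto simp: nn_integral_sum)
    also have "\<dots> \<le> ennreal (C powr q * n powr q * 65 powr q) * (\<Sum>i\<in>near_scales2 j. ennreal (4 / vol i) * Q f i)"
      by (intro mult_left_mono sum_mono int) auto
    also have "\<dots> = ennreal D * (\<Sum>i\<in>near_scales2 j. ennreal (1 / vol i) * Q f i)"
    proof -
      have "ennreal (4 / vol i) = ennreal 4 * ennreal (1 / vol i)" for i by (subst ennreal_mult[symmetric]) auto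
      thus ?thesis by (simp add: D_def ennreal_mult sum_distrib_left mult_ac)
    qed
    finally have "(\<integral>\<^sup>+x. epowr (babs f j x) q \<partial>lborel) \<le> ennreal D * (\<Sum>i\<in>near_scales2 j. ennreal (1 / vol i) * Q f i)" .
    hence "block_norm p f j \<le> epowr (ennreal D * (\<Sum>i\<in>near_scales2 j. ennreal (1 / vol i) * Q f i)) (1 / q)"
      using q unfolding pq block_norm_finite[OF q] by (intro epowr_mono) auto
    also have "\<dots> = ennreal (D powr (1 / q)) * epowr (\<Sum>i\<in>near_scales2 j. ennreal (1 / vol i) * Q f i) (1 / q)"
      using q D by (simp add: epowr_mult)
    also have "\<dots> \<le> ennreal (D powr (1 / q)) * (ennreal (n powr (1 / q)) * (\<Sum>i\<in>near_scales2 j. epowr (ennreal (1 / vol i) * Q f i) (1 / q)))"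
      unfolding n_def using q by (intro mult_left_mono epowr_sum_le' card_near_scales2) auto
    also have "\<dots> \<le> ennreal (D powr (1 / q)) * (ennreal (n powr (1 / q)) * (\<Sum>i\<in>near_scales2 j. coef_norm p f i))"
    proof (intro mult_left_mono sum_mono)
      fix i
      have "(1 / vol i) powr (1 / q) \<le> (1 / 2 powr of_int (fst i + snd i)) powr (1 / q)"
        using q vol_ge[of i] by (intro powr_mono2 divide_left_mono) auto
      also have "\<dots> = 2 powr (- of_int (fst i + snd i) / q)"
        by (simp only: powr_minus_divide[symmetric] powr_powr) simp
      finally have "ennreal ((1 / vol i) powr (1 / q)) \<le> ennreal (2 powr (- of_int (fst i + snd i) / q))" by (rule ennreal_leI)
      thus "epowr (ennreal (1 / vol i) * Q f i) (1 / q) \<le> coef_norm p f i"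
        unfolding pq coef_norm_finite[OF q] Q_def[symmetric] using q
        by (simp add: epowr_mult mult_right_mono)
    qed auto
    finally show ?thesis by (simp add: ennreal_mult mult.assoc)
  qed
  moreover have "0 < D powr (1 / q) * n powr (1 / q)" using D n by simp
  ultimately show thesis using that by blast
qed

text \<open>The coefficients sample means of the block at the nodes. The q-th power is moved inside
  the mean by \<open>epowr_wmean_babs_le\<close>, and summation over the nodes then costs a factor
  of order \<open>vol i\<close>, which the weight of the sequence norm compensates.\<close>

lemma coef_norm_le:
  assumes p: "0 < p"
  obtains C where "0 < C" "\<And>f i. tempered_distribution f \<Longrightarrow> i \<in> scales2 \<Longrightarrow>
    coef_norm p f i \<le> ennreal C * (\<Sum>j\<in>near_blocks2 i. block_norm p f j)"
proof (cases p)
  case top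
  obtain C where C: "0 < C" "\<And>f i k. tempered_distribution f \<Longrightarrow> i \<in> scales2 \<Longrightarrow> coef f i k \<le> ennreal C *
     (\<Sum>j\<in>near_blocks2 i. wmean 2 (int2 j) (babs f j) (node i k))"
    using coef_le by blast
  have "coef_norm p f i \<le> ennreal (C * 4) * (\<Sum>j\<in>near_blocks2 i. block_norm p f j)"
    if f: "tempered_distribution f" and i: "i \<in> scales2" for f i
  proof -
    have "wmean 2 (int2 j) (babs f j) x \<le> 4 * block_norm p f j" for j x
    proof -
      have "wmean 2 (int2 j) (babs f j) x \<le> (\<integral>\<^sup>+y. block_norm p f j * ennreal (vol (int2 j) * wt2 2 (sc2 (int2 j) (y - x))) \<partial>lborel)"
        unfolding wmean_def
      proof (rule nn_integral_mono_AE)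
        show "AE y in lborel. babs f j y * ennreal (vol (int2 j) * wt2 2 (sc2 (int2 j) (y - x))) \<le>
             block_norm p f j * ennreal (vol (int2 j) * wt2 2 (sc2 (int2 j) (y - x)))"
          using esssup_AE[of "babs f j" lborel] unfolding top block_norm_top
          by eventually_elim (rule mult_right_mono, auto)
      qed
      also have "\<dots> \<le> block_norm p f j * 4"
        by (simp add: nn_integral_cmult mult_left_mono nn_integral_vol_wt2)
      finally show ?thesis by (simp add: mult.commute)
    qed
    hence "coef f i k \<le> ennreal C * (\<Sum>j\<in>near_blocks2 i. 4 * block_norm p f j)" for k
      by (intro order_trans[OF C(2)[OF f i]] mult_left_mono sum_mono) auto
    also have "ennreal C * (\<Sum>j\<in>near_blocks2 i. 4 * block_norm p f j) = ennreal (C * 4) * (\<Sum>j\<in>near_blocks2 i. block_norm p f j)"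
      using C(1) by (simp add: sum_distrib_left[symmetric] ennreal_mult mult.assoc)
    finally have "coef f i k \<le> ennreal (C * 4) * (\<Sum>j\<in>near_blocks2 i. block_norm p f j)" for k .
    thus ?thesis unfolding top coef_norm_top[of f i] by (intro SUP_least) auto
  qed
  thus thesis using C(1) by (intro that[of "C * 4"]) auto
next
  case (real q)
  hence pq: "p = ennreal q" by simp
  from real have q: "0 < q" using p by (cases "q = 0") auto
  obtain N :: nat where "2 + 2 / q \<le> real N" using real_arch_simple by blast
  moreover have "0 < 2 / q" using q by simp
  ultimately have N: "2 \<le> N" "2 / q \<le> real N" by linarith+
  hence Nq: "2 \<le> real N * q" using q by (simp add: pos_divide_le_eq)
  obtain C where C: "0 < C" "\<And>f i k. tempered_distribution f \<Longrightarrow> i \<in> scales2 \<Longrightarrow> coef f i k \<le> ennreal C *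
     (\<Sum>j\<in>near_blocks2 i. wmean N (int2 j) (babs f j) (node i k))"
    using coef_le by blast
  obtain B where B: "0 < B" "\<And>f j x. tempered_distribution f \<Longrightarrow> (\<integral>\<^sup>+y. epowr (babs f j y) q \<partial>lborel) < \<infinity> \<Longrightarrow>
     epowr (wmean N (int2 j) (babs f j) x) q \<le> ennreal B *
       (\<integral>\<^sup>+y. epowr (babs f j y) q * ennreal (vol (int2 j) * wt2 2 (sc2 (int2 j) (y - x))) \<partial>lborel)"
    using epowr_wmean_babs_le[OF q N(1) Nq] by blast
  define n where "n = real overlap"
  have n: "0 < n" using overlap_pos by (simp add: n_def)
  define A where "A = (2 ^ (band + 2) * 2 ^ (band + 2)) * (2 ^ ((band + 2) * 2) * 2 ^ ((band + 2) * 2) :: real)"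
  have A: "0 < A" by (simp add: A_def)
  define D where "D = C powr q * n powr q * B * A * 64"
  have D: "0 < D" using C(1) B(1) n A by (simp add: D_def)
  have "coef_norm p f i \<le> ennreal (4 powr (1 / q) * D powr (1 / q) * n powr (1 / q)) * (\<Sum>j\<in>near_blocks2 i. block_norm p f j)"
    if f: "tempered_distribution f" and i: "i \<in> scales2" for f i
  \<comment> \<open>The inequality for means is available only for blocks with finite
    \<open>L^q\<close> integral. If one near block has an infinite integral, the right side is
    infinite.\<close>
  proof (cases "\<forall>j\<in>near_blocks2 i. (\<integral>\<^sup>+y. epowr (babs f j y) q \<partial>lborel) < \<infinity>")
    case False
    then obtain j where j: "j \<in> near_blocks2 i" "(\<integral>\<^sup>+y. epowr (babs f j y) q \<partial>lborel) = top"
      by (auto simp flip: top.not_eq_extremum)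
    hence "block_norm p f j = top" unfolding pq block_norm_finite[OF q] by simp
    hence T: "(\<Sum>j\<in>near_blocks2 i. block_norm p f j) = top" using j(1) by auto
    show ?thesis unfolding T using D n by (simp add: ennreal_mult_top)
  next
    case True
    define P where "P j = (\<integral>\<^sup>+y. epowr (babs f j y) q \<partial>lborel)" for j
    have [measurable]: "babs f j \<in> borel_measurable borel" for j by (rule measurable_babs[OF f])
    have pt: "epowr (coef f i k) q \<le> ennreal (C powr q * n powr q * B * (A * vol i)) *
      (\<Sum>j\<in>near_blocks2 i. \<integral>\<^sup>+y. epowr (babs f j y) q * ennreal (wt2 2 (sc2 i y - ireal k)) \<partial>lborel)" for k
    proof -
      have "epowr (coef f i k) q \<le> epowr (ennreal C * (\<Sum>j\<in>near_blocks2 i. wmean N (int2 j) (babs f j) (node i k))) q"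
        using q by (intro epowr_mono C f i) auto
      also have "\<dots> = ennreal (C powr q) * epowr (\<Sum>j\<in>near_blocks2 i. wmean N (int2 j) (babs f j) (node i k)) q"
        using q C(1) by (simp add: epowr_mult)
      also have "\<dots> \<le> ennreal (C powr q) * (ennreal (n powr q) * (\<Sum>j\<in>near_blocks2 i. epowr (wmean N (int2 j) (babs f j) (node i k)) q))"
        unfolding n_def by (intro mult_left_mono epowr_sum_le' q card_near_blocks2) auto
      also have "\<dots> \<le> ennreal (C powr q) * (ennreal (n powr q) * (\<Sum>j\<in>near_blocks2 i. ennreal B *
         (ennreal (A * vol i) * (\<integral>\<^sup>+y. epowr (babs f j y) q * ennreal (wt2 2 (sc2 i y - ireal k)) \<partial>lborel))))"
      proof (intro mult_left_mono sum_mono)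
        fix j assume j: "j \<in> near_blocks2 i"
        have "epowr (wmean N (int2 j) (babs f j) (node i k)) q \<le> ennreal B *
          (\<integral>\<^sup>+y. epowr (babs f j y) q * ennreal (vol (int2 j) * wt2 2 (sc2 (int2 j) (y - node i k))) \<partial>lborel)"
          using True j by (intro B f) auto
        also have "\<dots> \<le> ennreal B * (\<integral>\<^sup>+y. ennreal (A * vol i) * (epowr (babs f j y) q * ennreal (wt2 2 (sc2 i y - ireal k))) \<partial>lborel)"
        proof (intro mult_left_mono nn_integral_mono)
          fix y
          have "vol (int2 j) * wt2 2 (sc2 (int2 j) (y - node i k)) \<le> (2 ^ (band + 2) * 2 ^ (band + 2) * vol i) *
             (2 ^ ((band + 2) * 2) * 2 ^ ((band + 2) * 2) * wt2 2 (sc2 i y - ireal k))"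
            unfolding sc2_node[symmetric] by (intro mult_mono rescale_near near_int2 j) auto
          also have "\<dots> = A * vol i * wt2 2 (sc2 i y - ireal k)" by (simp only: A_def mult_ac)
          finally have "ennreal (vol (int2 j) * wt2 2 (sc2 (int2 j) (y - node i k))) \<le> ennreal (A * vol i * wt2 2 (sc2 i y - ireal k))"
            by (rule ennreal_leI)
          also have "\<dots> = ennreal (A * vol i) * ennreal (wt2 2 (sc2 i y - ireal k))"
            using A by (intro ennreal_mult) auto
          finally have "epowr (babs f j y) q * ennreal (vol (int2 j) * wt2 2 (sc2 (int2 j) (y - node i k))) \<le>
             epowr (babs f j y) q * (ennreal (A * vol i) * ennreal (wt2 2 (sc2 i y - ireal k)))"
            by (rule mult_left_mono) simp
          thus "epowr (babs f j y) q * ennreal (vol (int2 j) * wt2 2 (sc2 (int2 j) (y - node i k))) \<le>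
             ennreal (A * vol i) * (epowr (babs f j y) q * ennreal (wt2 2 (sc2 i y - ireal k)))"
            by (simp only: mult_ac)
        qed auto
        also have "\<dots> = ennreal B * (ennreal (A * vol i) * (\<integral>\<^sup>+y. epowr (babs f j y) q * ennreal (wt2 2 (sc2 i y - ireal k)) \<partial>lborel))"
          by (subst nn_integral_cmult) auto
        finally show "epowr (wmean N (int2 j) (babs f j) (node i k)) q \<le> ennreal B *
          (ennreal (A * vol i) * (\<integral>\<^sup>+y. epowr (babs f j y) q * ennreal (wt2 2 (sc2 i y - ireal k)) \<partial>lborel))" .
      qed auto
      also have "\<dots> = ennreal (C powr q * n powr q * B * (A * vol i)) *
        (\<Sum>j\<in>near_blocks2 i. \<integral>\<^sup>+y. epowr (babs f j y) q * ennreal (wt2 2 (sc2 i y - ireal k)) \<partial>lborel)"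
      proof -
        have "ennreal (C powr q * n powr q * B * (A * vol i)) = ennreal (C powr q) * (ennreal (n powr q) * (ennreal B * ennreal (A * vol i)))"
          using A B(1) by (simp add: ennreal_mult mult.assoc)
        thus ?thesis by (simp only: sum_distrib_left[symmetric] mult.assoc)
      qed
      finally show ?thesis .
    qed
    \<comment> \<open>After Tonelli the inner sum runs over all translates of one weight and is at
      most 64, uniformly in \<open>y\<close>.\<close>
    have int: "(\<integral>\<^sup>+k. (\<integral>\<^sup>+y. epowr (babs f j y) q * ennreal (wt2 2 (sc2 i y - ireal k)) \<partial>lborel) \<partial>count_space UNIV) \<le> 64 * P j" for j
    proof -
      have "(\<integral>\<^sup>+k. (\<integral>\<^sup>+y. epowr (babs f j y) q * ennreal (wt2 2 (sc2 i y - ireal k)) \<partial>lborel) \<partial>count_space UNIV)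
         = (\<integral>\<^sup>+y. (\<integral>\<^sup>+k. epowr (babs f j y) q * ennreal (wt2 2 (sc2 i y - ireal k)) \<partial>count_space UNIV) \<partial>lborel)"
        by (rule nn_integral_count_space_nn_integral[symmetric]) auto
      also have "\<dots> = (\<integral>\<^sup>+y. epowr (babs f j y) q * (\<integral>\<^sup>+k. ennreal (wt2 2 (sc2 i y - ireal k)) \<partial>count_space UNIV) \<partial>lborel)"
        by (intro nn_integral_cong nn_integral_cmult) auto
      also have "\<dots> \<le> (\<integral>\<^sup>+y. epowr (babs f j y) q * 64 \<partial>lborel)"
        by (intro nn_integral_mono mult_left_mono nn_integral_wt2_sum) auto
      also have "\<dots> = 64 * P j" unfolding P_def by (subst nn_integral_multc) (auto simp: mult.commute)
      finally show ?thesis .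
    qed
    have "(\<integral>\<^sup>+k. epowr (coef f i k) q \<partial>count_space UNIV) \<le> (\<integral>\<^sup>+k. ennreal (C powr q * n powr q * B * (A * vol i)) *
      (\<Sum>j\<in>near_blocks2 i. \<integral>\<^sup>+y. epowr (babs f j y) q * ennreal (wt2 2 (sc2 i y - ireal k)) \<partial>lborel) \<partial>count_space UNIV)"
      by (intro nn_integral_mono pt)
    also have "\<dots> = ennreal (C powr q * n powr q * B * (A * vol i)) * (\<Sum>j\<in>near_blocks2 i.
      \<integral>\<^sup>+k. (\<integral>\<^sup>+y. epowr (babs f j y) q * ennreal (wt2 2 (sc2 i y - ireal k)) \<partial>lborel) \<partial>count_space UNIV)"
      by (subst nn_integral_cmult) (auto simp: nn_integral_sum)
    also have "\<dots> \<le> ennreal (C powr q * n powr q * B * (A * vol i)) * (\<Sum>j\<in>near_blocks2 i. 64 * P j)"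
      by (intro mult_left_mono sum_mono int) auto
    also have "\<dots> = ennreal (D * vol i) * (\<Sum>j\<in>near_blocks2 i. P j)"
    proof -
      have "ennreal (D * vol i) = ennreal (C powr q * n powr q * B * (A * vol i)) * ennreal 64"
        unfolding D_def using A B(1) by (subst ennreal_mult[symmetric]) (auto simp: mult_ac)
      thus ?thesis by (simp add: sum_distrib_left[symmetric] mult.assoc)
    qed
    finally have "epowr (\<integral>\<^sup>+k. epowr (coef f i k) q \<partial>count_space UNIV) (1 / q) \<le> epowr (ennreal (D * vol i) * (\<Sum>j\<in>near_blocks2 i. P j)) (1 / q)"
      using q by (intro epowr_mono) auto
    also have "\<dots> = ennreal ((D * vol i) powr (1 / q)) * epowr (\<Sum>j\<in>near_blocks2 i. P j) (1 / q)"
      using q D by (subst epowr_mult) auto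
    also have "\<dots> \<le> ennreal ((D * vol i) powr (1 / q)) * (ennreal (n powr (1 / q)) * (\<Sum>j\<in>near_blocks2 i. epowr (P j) (1 / q)))"
      unfolding n_def using q by (intro mult_left_mono epowr_sum_le' card_near_blocks2) auto
    also have "(\<Sum>j\<in>near_blocks2 i. epowr (P j) (1 / q)) = (\<Sum>j\<in>near_blocks2 i. block_norm p f j)"
      unfolding pq block_norm_finite[OF q] P_def ..
    finally have "coef_norm p f i \<le> ennreal (2 powr (- of_int (fst i + snd i) / q)) *
       (ennreal ((D * vol i) powr (1 / q)) * (ennreal (n powr (1 / q)) * (\<Sum>j\<in>near_blocks2 i. block_norm p f j)))"
      unfolding pq coef_norm_finite[OF q] by (rule mult_left_mono) simp
    also have "\<dots> = ennreal (2 powr (- of_int (fst i + snd i) / q) * (D * vol i) powr (1 / q) * n powr (1 / q)) * (\<Sum>j\<in>near_blocks2 i. block_norm p f j)"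
      by (simp add: ennreal_mult mult.assoc)
    \<comment> \<open>The factor \<open>vol i\<close> and the weight of the sequence norm cancel up
      to the 4 of \<open>vol_le\<close>.\<close>
    also have "\<dots> \<le> ennreal (4 powr (1 / q) * D powr (1 / q) * n powr (1 / q)) * (\<Sum>j\<in>near_blocks2 i. block_norm p f j)"
    proof (rule mult_right_mono[OF ennreal_leI])
      have "vol i powr (1 / q) \<le> (4 * 2 powr of_int (fst i + snd i)) powr (1 / q)"
        using q by (intro powr_mono2 vol_le i) auto
      also have "\<dots> = 4 powr (1 / q) * 2 powr (of_int (fst i + snd i) / q)"
        by (simp add: powr_mult powr_powr)
      finally have "2 powr (- of_int (fst i + snd i) / q) * vol i powr (1 / q) \<le>
        2 powr (- of_int (fst i + snd i) / q) * (4 powr (1 / q) * 2 powr (of_int (fst i + snd i) / q))"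
        by (rule mult_left_mono) simp
      also have "\<dots> = 4 powr (1 / q) * (2 powr (- of_int (fst i + snd i) / q) * 2 powr (of_int (fst i + snd i) / q))"
        by (simp only: mult_ac)
      also have "2 powr (- of_int (fst i + snd i) / q) * 2 powr (of_int (fst i + snd i) / q) = (1::real)"
        unfolding powr_add[symmetric] by (simp add: add_divide_distrib[symmetric])
      finally have "2 powr (- of_int (fst i + snd i) / q) * vol i powr (1 / q) \<le> 4 powr (1 / q)" by simp
      hence "2 powr (- of_int (fst i + snd i) / q) * vol i powr (1 / q) * (D powr (1 / q) * n powr (1 / q)) \<le> 4 powr (1 / q) * (D powr (1 / q) * n powr (1 / q))"
        by (rule mult_right_mono) simp
      moreover have "(D * vol i) powr (1 / q) = D powr (1 / q) * vol i powr (1 / q)"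
        using D by (intro powr_mult)
      ultimately show "2 powr (- of_int (fst i + snd i) / q) * (D * vol i) powr (1 / q) * n powr (1 / q) \<le> 4 powr (1 / q) * D powr (1 / q) * n powr (1 / q)"
        by (simp only: mult_ac)
    qed auto
    finally show ?thesis .
  qed
  moreover have "0 < 4 powr (1 / q) * D powr (1 / q) * n powr (1 / q)" using D n by simp
  ultimately show thesis using that by blast
qed

end

section \<open>Summation over scales\<close>

text \<open>Extension by zero places blocks and coefficients on the same lattice of integer pairs,
  where indices can be translated freely.\<close>

lemma lq_norm_extend:
  assumes "0 < q"
  shows "lq_norm q A a = lq_norm q UNIV (\<lambda>i. if i \<in> A then a i else 0)"
proof (cases "q = \<infinity>")
  case True
  have "(SUP i\<in>A. a i) = (SUP i. if i \<in> A then a i else 0)"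
  proof (intro antisym SUP_least)
    show "a i \<le> (SUP i. if i \<in> A then a i else 0)" if "i \<in> A" for i
      by (rule SUP_upper2[of i]) (use that in auto)
    show "(if i \<in> A then a i else 0) \<le> (SUP i\<in>A. a i)" for i by (auto intro: SUP_upper)
  qed
  thus ?thesis by (simp add: lq_norm_def True)
next
  case False
  have "(\<Sum>\<^sub>\<infinity>i\<in>A. epowr (a i) (enn2real q)) = (\<Sum>\<^sub>\<infinity>i. epowr (if i \<in> A then a i else 0) (enn2real q))"
    by (rule infsum_cong_neutral) auto
  thus ?thesis using False by (simp add: lq_norm_def)
qed

lemma lq_norm_reindex:
  assumes "inj_on h A"
  shows "lq_norm q (h ` A) a = lq_norm q A (\<lambda>i. a (h i))"
  by (simp add: lq_norm_def infsum_reindex[OF assms] image_image o_def)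

text \<open>Sums over the lattice are translation invariant. One power of \<open>card F\<close>
  comes from the power of a finite sum, the other, with exponent \<open>1 / q\<close>, from adding
  up the translates. For \<open>q = \<infinity>\<close> the latter exponent is 0, and
  \<open>F\<close> must be nonempty because \<open>0 powr 0\<close> is 0.\<close>

lemma lq_norm_neighbours:
  fixes a b :: "int \<times> int \<Rightarrow> ennreal"
  assumes q: "0 < q" and F: "finite F" "F \<noteq> {}" and K: "0 < K"
    and le: "\<And>j. a j \<le> ennreal K * (\<Sum>d\<in>F. b (j + d))"
  shows "lq_norm q UNIV a \<le> ennreal (K * real (card F) * real (card F) powr enn2real (1 / q)) * lq_norm q UNIV b"
proof (cases q)
  case top
  have "a j \<le> ennreal (K * real (card F)) * (SUP i. b i)" for j
  proof -
    have "(\<Sum>d\<in>F. b (j + d)) \<le> of_nat (card F) * (SUP i. b i)"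
      by (rule sum_bounded_above) (rule SUP_upper, simp)
    hence "a j \<le> ennreal K * (of_nat (card F) * (SUP i. b i))"
      by (intro order_trans[OF le] mult_left_mono) auto
    thus ?thesis using K by (simp add: ennreal_mult ennreal_of_nat_eq_real_of_nat mult.assoc)
  qed
  thus ?thesis using F by (auto simp: lq_norm_def top card_gt_0_iff intro!: SUP_least)
next
  case (real r)
  hence r: "0 < r" using q by (cases "r = 0") auto
  define n where "n = real (card F)"
  have n: "0 < n" using F by (simp add: n_def card_gt_0_iff)
  define Q where "Q = (\<integral>\<^sup>+i. epowr (b i) r \<partial>count_space UNIV)"
  have pt: "epowr (a j) r \<le> ennreal (K powr r * n powr r) * (\<Sum>d\<in>F. epowr (b (j + d)) r)" for j
  proof -
    have "epowr (a j) r \<le> epowr (ennreal K * (\<Sum>d\<in>F. b (j + d))) r"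
      using r by (intro epowr_mono le) auto
    also have "\<dots> = ennreal (K powr r) * epowr (\<Sum>d\<in>F. b (j + d)) r"
      using r K by (simp add: epowr_mult)
    also have "\<dots> \<le> ennreal (K powr r) * (ennreal (n powr r) * (\<Sum>d\<in>F. epowr (b (j + d)) r))"
      unfolding n_def by (intro mult_left_mono epowr_sum_le' r F) auto
    finally show ?thesis by (simp add: ennreal_mult mult.assoc)
  qed
  have "(\<integral>\<^sup>+j. epowr (a j) r \<partial>count_space UNIV) \<le>
     (\<integral>\<^sup>+j. ennreal (K powr r * n powr r) * (\<Sum>d\<in>F. epowr (b (j + d)) r) \<partial>count_space UNIV)"
    by (intro nn_integral_mono pt)
  also have "\<dots> = ennreal (K powr r * n powr r) * (\<Sum>d\<in>F. \<integral>\<^sup>+j. epowr (b (j + d)) r \<partial>count_space UNIV)"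
    by (simp add: nn_integral_cmult nn_integral_sum)
  also have "(\<Sum>d\<in>F. \<integral>\<^sup>+j. epowr (b (j + d)) r \<partial>count_space UNIV) = (\<Sum>d\<in>F. Q)"
  proof (intro sum.cong refl)
    fix d
    have "bij_betw (\<lambda>j. j + d) UNIV (UNIV :: (int \<times> int) set)"
      by (rule bij_betw_byWitness[where f' = "\<lambda>j. j - d"]) auto
    thus "(\<integral>\<^sup>+j. epowr (b (j + d)) r \<partial>count_space UNIV) = Q"
      unfolding Q_def by (rule nn_integral_bij_count_space)
  qed
  also have "(\<Sum>d\<in>F. Q) = ennreal n * Q" by (simp add: n_def ennreal_of_nat_eq_real_of_nat)
  finally have "(\<integral>\<^sup>+j. epowr (a j) r \<partial>count_space UNIV) \<le> ennreal (K powr r * n powr r * n) * Q"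
    using n by (simp add: ennreal_mult mult.assoc)
  hence "epowr (\<integral>\<^sup>+j. epowr (a j) r \<partial>count_space UNIV) (1 / r) \<le> epowr (ennreal (K powr r * n powr r * n) * Q) (1 / r)"
    using r by (intro epowr_mono) auto
  also have "\<dots> = ennreal ((K powr r * n powr r * n) powr (1 / r)) * epowr Q (1 / r)"
    using r n K by (subst epowr_mult) auto
  also have "(K powr r * n powr r * n) powr (1 / r) = K * n * n powr (1 / r)"
    using r n K by (simp add: powr_mult powr_powr)
  finally show ?thesis
    using r by (simp add: lq_norm_def real infsum_ennreal_eq_nn_integral enn2real_one_divide n_def Q_def)
qed

text \<open>Maximum and minimum are 1-Lipschitz for the larger coordinate distance. The range of
  \<open>\<alpha>\<close> makes both coefficients \<open>1 + \<alpha>\<close> and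
  \<open>1 - \<alpha>\<close> nonnegative; they add up to 2, which gives the exponent
  \<open>2 * R * |s|\<close>.\<close>

lemma hyp_weight_le:
  assumes \<alpha>: "0 \<le> \<alpha>" "\<alpha> \<le> 1" and near: "\<bar>a - c\<bar> \<le> R" "\<bar>b - d\<bar> \<le> R"
  shows "hyp_weight s \<alpha> a b \<le> 2 powr (2 * R * \<bar>s\<bar>) * hyp_weight s \<alpha> c d"
proof -
  have m: "\<bar>max a b - max c d\<bar> \<le> R" "\<bar>min a b - min c d\<bar> \<le> R" using near by linarith+
  have "\<bar>(1 + \<alpha>) * (max a b - max c d) + (1 - \<alpha>) * (min a b - min c d)\<bar> \<le> (1 + \<alpha>) * R + (1 - \<alpha>) * R"
    by (rule order_trans[OF abs_triangle_ineq])
       (use m \<alpha> in \<open>simp add: abs_mult add_mono mult_left_mono\<close>)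
  also have "\<dots> = 2 * R" by (simp add: algebra_simps)
  finally have "\<bar>((1 + \<alpha>) * (max a b - max c d) + (1 - \<alpha>) * (min a b - min c d)) * s\<bar> \<le> 2 * R * \<bar>s\<bar>"
    unfolding abs_mult by (rule mult_right_mono) simp
  hence "((1 + \<alpha>) * (max a b - max c d) + (1 - \<alpha>) * (min a b - min c d)) * s \<le> 2 * R * \<bar>s\<bar>" by linarith
  hence "((1 + \<alpha>) * max a b + (1 - \<alpha>) * min a b) * s \<le> 2 * R * \<bar>s\<bar> + ((1 + \<alpha>) * max c d + (1 - \<alpha>) * min c d) * s"
    by (simp add: algebra_simps)
  thus ?thesis unfolding hyp_weight_def powr_add[symmetric] by (intro powr_mono) auto
qed

section \<open>Weighted summation over all scales\<close>

context hyperbolic_wavelets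
begin

definition shifts :: "(int \<times> int) set" where
  "shifts = {- int (band + 2)..int (band + 2)} \<times> {- int (band + 2)..int (band + 2)}"

lemma finite_shifts: "finite shifts" and shifts_nonempty: "shifts \<noteq> {}"
  by (auto simp: shifts_def)

text \<open>Replaces a neighbourhood that depends on the index by a fixed set of translations, as
  \<open>lq_norm_neighbours\<close> requires; the extra terms are nonnegative.\<close>

lemma sum_near_le:
  fixes b :: "int \<times> int \<Rightarrow> ennreal"
  assumes "\<And>i. i \<in> A \<Longrightarrow> near (fst i) (fst j) \<and> near (snd i) (snd j)"
  shows "(\<Sum>i\<in>A. b i) \<le> (\<Sum>d\<in>shifts. b (j + d))"
proof -
  have "A \<subseteq> (\<lambda>d. j + d) ` shifts"
  proof
    fix i assume "i \<in> A"
    hence "i - j \<in> shifts"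
      using assms[of i] by (auto simp: shifts_def near_def mem_Times_iff)
    thus "i \<in> (\<lambda>d. j + d) ` shifts" by (intro image_eqI[of _ _ "i - j"]) auto
  qed
  hence "(\<Sum>i\<in>A. b i) \<le> (\<Sum>i\<in>(\<lambda>d. j + d) ` shifts. b i)"
    by (intro sum_mono2) (auto simp: finite_shifts)
  also have "\<dots> = (\<Sum>d\<in>shifts. b (j + d))" by (subst sum.reindex) (auto simp: inj_on_def)
  finally show ?thesis .
qed

lemma inj_int2: "inj int2"
  by (auto simp: inj_def int2_def prod_eq_iff)

definition hw :: "real \<Rightarrow> real \<Rightarrow> int \<times> int \<Rightarrow> real" where
  "hw s \<alpha> i = hyp_weight s \<alpha> (of_int (fst i)) (of_int (snd i))"

text \<open>The blocks have natural indices and the coefficients start at \<open>-1\<close>. Both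
  weighted families are therefore transplanted to integer pairs and set to 0 elsewhere, so that one
  neighbour estimate serves both directions.\<close>

definition wblocks :: "real \<Rightarrow> real \<Rightarrow> ennreal \<Rightarrow> ((real \<times> real \<Rightarrow> complex) \<Rightarrow> complex) \<Rightarrow> int \<times> int \<Rightarrow> ennreal" where
  "wblocks s \<alpha> p f i = (if i \<in> range int2 then ennreal (hw s \<alpha> i) * block_norm p f (nat (fst i), nat (snd i)) else 0)"

definition wcoefs :: "real \<Rightarrow> real \<Rightarrow> ennreal \<Rightarrow> ((real \<times> real \<Rightarrow> complex) \<Rightarrow> complex) \<Rightarrow> int \<times> int \<Rightarrow> ennreal" where
  "wcoefs s \<alpha> p f i = (if i \<in> scales2 then ennreal (hw s \<alpha> i) * coef_norm p f i else 0)"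

lemma hw_pos [simp]: "0 < hw s \<alpha> i" and hw_nonneg [simp]: "0 \<le> hw s \<alpha> i"
  by (simp_all add: hw_def hyp_weight_def)

lemma wblocks_int2: "wblocks s \<alpha> p f (int2 j) = ennreal (hw s \<alpha> (int2 j)) * block_norm p f j"
  by (simp add: wblocks_def) (simp add: int2_def)

lemma tensor_besov_norm_eq:
  assumes f: "tempered_distribution f" and q: "0 < q"
  shows "tensor_besov_norm \<theta>\<^sub>0 s \<alpha> p q f = lq_norm q UNIV (wblocks s \<alpha> p f)"
proof -
  have "lq_norm q UNIV (wblocks s \<alpha> p f) = lq_norm q (range int2) (wblocks s \<alpha> p f)"
    by (subst (2) lq_norm_extend[OF q], rule arg_cong[where f = "lq_norm q UNIV"]) (auto simp: wblocks_def)
  also have "\<dots> = lq_norm q UNIV (\<lambda>j. wblocks s \<alpha> p f (int2 j))" by (rule lq_norm_reindex[OF inj_int2])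
  also have "(\<lambda>j. wblocks s \<alpha> p f (int2 j)) = (\<lambda>(j1, j2).
       ennreal (hyp_weight s \<alpha> (real j1) (real j2)) * dist_Lp_norm p (hyp_block \<theta>\<^sub>0 (j1, j2) f))"
    unfolding wblocks_int2 by (auto simp: hw_def int2_def dist_Lp_norm_hyp_block[OF f] block_norm_def)
  finally show ?thesis by (simp add: tensor_besov_norm_def)
qed

lemma seq_besov_norm_eq:
  assumes q: "0 < q"
  shows "seq_besov_norm s \<alpha> p q (wavelet_coeff \<psi> \<phi> f) = lq_norm q UNIV (wcoefs s \<alpha> p f)"
proof -
  have "seq_besov_norm s \<alpha> p q (wavelet_coeff \<psi> \<phi> f) = lq_norm q scales2 (\<lambda>i. ennreal (hw s \<alpha> i) * coef_norm p f i)"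
    unfolding seq_besov_norm_def scales2_def
    by (rule arg_cong[where f = "lq_norm q _"])
       (auto simp: hw_def coef_norm_def coef_def[abs_def] ennreal_mult hyp_weight_def mult_ac)
  also have "\<dots> = lq_norm q UNIV (wcoefs s \<alpha> p f)"
    by (subst lq_norm_extend[OF q]) (simp add: wcoefs_def[abs_def])
  finally show ?thesis .
qed

lemma near_weight:
  assumes \<alpha>: "0 \<le> \<alpha>" "\<alpha> \<le> 1" and "near (fst i) (fst j)" "near (snd i) (snd j)"
  shows "hw s \<alpha> j \<le> 2 powr (2 * real (band + 2) * \<bar>s\<bar>) * hw s \<alpha> i"
proof -
  have "\<bar>real_of_int b - real_of_int a\<bar> \<le> real n" if "\<bar>a - b\<bar> \<le> int n" for a b n
    using that by linarith
  thus ?thesis unfolding hw_def using assms(3,4) unfolding near_def by (intro hyp_weight_le \<alpha>)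
qed

lemma besov_le_seq:
  assumes \<alpha>: "0 \<le> \<alpha>" "\<alpha> \<le> 1" and p: "0 < p" and q: "0 < q"
  shows "\<exists>C>0. \<forall>f. tempered_distribution f \<longrightarrow>
    tensor_besov_norm \<theta>\<^sub>0 s \<alpha> p q f \<le> ennreal C * seq_besov_norm s \<alpha> p q (wavelet_coeff \<psi> \<phi> f)"
proof -
  obtain C where C: "0 < C" "\<And>f j. tempered_distribution f \<Longrightarrow>
    block_norm p f j \<le> ennreal C * (\<Sum>i\<in>near_scales2 j. coef_norm p f i)"
    using block_norm_le[OF p] by blast
  define W where "W = 2 powr (2 * real (band + 2) * \<bar>s\<bar>)"
  have W: "0 < W" by (simp add: W_def)
  have main: "wblocks s \<alpha> p f j \<le> ennreal (C * W) * (\<Sum>d\<in>shifts. wcoefs s \<alpha> p f (j + d))"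
    if f: "tempered_distribution f" for f j
  proof (cases "j \<in> range int2")
    case True
    then obtain l where l: "j = int2 l" by blast
    have near: "near (fst i) (fst j)" "near (snd i) (snd j)" if "i \<in> near_scales2 l" for i
      using that by (auto simp: near_scales2_def near_scales_def l int2_def)
    have "wblocks s \<alpha> p f j \<le> ennreal (hw s \<alpha> j) * (ennreal C * (\<Sum>i\<in>near_scales2 l. coef_norm p f i))"
      unfolding l wblocks_int2 by (intro mult_left_mono C f) auto
    also have "\<dots> = ennreal C * (\<Sum>i\<in>near_scales2 l. ennreal (hw s \<alpha> j) * coef_norm p f i)"
      by (simp only: sum_distrib_left mult_ac)
    also have "\<dots> \<le> ennreal C * (\<Sum>i\<in>near_scales2 l. ennreal W * wcoefs s \<alpha> p f i)"
    proof (intro mult_left_mono sum_mono)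
      fix i assume i: "i \<in> near_scales2 l"
      have "ennreal (hw s \<alpha> j) \<le> ennreal (W * hw s \<alpha> i)"
        unfolding W_def by (intro ennreal_leI near_weight \<alpha> near i)
      hence "ennreal (hw s \<alpha> j) * coef_norm p f i \<le> ennreal (W * hw s \<alpha> i) * coef_norm p f i"
        by (rule mult_right_mono) simp
      thus "ennreal (hw s \<alpha> j) * coef_norm p f i \<le> ennreal W * wcoefs s \<alpha> p f i"
        using near_scales2_subset[OF i] W by (simp add: wcoefs_def ennreal_mult mult.assoc)
    qed auto
    also have "\<dots> = ennreal (C * W) * (\<Sum>i\<in>near_scales2 l. wcoefs s \<alpha> p f i)"
      using C(1) W by (simp add: sum_distrib_left[symmetric] ennreal_mult mult.assoc)
    also have "\<dots> \<le> ennreal (C * W) * (\<Sum>d\<in>shifts. wcoefs s \<alpha> p f (j + d))"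
      by (intro mult_left_mono sum_near_le) (auto intro: near)
    finally show ?thesis .
  qed (simp add: wblocks_def)
  let ?K = "C * W * real (card shifts) * real (card shifts) powr enn2real (1 / q)"
  have "tensor_besov_norm \<theta>\<^sub>0 s \<alpha> p q f \<le> ennreal ?K * seq_besov_norm s \<alpha> p q (wavelet_coeff \<psi> \<phi> f)"
    if f: "tempered_distribution f" for f
    unfolding tensor_besov_norm_eq[OF f q] seq_besov_norm_eq[OF q]
    by (rule lq_norm_neighbours[OF q finite_shifts shifts_nonempty _ main[OF f]]) (use C(1) W in simp)
  moreover have "0 < ?K" using C(1) W finite_shifts shifts_nonempty by (simp add: card_gt_0_iff)
  ultimately show ?thesis by blast
qed

lemma seq_le_besov:
  assumes \<alpha>: "0 \<le> \<alpha>" "\<alpha> \<le> 1" and p: "0 < p" and q: "0 < q"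
  shows "\<exists>C>0. \<forall>f. tempered_distribution f \<longrightarrow>
    seq_besov_norm s \<alpha> p q (wavelet_coeff \<psi> \<phi> f) \<le> ennreal C * tensor_besov_norm \<theta>\<^sub>0 s \<alpha> p q f"
proof -
  obtain C where C: "0 < C" "\<And>f i. tempered_distribution f \<Longrightarrow> i \<in> scales2 \<Longrightarrow>
    coef_norm p f i \<le> ennreal C * (\<Sum>j\<in>near_blocks2 i. block_norm p f j)"
    using coef_norm_le[OF p] by blast
  define W where "W = 2 powr (2 * real (band + 2) * \<bar>s\<bar>)"
  have W: "0 < W" by (simp add: W_def)
  have main: "wcoefs s \<alpha> p f i \<le> ennreal (C * W) * (\<Sum>d\<in>shifts. wblocks s \<alpha> p f (i + d))"
    if f: "tempered_distribution f" for f i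
  proof (cases "i \<in> scales2")
    case True
    have "wcoefs s \<alpha> p f i \<le> ennreal (hw s \<alpha> i) * (ennreal C * (\<Sum>j\<in>near_blocks2 i. block_norm p f j))"
      using True by (simp add: wcoefs_def) (intro mult_left_mono C f, auto)
    also have "\<dots> = ennreal C * (\<Sum>j\<in>near_blocks2 i. ennreal (hw s \<alpha> i) * block_norm p f j)"
      by (simp only: sum_distrib_left mult_ac)
    also have "\<dots> \<le> ennreal C * (\<Sum>j\<in>near_blocks2 i. ennreal W * wblocks s \<alpha> p f (int2 j))"
    proof (intro mult_left_mono sum_mono)
      fix j assume j: "j \<in> near_blocks2 i"
      have "ennreal (hw s \<alpha> i) \<le> ennreal (W * hw s \<alpha> (int2 j))"
        unfolding W_def by (intro ennreal_leI near_weight \<alpha> near_int2 j)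
      hence "ennreal (hw s \<alpha> i) * block_norm p f j \<le> ennreal (W * hw s \<alpha> (int2 j)) * block_norm p f j"
        by (rule mult_right_mono) simp
      thus "ennreal (hw s \<alpha> i) * block_norm p f j \<le> ennreal W * wblocks s \<alpha> p f (int2 j)"
        using W by (simp add: wblocks_int2 ennreal_mult mult.assoc)
    qed auto
    also have "\<dots> = ennreal (C * W) * (\<Sum>j\<in>int2 ` near_blocks2 i. wblocks s \<alpha> p f j)"
      using C(1) W inj_on_subset[OF inj_int2]
      by (subst sum.reindex) (auto simp: sum_distrib_left[symmetric] ennreal_mult mult.assoc)
    also have "\<dots> \<le> ennreal (C * W) * (\<Sum>d\<in>shifts. wblocks s \<alpha> p f (i + d))"
      by (intro mult_left_mono sum_near_le) (auto intro: near_int2)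
    finally show ?thesis .
  qed (simp add: wcoefs_def)
  let ?K = "C * W * real (card shifts) * real (card shifts) powr enn2real (1 / q)"
  have "seq_besov_norm s \<alpha> p q (wavelet_coeff \<psi> \<phi> f) \<le> ennreal ?K * tensor_besov_norm \<theta>\<^sub>0 s \<alpha> p q f"
    if f: "tempered_distribution f" for f
    unfolding tensor_besov_norm_eq[OF f q] seq_besov_norm_eq[OF q]
    by (rule lq_norm_neighbours[OF q finite_shifts shifts_nonempty _ main[OF f]]) (use C(1) W in simp)
  moreover have "0 < ?K" using C(1) W finite_shifts shifts_nonempty by (simp add: card_gt_0_iff)
  ultimately show ?thesis by blast
qed

end

theorem theorem4p13:
  fixes p q :: ennreal and s \<alpha> :: real
    and \<theta>\<^sub>0 :: "real \<Rightarrow> real" and \<psi> \<phi> :: "real \<Rightarrow> complex"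
  assumes "0 < p" and "0 < q" and "0 \<le> \<alpha>" and "\<alpha> \<le> 1"
    and "littlewood_paley_generator \<theta>\<^sub>0"
    and "lemarie_meyer \<psi> \<phi>"
  shows "(\<forall>f. tempered_distribution f \<longrightarrow>
            (f \<in> tensor_besov \<theta>\<^sub>0 s \<alpha> p q \<longleftrightarrow> wavelet_coeff \<psi> \<phi> f \<in> seq_besov s \<alpha> p q)) \<and>
         (\<exists>C\<^sub>1 C\<^sub>2 :: real. 0 < C\<^sub>1 \<and> 0 < C\<^sub>2 \<and>
            (\<forall>f. tempered_distribution f \<longrightarrow>
               ennreal C\<^sub>1 * seq_besov_norm s \<alpha> p q (wavelet_coeff \<psi> \<phi> f)
                 \<le> tensor_besov_norm \<theta>\<^sub>0 s \<alpha> p q f \<and>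
               tensor_besov_norm \<theta>\<^sub>0 s \<alpha> p q f
                 \<le> ennreal C\<^sub>2 * seq_besov_norm s \<alpha> p q (wavelet_coeff \<psi> \<phi> f)))"
proof -
  interpret hyperbolic_wavelets \<theta>\<^sub>0 \<psi> \<phi> using assms(5,6) by unfold_locales
  let ?S = "\<lambda>f. seq_besov_norm s \<alpha> p q (wavelet_coeff \<psi> \<phi> f)" and ?T = "tensor_besov_norm \<theta>\<^sub>0 s \<alpha> p q"
  obtain A where A: "0 < A" "\<And>f. tempered_distribution f \<Longrightarrow> ?T f \<le> ennreal A * ?S f"
    using besov_le_seq[OF assms(3,4,1,2)] by blast
  obtain B where B: "0 < B" "\<And>f. tempered_distribution f \<Longrightarrow> ?S f \<le> ennreal B * ?T f"
    using seq_le_besov[OF assms(3,4,1,2)] by blast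
  have lower: "ennreal (1 / B) * ?S f \<le> ?T f" if "tempered_distribution f" for f
  proof -
    have "ennreal (1 / B) * ?S f \<le> ennreal (1 / B) * (ennreal B * ?T f)"
      by (intro mult_left_mono B that) auto
    also have "\<dots> = ?T f" using B(1) by (simp add: mult.assoc[symmetric] flip: ennreal_mult)
    finally show ?thesis .
  qed
  have "f \<in> tensor_besov \<theta>\<^sub>0 s \<alpha> p q \<longleftrightarrow> wavelet_coeff \<psi> \<phi> f \<in> seq_besov s \<alpha> p q"
    if f: "tempered_distribution f" for f
  proof -
    have "?S f < \<infinity>" if "?T f < \<infinity>"
      using order.strict_trans1[OF B(2)[OF f]] that by (simp add: ennreal_mult_less_top)
    moreover have "?T f < \<infinity>" if "?S f < \<infinity>"
      using order.strict_trans1[OF A(2)[OF f]] that by (simp add: ennreal_mult_less_top)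
    ultimately show ?thesis using f by (auto simp: tensor_besov_def seq_besov_def)
  qed
  moreover have "0 < 1 / B" using B(1) by simp
  ultimately show ?thesis using A lower by blast
qed

end
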